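(* Let $n\ge1$, let $V=\mathbb{C}^n$ be the permutation module of $S_n$, and let $\lambda$ be a strict partition of $n$. The bi-graded multiplicity of $D^\lambda$ in the $\mathcal{H}_n$-module $\mathcal{C}_n\otimes S^*V\otimes\wedge^*V$, i.e. $\sum_{p=0}^\infty\sum_{q=0}^n t^ps^q\,m_\lambda(\mathcal{C}_n\otimes S^pV\otimes\wedge^qV)$, equals $$2^{-\frac{\ell(\lambda)+\delta(\lambda)}{2}}\,Q_\lambda(t^\bullet;st^\bullet),$$ where $Q_\lambda(t^\bullet;st^\bullet)=Q_\lambda(1,t,t^2,\ldots;s,st,st^2,\ldots)$ is the specialization of the Schur $Q$-function $Q_\lambda$ at the variables $1,t,t^2,\ldots,s,st,st^2,\ldots$.
   Context: Ground field $\mathbb{C}$. All algebras and modules are $\mathbb{Z}_2$-graded (super); homomorphisms $f$ satisfy $f(av)=(-1)^{\bar f\bar a}af(v)$ and need not be even; $\Pi$ denotes parity shift. $S_n$-modules such as $S^pV\otimes\wedge^qV$ are regarded as purely even. For a strict partition $\lambda=(\lambda_1>\cdots>\lambda_\ell>0)$ of $n$, $\ell(\lambda)=\ell$, and $\delta(\lambda)=0$ if $\ell(\lambda)$ is even and $1$ if odd. Algebras. $\mathcal{C}_n$ is the Clifford superalgebra generated by odd $c_1,\dots,c_n$ with $c_i^2=1$, $c_ic_j=-c_jc_i$ ($i\ne j$). $\mathcal{H}_n=\mathcal{C}_n\rtimes\mathbb{C}S_n$ (Hecke–Clifford algebra) is generated by $\mathcal{C}_n$ and $\mathbb{C}S_n$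 (even, with simple transpositions $s_i$), with $s_ic_i=c_{i+1}s_i$ and $s_ic_j=c_js_i$ for $j\ne i,i+1$. $\mathcal{C}_n$ is an $\mathcal{H}_n$-module via $\mathcal{C}_n\cong\mathrm{ind}_{\mathbb{C}S_n}^{\mathcal{H}_n}\mathbf 1$ ($c_i$ acts by left multiplication, $S_n$ permutes the $c_i$). For an $\mathcal{H}_n$-module $F$ and an $S_n$-module $M$, $F\otimes M$ is an $\mathcal{H}_n$-module via $c_i(u\otimes x)=c_iu\otimes x$, $s_j(u\otimes x)=s_ju\otimes s_jx$. Schur $Q$-functions. For $m\ge\ell=\ell(\lambda)$, $Q_\lambda(z_1,\dots,z_m)=2^{\ell}\sum_{w\in S_m/S_{m-\ell}}w\big(z_1^{\lambda_1}\cdots z_\ell^{\lambda_\ell}\prod_{1\le i\le\ell}\prod_{i<j\le m}\frac{z_i+z_j}{z_i-z_j}\big)$, where $S_{m-\ell}$ permutes $z_{\ell+1},\dots,z_m$; letting $m\to\infty$ gives $Q_\lambda(z)$. Define $q_r$ by $\sum_{r\ge0}q_r(z)u^r=\prod_i\frac{1+z_iu}{1-z_iu}$, $q_\nu=q_{\nu_1}q_{\nu_2}\cdots$, and $\Gamma_{\mathbb{C}}=\mathbb{C}[q_1,q_2,\dots]$. Irreducibles. The irreducible $\mathcal{H}_n$-modules, up to (not necessarily even) isomorphism, are $D^\lambda$, $\lambda$ a strict partition of $n$. Their labelling is characterized as follows: the characteristic map $\mathrm{ch}:\bigoplus_n K(\mathcal{H}_n\text{-smod})\to\Gamma_{\mathbb{C}}$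 (complexified Grothendieck groups of finite-dimensional modules, with $[\Pi M]=[M]$) is the linear isomorphism with $\mathrm{ch}(\mathrm{ind}_{\mathbb{C}S_\nu}^{\mathcal{H}_n}\mathbf 1)=q_\nu$ for all compositions $\nu$ of $n$ ($S_\nu$ the Young subgroup, $\mathbf 1$ the trivial module), and $\mathrm{ch}(D^\lambda)=2^{-\frac{\ell(\lambda)-\delta(\lambda)}{2}}Q_\lambda$. $m_\lambda(N)$ denotes the multiplicity of $D^\lambda$ in a finite-dimensional $\mathcal{H}_n$-module $N$, counting $D^\lambda$ and $\Pi D^\lambda$ together. *)

theory Defs
  imports
    Complex_Main
    "HOL-Library.Poly_Mapping"
    "HOL-Library.Function_Algebras"
    "HOL-Library.Z2"
    "HOL-Combinatorics.Permutations"
    "HOL-Computational_Algebra.Polynomial_Factorial"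
    "HOL-Computational_Algebra.Formal_Power_Series"
begin

section \<open>Complex vector spaces\<close>

text \<open>
  The type \<open>'b \<Rightarrow>\<^sub>0 complex\<close> is the vector space with basis \<open>'b\<close>. All modules below are
  finite-dimensional subspaces of such spaces. Their operators are linear on the whole ambient
  space, but only their restriction to the module matters; every operator on a subspace extends.
\<close>

definition cscale :: "complex \<Rightarrow> ('b \<Rightarrow>\<^sub>0 complex) \<Rightarrow> ('b \<Rightarrow>\<^sub>0 complex)" where
  "cscale c x = Poly_Mapping.map ((*) c) x"

lemma lookup_cscale [simp]: "Poly_Mapping.lookup (cscale c x) k = c * Poly_Mapping.lookup x k"
  by (auto simp: cscale_def Poly_Mapping.map.rep_eq when_def)

global_interpretation cvs: vector_space "cscale :: complex \<Rightarrow> ('b \<Rightarrow>\<^sub>0 complex) \<Rightarrow> ('b \<Rightarrow>\<^sub>0 complex)"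
  by standard (auto intro!: poly_mapping_eqI simp: algebra_simps lookup_add)

abbreviation clinear :: "(('a \<Rightarrow>\<^sub>0 complex) \<Rightarrow> ('b \<Rightarrow>\<^sub>0 complex)) \<Rightarrow> bool" where
  "clinear \<equiv> Vector_Spaces.linear cscale cscale"

abbreviation basis_vec :: "'b \<Rightarrow> ('b \<Rightarrow>\<^sub>0 complex)" where
  "basis_vec b \<equiv> Poly_Mapping.single b 1"

definition lin_ext :: "('a \<Rightarrow> ('b \<Rightarrow>\<^sub>0 complex)) \<Rightarrow> ('a \<Rightarrow>\<^sub>0 complex) \<Rightarrow> ('b \<Rightarrow>\<^sub>0 complex)" where
  "lin_ext f x = (\<Sum>a\<in>Poly_Mapping.keys x. cscale (Poly_Mapping.lookup x a) (f a))"

definition tensor_vec :: "('a \<Rightarrow>\<^sub>0 complex) \<Rightarrow> ('b \<Rightarrow>\<^sub>0 complex) \<Rightarrow> ('a \<times> 'b \<Rightarrow>\<^sub>0 complex)" where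
  "tensor_vec u x = lin_ext (\<lambda>a. lin_ext (\<lambda>b. basis_vec (a, b)) x) u"

definition tensor_space ::
  "('a \<Rightarrow>\<^sub>0 complex) set \<Rightarrow> ('b \<Rightarrow>\<^sub>0 complex) set \<Rightarrow> ('a \<times> 'b \<Rightarrow>\<^sub>0 complex) set" where
  "tensor_space U X = cvs.span {tensor_vec u x |u x. u \<in> U \<and> x \<in> X}"

definition tensor_op ::
  "(('a \<Rightarrow>\<^sub>0 complex) \<Rightarrow> ('c \<Rightarrow>\<^sub>0 complex)) \<Rightarrow> (('b \<Rightarrow>\<^sub>0 complex) \<Rightarrow> ('d \<Rightarrow>\<^sub>0 complex)) \<Rightarrow>
   ('a \<times> 'b \<Rightarrow>\<^sub>0 complex) \<Rightarrow> ('c \<times> 'd \<Rightarrow>\<^sub>0 complex)" where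
  "tensor_op f g = lin_ext (\<lambda>(a, b). tensor_vec (f (basis_vec a)) (g (basis_vec b)))"


section \<open>Modules over the symmetric group\<close>

text \<open>The symmetric group $S_n$ consists of the \<open>w\<close> with \<open>w permutes {1..n}\<close>.\<close>

record 'b snmod =
  sn_space :: "('b \<Rightarrow>\<^sub>0 complex) set"
  sn_act :: "(nat \<Rightarrow> nat) \<Rightarrow> ('b \<Rightarrow>\<^sub>0 complex) \<Rightarrow> ('b \<Rightarrow>\<^sub>0 complex)"

definition perm_rep :: "nat \<Rightarrow> nat snmod" where
  "perm_rep n = \<lparr>sn_space = cvs.span (basis_vec ` {1..n}),
                 sn_act = (\<lambda>w. lin_ext (\<lambda>i. basis_vec (w i)))\<rparr>"

definition sn_tensor :: "'a snmod \<Rightarrow> 'b snmod \<Rightarrow> ('a \<times> 'b) snmod" where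
  "sn_tensor M N = \<lparr>sn_space = tensor_space (sn_space M) (sn_space N),
                    sn_act = (\<lambda>w. tensor_op (sn_act M w) (sn_act N w))\<rparr>"

text \<open>
  The symmetric algebra of the space with basis \<open>'b\<close> is the polynomial ring
  \<open>('b \<Rightarrow>\<^sub>0 nat) \<Rightarrow>\<^sub>0 complex\<close>, with the product of \<open>HOL-Library.Poly_Mapping\<close>; a vector is
  identified with a linear form. The symmetric power of a subspace is the span of the products
  of its elements, and operators act through the induced ring endomorphism.
\<close>

definition sym_embed :: "('b \<Rightarrow>\<^sub>0 complex) \<Rightarrow> (('b \<Rightarrow>\<^sub>0 nat) \<Rightarrow>\<^sub>0 complex)" where
  "sym_embed = lin_ext (\<lambda>b. basis_vec (Poly_Mapping.single b 1))"

definition sym_power :: "nat \<Rightarrow> 'b snmod \<Rightarrow> ('b \<Rightarrow>\<^sub>0 nat) snmod" where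
  "sym_power p M =
     \<lparr>sn_space = cvs.span {prod_list (map sym_embed vs) |vs. length vs = p \<and> set vs \<subseteq> sn_space M},
      sn_act = (\<lambda>w. lin_ext (\<lambda>a. \<Prod>b\<in>Poly_Mapping.keys a.
                  sym_embed (sn_act M w (basis_vec b)) ^ Poly_Mapping.lookup a b))\<rparr>"

text \<open>
  The exterior algebra of the space with basis \<open>'b\<close>, linearly ordered, has as basis the finite
  sets of basis elements: \<open>{a\<^sub>1 < \<dots> < a\<^sub>k}\<close> stands for $a_1\wedge\dots\wedge a_k$.
  The operator \<open>wedge v\<close> is left multiplication by the vector \<open>v\<close>.
\<close>

definition wedge :: "('b::linorder \<Rightarrow>\<^sub>0 complex) \<Rightarrow> ('b set \<Rightarrow>\<^sub>0 complex) \<Rightarrow> ('b set \<Rightarrow>\<^sub>0 complex)" where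
  "wedge v x = lin_ext (\<lambda>b. lin_ext (\<lambda>A.
     if b \<in> A then 0 else cscale ((-1) ^ card {a \<in> A. a < b}) (basis_vec (insert b A))) x) v"

definition wedge_list :: "('b::linorder \<Rightarrow>\<^sub>0 complex) list \<Rightarrow> ('b set \<Rightarrow>\<^sub>0 complex)" where
  "wedge_list vs = foldr wedge vs (basis_vec {})"

definition ext_power :: "nat \<Rightarrow> 'b::linorder snmod \<Rightarrow> 'b set snmod" where
  "ext_power q M =
     \<lparr>sn_space = cvs.span {wedge_list vs |vs. length vs = q \<and> set vs \<subseteq> sn_space M},
      sn_act = (\<lambda>w. lin_ext (\<lambda>A. wedge_list
                  (map (\<lambda>b. sn_act M w (basis_vec b)) (sorted_list_of_set A))))\<rparr>"

definition regular_sn :: "nat \<Rightarrow> (nat \<Rightarrow> nat) snmod" where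
  "regular_sn n = \<lparr>sn_space = cvs.span (basis_vec ` {w. w permutes {1..n}}),
                   sn_act = (\<lambda>v. lin_ext (\<lambda>w. basis_vec (v \<circ> w)))\<rparr>"


section \<open>Modules over the Hecke-Clifford algebra\<close>

text \<open>
  A finite-dimensional $\mathcal{H}_n$-module is a super vector space with operators
  \<open>hc_c M i\<close> (for $c_i$) and \<open>hc_s M w\<close> (for $w\in S_n$) satisfying the defining relations.
\<close>

record 'b hcmod =
  grade :: "bit \<Rightarrow> ('b \<Rightarrow>\<^sub>0 complex) set"
  hc_c :: "nat \<Rightarrow> ('b \<Rightarrow>\<^sub>0 complex) \<Rightarrow> ('b \<Rightarrow>\<^sub>0 complex)"
  hc_s :: "(nat \<Rightarrow> nat) \<Rightarrow> ('b \<Rightarrow>\<^sub>0 complex) \<Rightarrow> ('b \<Rightarrow>\<^sub>0 complex)"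

definition hc_space :: "'b hcmod \<Rightarrow> ('b \<Rightarrow>\<^sub>0 complex) set" where
  "hc_space M = {u + v |u v. u \<in> grade M 0 \<and> v \<in> grade M 1}"

definition hc_module :: "nat \<Rightarrow> 'b hcmod \<Rightarrow> bool" where
  "hc_module n M \<longleftrightarrow>
     (\<forall>p. cvs.subspace (grade M p)) \<and> grade M 0 \<inter> grade M 1 = {0} \<and>
     (\<exists>B. finite B \<and> hc_space M = cvs.span B) \<and>
     (\<forall>i\<in>{1..n}. clinear (hc_c M i) \<and> (\<forall>p. hc_c M i ` grade M p \<subseteq> grade M (p + 1))) \<and>
     (\<forall>w. w permutes {1..n} \<longrightarrow> clinear (hc_s M w) \<and> (\<forall>p. hc_s M w ` grade M p \<subseteq> grade M p)) \<and>
     (\<forall>x\<in>hc_space M.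
        (\<forall>i\<in>{1..n}. hc_c M i (hc_c M i x) = x) \<and>
        (\<forall>i\<in>{1..n}. \<forall>j\<in>{1..n}. i \<noteq> j \<longrightarrow> hc_c M i (hc_c M j x) = - hc_c M j (hc_c M i x)) \<and>
        hc_s M id x = x \<and>
        (\<forall>v w. v permutes {1..n} \<longrightarrow> w permutes {1..n} \<longrightarrow> hc_s M (v \<circ> w) x = hc_s M v (hc_s M w x)) \<and>
        (\<forall>i\<in>{1..<n}.
           hc_s M (transpose i (i + 1)) (hc_c M i x) = hc_c M (i + 1) (hc_s M (transpose i (i + 1)) x) \<and>
           (\<forall>j\<in>{1..n} - {i, i + 1}.
              hc_s M (transpose i (i + 1)) (hc_c M j x) = hc_c M j (hc_s M (transpose i (i + 1)) x))))"

definition hc_hom_of_parity ::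
  "nat \<Rightarrow> bit \<Rightarrow> 'a hcmod \<Rightarrow> 'b hcmod \<Rightarrow> (('a \<Rightarrow>\<^sub>0 complex) \<Rightarrow> ('b \<Rightarrow>\<^sub>0 complex)) \<Rightarrow> bool" where
  "hc_hom_of_parity n p M N f \<longleftrightarrow> clinear f \<and>
     (\<forall>q. f ` grade M q \<subseteq> grade N (q + p)) \<and>
     (\<forall>x\<in>hc_space M.
        (\<forall>i\<in>{1..n}. f (hc_c M i x) = (if p = 1 then - hc_c N i (f x) else hc_c N i (f x))) \<and>
        (\<forall>w. w permutes {1..n} \<longrightarrow> f (hc_s M w x) = hc_s N w (f x)))"

definition hc_hom ::
  "nat \<Rightarrow> 'a hcmod \<Rightarrow> 'b hcmod \<Rightarrow> (('a \<Rightarrow>\<^sub>0 complex) \<Rightarrow> ('b \<Rightarrow>\<^sub>0 complex)) \<Rightarrow> bool" where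
  "hc_hom n M N f \<longleftrightarrow>
     (\<exists>f0 f1. hc_hom_of_parity n 0 M N f0 \<and> hc_hom_of_parity n 1 M N f1 \<and> f = (\<lambda>x. f0 x + f1 x))"

definition hc_iso :: "nat \<Rightarrow> 'a hcmod \<Rightarrow> 'b hcmod \<Rightarrow> bool" where
  "hc_iso n M N \<longleftrightarrow> (\<exists>f. hc_hom n M N f \<and> bij_betw f (hc_space M) (hc_space N))"

definition hc_submodule :: "nat \<Rightarrow> 'b hcmod \<Rightarrow> ('b \<Rightarrow>\<^sub>0 complex) set \<Rightarrow> bool" where
  "hc_submodule n M U \<longleftrightarrow> cvs.subspace U \<and> U \<subseteq> hc_space M \<and>
     U = {u + v |u v. u \<in> U \<inter> grade M 0 \<and> v \<in> U \<inter> grade M 1} \<and>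
     (\<forall>i\<in>{1..n}. hc_c M i ` U \<subseteq> U) \<and>
     (\<forall>w. w permutes {1..n} \<longrightarrow> hc_s M w ` U \<subseteq> U)"

definition hc_restrict :: "'b hcmod \<Rightarrow> ('b \<Rightarrow>\<^sub>0 complex) set \<Rightarrow> 'b hcmod" where
  "hc_restrict M U = M\<lparr>grade := (\<lambda>p. grade M p \<inter> U)\<rparr>"

text \<open>\<open>hc_quotient_iso n M U N\<close> says $M/U\cong N$, the isomorphism being induced by \<open>f\<close>.\<close>

definition hc_quotient_iso :: "nat \<Rightarrow> 'a hcmod \<Rightarrow> ('a \<Rightarrow>\<^sub>0 complex) set \<Rightarrow> 'b hcmod \<Rightarrow> bool" where
  "hc_quotient_iso n M U N \<longleftrightarrow>
     (\<exists>f. hc_hom n M N f \<and> f ` hc_space M = hc_space N \<and> {x \<in> hc_space M. f x = 0} = U)"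

definition hc_irreducible :: "nat \<Rightarrow> 'b hcmod \<Rightarrow> bool" where
  "hc_irreducible n M \<longleftrightarrow> hc_module n M \<and> hc_space M \<noteq> {0} \<and>
     (\<forall>U. hc_submodule n M U \<longrightarrow> U = {0} \<or> U = hc_space M)"

definition composition_series :: "nat \<Rightarrow> 'b hcmod \<Rightarrow> ('b \<Rightarrow>\<^sub>0 complex) set list \<Rightarrow> bool" where
  "composition_series n M Us \<longleftrightarrow>
     Us \<noteq> [] \<and> hd Us = {0} \<and> last Us = hc_space M \<and> (\<forall>U\<in>set Us. hc_submodule n M U) \<and>
     (\<forall>i. Suc i < length Us \<longrightarrow> Us ! i \<subset> Us ! Suc i \<and>
        (\<forall>U. hc_submodule n M U \<and> Us ! i \<subseteq> U \<and> U \<subseteq> Us ! Suc i \<longrightarrow> U = Us ! i \<or> U = Us ! Suc i))"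

text \<open>
  The Jordan-Hoelder multiplicity of an irreducible module \<open>D\<close> in \<open>M\<close>. Isomorphisms need not be
  even, so \<open>D\<close> and its parity shift are counted together.
\<close>

definition hc_multiplicity :: "nat \<Rightarrow> 'a hcmod \<Rightarrow> 'b hcmod \<Rightarrow> nat" where
  "hc_multiplicity n D M = (THE k. \<exists>Us. composition_series n M Us \<and>
     k = card {i. Suc i < length Us \<and>
                  hc_quotient_iso n (hc_restrict M (Us ! Suc i)) (Us ! i) D})"

definition parity_shift :: "'b hcmod \<Rightarrow> 'b hcmod" where
  "parity_shift M = \<lparr>grade = (\<lambda>p. grade M (p + 1)), hc_c = (\<lambda>i x. - hc_c M i x), hc_s = hc_s M\<rparr>"

definition hc_tensor :: "'a hcmod \<Rightarrow> 'b snmod \<Rightarrow> ('a \<times> 'b) hcmod" where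
  "hc_tensor F M = \<lparr>grade = (\<lambda>p. tensor_space (grade F p) (sn_space M)),
                    hc_c = (\<lambda>i. tensor_op (hc_c F i) id),
                    hc_s = (\<lambda>w. tensor_op (hc_s F w) (sn_act M w))\<rparr>"

text \<open>
  The Clifford algebra $\mathcal{C}_n$ has the basis $c_A = c_{a_1}\cdots c_{a_k}$ for
  $A=\{a_1<\dots<a_k\}\subseteq\{1,\dots,n\}$, and \<open>clifford_mult i\<close> is left multiplication
  by $c_i$. A permutation $w$ sends $c_A$ to $c_{w(a_1)}\cdots c_{w(a_k)}$.
\<close>

definition clifford_mult :: "nat \<Rightarrow> (nat set \<Rightarrow>\<^sub>0 complex) \<Rightarrow> (nat set \<Rightarrow>\<^sub>0 complex)" where
  "clifford_mult i = lin_ext (\<lambda>A. cscale ((-1) ^ card {a \<in> A. a < i})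
     (basis_vec (if i \<in> A then A - {i} else insert i A)))"

definition clifford_module :: "nat \<Rightarrow> nat set hcmod" where
  "clifford_module n =
     \<lparr>grade = (\<lambda>p. cvs.span (basis_vec ` {A. A \<subseteq> {1..n} \<and> of_nat (card A) = p})),
      hc_c = clifford_mult,
      hc_s = (\<lambda>w. lin_ext (\<lambda>A.
                foldr (\<lambda>a. clifford_mult (w a)) (sorted_list_of_set A) (basis_vec {})))\<rparr>"


section \<open>Induction of the trivial module of a Young subgroup\<close>

text \<open>
  As a left module over itself, $\mathcal{H}_n=\mathcal{C}_n\rtimes\mathbb{C}S_n$ is
  $\mathcal{C}_n\otimes\mathbb{C}S_n$ with $c_A w$ corresponding to $c_A\otimes w$.
\<close>

definition hc_regular :: "nat \<Rightarrow> (nat set \<times> (nat \<Rightarrow> nat)) hcmod" where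
  "hc_regular n = hc_tensor (clifford_module n) (regular_sn n)"

definition hc_right_mult ::
  "(nat \<Rightarrow> nat) \<Rightarrow> (nat set \<times> (nat \<Rightarrow> nat) \<Rightarrow>\<^sub>0 complex) \<Rightarrow> (nat set \<times> (nat \<Rightarrow> nat) \<Rightarrow>\<^sub>0 complex)" where
  "hc_right_mult v = lin_ext (\<lambda>(A, w). basis_vec (A, w \<circ> v))"

definition is_composition :: "nat \<Rightarrow> nat list \<Rightarrow> bool" where
  "is_composition n nu \<longleftrightarrow> (\<forall>r\<in>set nu. 0 < r) \<and> sum_list nu = n"

definition young_subgroup :: "nat list \<Rightarrow> (nat \<Rightarrow> nat) set" where
  "young_subgroup nu = {w. w permutes {1..sum_list nu} \<and>
     (\<forall>k<length nu. let B = {sum_list (take k nu) + 1..sum_list (take (Suc k) nu)} in w ` B = B)}"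

text \<open>
  $\mathcal{H}_n\otimes_{\mathbb{C}S_\nu}\mathbf 1$ is the quotient of $\mathcal{H}_n$ by the
  span of all $hv-h$ with $v\in S_\nu$; the predicate holds for the modules isomorphic to it.
\<close>

definition is_induced_trivial :: "nat \<Rightarrow> nat list \<Rightarrow> 'b hcmod \<Rightarrow> bool" where
  "is_induced_trivial n nu M \<longleftrightarrow> hc_module n M \<and>
     hc_quotient_iso n (hc_regular n)
       (cvs.span {hc_right_mult v h - h |v h. v \<in> young_subgroup nu \<and> h \<in> hc_space (hc_regular n)}) M"


section \<open>The Grothendieck group\<close>

text \<open>
  Every finite-dimensional module is isomorphic to one inside \<open>nat \<Rightarrow>\<^sub>0 complex\<close>.
  The objects are those modules, for all $n$ at once.
\<close>

typedef hc_object = "{(n, M :: nat hcmod). hc_module n M}"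
  morphisms rep_object Object
proof
  let ?Z = "\<lparr>grade = (\<lambda>_. {0}), hc_c = (\<lambda>_ _. 0), hc_s = (\<lambda>_ _. 0)\<rparr> :: nat hcmod"
  have "hc_space ?Z = {0}"
    by (auto simp: hc_space_def)
  moreover have "clinear (\<lambda>_ :: nat \<Rightarrow>\<^sub>0 complex. 0 :: nat \<Rightarrow>\<^sub>0 complex)"
    by (simp add: Vector_Spaces.linear_iff cvs.vector_space_axioms)
  moreover have "\<exists>B :: (nat \<Rightarrow>\<^sub>0 complex) set. finite B \<and> {0} = cvs.span B"
    by (rule exI[of _ "{}"]) auto
  ultimately have "hc_module 0 ?Z"
    by (simp add: hc_module_def)
  then show "(0, ?Z) \<in> {(n, M). hc_module n M}"
    by simp
qed

definition hc_short_exact ::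
  "nat \<Rightarrow> 'a hcmod \<Rightarrow> 'b hcmod \<Rightarrow> 'c hcmod \<Rightarrow> bool" where
  "hc_short_exact n M' M M'' \<longleftrightarrow>
     (\<exists>f g. hc_hom_of_parity n 0 M' M f \<and> hc_hom_of_parity n 0 M M'' g \<and>
        inj_on f (hc_space M') \<and> f ` hc_space M' = {x \<in> hc_space M. g x = 0} \<and>
        g ` hc_space M = hc_space M'')"

definition k_relations :: "(hc_object \<Rightarrow>\<^sub>0 complex) set" where
  "k_relations =
     {basis_vec (Object (n, M)) - basis_vec (Object (n, M')) - basis_vec (Object (n, M'')) |n M' M M''.
        hc_module n M' \<and> hc_module n M \<and> hc_module n M'' \<and> hc_short_exact n M' M M''} \<union>
     {basis_vec (Object (n, parity_shift M)) - basis_vec (Object (n, M)) |n M. hc_module n M}"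

text \<open>The type \<open>k_group\<close> is $\bigoplus_n K(\mathcal{H}_n)$, complexified, with $[\Pi M]=[M]$.\<close>

quotient_type k_group = "hc_object \<Rightarrow>\<^sub>0 complex" / "\<lambda>x y. x - y \<in> cvs.span k_relations"
proof (rule equivpI)
  show "reflp (\<lambda>x y. x - y \<in> cvs.span k_relations)"
    by (simp add: reflp_def cvs.span_zero)
  show "symp (\<lambda>x y. x - y \<in> cvs.span k_relations)"
    unfolding symp_def using cvs.span_neg[of _ k_relations] minus_diff_eq by metis
  show "transp (\<lambda>x y. x - y \<in> cvs.span k_relations)"
    unfolding transp_def
  proof (intro allI impI)
    fix x y z
    assume "x - y \<in> cvs.span k_relations" "y - z \<in> cvs.span k_relations"
    then have "(x - y) + (y - z) \<in> cvs.span k_relations"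
      by (rule cvs.span_add)
    then show "x - z \<in> cvs.span k_relations"
      by simp
  qed
qed

instantiation k_group :: ab_group_add
begin

lift_definition zero_k_group :: k_group is 0 .

lift_definition plus_k_group :: "k_group \<Rightarrow> k_group \<Rightarrow> k_group" is "(+)"
proof -
  fix x y x' y'
  assume "x - y \<in> cvs.span k_relations" "x' - y' \<in> cvs.span k_relations"
  then have "(x - y) + (x' - y') \<in> cvs.span k_relations"
    by (rule cvs.span_add)
  then show "x + x' - (y + y') \<in> cvs.span k_relations"
    by (simp add: algebra_simps)
qed

lift_definition uminus_k_group :: "k_group \<Rightarrow> k_group" is uminus
proof -
  fix x y
  assume "x - y \<in> cvs.span k_relations"
  then have "- (x - y) \<in> cvs.span k_relations"
    by (rule cvs.span_neg)
  then show "- x - - y \<in> cvs.span k_relations"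
    by simp
qed

definition minus_k_group :: "k_group \<Rightarrow> k_group \<Rightarrow> k_group" where
  "minus_k_group x y = x + - y"

instance
proof
  fix a b c :: k_group
  show "a + b + c = a + (b + c)"
    by transfer (simp add: add.assoc cvs.span_zero)
  show "a + b = b + a"
    by transfer (simp add: add.commute cvs.span_zero)
  show "0 + a = a"
    by transfer (simp add: cvs.span_zero)
  show "- a + a = 0"
    by transfer (simp add: cvs.span_zero)
  show "a - b = a + - b"
    by (rule minus_k_group_def)
qed

end

lift_definition k_scale :: "complex \<Rightarrow> k_group \<Rightarrow> k_group" is cscale
  by (metis cvs.scale_right_diff_distrib cvs.span_scale)

lemma vector_space_k_scale: "vector_space k_scale"
  by standard (transfer, simp add: cvs.scale_right_distrib cvs.scale_left_distrib cvs.span_zero)+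

definition k_class :: "nat \<Rightarrow> nat hcmod \<Rightarrow> k_group" where
  "k_class n M = abs_k_group (basis_vec (Object (n, M)))"


section \<open>Schur Q-functions\<close>

text \<open>
  A symmetric function is the family, indexed by $m$, of its specializations at finitely many
  variables $z_1,\dots,z_m$. These are regarded as rational functions, as the formula
  for $Q_\lambda$ has denominators.
\<close>

type_synonym zpoly = "(nat \<Rightarrow>\<^sub>0 nat) \<Rightarrow>\<^sub>0 complex"
type_synonym symfun = "nat \<Rightarrow> zpoly fract"

definition zvar :: "nat \<Rightarrow> zpoly fract" where
  "zvar i = to_fract (Poly_Mapping.single (Poly_Mapping.single i 1) 1)"

definition sf_scale :: "complex \<Rightarrow> symfun \<Rightarrow> symfun" where
  "sf_scale c f = (\<lambda>m. to_fract (Poly_Mapping.single 0 c) * f m)"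

lemma vector_space_sf_scale: "vector_space sf_scale"
proof -
  have *: "to_fract (Poly_Mapping.single 0 (a + b)) =
           to_fract (Poly_Mapping.single 0 a) + to_fract (Poly_Mapping.single 0 b :: zpoly)"
    "to_fract (Poly_Mapping.single 0 (a * b)) =
           to_fract (Poly_Mapping.single 0 a) * to_fract (Poly_Mapping.single 0 b :: zpoly)" for a b
    by (simp add: single_add) (metis add_0 mult_single to_fract_mult)
  show ?thesis
    by standard (auto simp: sf_scale_def fun_eq_iff * algebra_simps)
qed

definition q_fun :: "nat \<Rightarrow> symfun" where
  "q_fun r = (\<lambda>m. fps_nth
     (\<Prod>i=1..m. (1 + fps_const (zvar i) * fps_X) / (1 - fps_const (zvar i) * fps_X)) r)"

inductive_set Gamma_C :: "symfun set" where
  one: "1 \<in> Gamma_C"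
| gen: "1 \<le> r \<Longrightarrow> q_fun r \<in> Gamma_C"
| scale: "f \<in> Gamma_C \<Longrightarrow> sf_scale c f \<in> Gamma_C"
| add: "f \<in> Gamma_C \<Longrightarrow> g \<in> Gamma_C \<Longrightarrow> f + g \<in> Gamma_C"
| mult: "f \<in> Gamma_C \<Longrightarrow> g \<in> Gamma_C \<Longrightarrow> f * g \<in> Gamma_C"

definition strict_partition :: "nat \<Rightarrow> nat list \<Rightarrow> bool" where
  "strict_partition n lam \<longleftrightarrow> sorted_wrt (>) lam \<and> (\<forall>r\<in>set lam. 0 < r) \<and> sum_list lam = n"

definition partition_delta :: "nat list \<Rightarrow> nat" where
  "partition_delta lam = (if even (length lam) then 0 else 1)"

definition tail_cosets :: "nat \<Rightarrow> nat \<Rightarrow> (nat \<Rightarrow> nat) set set" where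
  "tail_cosets m l = (\<lambda>w. {w \<circ> v |v. v permutes {l + 1..m}}) ` {w. w permutes {1..m}}"

text \<open>
  The summand only depends on the coset. For $m<\ell(\lambda)$, where the defining formula does
  not apply, stability ($z_{m+1}=\dots=z_\ell=0$) gives the value 0.
\<close>

definition schur_Q :: "nat list \<Rightarrow> symfun" where
  "schur_Q lam = (\<lambda>m. let l = length lam in
     if m < l then 0 else 2 ^ l * (\<Sum>C\<in>tail_cosets m l. let w = (SOME w. w \<in> C) in
       (\<Prod>i=1..l. zvar (w i) ^ (lam ! (i - 1))) *
       (\<Prod>i=1..l. \<Prod>j=i + 1..m. (zvar (w i) + zvar (w j)) / (zvar (w i) - zvar (w j)))))"

text \<open>
  Evaluation of a polynomial in the ring $\mathbb{C}[s][[t]]$.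
  The specialization at $1,t,t^2,\dots,s,st,st^2,\dots$ is the $t$-adic limit of those at
  the finite sets of variables $1,\dots,t^{k-1},s,\dots,st^{k-1}$.
\<close>

definition zpoly_eval :: "(nat \<Rightarrow> complex poly fps) \<Rightarrow> zpoly \<Rightarrow> complex poly fps" where
  "zpoly_eval z f = (\<Sum>a\<in>Poly_Mapping.keys f.
     fps_const [:Poly_Mapping.lookup f a:] *
     (\<Prod>i\<in>Poly_Mapping.keys a. z i ^ Poly_Mapping.lookup a i))"

definition principal_vars :: "nat \<Rightarrow> nat \<Rightarrow> complex poly fps" where
  "principal_vars k i =
     (if i \<le> k then fps_X ^ (i - 1) else fps_const [:0, 1:] * fps_X ^ (i - k - 1))"

definition schur_Q_principal :: "nat list \<Rightarrow> complex poly fps" where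
  "schur_Q_principal lam =
     lim (\<lambda>k. zpoly_eval (principal_vars k) (THE f. to_fract f = schur_Q lam (2 * k)))"


section \<open>The characteristic map and the labelling of the irreducible modules\<close>

definition characteristic_map :: "(k_group \<Rightarrow> symfun) \<Rightarrow> bool" where
  "characteristic_map ch \<longleftrightarrow>
     Vector_Spaces.linear k_scale sf_scale ch \<and> bij_betw ch UNIV Gamma_C \<and>
     (\<forall>n nu M. is_composition n nu \<longrightarrow> is_induced_trivial n nu M \<longrightarrow>
        ch (k_class n M) = prod_list (map q_fun nu))"

definition irreducible_labelling ::
  "(k_group \<Rightarrow> symfun) \<Rightarrow> nat \<Rightarrow> (nat list \<Rightarrow> nat hcmod) \<Rightarrow> bool" where
  "irreducible_labelling ch n D \<longleftrightarrow>
     (\<forall>lam. strict_partition n lam \<longrightarrow> hc_irreducible n (D lam) \<and>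
        ch (k_class n (D lam)) =
          sf_scale (1 / 2 ^ ((length lam - partition_delta lam) div 2)) (schur_Q lam)) \<and>
     (\<forall>lam mu. strict_partition n lam \<longrightarrow> strict_partition n mu \<longrightarrow>
        hc_iso n (D lam) (D mu) \<longrightarrow> lam = mu) \<and>
     (\<forall>M :: nat hcmod. hc_irreducible n M \<longrightarrow> (\<exists>lam. strict_partition n lam \<and> hc_iso n M (D lam)))"

end

theory Submission
  imports Defs
begin

text \<open>
  The basis vector $c_A\otimes x^a\otimes e_B$ of $\mathcal{C}_n\otimes S^pV\otimes\wedge^qV$ is
  multiplied by $c_B$ on the right of $c_A$. The sign of a permutation on $e_B$ cancels the
  one on $c_B$, so the module becomes, up to parity, $\mathcal{C}_n\otimes M$ with $M$
  the permutation module on the pairs $(a,B)$. The orbits of these pairs are the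
  colourings of $\{1,\dots,n\}$ with prescribed numbers $\nu_j$ of elements of colour $j$, and give the
  modules induced from the Young subgroups $S_\nu$. Hence the characteristic is a sum
  of products $q_\nu$. By the Cauchy identity $\sum_\nu q_\nu(x)y^\nu=\sum_\lambda 2^{-\ell(\lambda)}Q_\lambda(x)Q_\lambda(y)$
  the coefficient of $Q_\lambda$ in it is the sum of the corresponding coefficients of $y^\nu$ in $2^{-\ell(\lambda)}Q_\lambda(y)$,
  which is the coefficient of $t^ps^q$ in the specialization at $1,t,\dots,t^{k-1},s,\dots,st^{k-1}$ when $p<k$.

  For the Cauchy identity, $q_\nu=\sum_\lambda a_{\nu\lambda}Q_\lambda$ for some coefficients by the
  raising operator formula, triangularly. The matrix of the coefficients of $q_\nu$ at $y^\mu$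
  is symmetric, and comparing the two expansions of it
  forces $2^{\ell(\lambda)}a_{\nu\lambda}$ to be the coefficient of $y^\nu$ in $Q_\lambda$, by induction along the order of leading exponents.
\<close>


section \<open>Expansion of Schur Q-functions in the products $q_\nu$\<close>

text \<open>The formula for \<open>schur_Q\<close> is a sum of fractions, so its monomials cannot be
  read off directly. Two devices get round this. The expansion in the \<open>q_prod nu\<close>
  exhibits the polynomial \<open>Q_poly\<close>; its leading term is then found from the growth of
  the original fractions along a curve of real points, where every cross factor (z_i + z_j) / (z_i -
  z_j) tends to a sign. For both purposes the coset sum is regrouped by the index that receives the
  first part, which gives the recursion \<open>Q_on\<close> over any field and index set. Two orders
  on strict partitions occur: \<open>excess\<close>, which raising operators and the relations among
  the q_r increase, and the weight of the leading exponent. The Cauchy identity uses both, so they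
  have to be compatible. On the module side a composition factor may be identified with D^lam by a
  map that mixes parities. Such maps are split into components, and multiplicities are read from
  classes in the Grothendieck group by linear independence of the Q_lam. The power of 2 in the
  theorem is 2^(-l), from the Cauchy identity, divided by 2^(-(l - delta)/2), from the
  characteristic of D^lam.\<close>

fun Q_on :: "(nat \<Rightarrow> 'a::field) \<Rightarrow> nat list \<Rightarrow> nat set \<Rightarrow> 'a" where
  "Q_on z [] I = 1"
| "Q_on z (r # rs) I =
     2 * (\<Sum>i\<in>I. z i ^ r * (\<Prod>j\<in>I - {i}. (z i + z j) / (z i - z j)) * Q_on z rs (I - {i}))"

definition q_series :: "(nat \<Rightarrow> 'a::field) \<Rightarrow> nat set \<Rightarrow> 'a fps" where
  "q_series z I = (\<Prod>i\<in>I. (1 + fps_const (z i) * fps_X) / (1 - fps_const (z i) * fps_X))"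

definition q_list :: "(nat \<Rightarrow> 'a::field) \<Rightarrow> nat set \<Rightarrow> nat list \<Rightarrow> 'a" where
  "q_list z I nu = prod_list (map (fps_nth (q_series z I)) nu)"

text \<open>Partial fractions in x: the poles are simple and lie at the z_i, and the term for z_i is
  normalised as x / (x - z_i) so that the constant is the value (-1)^|I| at x = 0. The induction
  needs the claim both at x and at the new point z_k, hence x is arbitrary.\<close>

lemma cross_product_partial_fractions:
  fixes z :: "nat \<Rightarrow> 'a::field"
  assumes "finite I" "inj_on z I" "x \<notin> z ` I"
  shows "(\<Prod>j\<in>I. (x + z j) / (x - z j)) =
    (- 1) ^ card I + (\<Sum>i\<in>I. 2 * (x / (x - z i)) * (\<Prod>j\<in>I - {i}. (z i + z j) / (z i - z j)))"
  using assms
proof (induction I arbitrary: x rule: finite_induct)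
  case empty
  then show ?case by simp
next
  case (insert k I)
  define g where "g i = (\<Prod>j\<in>I - {i}. (z i + z j) / (z i - z j))" for i
  let ?e = "(- 1) ^ card I :: 'a"
  have zk: "z k \<notin> z ` I" "x \<noteq> z k" "\<And>i. i \<in> I \<Longrightarrow> x \<noteq> z i" "\<And>i. i \<in> I \<Longrightarrow> z i \<noteq> z k"
    using insert.prems insert.hyps by (auto simp: inj_on_def)
  have prod_ins: "(\<Prod>j\<in>insert k I - {i}. (z i + z j) / (z i - z j)) = (z i + z k) / (z i - z k) * g i"
    if "i \<in> I" for i
  proof -
    have "insert k I - {i} = insert k (I - {i})" using that insert.hyps by auto
    then show ?thesis using insert.hyps by (simp add: g_def)
  qed
  have ins_k: "insert k I - {k} = I" using insert.hyps by auto
  have IHk: "(\<Prod>j\<in>I. (z k + z j) / (z k - z j)) = ?e + (\<Sum>i\<in>I. 2 * (z k / (z k - z i)) * g i)"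
    unfolding g_def using insert.IH[of "z k"] insert.prems zk by auto
  have IHx: "(\<Prod>j\<in>I. (x + z j) / (x - z j)) = ?e + (\<Sum>i\<in>I. 2 * (x / (x - z i)) * g i)"
    unfolding g_def using insert.IH[of x] insert.prems zk by auto
  \<comment> \<open>Separates the poles z_k and z_i. Summed over i, the parts at z_k form the sum in
    \<open>IHk\<close>, that is, the product at x = z_k without its constant.\<close>
  have termwise: "(x + z k) / (x - z k) * (2 * (x / (x - z i)) * g i) =
      2 * (x / (x - z k)) * (2 * (z k / (z k - z i)) * g i)
      + 2 * (x / (x - z i)) * ((z i + z k) / (z i - z k) * g i)" if "i \<in> I" for i
  proof -
    have "(x + z k) / (x - z k) * (x / (x - z i)) =
       2 * (x / (x - z k)) * (z k / (z k - z i)) + (x / (x - z i)) * ((z i + z k) / (z i - z k))"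
      using zk(2) zk(3,4)[OF that] by (simp add: divide_simps) (simp add: algebra_simps)
    then have "(x + z k) / (x - z k) * (x / (x - z i)) * (2 * g i) =
       (2 * (x / (x - z k)) * (z k / (z k - z i)) + (x / (x - z i)) * ((z i + z k) / (z i - z k))) * (2 * g i)"
      by simp
    then show ?thesis by (simp only: ring_distribs mult_ac)
  qed
  have const: "(x + z k) / (x - z k) * ?e = - ?e + 2 * (x / (x - z k)) * ?e"
  proof -
    have "(x + z k) / (x - z k) = - 1 + 2 * (x / (x - z k))"
      using zk by (simp add: field_simps)
    then show ?thesis by (simp only: ring_distribs mult_ac) simp
  qed
  have "(\<Prod>j\<in>insert k I. (x + z j) / (x - z j)) =
      (x + z k) / (x - z k) * (?e + (\<Sum>i\<in>I. 2 * (x / (x - z i)) * g i))"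
    using insert.hyps IHx by simp
  also have "\<dots> = - ?e + 2 * (x / (x - z k)) * ?e + (\<Sum>i\<in>I. 2 * (x / (x - z k)) * (2 * (z k / (z k - z i)) * g i)
      + 2 * (x / (x - z i)) * ((z i + z k) / (z i - z k) * g i))"
    by (simp only: distrib_left const sum_distrib_left termwise cong: sum.cong)
  also have "\<dots> = - ?e + 2 * (x / (x - z k)) * (?e + (\<Sum>i\<in>I. 2 * (z k / (z k - z i)) * g i))
      + (\<Sum>i\<in>I. 2 * (x / (x - z i)) * ((z i + z k) / (z i - z k) * g i))"
    by (simp add: sum.distrib sum_distrib_left algebra_simps)
  also have "\<dots> = (- 1) ^ card (insert k I) +
      (\<Sum>i\<in>insert k I. 2 * (x / (x - z i)) * (\<Prod>j\<in>insert k I - {i}. (z i + z j) / (z i - z j)))"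
    using insert.hyps by (simp add: ins_k IHk prod_ins mult_ac cong: sum.cong)
  finally show ?case .
qed

lemma fps_geometric_nth:
  "fps_nth (inverse (1 - fps_const c * fps_X)) r = (c::'a::field) ^ r"
proof -
  have "inverse (1 - fps_const c * fps_X) = Abs_fps (\<lambda>r. c ^ r)"
  proof (rule fps_inverse_unique)
    show "(1 - fps_const c * fps_X) * Abs_fps (\<lambda>r. c ^ r) = 1"
    proof (rule fps_ext)
      fix n show "fps_nth ((1 - fps_const c * fps_X) * Abs_fps (\<lambda>r. c ^ r)) n = fps_nth 1 n"
        by (cases n) (simp_all add: algebra_simps)
    qed
  qed
  then show ?thesis by simp
qed

lemma fps_const_sum: "fps_const (sum f A) = (\<Sum>a\<in>A. fps_const (f a))"
  by (induction A rule: infinite_finite_induct) (simp_all flip: fps_const_add)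

text \<open>The preceding expansion with x = 1/u, so that x / (x - z_i) becomes the geometric series
  of z_i u. As u has no inverse among the power series, the induction is repeated with the geometric
  series h_i in place of the fractions.\<close>

lemma q_series_partial_fractions:
  fixes z :: "nat \<Rightarrow> 'a::field"
  assumes "finite I" "inj_on z I"
  shows "q_series z I = fps_const ((- 1) ^ card I) +
    (\<Sum>i\<in>I. fps_const (2 * (\<Prod>j\<in>I - {i}. (z i + z j) / (z i - z j))) * inverse (1 - fps_const (z i) * fps_X))"
  using assms
proof (induction I rule: finite_induct)
  case empty
  then show ?case by (simp add: q_series_def)
next
  case (insert k I)
  define g where "g i = (\<Prod>j\<in>I - {i}. (z i + z j) / (z i - z j))" for i
  define h where "h i = inverse (1 - fps_const (z i) * fps_X)" for i
  let ?e = "(- 1) ^ card I :: 'a"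
  have hinv: "(1 - fps_const (z i) * fps_X) * h i = 1" for i
    unfolding h_def by (rule inverse_mult_eq_1') simp
  have factor: "(1 + fps_const (z k) * fps_X) / (1 - fps_const (z k) * fps_X) = 2 * h k - 1"
  proof -
    have "(1 + fps_const (z k) * fps_X) / (1 - fps_const (z k) * fps_X) = (1 + fps_const (z k) * fps_X) * h k"
      unfolding h_def by (rule fps_divide_unit) simp
    also have "\<dots> = 2 * h k - (1 - fps_const (z k) * fps_X) * h k" by (simp add: algebra_simps)
    finally show ?thesis by (simp add: hinv)
  qed
  have zk: "z k \<notin> z ` I" "\<And>i. i \<in> I \<Longrightarrow> z i \<noteq> z k"
    using insert.prems insert.hyps by (auto simp: inj_on_def)
  have prod_ins: "(\<Prod>j\<in>insert k I - {i}. (z i + z j) / (z i - z j)) = (z i + z k) / (z i - z k) * g i"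
    if "i \<in> I" for i
  proof -
    have "insert k I - {i} = insert k (I - {i})" using that insert.hyps by auto
    then show ?thesis using insert.hyps by (simp add: g_def)
  qed
  have ins_k: "insert k I - {k} = I" using insert.hyps by auto
  have gk: "(\<Prod>j\<in>I. (z k + z j) / (z k - z j)) = ?e + (\<Sum>i\<in>I. 2 * (z k / (z k - z i)) * g i)"
    unfolding g_def using cross_product_partial_fractions[of I z "z k"] insert zk by auto
  \<comment> \<open>The resolvent identity for two geometric series, which replaces the separation
    of poles.\<close>
  have hh: "h i * h k = fps_const (z i / (z i - z k)) * h i - fps_const (z k / (z i - z k)) * h k"
    if "i \<in> I" for i
  proof -
    have "fps_const (z i - z k) * (h i * h k) =
        fps_const (z i) * h i * ((1 - fps_const (z k) * fps_X) * h k)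
        - fps_const (z k) * h k * ((1 - fps_const (z i) * fps_X) * h i)"
      by (simp add: algebra_simps flip: fps_const_sub)
    then have "fps_const (1 / (z i - z k)) * (fps_const (z i - z k) * (h i * h k)) =
        fps_const (1 / (z i - z k)) * (fps_const (z i) * h i - fps_const (z k) * h k)"
      by (simp add: hinv)
    moreover have "fps_const (1 / (z i - z k)) * fps_const (z i - z k) = 1"
      using zk(2)[OF that] by (simp del: fps_const_sub)
    ultimately show ?thesis
      by (simp add: right_diff_distrib flip: mult.assoc del: fps_const_sub)
  qed
  have termwise: "fps_const (2 * g i) * h i * (2 * h k - 1) =
     fps_const (2 * ((z i + z k) / (z i - z k) * g i)) * h i + fps_const (2 * (2 * (z k / (z k - z i)) * g i)) * h k"
    if "i \<in> I" for i
  proof -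
    have "fps_const (2 * g i) * h i * (2 * h k - 1) = fps_const (4 * g i) * (h i * h k) - fps_const (2 * g i) * h i"
      by (simp add: algebra_simps numeral_fps_const)
    also have "\<dots> = (fps_const (4 * g i * (z i / (z i - z k))) - fps_const (2 * g i)) * h i
          + fps_const (- (4 * g i * (z k / (z i - z k)))) * h k"
      unfolding hh[OF that] fps_const_neg[symmetric] fps_const_mult[symmetric] 
      by (simp only: algebra_simps) (simp flip: fps_const_neg)
    also have "fps_const (4 * g i * (z i / (z i - z k))) - fps_const (2 * g i) =
       fps_const (2 * ((z i + z k) / (z i - z k) * g i))"
      using zk(2)[OF that] by (simp add: field_simps)
    also have "- (4 * g i * (z k / (z i - z k))) = 2 * (2 * (z k / (z k - z i)) * g i)"
      using zk(2)[OF that] by (simp add: divide_simps) (simp add: algebra_simps)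
    finally show ?thesis by simp
  qed
  have "q_series z (insert k I) = q_series z I * (2 * h k - 1)"
    using insert.hyps factor by (simp add: q_series_def)
  also have "q_series z I = fps_const ?e + (\<Sum>i\<in>I. fps_const (2 * g i) * h i)"
    using insert by (simp add: g_def h_def)
  also have "(fps_const ?e + (\<Sum>i\<in>I. fps_const (2 * g i) * h i)) * (2 * h k - 1) =
     fps_const ?e * (2 * h k - 1) + (\<Sum>i\<in>I. fps_const (2 * ((z i + z k) / (z i - z k) * g i)) * h i
       + fps_const (2 * (2 * (z k / (z k - z i)) * g i)) * h k)"
    by (simp add: distrib_right sum_distrib_right termwise cong: sum.cong)
  also have "\<dots> = fps_const (- ?e) + fps_const (2 * (?e + (\<Sum>i\<in>I. 2 * (z k / (z k - z i)) * g i))) * h k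
      + (\<Sum>i\<in>I. fps_const (2 * ((z i + z k) / (z i - z k) * g i)) * h i)"
  proof -
    have "fps_const (2 * (?e + (\<Sum>i\<in>I. 2 * (z k / (z k - z i)) * g i))) =
        2 * fps_const ?e + (\<Sum>i\<in>I. fps_const (2 * (2 * (z k / (z k - z i)) * g i)))"
      by (simp add: numeral_fps_const sum_distrib_left distrib_left flip: fps_const_sum)
    then show ?thesis
      by (simp only: sum.distrib sum_distrib_right distrib_right)
        (simp add: algebra_simps flip: fps_const_neg)
  qed
  also have "\<dots> = fps_const ((- 1) ^ card (insert k I)) +
    (\<Sum>i\<in>insert k I. fps_const (2 * (\<Prod>j\<in>insert k I - {i}. (z i + z j) / (z i - z j))) * h i)"
    using insert.hyps by (simp add: ins_k gk prod_ins cong: sum.cong)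
  finally show ?case by (simp add: h_def)
qed

text \<open>The one-row case Q_(r) = q_r. The constant of the partial fractions only meets the
  coefficient at u^0, hence r > 0.\<close>

lemma q_series_nth_pos:
  fixes z :: "nat \<Rightarrow> 'a::field"
  assumes "finite I" "inj_on z I" "0 < r"
  shows "fps_nth (q_series z I) r = 2 * (\<Sum>i\<in>I. z i ^ r * (\<Prod>j\<in>I - {i}. (z i + z j) / (z i - z j)))"
  unfolding q_series_partial_fractions[OF assms(1,2)] using assms(3)
  by (simp add: fps_sum_nth fps_geometric_nth sum_distrib_left mult.assoc mult.commute[of "z _ ^ r"])

lemma q_series_nth_0: "fps_nth (q_series z I) 0 = 1"
  by (induction I rule: infinite_finite_induct) (simp_all add: q_series_def fps_divide_unit)

text \<open>Removing z_i divides the series by (1 + z_i u) / (1 - z_i u). The inverse factor is 2 /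
  (1 + z_i u) - 1 = 1 - 2 z_i u + 2 z_i^2 u^2 - ..., whose coefficients appear on the right.\<close>

lemma q_series_remove:
  fixes z :: "nat \<Rightarrow> 'a::field"
  assumes "finite I" "i \<in> I"
  shows "fps_nth (q_series z (I - {i})) s =
    (\<Sum>k\<in>{0..s}. of_int (if k = 0 then 1 else 2 * (- 1) ^ k) * z i ^ k * fps_nth (q_series z I) (s - k))"
proof -
  let ?h = "inverse (1 - fps_const (- z i) * fps_X)"
  let ?g = "inverse (1 - fps_const (z i) * fps_X)"
  have inv1: "(1 + fps_const (z i) * fps_X) * ?h = 1"
    using inverse_mult_eq_1'[of "1 - fps_const (- z i) * fps_X"]
    by (simp only: fps_const_neg[symmetric] mult_minus_left diff_minus_eq_add) simp
  have inv2: "(1 - fps_const (z i) * fps_X) * ?g = 1"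
    by (rule inverse_mult_eq_1') simp
  have "q_series z I = (1 + fps_const (z i) * fps_X) / (1 - fps_const (z i) * fps_X) * q_series z (I - {i})"
    unfolding q_series_def using assms by (rule prod.remove)
  then have "q_series z I = (1 + fps_const (z i) * fps_X) * ?g * q_series z (I - {i})"
    by (simp add: fps_divide_unit)
  then have "(2 * ?h - 1) * q_series z I =
     (2 * ((1 + fps_const (z i) * fps_X) * ?h) - (1 + fps_const (z i) * fps_X)) * ?g * q_series z (I - {i})"
    by (simp add: algebra_simps)
  also have "\<dots> = ((1 - fps_const (z i) * fps_X) * ?g) * q_series z (I - {i})"
    by (simp only: inv1) simp
  finally have "q_series z (I - {i}) = (2 * ?h - 1) * q_series z I"
    by (simp only: inv2) simp
  moreover have "fps_nth (2 * ?h - 1) k = of_int (if k = 0 then 1 else 2 * (- 1) ^ k) * z i ^ k" for k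
    using fps_geometric_nth[of "- z i" k] power_minus[of "z i" k]
    by (simp add: numeral_fps_const del: fps_const_neg)
  ultimately show ?thesis by (simp add: fps_mult_nth)
qed

text \<open>
  The raising operator formula $Q_\lambda=\prod_{i<j}\frac{1-R_{ij}}{1+R_{ij}}\,q_\lambda$, with
  $\frac{1-u}{1+u}=1-2u+2u^2-\cdots$ expanded in each factor: the operators $R_{1j}$ lower the later parts.
\<close>

fun lower_terms :: "nat list \<Rightarrow> (int \<times> nat list) list" where
  "lower_terms [] = [(1, [])]"
| "lower_terms (s # nu) =
     [((if k = 0 then 1 else 2 * (- 1) ^ k) * d, (s - k) # be). k \<leftarrow> [0..<Suc s], (d, be) \<leftarrow> lower_terms nu]"

fun Q_expansion :: "nat list \<Rightarrow> (int \<times> nat list) list" where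
  "Q_expansion [] = [(1, [])]"
| "Q_expansion (r # mu) =
     [(c * d, (r + (sum_list al - sum_list be)) # be). (c, al) \<leftarrow> Q_expansion mu, (d, be) \<leftarrow> lower_terms al]"

lemma sum_list_concat: "sum_list (concat xss) = sum_list (map sum_list xss)"
  by (induction xss) simp_all

text \<open>Makes the truncated subtraction of sizes in \<open>Q_expansion\<close> exact.\<close>

lemma lower_terms_sum_length:
  "(d, be) \<in> set (lower_terms nu) \<Longrightarrow> sum_list be \<le> sum_list nu \<and> length be = length nu"
  by (induction nu arbitrary: d be) (force simp: add_mono)+

text \<open>One use of \<open>q_series_remove\<close> for each entry. The exponent of z_i is the
  total number of boxes taken from the entries, which \<open>Q_expansion\<close> adds to the first
  part.\<close>

lemma q_list_remove:
  fixes z :: "nat \<Rightarrow> 'a::field"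
  assumes "finite I" "i \<in> I"
  shows "q_list z (I - {i}) nu =
    (\<Sum>(d, be)\<leftarrow>lower_terms nu. of_int d * z i ^ (sum_list nu - sum_list be) * q_list z I be)"
proof (induction nu)
  case Nil
  then show ?case by (simp add: q_list_def)
next
  case (Cons s nu)
  let ?d = "\<lambda>k::nat. if k = 0 then 1 else 2 * (- 1) ^ k :: int"
  have "(\<Sum>(d, be)\<leftarrow>lower_terms (s # nu). of_int d * z i ^ (sum_list (s # nu) - sum_list be) * q_list z I be)
    = (\<Sum>k\<leftarrow>[0..<Suc s]. \<Sum>(d, be)\<leftarrow>lower_terms nu.
         of_int (?d k * d) * z i ^ (s + sum_list nu - (s - k + sum_list be)) * q_list z I ((s - k) # be))"
    by (simp add: map_concat sum_list_concat comp_def split_def del: upt_Suc)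
  also have "\<dots> = (\<Sum>k\<leftarrow>[0..<Suc s]. (of_int (?d k) * z i ^ k * fps_nth (q_series z I) (s - k)) *
         (\<Sum>(d, be)\<leftarrow>lower_terms nu. of_int d * z i ^ (sum_list nu - sum_list be) * q_list z I be))"
  proof (intro arg_cong[of _ _ sum_list] map_cong refl, goal_cases)
    case (1 k)
    then have k: "k \<le> s" by auto
    show ?case
      unfolding sum_list_const_mult[symmetric]
    proof (intro arg_cong[of _ _ sum_list] map_cong refl, goal_cases)
      case (1 x)
      obtain d be where x: "x = (d, be)" by fastforce
      have le: "sum_list be \<le> sum_list nu" using 1 x lower_terms_sum_length by blast
      then have "s + sum_list nu - (s - k + sum_list be) = k + (sum_list nu - sum_list be)"
        using k by simp
      then show ?case
        unfolding x prod.case by (simp only: q_list_def list.map prod_list.Cons power_add of_int_mult mult_ac)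
    qed
  qed
  also have "\<dots> = fps_nth (q_series z (I - {i})) s * q_list z (I - {i}) nu"
    unfolding sum_list_mult_const Cons.IH[symmetric] q_series_remove[OF assms]
    by (simp only: interv_sum_list_conv_sum_set_nat atLeastLessThanSuc_atLeastAtMost set_upt)
  finally show ?case by (simp add: q_list_def)
qed

text \<open>In \<open>Q_on\<close> the factor for the remaining parts is by induction a combination
  of products of the q's in the variables other than z_i. Rewriting these in all variables leaves
  powers of z_i, and the sum over i is then a single q_r with r raised by the boxes taken away. Here
  r > 0 is what allows the one-row formula.\<close>

lemma Q_expansion_correct:
  fixes z :: "nat \<Rightarrow> 'a::field"
  assumes "inj_on z I" "finite I" "\<forall>r\<in>set lam. 0 < r"
  shows "Q_on z lam I = (\<Sum>(c, al)\<leftarrow>Q_expansion lam. of_int c * q_list z I al)"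
  using assms
proof (induction lam arbitrary: I)
  case Nil
  then show ?case by (simp add: q_list_def)
next
  case (Cons r mu)
  let ?g = "\<lambda>i. \<Prod>j\<in>I - {i}. (z i + z j) / (z i - z j)"
  have swap: "(\<Sum>i\<in>I. \<Sum>x\<leftarrow>xs. F i x) = (\<Sum>x\<leftarrow>xs. \<Sum>i\<in>I. F i x)" for F :: "nat \<Rightarrow> 'b \<Rightarrow> 'a" and xs
    by (induction xs) (simp_all add: sum.distrib)
  have "Q_on z (r # mu) I = 2 * (\<Sum>i\<in>I. z i ^ r * ?g i *
      (\<Sum>(c, al)\<leftarrow>Q_expansion mu. of_int c *
         (\<Sum>(d, be)\<leftarrow>lower_terms al. of_int d * z i ^ (sum_list al - sum_list be) * q_list z I be)))"
  proof -
    have "Q_on z mu (I - {i}) = (\<Sum>(c, al)\<leftarrow>Q_expansion mu. of_int c *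
         (\<Sum>(d, be)\<leftarrow>lower_terms al. of_int d * z i ^ (sum_list al - sum_list be) * q_list z I be))"
      if "i \<in> I" for i
    proof -
      have "Q_on z mu (I - {i}) = (\<Sum>(c, al)\<leftarrow>Q_expansion mu. of_int c * q_list z (I - {i}) al)"
        using Cons.prems by (intro Cons.IH) (auto intro: inj_on_subset)
      then show ?thesis using q_list_remove[OF \<open>finite I\<close> that, of z] by simp
    qed
    then show ?thesis by simp
  qed
  also have "\<dots> = (\<Sum>(c, al)\<leftarrow>Q_expansion mu. \<Sum>(d, be)\<leftarrow>lower_terms al. of_int (c * d) *
      (2 * (\<Sum>i\<in>I. z i ^ (r + (sum_list al - sum_list be)) * ?g i)) * q_list z I be)"
    by (simp add: split_def swap power_add sum_distrib_left sum_distrib_right mult_ac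
        flip: sum_list_const_mult)
  also have "\<dots> = (\<Sum>(c, al)\<leftarrow>Q_expansion mu. \<Sum>(d, be)\<leftarrow>lower_terms al. of_int (c * d) *
      q_list z I ((r + (sum_list al - sum_list be)) # be))"
    using Cons.prems q_series_nth_pos[of I z] by (simp add: q_list_def split_def mult_ac)
  also have "\<dots> = (\<Sum>(c, al)\<leftarrow>Q_expansion (r # mu). of_int c * q_list z I al)"
    by (simp add: map_concat sum_list_concat comp_def split_def)
  finally show ?case .
qed

section \<open>The coset sum and its recursive form\<close>

definition distinct_lists :: "nat \<Rightarrow> nat set \<Rightarrow> nat list set" where
  "distinct_lists l I = {xs. length xs = l \<and> distinct xs \<and> set xs \<subseteq> I}"

lemma finite_distinct_lists: "finite I \<Longrightarrow> finite (distinct_lists l I)"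
  unfolding distinct_lists_def by (rule finite_subset[OF _ finite_lists_length_eq[of I l]]) auto

lemma distinct_lists_Suc:
  "distinct_lists (Suc l) I = (\<lambda>(i, xs). i # xs) ` (SIGMA i:I. distinct_lists l (I - {i}))"
proof -
  have "xs \<in> distinct_lists (Suc l) I \<longleftrightarrow> xs \<in> (\<lambda>(i, xs). i # xs) ` (SIGMA i:I. distinct_lists l (I - {i}))" for xs
    by (cases xs) (auto simp: distinct_lists_def image_iff)
  then show ?thesis by blast
qed

text \<open>The successive choices of i in the recursion form a list without repetition, and each
  factor runs over the indices not chosen so far.\<close>

lemma Q_on_distinct_lists:
  fixes z :: "nat \<Rightarrow> 'a::field"
  assumes "finite I"
  shows "Q_on z lam I = 2 ^ length lam * (\<Sum>xs\<in>distinct_lists (length lam) I.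
     (\<Prod>k<length lam. z (xs ! k) ^ (lam ! k) *
        (\<Prod>j\<in>I - set (take (Suc k) xs). (z (xs ! k) + z j) / (z (xs ! k) - z j))))"
  using assms
proof (induction lam arbitrary: I)
  case Nil
  have "distinct_lists 0 I = {[]}" by (auto simp: distinct_lists_def)
  then show ?case by simp
next
  case (Cons r rs)
  let ?g = "\<lambda>i. \<Prod>j\<in>I - {i}. (z i + z j) / (z i - z j)"
  let ?T = "\<lambda>lam I xs. \<Prod>k<length lam. z (xs ! k) ^ (lam ! k) *
        (\<Prod>j\<in>I - set (take (Suc k) xs). (z (xs ! k) + z j) / (z (xs ! k) - z j))"
  have T_Cons: "?T (r # rs) I (i # xs) = z i ^ r * ?g i * ?T rs (I - {i}) xs" for i xs
  proof -
    have "I - set (take (Suc (Suc k)) (i # xs)) = I - {i} - set (take (Suc k) xs)" for k by auto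
    moreover have "I - set (take (Suc 0) (i # xs)) = I - {i}" by auto
    ultimately show ?thesis
      by (simp only: list.size add_Suc_right add_0_right prod.lessThan_Suc_shift nth_Cons_0 nth_Cons_Suc comp_def)
  qed
  have "Q_on z (r # rs) I = 2 * (\<Sum>i\<in>I. z i ^ r * ?g i *
      (2 ^ length rs * (\<Sum>xs\<in>distinct_lists (length rs) (I - {i}). ?T rs (I - {i}) xs)))"
    using Cons by simp
  also have "\<dots> = 2 ^ length (r # rs) * (\<Sum>i\<in>I. \<Sum>xs\<in>distinct_lists (length rs) (I - {i}). ?T (r # rs) I (i # xs))"
    by (simp only: T_Cons) (simp add: sum_distrib_left mult_ac)
  also have "(\<Sum>i\<in>I. \<Sum>xs\<in>distinct_lists (length rs) (I - {i}). ?T (r # rs) I (i # xs)) =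
     (\<Sum>(i, xs)\<in>(SIGMA i:I. distinct_lists (length rs) (I - {i})). ?T (r # rs) I (i # xs))"
    using Cons.prems by (intro sum.Sigma) (auto intro: finite_distinct_lists)
  also have "\<dots> = (\<Sum>xs\<in>distinct_lists (length (r # rs)) I. ?T (r # rs) I xs)"
    unfolding list.size add_Suc_right add_0_right distinct_lists_Suc
    by (subst sum.reindex) (auto simp: inj_on_def comp_def split_def)
  finally show ?case .
qed

definition prefix_coset :: "nat \<Rightarrow> nat list \<Rightarrow> (nat \<Rightarrow> nat) set" where
  "prefix_coset m xs = {w. w permutes {1..m} \<and> (\<forall>k<length xs. w (Suc k) = xs ! k)}"

text \<open>An injective prefix extends to a permutation, since the two complements have equal size.
  This guarantees that \<open>SOME\<close> in \<open>schur_Q\<close> picks a member of the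
  coset.\<close>

lemma prefix_coset_nonempty:
  assumes "xs \<in> distinct_lists l {1..m}"
  obtains w where "w \<in> prefix_coset m xs"
proof -
  from assms have xs: "length xs = l" "distinct xs" "set xs \<subseteq> {1..m}" by (auto simp: distinct_lists_def)
  have card_xs: "card (set xs) = l" using xs distinct_card by auto
  have lm: "l \<le> m" using card_mono[OF _ xs(3)] card_xs by simp
  have "card {l + 1..m} = card ({1..m} - set xs)"
    using xs card_xs by (simp add: card_Diff_subset)
  then obtain g where g: "bij_betw g {l + 1..m} ({1..m} - set xs)"
    using finite_same_card_bij by blast
  have b1: "bij_betw (\<lambda>i. xs ! (i - 1)) {1..l} (set xs)"
    using xs(1) by (intro bij_betwI'[where X = "{1..l}"])
      (auto simp: in_set_conv_nth nth_eq_iff_index_eq[OF xs(2)] intro!: bexI[of _ "Suc _"] exI[of _ "_ - Suc 0"])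
  define w where "w i = (if i \<in> {1..l} then xs ! (i - 1) else if i \<in> {l + 1..m} then g i else i)" for i
  have "bij_betw w ({1..l} \<union> {l + 1..m}) (set xs \<union> ({1..m} - set xs))"
  proof (rule bij_betw_combine)
    show "bij_betw w {1..l} (set xs)"
      using b1 by (rule bij_betw_cong[THEN iffD1, rotated]) (simp add: w_def)
    show "bij_betw w {l + 1..m} ({1..m} - set xs)"
      using g by (rule bij_betw_cong[THEN iffD1, rotated]) (auto simp: w_def)
  qed auto
  moreover have "{1..l} \<union> {l + 1..m} = {1..m}" using lm by auto
  moreover have "set xs \<union> ({1..m} - set xs) = {1..m}" using xs by auto
  ultimately have "bij_betw w {1..m} {1..m}" by simp
  then have "w permutes {1..m}"
    by (rule bij_imp_permutes) (use lm in \<open>auto simp: w_def\<close>)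
  then have "w \<in> prefix_coset m xs"
    using xs(1) by (auto simp: prefix_coset_def w_def)
  then show ?thesis by (rule that)
qed

text \<open>Two permutations differ by a right factor that fixes 1, ..., l exactly when they agree
  on 1, ..., l. A coset is therefore the list w(1), ..., w(l).\<close>

lemma tail_cosets_eq:
  assumes "l \<le> m"
  shows "tail_cosets m l = prefix_coset m ` distinct_lists l {1..m}"
proof -
  have *: "{w \<circ> v |v. v permutes {l + 1..m}} = prefix_coset m (map (\<lambda>k. w (Suc k)) [0..<l])"
    if w: "w permutes {1..m}" for w
  proof (intro equalityI subsetI)
    fix u assume "u \<in> {w \<circ> v |v. v permutes {l + 1..m}}"
    then obtain v where v: "u = w \<circ> v" "v permutes {l + 1..m}" by auto
    have "v permutes {1..m}" using permutes_subset[OF v(2)] by auto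
    moreover have "v (Suc k) = Suc k" if "k < l" for k
      using v(2) that by (auto simp: permutes_def)
    ultimately show "u \<in> prefix_coset m (map (\<lambda>k. w (Suc k)) [0..<l])"
      using v(1) w by (auto simp: prefix_coset_def intro: permutes_compose)
  next
    fix u assume "u \<in> prefix_coset m (map (\<lambda>k. w (Suc k)) [0..<l])"
    then have u: "u permutes {1..m}" "\<And>k. k < l \<Longrightarrow> u (Suc k) = w (Suc k)"
      by (auto simp: prefix_coset_def)
    let ?v = "inv w \<circ> u"
    have v: "?v permutes {1..m}" using u w by (intro permutes_compose permutes_inv)
    have "?v permutes {l + 1..m}"
    proof (rule permutes_superset[OF v])
      fix x assume "x \<in> {1..m} - {l + 1..m}"
      then obtain k where "x = Suc k" "k < l" by (cases x) auto
      then show "?v x = x" using u(2) permutes_inverses(2)[OF w] by simp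
    qed
    moreover have "u = w \<circ> ?v" using permutes_inverses(1)[OF w] by (auto simp: fun_eq_iff)
    ultimately show "u \<in> {w \<circ> v |v. v permutes {l + 1..m}}" by blast
  qed
  show ?thesis
  proof (intro equalityI subsetI)
    fix C assume "C \<in> tail_cosets m l"
    then obtain w where w: "w permutes {1..m}" "C = prefix_coset m (map (\<lambda>k. w (Suc k)) [0..<l])"
      unfolding tail_cosets_def using * by auto
    have "w ` {1..m} = {1..m}" using w permutes_image by blast
    then have "map (\<lambda>k. w (Suc k)) [0..<l] \<in> distinct_lists l {1..m}"
      using permutes_inj[OF w(1)] assms
      by (auto simp: distinct_lists_def distinct_map inj_on_def inj_def)
    with w show "C \<in> prefix_coset m ` distinct_lists l {1..m}" by blast
  next
    fix C assume "C \<in> prefix_coset m ` distinct_lists l {1..m}"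
    then obtain xs where xs: "xs \<in> distinct_lists l {1..m}" "C = prefix_coset m xs" by auto
    obtain w where w: "w \<in> prefix_coset m xs" using prefix_coset_nonempty[OF xs(1)] .
    have "length xs = l" using xs by (auto simp: distinct_lists_def)
    then have "map (\<lambda>k. w (Suc k)) [0..<l] = xs" 
      using w by (auto simp: prefix_coset_def intro!: nth_equalityI)
    then show "C \<in> tail_cosets m l"
      using w *[of w] xs unfolding tail_cosets_def by (auto simp: prefix_coset_def image_iff)
  qed
qed

text \<open>The product over j > i runs over the image of {i+1..m}, which is the complement of the
  first i values. So the summand depends only on the list of values and not on the representative.
  For m < length lam there are no lists, in agreement with the value 0.\<close>

lemma schur_Q_eq_Q_on: "schur_Q lam m = Q_on zvar lam {1..m}"
proof (cases "m < length lam")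
  case True
  have "distinct_lists (length lam) {1..m} = {}"
  proof -
    have False if "xs \<in> distinct_lists (length lam) {1..m}" for xs
      using that True card_mono[of "{1..m}" "set xs"] distinct_card[of xs]
      by (auto simp: distinct_lists_def)
    then show ?thesis by blast
  qed
  with True show ?thesis by (simp add: schur_Q_def Q_on_distinct_lists)
next
  case False
  define l where "l = length lam"
  have lm: "l \<le> m" using False l_def by simp
  let ?z = "zvar"
  let ?F = "\<lambda>C. let w = (SOME w. w \<in> C) in
       (\<Prod>i=1..l. ?z (w i) ^ (lam ! (i - 1))) *
       (\<Prod>i=1..l. \<Prod>j=i + 1..m. (?z (w i) + ?z (w j)) / (?z (w i) - ?z (w j)))"
  have inj: "inj_on (prefix_coset m) (distinct_lists l {1..m})"
  proof (rule inj_onI)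
    fix xs ys assume *: "xs \<in> distinct_lists l {1..m}" "ys \<in> distinct_lists l {1..m}"
      "prefix_coset m xs = prefix_coset m ys"
    obtain w where "w \<in> prefix_coset m xs" using prefix_coset_nonempty[OF *(1)] .
    moreover from this have "w \<in> prefix_coset m ys" using *(3) by simp
    ultimately have "\<forall>k<length xs. w (Suc k) = xs ! k" "\<forall>k<length ys. w (Suc k) = ys ! k"
      by (simp_all add: prefix_coset_def)
    with *(1,2) show "xs = ys" by (auto simp: distinct_lists_def intro!: nth_equalityI)
  qed
  have F: "?F (prefix_coset m xs) = (\<Prod>k<l. ?z (xs ! k) ^ (lam ! k) *
        (\<Prod>j\<in>{1..m} - set (take (Suc k) xs). (?z (xs ! k) + ?z j) / (?z (xs ! k) - ?z j)))"
    if xs: "xs \<in> distinct_lists l {1..m}" for xs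
  proof -
    define w where "w = (SOME w. w \<in> prefix_coset m xs)"
    have "w \<in> prefix_coset m xs" unfolding w_def using prefix_coset_nonempty[OF xs] by (metis someI)
    moreover have len: "length xs = l" using xs by (simp add: distinct_lists_def)
    ultimately have w: "w permutes {1..m}" "\<And>k. k < l \<Longrightarrow> w (Suc k) = xs ! k"
      by (auto simp: prefix_coset_def)
    have img: "w ` {Suc (Suc k)..m} = {1..m} - set (take (Suc k) xs)" if k: "k < l" for k
    proof -
      have "set (take (Suc k) xs) = (\<lambda>i. xs ! i) ` {..<Suc k}"
        using nth_image[of "Suc k" xs] k len by (simp add: atLeast0LessThan)
      also have "\<dots> = w ` Suc ` {..<Suc k}" using w(2) k by (auto simp: image_image)
      also have "Suc ` {..<Suc k} = {1..Suc k}" by (simp add: image_Suc_lessThan)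
      finally have "set (take (Suc k) xs) = w ` {1..Suc k}" .
      moreover have "{1..m} - w ` {1..Suc k} = w ` ({1..m} - {1..Suc k})"
        using permutes_image[OF w(1)] permutes_inj[OF w(1)] by (simp add: image_set_diff)
      moreover have "{1..m} - {1..Suc k} = {Suc (Suc k)..m}" by auto
      ultimately show ?thesis by simp
    qed
    have "?F (prefix_coset m xs) = (\<Prod>i=1..l. ?z (w i) ^ (lam ! (i - 1)) *
        (\<Prod>j=i + 1..m. (?z (w i) + ?z (w j)) / (?z (w i) - ?z (w j))))"
      by (simp add: Let_def prod.distrib flip: w_def)
    also have "\<dots> = (\<Prod>k<l. ?z (w (Suc k)) ^ (lam ! k) *
        (\<Prod>j=Suc (Suc k)..m. (?z (w (Suc k)) + ?z (w j)) / (?z (w (Suc k)) - ?z (w j))))"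
      by (rule prod.reindex_bij_witness[of _ Suc "\<lambda>i. i - 1"]) auto
    also have "\<dots> = (\<Prod>k<l. ?z (xs ! k) ^ (lam ! k) *
        (\<Prod>j\<in>{1..m} - set (take (Suc k) xs). (?z (xs ! k) + ?z j) / (?z (xs ! k) - ?z j)))"
    proof (rule prod.cong[OF refl])
      fix k assume "k \<in> {..<l}"
      then have k: "k < l" by simp
      have "(\<Prod>j=Suc (Suc k)..m. (?z (w (Suc k)) + ?z (w j)) / (?z (w (Suc k)) - ?z (w j))) =
         (\<Prod>j\<in>{1..m} - set (take (Suc k) xs). (?z (xs ! k) + ?z j) / (?z (xs ! k) - ?z j))"
        unfolding img[OF k, symmetric] w(2)[OF k]
        by (subst prod.reindex) (use permutes_inj[OF w(1)] in \<open>auto intro: inj_on_subset\<close>)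
      then show "?z (w (Suc k)) ^ (lam ! k) *
          (\<Prod>j=Suc (Suc k)..m. (?z (w (Suc k)) + ?z (w j)) / (?z (w (Suc k)) - ?z (w j))) =
         ?z (xs ! k) ^ (lam ! k) *
          (\<Prod>j\<in>{1..m} - set (take (Suc k) xs). (?z (xs ! k) + ?z j) / (?z (xs ! k) - ?z j))"
        using w(2)[OF k] by simp
    qed
    finally show ?thesis .
  qed
  have "schur_Q lam m = 2 ^ l * (\<Sum>C\<in>prefix_coset m ` distinct_lists l {1..m}. ?F C)"
    using False tail_cosets_eq[OF lm] by (simp add: schur_Q_def l_def Let_def)
  also have "(\<Sum>C\<in>prefix_coset m ` distinct_lists l {1..m}. ?F C) =
     (\<Sum>xs\<in>distinct_lists l {1..m}. ?F (prefix_coset m xs))"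
    using inj by (subst sum.reindex) (simp_all add: comp_def)
  also have "2 ^ l * \<dots> = Q_on zvar lam {1..m}"
    using F by (simp only: Q_on_distinct_lists[OF finite_atLeastAtMost] flip: l_def cong: sum.cong)
  finally show ?thesis .
qed

lemma q_fun_eq: "q_fun r m = fps_nth (q_series zvar {1..m}) r"
  by (simp add: q_fun_def q_series_def)

lemma prod_list_q_fun: "prod_list (map q_fun nu) m = q_list zvar {1..m} nu"
  by (induction nu) (simp_all add: q_list_def q_fun_eq)

lemma inj_zvar: "inj zvar"
proof (rule injI)
  fix i j assume "zvar i = zvar j"
  then have "(Poly_Mapping.single (Poly_Mapping.single i 1) 1 :: zpoly) = Poly_Mapping.single (Poly_Mapping.single j 1) 1"
    by (simp add: zvar_def)
  then have "Poly_Mapping.keys (Poly_Mapping.single (Poly_Mapping.single i 1) 1 :: zpoly) =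
     Poly_Mapping.keys (Poly_Mapping.single (Poly_Mapping.single j 1) 1 :: zpoly)" by simp
  then have "Poly_Mapping.single i (1::nat) = Poly_Mapping.single j 1" by simp
  then have "Poly_Mapping.keys (Poly_Mapping.single i (1::nat)) = Poly_Mapping.keys (Poly_Mapping.single j (1::nat))"
    by simp
  then show "i = j" by simp
qed

section \<open>Quadratic relations among the q_r\<close>

lemma q_series_reflection:
  fixes z :: "nat \<Rightarrow> 'a::field"
  shows "(\<Prod>i\<in>I. (1 + fps_const (- z i) * fps_X) / (1 - fps_const (- z i) * fps_X)) =
     Abs_fps (\<lambda>r. (- 1) ^ r * fps_nth (q_series z I) r)"
proof -
  have mult: "Abs_fps (\<lambda>r. (- 1) ^ r * fps_nth (f * g) r) =
     Abs_fps (\<lambda>r. (- 1) ^ r * fps_nth f r) * Abs_fps (\<lambda>r. (- 1) ^ r * fps_nth g r)" for f g :: "'a fps"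
  proof (rule fps_ext)
    fix r
    have "(- 1) ^ r * (fps_nth f i * fps_nth g (r - i)) =
        (- 1) ^ i * fps_nth f i * ((- 1) ^ (r - i) * fps_nth g (r - i))" if "i \<le> r" for i
    proof -
      have "(- 1) ^ r = (- 1 :: 'a) ^ i * (- 1) ^ (r - i)" using that by (simp flip: power_add)
      then show ?thesis by (simp only: mult_ac)
    qed
    then show "fps_nth (Abs_fps (\<lambda>r. (- 1) ^ r * fps_nth (f * g) r)) r =
       fps_nth (Abs_fps (\<lambda>r. (- 1) ^ r * fps_nth f r) * Abs_fps (\<lambda>r. (- 1) ^ r * fps_nth g r)) r"
      unfolding fps_mult_nth fps_nth_Abs_fps sum_distrib_left by (intro sum.cong) auto
  qed
  have factor: "(1 + fps_const (- c) * fps_X) / (1 - fps_const (- c) * fps_X) =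
     Abs_fps (\<lambda>r. (- 1) ^ r * fps_nth ((1 + fps_const c * fps_X) / (1 - fps_const c * fps_X)) r)" for c :: 'a
  proof -
    have "(1 + fps_const c * fps_X) / (1 - fps_const c * fps_X) = (1 + fps_const c * fps_X) * inverse (1 - fps_const c * fps_X)"
      for c :: 'a by (rule fps_divide_unit) simp
    then have nth: "fps_nth ((1 + fps_const c * fps_X) / (1 - fps_const c * fps_X)) r = (if r = 0 then 1 else 2 * c ^ r)" for c :: 'a and r
      by (cases r) (simp_all add: distrib_right mult.assoc fps_geometric_nth del: fps_const_neg)
    show ?thesis
    proof (rule fps_ext)
      fix r
      show "fps_nth ((1 + fps_const (- c) * fps_X) / (1 - fps_const (- c) * fps_X)) r =
         fps_nth (Abs_fps (\<lambda>r. (- 1) ^ r * fps_nth ((1 + fps_const c * fps_X) / (1 - fps_const c * fps_X)) r)) r"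
        unfolding fps_nth_Abs_fps nth using power_minus[of c r] by simp
    qed
  qed
  have one: "Abs_fps (\<lambda>r. (- 1) ^ r * fps_nth 1 r) = (1 :: 'a fps)"
    by (rule fps_ext) simp
  show ?thesis
    unfolding q_series_def
    by (induction I rule: infinite_finite_induct)
      (simp_all only: prod.infinite prod.empty prod.insert mult factor one not_False_eq_True)
qed

text \<open>The identity q(u) q(-u) = 1, compared at u^n; changing the sign of u amounts to changing
  the sign of all z_i.\<close>

lemma q_series_relation:
  fixes z :: "nat \<Rightarrow> 'a::field"
  assumes "0 < n"
  shows "(\<Sum>i=0..n. (- 1) ^ i * fps_nth (q_series z I) i * fps_nth (q_series z I) (n - i)) = 0"
proof -
  have "(1 + fps_const (- c) * fps_X) / (1 - fps_const (- c) * fps_X) *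
     ((1 + fps_const c * fps_X) / (1 - fps_const c * fps_X)) = 1" for c :: 'a
  proof -
    let ?a = "1 + fps_const c * fps_X" and ?b = "1 - fps_const c * fps_X"
    have "(?b / ?a) * (?a / ?b) = (?b * inverse ?a) * (?a * inverse ?b)"
      by (intro arg_cong2[of _ _ _ _ "(*)"] fps_divide_unit) simp_all
    also have "\<dots> = (?b * inverse ?b) * (?a * inverse ?a)" by (simp only: mult_ac)
    also have "?b * inverse ?b = 1" by (rule inverse_mult_eq_1') simp
    also have "?a * inverse ?a = 1" by (rule inverse_mult_eq_1') simp
    finally have "(?b / ?a) * (?a / ?b) = 1" by simp
    moreover have "1 + fps_const (- c) * fps_X = ?b" "1 - fps_const (- c) * fps_X = ?a"
      by (simp_all flip: fps_const_neg)
    ultimately show ?thesis by simp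
  qed
  then have "(\<Prod>i\<in>I. (1 + fps_const (- z i) * fps_X) / (1 - fps_const (- z i) * fps_X)) * q_series z I = 1"
    by (simp only: q_series_def prod.distrib[symmetric] prod.neutral_const)
  then have "Abs_fps (\<lambda>r. (- 1) ^ r * fps_nth (q_series z I) r) * q_series z I = 1"
    by (simp only: q_series_reflection)
  then have "fps_nth (Abs_fps (\<lambda>r. (- 1) ^ r * fps_nth (q_series z I) r) * q_series z I) n = 0"
    using assms by simp
  then show ?thesis by (simp add: fps_mult_nth)
qed

text \<open>A convex statistic: moving boxes from a smaller to a larger part increases it, so $R_{ij}$ does.\<close>

definition excess :: "nat list \<Rightarrow> nat" where
  "excess al = (\<Sum>r\<leftarrow>al. 2 ^ r - 1)"

lemma excess_simps [simp]:
  "excess [] = 0" "excess (r # al) = 2 ^ r - 1 + excess al" "excess (al @ be) = excess al + excess be"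
  by (simp_all add: excess_def)

text \<open>Distinct powers of 2 up to 2^r sum to less than 2^(r+1). So a larger first part
  outweighs every strict list with first part r, which is the reason for base 2 in
  \<open>excess\<close>.\<close>

lemma excess_strict:
  "sorted_wrt (>) (r # mu) \<Longrightarrow> excess (r # mu) + 1 < 2 ^ Suc r"
proof (induction mu arbitrary: r)
  case Nil
  then show ?case by simp
next
  case (Cons s mu)
  then have "excess (s # mu) + 1 < 2 ^ Suc s" "Suc s \<le> r" by auto
  moreover have "(2::nat) ^ Suc s \<le> 2 ^ r" using \<open>Suc s \<le> r\<close> by (intro power_increasing) auto
  ultimately have "excess (s # mu) + 1 < 2 ^ r" by linarith
  then show ?case by (simp only: excess_simps(2)[of r] power_Suc)
qed

text \<open>A crude bound, which makes n * 2^n - \<open>excess al\<close> a decreasing measure for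
  an induction that raises the excess.\<close>

lemma excess_le: "excess al \<le> sum_list al * 2 ^ sum_list al"
proof (induction al)
  case Nil
  then show ?case by simp
next
  case (Cons r al)
  have "(2::nat) ^ r - 1 \<le> r * 2 ^ (r + sum_list al)"
  proof (cases r)
    case (Suc k)
    have "(2::nat) ^ r \<le> 2 ^ (r + sum_list al)" by (intro power_increasing) auto
    then show ?thesis using Suc by (metis diff_le_self le_trans mult_le_mono1 nat_mult_1 Suc_leI zero_less_Suc One_nat_def)
  qed simp
  moreover have "sum_list al * 2 ^ sum_list al \<le> sum_list al * 2 ^ (r + sum_list al)"
    by (intro mult_left_mono power_increasing) auto
  ultimately show ?case using Cons unfolding excess_simps sum_list.Cons distrib_right by linarith
qed

text \<open>The leading term takes k = 0 everywhere; every other one removes at least one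
  box.\<close>

lemma lower_terms_head:
  "\<exists>rest. lower_terms nu = (1, nu) # rest \<and> (\<forall>(d, be)\<in>set rest. sum_list be < sum_list nu)"
proof (induction nu)
  case Nil
  then show ?case by simp
next
  case (Cons s nu)
  then obtain rest where rest: "lower_terms nu = (1, nu) # rest"
    "\<And>d be. (d, be) \<in> set rest \<Longrightarrow> sum_list be < sum_list nu" by auto
  let ?d = "\<lambda>k::nat. if k = 0 then 1 else 2 * (- 1) ^ k :: int"
  have upt: "[0..<Suc s] = 0 # [1..<Suc s]" by (simp add: upt_conv_Cons del: upt_Suc)
  have "lower_terms (s # nu) = (1, s # nu) # ([(d, s # be). (d, be) \<leftarrow> rest] @
     [(?d k * d, (s - k) # be). k \<leftarrow> [1..<Suc s], (d, be) \<leftarrow> lower_terms nu])"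
    by (simp add: upt rest(1) del: upt_Suc)
  moreover have "sum_list be < sum_list (s # nu)"
    if "(d, be) \<in> set ([(d, s # be). (d, be) \<leftarrow> rest] @
     [(?d k * d, (s - k) # be). k \<leftarrow> [1..<Suc s], (d, be) \<leftarrow> lower_terms nu])" for d be
    using that rest(2) lower_terms_sum_length[of _ _ nu] by (fastforce simp del: upt_Suc)
  ultimately show ?case by blast
qed

text \<open>A further term either moves a box to the first part, which then exceeds r, or moves none
  there and has larger excess in the remaining parts by induction. In the first case
  \<open>excess_strict\<close> applies, as lam is strict.\<close>

lemma Q_expansion_triangular:
  assumes "sorted_wrt (>) lam"
  shows "\<exists>rest. Q_expansion lam = (1, lam) # rest \<and>
    (\<forall>(c, al)\<in>set rest. excess lam < excess al \<and> sum_list al = sum_list lam)"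
  using assms
proof (induction lam)
  case Nil
  then show ?case by simp
next
  case (Cons r mu)
  then obtain rest where rest: "Q_expansion mu = (1, mu) # rest"
    "\<And>c al. (c, al) \<in> set rest \<Longrightarrow> excess mu < excess al \<and> sum_list al = sum_list mu" by fastforce
  obtain low where low: "lower_terms mu = (1, mu) # low"
    "\<And>d be. (d, be) \<in> set low \<Longrightarrow> sum_list be < sum_list mu" using lower_terms_head[of mu] by fastforce
  have big: "excess (r # mu) < excess (r' # be)" if "r < r'" for r' be
  proof -
    have "(2::nat) ^ Suc r \<le> 2 ^ r'" using that by (intro power_increasing) auto
    then show ?thesis using excess_strict[OF Cons.prems] by simp
  qed
  let ?L = "\<lambda>(c, al). [(c * d, (r + (sum_list al - sum_list be)) # be). (d, be) \<leftarrow> lower_terms al]"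
  let ?rest = "[(d, (r + (sum_list mu - sum_list be)) # be). (d, be) \<leftarrow> low] @ concat (map ?L rest)"
  have "Q_expansion (r # mu) = (1, r # mu) # ?rest"
    by (simp add: rest(1) low(1))
  moreover have "excess (r # mu) < excess al \<and> sum_list al = sum_list (r # mu)" if cal: "(c, al) \<in> set ?rest" for c al
  proof -
    from cal consider
        (a) d be where "(d, be) \<in> set low" "al = (r + (sum_list mu - sum_list be)) # be"
      | (b) c' d ga be where "(c', ga) \<in> set rest" "(d, be) \<in> set (lower_terms ga)"
          "al = (r + (sum_list ga - sum_list be)) # be"
      by auto
    then show ?thesis
    proof cases
      case a
      then show ?thesis using low(2)[OF a(1)] big[of "r + (sum_list mu - sum_list be)" be] by simp
    next
      case b
      obtain low' where low': "lower_terms ga = (1, ga) # low'"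
        "\<And>d be. (d, be) \<in> set low' \<Longrightarrow> sum_list be < sum_list ga" using lower_terms_head[of ga] by fastforce
      have le: "sum_list be \<le> sum_list ga" using lower_terms_sum_length b(2) by blast
      have "excess (r # mu) < excess al"
      proof (cases "(d, be) \<in> set low'")
        case True
        then show ?thesis using low'(2)[OF True] b(3) big[of "r + (sum_list ga - sum_list be)" be] by simp
      next
        case False
        then have "be = ga" using b(2) low'(1) by simp
        then have "al = r # ga" using b(3) by simp
        then show ?thesis using rest(2)[OF b(1)] unfolding \<open>al = r # ga\<close> excess_simps by linarith
      qed
      then show ?thesis using b rest(2)[OF b(1)] le by simp
    qed
  qed
  ultimately show ?case by blast
qed

section \<open>The products q_nu as combinations of Schur Q-functions\<close>

definition strict_partitions :: "nat \<Rightarrow> nat list set" where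
  "strict_partitions n = {lam. strict_partition n lam}"

lemma finite_strict_partitions [simp]: "finite (strict_partitions n)"
proof (rule finite_subset)
  have len: "length xs \<le> sum_list xs" if "\<forall>r\<in>set xs. 0 < r" for xs :: "nat list"
    using that by (induction xs) auto
  show "strict_partitions n \<subseteq> {xs. set xs \<subseteq> {..n} \<and> length xs \<le> n}"
  proof
    fix lam assume "lam \<in> strict_partitions n"
    then have *: "\<forall>r\<in>set lam. 0 < r" "sum_list lam = n"
      by (auto simp: strict_partitions_def strict_partition_def)
    then have "length lam \<le> n" "\<forall>r\<in>set lam. r \<le> n" using len[of lam] member_le_sum_list[of _ lam] by auto
    then show "lam \<in> {xs. set xs \<subseteq> {..n} \<and> length xs \<le> n}" by auto
  qed
  show "finite {xs. set xs \<subseteq> {..n} \<and> length xs \<le> n}"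
    by (rule finite_lists_length_le) simp
qed

text \<open>A filtration of degree n by excess, which turns triangularity into membership.\<close>

definition Q_span :: "nat \<Rightarrow> nat \<Rightarrow> symfun set" where
  "Q_span n x = {\<Sum>lam\<in>strict_partitions n. sf_scale (a lam) (schur_Q lam) |a. \<forall>lam. a lam \<noteq> 0 \<longrightarrow> x \<le> excess lam}"

interpretation sf: vector_space sf_scale by (rule vector_space_sf_scale)

lemma Q_span_0: "0 \<in> Q_span n x"
  unfolding Q_span_def by (intro CollectI exI[of _ "\<lambda>_. 0"]) simp

lemma Q_span_add: "f \<in> Q_span n x \<Longrightarrow> g \<in> Q_span n x \<Longrightarrow> f + g \<in> Q_span n x"
proof -
  assume "f \<in> Q_span n x" "g \<in> Q_span n x"
  then obtain a b where *: "f = (\<Sum>lam\<in>strict_partitions n. sf_scale (a lam) (schur_Q lam))"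
    "g = (\<Sum>lam\<in>strict_partitions n. sf_scale (b lam) (schur_Q lam))"
    "\<And>lam. a lam \<noteq> 0 \<Longrightarrow> x \<le> excess lam" "\<And>lam. b lam \<noteq> 0 \<Longrightarrow> x \<le> excess lam"
    unfolding Q_span_def by blast
  have "x \<le> excess lam" if "a lam + b lam \<noteq> 0" for lam
    using that *(3,4)[of lam] by (cases "a lam = 0") auto
  moreover have "f + g = (\<Sum>lam\<in>strict_partitions n. sf_scale (a lam + b lam) (schur_Q lam))"
    by (simp only: *(1,2) sf.scale_left_distrib sum.distrib)
  ultimately show ?thesis
    unfolding Q_span_def by (intro CollectI exI[of _ "\<lambda>lam. a lam + b lam"]) blast
qed

lemma Q_span_scale: "f \<in> Q_span n x \<Longrightarrow> sf_scale c f \<in> Q_span n x"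
proof -
  assume "f \<in> Q_span n x"
  then obtain a where *: "f = (\<Sum>lam\<in>strict_partitions n. sf_scale (a lam) (schur_Q lam))"
    "\<And>lam. a lam \<noteq> 0 \<Longrightarrow> x \<le> excess lam"
    unfolding Q_span_def by blast
  have "sf_scale c f = (\<Sum>lam\<in>strict_partitions n. sf_scale (c * a lam) (schur_Q lam))"
    by (simp add: *(1) sf.scale_sum_right)
  with *(2) show ?thesis
    unfolding Q_span_def by (intro CollectI exI[of _ "\<lambda>lam. c * a lam"]) auto
qed

lemma Q_span_antimono: "x \<le> y \<Longrightarrow> Q_span n y \<subseteq> Q_span n x"
  unfolding Q_span_def by (auto intro: le_trans)

lemma Q_span_sum: "(\<And>i. i \<in> A \<Longrightarrow> f i \<in> Q_span n x) \<Longrightarrow> sum f A \<in> Q_span n x"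
  by (induction A rule: infinite_finite_induct) (auto intro: Q_span_0 Q_span_add)

lemma Q_span_sum_list: "(\<And>f. f \<in> set fs \<Longrightarrow> f \<in> Q_span n x) \<Longrightarrow> sum_list fs \<in> Q_span n x"
  by (induction fs) (auto intro: Q_span_0 Q_span_add)

lemma Q_span_schur_Q:
  assumes "lam \<in> strict_partitions n"
  shows "schur_Q lam \<in> Q_span n (excess lam)"
proof -
  have "(\<Sum>mu\<in>strict_partitions n. sf_scale (if mu = lam then 1 else 0) (schur_Q mu)) =
      (\<Sum>mu\<in>strict_partitions n. if mu = lam then schur_Q mu else 0)"
    by (intro sum.cong) auto
  also have "\<dots> = schur_Q lam" using assms by simp
  finally show ?thesis
    unfolding Q_span_def by (intro CollectI exI[of _ "\<lambda>mu. if mu = lam then 1 else 0"]) auto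
qed

abbreviation q_prod :: "nat list \<Rightarrow> symfun" where
  "q_prod nu \<equiv> prod_list (map q_fun nu)"

lemma to_fract_of_int: "to_fract (of_int c :: 'a :: {idom,ring_char_0}) = of_int c"
proof -
  have "to_fract (of_nat k :: 'a) = of_nat k" for k
    by (induction k) (simp_all add: to_fract_add)
  then show ?thesis by (cases c rule: int_diff_cases) (simp add: to_fract_diff)
qed

text \<open>The coefficients in \<open>Q_expansion\<close> are integers that do not depend on the
  variables, so the identities for all m combine into one of symmetric functions.\<close>

lemma schur_Q_expansion:
  assumes "\<forall>r\<in>set lam. 0 < r"
  shows "schur_Q lam = (\<Sum>(c, al)\<leftarrow>Q_expansion lam. sf_scale (of_int c) (q_prod al))"
proof
  fix m
  have sum_list_apply: "sum_list fs m = sum_list (map (\<lambda>f. f m) fs)" for fs :: "symfun list"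
    by (induction fs) simp_all
  have "inj_on zvar {1..m}" using inj_zvar by (rule inj_on_subset) simp
  then have "schur_Q lam m = (\<Sum>(c, al)\<leftarrow>Q_expansion lam. of_int c * q_list zvar {1..m} al)"
    unfolding schur_Q_eq_Q_on using assms by (intro Q_expansion_correct) auto
  also have "\<dots> = (\<Sum>(c, al)\<leftarrow>Q_expansion lam. sf_scale (of_int c) (q_prod al)) m"
    unfolding sum_list_apply
    by (simp add: comp_def split_def sf_scale_def prod_list_q_fun single_of_int to_fract_of_int)
  finally show "schur_Q lam m = (\<Sum>(c, al)\<leftarrow>Q_expansion lam. sf_scale (of_int c) (q_prod al)) m" .
qed

lemma q_fun_0: "q_fun 0 = 1"
  by (simp add: fun_eq_iff q_fun_eq q_series_nth_0)

lemma q_prod_filter: "q_prod (filter ((<) 0) nu) = q_prod nu"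
  by (induction nu) (auto simp: q_fun_0)

lemma q_prod_mset: "mset nu = mset mu \<Longrightarrow> q_prod nu = q_prod mu"
  by (metis mset_map prod_mset_prod_list)

lemma excess_mset: "mset nu = mset mu \<Longrightarrow> excess nu = excess mu"
  unfolding excess_def by (metis mset_map sum_mset_sum_list)

lemma excess_filter: "excess (filter ((<) 0) nu) = excess nu"
  by (induction nu) auto

lemma sum_list_filter_pos: "sum_list (filter ((<) 0) nu) = sum_list (nu :: nat list)"
  by (induction nu) auto

text \<open>The relation q(u) q(-u) = 1 in degree 2r, solved for its middle term, whose sign (-1)^r
  is its own inverse.\<close>

lemma q_fun_square:
  assumes "0 < r"
  shows "q_fun r * q_fun r =
    sf_scale (- ((- 1) ^ r)) (\<Sum>i\<in>{0..2 * r} - {r}. sf_scale ((- 1) ^ i) (q_fun i * q_fun (2 * r - i)))"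
proof
  fix m
  let ?q = "\<lambda>i. fps_nth (q_series zvar {1..m}) i"
  have sgn: "to_fract (Poly_Mapping.single 0 ((- 1) ^ i) :: zpoly) = (- 1) ^ i" for i
  proof -
    have "to_fract (Poly_Mapping.single 0 (of_int ((- 1) ^ i)) :: zpoly) = of_int ((- 1) ^ i)"
      by (simp only: single_of_int to_fract_of_int)
    then show ?thesis by simp
  qed
  have neg_sgn: "to_fract (Poly_Mapping.single 0 (- ((- 1) ^ i)) :: zpoly) = - ((- 1) ^ i)" for i
    unfolding single_uminus to_fract_uminus sgn ..
  have "(\<Sum>i=0..2 * r. (- 1) ^ i * ?q i * ?q (2 * r - i)) = 0"
    using assms by (intro q_series_relation) simp
  moreover have "(\<Sum>i=0..2 * r. (- 1) ^ i * ?q i * ?q (2 * r - i)) =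
     (- 1) ^ r * ?q r * ?q (2 * r - r) + (\<Sum>i\<in>{0..2 * r} - {r}. (- 1) ^ i * ?q i * ?q (2 * r - i))"
    by (rule sum.remove) auto
  ultimately have "(- 1) ^ r * (?q r * ?q r) = - (\<Sum>i\<in>{0..2 * r} - {r}. (- 1) ^ i * ?q i * ?q (2 * r - i))"
    by (simp add: mult_2 algebra_simps eq_neg_iff_add_eq_0)
  then have "(- 1) ^ r * ((- 1) ^ r * (?q r * ?q r)) =
     (- 1) ^ r * (- (\<Sum>i\<in>{0..2 * r} - {r}. (- 1) ^ i * ?q i * ?q (2 * r - i)))" by simp
  moreover have "(- 1) ^ r * ((- 1) ^ r * (?q r * ?q r)) = ?q r * ?q r"
    by (simp flip: mult.assoc power_add)
  moreover have sum_apply: "(sum F A) m = (\<Sum>i\<in>A. F i m)" for F :: "nat \<Rightarrow> symfun" and A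
    by (induction A rule: infinite_finite_induct) simp_all
  ultimately show "(q_fun r * q_fun r) m = sf_scale (- ((- 1) ^ r))
      (\<Sum>i\<in>{0..2 * r} - {r}. sf_scale ((- 1) ^ i) (q_fun i * q_fun (2 * r - i))) m"
    by (simp add: sf_scale_def q_fun_eq sgn neg_sgn mult.assoc)
qed

text \<open>Convexity of 2^r, for the pairs that replace a repeated part in
  \<open>q_fun_square\<close>.\<close>

lemma excess_spread:
  assumes "i \<le> 2 * r" "i \<noteq> r"
  shows "excess [r, r] < excess [i, 2 * r - i]"
proof -
  have *: "excess [r, r] < excess [r + k, r - k]" if "0 < k" "k \<le> r" for k
  proof -
    have "(2::nat) ^ Suc r \<le> 2 ^ (r + k)" using that by (intro power_increasing) auto
    moreover have "(1::nat) \<le> 2 ^ (r - k)" "(1::nat) \<le> 2 ^ r" by simp_all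
    ultimately show ?thesis unfolding excess_simps power_Suc by linarith
  qed
  show ?thesis
  proof (cases "r < i")
    case True
    then have "r + (i - r) = i" "r - (i - r) = 2 * r - i" using assms by simp_all
    then show ?thesis using *[of "i - r"] assms True by simp
  next
    case False
    then have "r + (r - i) = 2 * r - i" "r - (r - i) = i" using assms by simp_all
    then show ?thesis using *[of "r - i"] assms False by simp
  qed
qed

text \<open>Inverts the unitriangular expansion of Q_lam. The second assumption is the induction
  hypothesis in the proof that every \<open>q_prod be\<close> lies in the span; it is an assumption
  so that the lemma can be applied once more after that proof.\<close>

lemma q_prod_minus_schur_Q:
  assumes "lam \<in> strict_partitions n"
    and "\<And>be. sum_list be = n \<Longrightarrow> excess lam < excess be \<Longrightarrow> q_prod be \<in> Q_span n (excess be)"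
  shows "q_prod lam - schur_Q lam \<in> Q_span n (Suc (excess lam))"
proof -
  have lam: "sorted_wrt (>) lam" "\<forall>r\<in>set lam. 0 < r" "sum_list lam = n"
    using assms(1) by (auto simp: strict_partitions_def strict_partition_def)
  obtain rest where rest: "Q_expansion lam = (1, lam) # rest"
    "\<And>c al. (c, al) \<in> set rest \<Longrightarrow> excess lam < excess al \<and> sum_list al = n"
    using Q_expansion_triangular[OF lam(1)] lam(3) by fastforce
  have "(\<Sum>(c, al)\<leftarrow>rest. sf_scale (of_int c) (q_prod al)) \<in> Q_span n (Suc (excess lam))"
  proof (rule Q_span_sum_list)
    fix f assume "f \<in> set (map (\<lambda>(c, al). sf_scale (of_int c) (q_prod al)) rest)"
    then obtain c al where *: "(c, al) \<in> set rest" "f = sf_scale (of_int c) (q_prod al)" by auto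
    then have "q_prod al \<in> Q_span n (Suc (excess lam))"
      using rest(2)[OF *(1)] assms(2)[of al] Q_span_antimono[of "Suc (excess lam)" "excess al" n] by auto
    then show "f \<in> Q_span n (Suc (excess lam))" using * Q_span_scale by simp
  qed
  then have "sf_scale (- 1) (\<Sum>(c, al)\<leftarrow>rest. sf_scale (of_int c) (q_prod al)) \<in> Q_span n (Suc (excess lam))"
    by (rule Q_span_scale)
  moreover have "schur_Q lam = q_prod lam + (\<Sum>(c, al)\<leftarrow>rest. sf_scale (of_int c) (q_prod al))"
    using schur_Q_expansion[OF lam(2)] rest(1) by simp
  then have "q_prod lam - schur_Q lam = sf_scale (- 1) (\<Sum>(c, al)\<leftarrow>rest. sf_scale (of_int c) (q_prod al))"
    using sf.scale_minus_left[of 1] by simp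
  ultimately show ?thesis by simp
qed

text \<open>Downward induction on the excess. Zeros are dropped since q_0 = 1, and the order of the
  factors is immaterial. If the parts are distinct, the product is Q_lam plus terms of larger
  excess; if some r occurs twice, \<open>q_fun_square\<close> spreads the pair and raises the excess
  of every term.\<close>

lemma q_prod_in_Q_span:
  "sum_list al = n \<Longrightarrow> q_prod al \<in> Q_span n (excess al)"
proof (induction "n * 2 ^ n - excess al" arbitrary: al rule: less_induct)
  case less
  have IH: "q_prod be \<in> Q_span n (excess be)" if "sum_list be = n" "excess al < excess be" for be
    using that less.hyps[of be] excess_le[of be] by simp
  define f where "f = filter ((<) 0) al"
  have f: "q_prod f = q_prod al" "excess f = excess al" "sum_list f = n" "\<forall>r\<in>set f. 0 < r"
    using less.prems by (auto simp: f_def q_prod_filter excess_filter sum_list_filter_pos)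
  show ?case
  proof (cases "distinct f")
    case True
    define lam where "lam = rev (sort f)"
    have lam: "mset lam = mset f" by (simp add: lam_def)
    have "sorted_wrt (>) lam"
      using True by (simp add: lam_def sorted_wrt_rev strict_sorted_iff)
    moreover have "sum_list lam = n" using f(3) lam by (metis sum_mset_sum_list)
    moreover have "\<forall>r\<in>set lam. 0 < r" using f(4) lam by (metis set_mset_mset)
    ultimately have sp: "lam \<in> strict_partitions n"
      by (simp add: strict_partitions_def strict_partition_def)
    have ex: "excess lam = excess al" "q_prod lam = q_prod al"
      using f(1,2) excess_mset[OF lam] q_prod_mset[OF lam] by simp_all
    have "q_prod lam - schur_Q lam \<in> Q_span n (excess lam)"
      using q_prod_minus_schur_Q[OF sp] IH ex Q_span_antimono[of "excess lam" "Suc (excess lam)" n] by auto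
    then have "q_prod lam - schur_Q lam + schur_Q lam \<in> Q_span n (excess lam)"
      using Q_span_schur_Q[OF sp] by (rule Q_span_add)
    then show ?thesis using ex by simp
  next
    case False
    then obtain xs ys zs r where "f = xs @ [r] @ ys @ [r] @ zs" using not_distinct_decomp by blast
    then have fm: "mset f = mset ([r, r] @ xs @ ys @ zs)" and r: "0 < r" using f(4) by auto
    let ?w = "xs @ ys @ zs"
    have sum_w: "2 * r + sum_list ?w = n" using f(3) fm by (metis sum_mset_sum_list sum_list_append sum_list.Cons sum_list.Nil add_0_right mult_2 add.assoc)
    have ex: "excess al = excess [r, r] + excess ?w"
      using f(2) excess_mset[OF fm] unfolding excess_simps(3)[of "[r, r]"] by simp
    have termwise: "q_fun i * q_fun (2 * r - i) * q_prod ?w \<in> Q_span n (excess al)" if i: "i \<in> {0..2 * r} - {r}" for i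
    proof -
      have lt: "excess al < excess ([i, 2 * r - i] @ ?w)"
        using excess_spread[of i r] i ex by simp
      moreover have "sum_list ([i, 2 * r - i] @ ?w) = n" using sum_w i by simp
      ultimately have "q_prod ([i, 2 * r - i] @ ?w) \<in> Q_span n (excess ([i, 2 * r - i] @ ?w))" by (intro IH)
      then have "q_prod ([i, 2 * r - i] @ ?w) \<in> Q_span n (excess al)"
        using Q_span_antimono[OF less_imp_le[OF lt], of n] by blast
      then show ?thesis by (simp add: mult.assoc)
    qed
    have mult_scale: "sf_scale c g * h = sf_scale c (g * h)" for c g h
      by (simp add: sf_scale_def fun_eq_iff mult.assoc)
    have "q_prod al = q_fun r * q_fun r * q_prod ?w"
      using f(1) q_prod_mset[OF fm] by (simp add: mult.assoc)
    also have "\<dots> = sf_scale (- ((- 1) ^ r))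
       (\<Sum>i\<in>{0..2 * r} - {r}. sf_scale ((- 1) ^ i) (q_fun i * q_fun (2 * r - i) * q_prod ?w))"
      by (simp only: q_fun_square[OF r] mult_scale sum_distrib_right)
    also have "\<dots> \<in> Q_span n (excess al)"
      by (intro Q_span_scale Q_span_sum termwise)
    finally show ?thesis .
  qed
qed

text \<open>For strict nu the difference from Q_nu lies one step higher in the filtration, so the
  coefficient of Q_nu is 1. The Cauchy identity relies on this unitriangularity.\<close>

lemma q_prod_expansion:
  assumes "sum_list nu = n"
  shows "\<exists>a. q_prod nu = (\<Sum>lam\<in>strict_partitions n. sf_scale (a lam) (schur_Q lam)) \<and>
    (\<forall>lam. a lam \<noteq> 0 \<longrightarrow> lam = nu \<or> excess nu \<le> excess lam) \<and>
    (nu \<in> strict_partitions n \<longrightarrow> a nu = 1 \<and> (\<forall>lam. a lam \<noteq> 0 \<longrightarrow> lam = nu \<or> excess nu < excess lam))"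
proof (cases "nu \<in> strict_partitions n")
  case True
  have "q_prod nu - schur_Q nu \<in> Q_span n (Suc (excess nu))"
    by (intro q_prod_minus_schur_Q[OF True] q_prod_in_Q_span)
  then obtain b where b: "q_prod nu - schur_Q nu = (\<Sum>lam\<in>strict_partitions n. sf_scale (b lam) (schur_Q lam))"
    "\<And>lam. b lam \<noteq> 0 \<Longrightarrow> Suc (excess nu) \<le> excess lam"
    unfolding Q_span_def by blast
  \<comment> \<open>The bound on the excess forces b nu = 0, so the value 1 at nu adds exactly
    Q_nu.\<close>
  define a where "a = b(nu := 1)"
  have b0: "b nu = 0" using b(2)[of nu] by force
  have "(\<Sum>lam\<in>strict_partitions n. sf_scale (a lam) (schur_Q lam)) =
     schur_Q nu + (\<Sum>lam\<in>strict_partitions n - {nu}. sf_scale (a lam) (schur_Q lam))"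
    by (subst sum.remove[OF _ True]) (simp_all add: a_def)
  also have "(\<Sum>lam\<in>strict_partitions n - {nu}. sf_scale (a lam) (schur_Q lam)) =
      (\<Sum>lam\<in>strict_partitions n - {nu}. sf_scale (b lam) (schur_Q lam))"
    by (intro sum.cong) (auto simp: a_def)
  also have "\<dots> = (\<Sum>lam\<in>strict_partitions n. sf_scale (b lam) (schur_Q lam))"
    using sum.remove[OF finite_strict_partitions True, of "\<lambda>lam. sf_scale (b lam) (schur_Q lam)"] b0 by simp
  finally have "q_prod nu = (\<Sum>lam\<in>strict_partitions n. sf_scale (a lam) (schur_Q lam))"
    using b(1) by (metis add.commute diff_eq_eq)
  moreover have "lam = nu \<or> excess nu < excess lam" if "a lam \<noteq> 0" for lam
    using that b(2)[of lam] by (auto simp: a_def split: if_splits)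
  moreover have "a nu = 1" by (simp add: a_def)
  ultimately show ?thesis
    by (intro exI[of _ a]) (metis less_imp_le)
next
  case False
  then show ?thesis
    using q_prod_in_Q_span[OF assms] unfolding Q_span_def by blast
qed

section \<open>Values of rational functions at numerical points\<close>

definition mono_eval :: "(nat \<Rightarrow> 'a::comm_ring_1) \<Rightarrow> (nat \<Rightarrow>\<^sub>0 nat) \<Rightarrow> 'a" where
  "mono_eval p a = (\<Prod>i\<in>Poly_Mapping.keys a. p i ^ Poly_Mapping.lookup a i)"

definition poly_eval :: "(nat \<Rightarrow> complex) \<Rightarrow> zpoly \<Rightarrow> complex" where
  "poly_eval p f = (\<Sum>a\<in>Poly_Mapping.keys f. Poly_Mapping.lookup f a * mono_eval p a)"

lemma mono_eval_superset:
  assumes "finite S" "Poly_Mapping.keys a \<subseteq> S"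
  shows "mono_eval p a = (\<Prod>i\<in>S. p i ^ Poly_Mapping.lookup a i)"
  unfolding mono_eval_def using assms
  by (intro prod.mono_neutral_left) (auto simp: in_keys_iff)

lemma mono_eval_add: "mono_eval p (a + b) = mono_eval p a * mono_eval p b"
proof -
  let ?S = "Poly_Mapping.keys a \<union> Poly_Mapping.keys b"
  have "mono_eval p (a + b) = (\<Prod>i\<in>?S. p i ^ Poly_Mapping.lookup (a + b) i)"
    using keys_add[of a b] by (intro mono_eval_superset) auto
  also have "\<dots> = (\<Prod>i\<in>?S. p i ^ Poly_Mapping.lookup a i) * (\<Prod>i\<in>?S. p i ^ Poly_Mapping.lookup b i)"
    by (simp add: lookup_add power_add prod.distrib)
  also have "\<dots> = mono_eval p a * mono_eval p b"
    using mono_eval_superset[of ?S a p] mono_eval_superset[of ?S b p] by simp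
  finally show ?thesis .
qed

lemma poly_eval_superset:
  assumes "finite S" "Poly_Mapping.keys f \<subseteq> S"
  shows "poly_eval p f = (\<Sum>a\<in>S. Poly_Mapping.lookup f a * mono_eval p a)"
  unfolding poly_eval_def using assms
  by (intro sum.mono_neutral_left) (auto simp: in_keys_iff)

lemma poly_eval_0 [simp]: "poly_eval p 0 = 0"
  by (simp add: poly_eval_def)

lemma poly_eval_add: "poly_eval p (f + g) = poly_eval p f + poly_eval p g"
proof -
  let ?S = "Poly_Mapping.keys f \<union> Poly_Mapping.keys g"
  have "poly_eval p (f + g) = (\<Sum>a\<in>?S. Poly_Mapping.lookup (f + g) a * mono_eval p a)"
    using keys_add[of f g] by (intro poly_eval_superset) auto
  also have "\<dots> = poly_eval p f + poly_eval p g"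
    using poly_eval_superset[of ?S f p] poly_eval_superset[of ?S g p]
    by (simp add: lookup_add distrib_right sum.distrib)
  finally show ?thesis .
qed

lemma poly_eval_sum: "poly_eval p (sum F A) = (\<Sum>x\<in>A. poly_eval p (F x))"
  by (induction A rule: infinite_finite_induct) (simp_all add: poly_eval_add)

lemma poly_eval_single: "poly_eval p (Poly_Mapping.single a c) = c * mono_eval p a"
  by (subst poly_eval_superset[of "{a}"]) auto

lemma poly_mapping_sum_single:
  "(\<Sum>a\<in>Poly_Mapping.keys f. Poly_Mapping.single a (Poly_Mapping.lookup f a)) = f"
  by (rule poly_mapping_eqI) (auto simp: lookup_sum lookup_single when_def in_keys_iff)

lemma poly_eval_mult: "poly_eval p (f * g) = poly_eval p f * poly_eval p g"
proof -
  let ?F = "Poly_Mapping.keys f" and ?G = "Poly_Mapping.keys g"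
  have "f * g = (\<Sum>a\<in>?F. Poly_Mapping.single a (Poly_Mapping.lookup f a)) *
      (\<Sum>b\<in>?G. Poly_Mapping.single b (Poly_Mapping.lookup g b))"
    by (simp only: poly_mapping_sum_single)
  also have "\<dots> = (\<Sum>a\<in>?F. \<Sum>b\<in>?G. Poly_Mapping.single (a + b) (Poly_Mapping.lookup f a * Poly_Mapping.lookup g b))"
    by (simp add: sum_product mult_single)
  finally have "poly_eval p (f * g) = (\<Sum>a\<in>?F. \<Sum>b\<in>?G.
      (Poly_Mapping.lookup f a * mono_eval p a) * (Poly_Mapping.lookup g b * mono_eval p b))"
    by (simp add: poly_eval_sum poly_eval_single mono_eval_add mult_ac)
  then show ?thesis by (simp add: poly_eval_def sum_product)
qed

text \<open>A relation instead of a function: a rational function has a value at p only through a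
  fraction whose denominator does not vanish there.\<close>

definition evaluates :: "(nat \<Rightarrow> complex) \<Rightarrow> zpoly fract \<Rightarrow> complex \<Rightarrow> bool" where
  "evaluates p x c \<longleftrightarrow> (\<exists>f g. x = to_fract f / to_fract g \<and> poly_eval p g \<noteq> 0 \<and> c = poly_eval p f / poly_eval p g)"

lemma poly_eval_1 [simp]: "poly_eval p 1 = 1"
  using poly_eval_single[of p 0 1] by (simp add: mono_eval_def)

lemma poly_eval_of_nat [simp]: "poly_eval p (of_nat k) = of_nat k"
  by (induction k) (simp_all add: poly_eval_add)

lemma evaluates_to_fract: "evaluates p (to_fract f) (poly_eval p f)"
  unfolding evaluates_def
  by (rule exI[of _ f], rule exI[of _ "Poly_Mapping.single 0 1"])
    simp

lemma nonzero_of_poly_eval: "poly_eval p g \<noteq> 0 \<Longrightarrow> to_fract g \<noteq> 0"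
  by auto

lemma evaluates_unique: "evaluates p x c \<Longrightarrow> evaluates p x d \<Longrightarrow> c = d"
proof -
  assume "evaluates p x c" "evaluates p x d"
  then obtain f g f' g' where *: "x = to_fract f / to_fract g" "poly_eval p g \<noteq> 0" "c = poly_eval p f / poly_eval p g"
    "x = to_fract f' / to_fract g'" "poly_eval p g' \<noteq> 0" "d = poly_eval p f' / poly_eval p g'"
    unfolding evaluates_def by blast
  then have "to_fract (f * g') = to_fract (f' * g)"
    using nonzero_of_poly_eval[OF *(2)] nonzero_of_poly_eval[OF *(5)] by (simp add: field_simps)
  then have "f * g' = f' * g" by (simp only: to_fract_eq_iff)
  then have "poly_eval p (f * g') = poly_eval p (f' * g)" by simp
  then show "c = d" unfolding *(3) *(6) by (simp add: poly_eval_mult frac_eq_eq *(2) *(5))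
qed

lemma evaluates_add: "evaluates p x c \<Longrightarrow> evaluates p y d \<Longrightarrow> evaluates p (x + y) (c + d)"
proof -
  assume "evaluates p x c" "evaluates p y d"
  then obtain f g f' g' where *: "x = to_fract f / to_fract g" "poly_eval p g \<noteq> 0" "c = poly_eval p f / poly_eval p g"
    "y = to_fract f' / to_fract g'" "poly_eval p g' \<noteq> 0" "d = poly_eval p f' / poly_eval p g'"
    unfolding evaluates_def by blast
  show "evaluates p (x + y) (c + d)"
    unfolding evaluates_def
    by (rule exI[of _ "f * g' + f' * g"], rule exI[of _ "g * g'"])
      (unfold *(1,3,4,6), use *(2,5) nonzero_of_poly_eval[OF *(2)] nonzero_of_poly_eval[OF *(5)] in
        \<open>simp add: poly_eval_add poly_eval_mult add_frac_eq\<close>)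
qed

lemma evaluates_mult: "evaluates p x c \<Longrightarrow> evaluates p y d \<Longrightarrow> evaluates p (x * y) (c * d)"
proof -
  assume "evaluates p x c" "evaluates p y d"
  then obtain f g f' g' where *: "x = to_fract f / to_fract g" "poly_eval p g \<noteq> 0" "c = poly_eval p f / poly_eval p g"
    "y = to_fract f' / to_fract g'" "poly_eval p g' \<noteq> 0" "d = poly_eval p f' / poly_eval p g'"
    unfolding evaluates_def by blast
  show "evaluates p (x * y) (c * d)"
    unfolding evaluates_def
    by (rule exI[of _ "f * f'"], rule exI[of _ "g * g'"]) (use * in \<open>auto simp: poly_eval_mult\<close>)
qed

lemma evaluates_divide:
  "evaluates p x c \<Longrightarrow> evaluates p y d \<Longrightarrow> d \<noteq> 0 \<Longrightarrow> evaluates p (x / y) (c / d)"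
proof -
  assume "evaluates p x c" "evaluates p y d" "d \<noteq> 0"
  then obtain f g f' g' where *: "x = to_fract f / to_fract g" "poly_eval p g \<noteq> 0" "c = poly_eval p f / poly_eval p g"
    "y = to_fract f' / to_fract g'" "poly_eval p g' \<noteq> 0" "d = poly_eval p f' / poly_eval p g'"
    unfolding evaluates_def by blast
  show "evaluates p (x / y) (c / d)"
    unfolding evaluates_def
    by (rule exI[of _ "f * g'"], rule exI[of _ "g * f'"]) (use * \<open>d \<noteq> 0\<close> in \<open>auto simp: poly_eval_mult\<close>)
qed

lemma evaluates_of_nat: "evaluates p (of_nat k) (of_nat k)"
proof -
  have "to_fract (of_nat k :: zpoly) = of_nat k"
    using to_fract_of_int[of "int k", where 'a = zpoly] by simp
  then show ?thesis
    using evaluates_to_fract[of p "of_nat k"] by simp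
qed

lemma evaluates_minus: "evaluates p x c \<Longrightarrow> evaluates p y d \<Longrightarrow> evaluates p (x - y) (c - d)"
proof -
  assume *: "evaluates p x c" "evaluates p y d"
  have "poly_eval p (- 1) = - 1"
    using poly_eval_single[of p 0 "- 1"] by (simp add: mono_eval_def single_uminus)
  then have "evaluates p (- 1) (- 1)"
    using evaluates_to_fract[of p "- 1"] by simp
  from evaluates_add[OF *(1) evaluates_mult[OF this *(2)]] show ?thesis by simp
qed

lemma evaluates_zvar: "evaluates p (zvar i) (p i)"
  unfolding zvar_def
  using evaluates_to_fract[of p "Poly_Mapping.single (Poly_Mapping.single i 1) 1"]
  by (simp add: poly_eval_single mono_eval_def)

lemma evaluates_power: "evaluates p x c \<Longrightarrow> evaluates p (x ^ k) (c ^ k)"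
  using evaluates_of_nat[of p 1] by (induction k) (auto intro: evaluates_mult)

lemma evaluates_sum: "(\<And>i. i \<in> A \<Longrightarrow> evaluates p (f i) (g i)) \<Longrightarrow> evaluates p (sum f A) (sum g A)"
  using evaluates_of_nat[of p 0] by (induction A rule: infinite_finite_induct) (auto intro: evaluates_add)

lemma evaluates_prod: "(\<And>i. i \<in> A \<Longrightarrow> evaluates p (f i) (g i)) \<Longrightarrow> evaluates p (prod f A) (prod g A)"
  using evaluates_of_nat[of p 1] by (induction A rule: infinite_finite_induct) (auto intro: evaluates_mult)

text \<open>Distinct coordinates keep all denominators z_i - z_j nonzero at p. Through this, limits
  computed with real numbers give information on the polynomial that the fractions
  represent.\<close>

lemma evaluates_Q_on:
  assumes "inj_on p I"
  shows "evaluates p (Q_on zvar lam I) (Q_on p lam I)"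
  using assms
proof (induction lam arbitrary: I)
  case Nil
  then show ?case using evaluates_of_nat[of p 1] by simp
next
  case (Cons r rs)
  have "evaluates p (zvar i ^ r * (\<Prod>j\<in>I - {i}. (zvar i + zvar j) / (zvar i - zvar j)) * Q_on zvar rs (I - {i}))
     (p i ^ r * (\<Prod>j\<in>I - {i}. (p i + p j) / (p i - p j)) * Q_on p rs (I - {i}))" if "i \<in> I" for i
  proof (intro evaluates_mult evaluates_power evaluates_zvar evaluates_prod evaluates_divide
      evaluates_add evaluates_minus)
    show "evaluates p (Q_on zvar rs (I - {i})) (Q_on p rs (I - {i}))"
      using Cons.prems by (intro Cons.IH) (auto intro: inj_on_subset)
    show "p i - p j \<noteq> 0" if "j \<in> I - {i}" for j
      using Cons.prems that \<open>i \<in> I\<close> by (auto simp: inj_on_def)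
  qed
  then show ?case
    unfolding Q_on.simps using evaluates_of_nat[of p 2]
    by (intro evaluates_mult[of p 2] evaluates_sum) simp_all
qed

lemma Q_on_of_real: "Q_on (\<lambda>i. complex_of_real (p i)) lam I = complex_of_real (Q_on p lam I)"
  by (induction lam arbitrary: I) simp_all

section \<open>Leading exponents\<close>

text \<open>
  For a base larger than the size, comparing weights is the lexicographic comparison of exponents.
  The variables \<open>grow b t i\<close> turn the monomial of weight \<open>y\<close> into $e^{ty}$, so that the
  behaviour for $t\to\infty$ detects the leading term even of a rational expression.
\<close>

fun weight :: "real \<Rightarrow> nat \<Rightarrow> nat list \<Rightarrow> real" where
  "weight b s [] = 0"
| "weight b s (r # mu) = real r / b ^ s + weight b (Suc s) mu"

lemma weight_nonneg: "0 < b \<Longrightarrow> 0 \<le> weight b s mu"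
  by (induction mu arbitrary: s) auto

lemma weight_Suc: "0 < b \<Longrightarrow> weight b (Suc s) mu = weight b s mu / b"
  by (induction mu arbitrary: s) (auto simp: field_simps)

lemma weight_le:
  assumes "1 \<le> b"
  shows "weight b s mu \<le> real (sum_list mu) / b ^ s"
proof (induction mu arbitrary: s)
  case (Cons r mu)
  have "real (sum_list mu) / b ^ Suc s \<le> real (sum_list mu) / b ^ s"
    using assms by (intro divide_left_mono power_increasing) auto
  then show ?case using Cons[of "Suc s"] by (simp add: add_divide_distrib)
qed simp

text \<open>Since the list is strict, its second part is at most r - 1, and the parts after it, of
  total below b, add less than one unit 1 / b^s.\<close>

lemma weight_less_head:
  assumes "sorted_wrt (>) (r # mu)" "0 < r" "real (sum_list mu) < b" "1 < b"
  shows "weight b s mu < real r / b ^ s"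
proof -
  have b: "0 < b" using assms(3) by (meson le_less_trans of_nat_0_le_iff)
  show ?thesis
  proof (cases mu)
    case Nil
    then show ?thesis using assms b by simp
  next
    case (Cons x xs)
    have b1: "1 \<le> b" using assms(4) by simp
    have "weight b (Suc s) xs \<le> real (sum_list xs) / b ^ Suc s" by (rule weight_le[OF b1])
    also have "\<dots> < 1 / b ^ s"
      using assms(3) Cons b by (simp add: field_simps)
    finally have "weight b s mu < real (Suc x) / b ^ s"
      using Cons by (simp add: add_divide_distrib)
    also have "\<dots> \<le> real r / b ^ s"
      using assms(1) Cons b by (intro divide_right_mono) auto
    finally show ?thesis .
  qed
qed

lemma tendsto_exp_neg_mult: "c < 0 \<Longrightarrow> ((\<lambda>t::real. exp (t * c)) \<longlongrightarrow> 0) at_top"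
  by (rule filterlim_compose[OF exp_at_bot])
    (use filterlim_tendsto_neg_mult_at_bot[OF tendsto_const _ filterlim_ident, of c] in \<open>simp add: mult.commute\<close>)

definition grow :: "real \<Rightarrow> real \<Rightarrow> nat \<Rightarrow> real" where
  "grow b t i = exp (t * (1 / b ^ i))"

lemma grow_pos: "0 < grow b t i"
  by (simp add: grow_def)

lemma grow_exponent_less:
  assumes "1 < b" "i < j"
  shows "1 / b ^ j < (1 / b ^ i :: real)"
  using assms by (intro divide_strict_left_mono power_strict_increasing) auto

lemma inj_grow:
  assumes "1 < b" "0 < t"
  shows "inj (grow b t)"
proof (rule injI)
  fix i j assume "grow b t i = grow b t j"
  then have "1 / b ^ i = 1 / b ^ j" using assms by (simp add: grow_def)
  then show "i = j"
    using grow_exponent_less[OF assms(1), of i j] grow_exponent_less[OF assms(1), of j i]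
    by (cases i j rule: linorder_cases) auto
qed

text \<open>Division by the variable z_i, which dominates z_j because its exponent 1 / b^i is
  larger. Cross factors thus tend to signs and do not influence the rate of growth.\<close>

lemma grow_cross_tendsto_less:
  assumes "1 < b" "i < j"
  shows "((\<lambda>t. (grow b t i + grow b t j) / (grow b t i - grow b t j)) \<longlongrightarrow> 1) at_top"
proof -
  let ?c = "1 / b ^ j - 1 / b ^ i"
  have c: "?c < 0" using grow_exponent_less[OF assms] by simp
  have "((\<lambda>t. (1 + exp (t * ?c)) / (1 - exp (t * ?c))) \<longlongrightarrow> (1 + 0) / (1 - 0)) at_top"
    by (intro tendsto_intros tendsto_exp_neg_mult c) simp
  moreover have "(1 + exp (t * ?c)) / (1 - exp (t * ?c)) = (grow b t i + grow b t j) / (grow b t i - grow b t j)" for t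
  proof -
    have "grow b t j = grow b t i * exp (t * ?c)"
      by (simp add: grow_def right_diff_distrib flip: exp_add)
    then have "grow b t i + grow b t j = grow b t i * (1 + exp (t * ?c))"
      "grow b t i - grow b t j = grow b t i * (1 - exp (t * ?c))" by (simp_all add: algebra_simps)
    then show ?thesis using grow_pos[of b t i] by simp
  qed
  ultimately show ?thesis by simp
qed

lemma grow_cross_tendsto:
  assumes "1 < b" "i \<noteq> j"
  shows "((\<lambda>t. (grow b t i + grow b t j) / (grow b t i - grow b t j)) \<longlongrightarrow> (if i < j then 1 else - 1)) at_top"
proof (cases "i < j")
  case True
  then show ?thesis using grow_cross_tendsto_less[OF assms(1)] by simp
next
  case False
  then have "((\<lambda>t. - ((grow b t j + grow b t i) / (grow b t j - grow b t i))) \<longlongrightarrow> - 1) at_top"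
    using grow_cross_tendsto_less[OF assms(1), of j i] assms(2) by (intro tendsto_minus) auto
  moreover have "- ((grow b t j + grow b t i) / (grow b t j - grow b t i)) = (grow b t i + grow b t j) / (grow b t i - grow b t j)" for t
    by (metis minus_diff_eq minus_divide_right add.commute)
  ultimately show ?thesis using False by simp
qed

lemma grow_power_exp: "grow b t i ^ r * exp (- (t * x)) = exp (- (t * (x - real r / b ^ i)))"
  by (simp add: grow_def exp_of_nat_mult[symmetric] right_diff_distrib mult_exp_exp)

text \<open>With W the weight of mu from place s, the difference of the two sides is (r / b^s - W)
  (1 - 1/b), which is positive. So giving the first part to a later variable is strictly
  worse.\<close>

lemma weight_swap:
  assumes "sorted_wrt (>) (r # mu)" "0 < r" "real (sum_list mu) < b" "1 < b"
  shows "weight b s mu + real r / b ^ Suc s < weight b s (r # mu)"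
proof -
  have "weight b s mu * (1 - 1 / b) < real r / b ^ s * (1 - 1 / b)"
    using weight_less_head[OF assms, of s] assms(4) by (intro mult_strict_right_mono) auto
  then have "weight b s mu + real r / b ^ s / b < weight b s mu / b + real r / b ^ s"
    by (simp add: algebra_simps diff_divide_distrib)
  moreover have "weight b (Suc s) mu = weight b s mu / b" using assms(4) by (intro weight_Suc) simp
  ultimately show ?thesis by (simp add: mult.commute)
qed

text \<open>The growth rate of Q_lam is at most its weight. In the recursion the first part takes
  some variable i: for i = s the rest starts at s + 1 and has exactly the weight that is left, and
  for i > s \<open>weight_swap\<close> gives a strict loss.\<close>

lemma Q_on_grow_upper:
  assumes "1 < b" "sorted_wrt (>) lam" "\<forall>r\<in>set lam. 0 < r" "real (sum_list lam) < b"
    "finite I" "\<forall>i\<in>I. s \<le> i" "weight b s lam < x"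
  shows "((\<lambda>t. Q_on (grow b t) lam I * exp (- (t * x))) \<longlongrightarrow> 0) at_top"
  using assms(2-)
proof (induction lam arbitrary: I s x)
  case Nil
  then show ?case using tendsto_exp_neg_mult[of "- x"] by simp
next
  case (Cons r mu)
  have IH: "((\<lambda>t. Q_on (grow b t) mu (I - {i}) * exp (- (t * (x - real r / b ^ i)))) \<longlongrightarrow> 0) at_top" if i: "i \<in> I" for i
  proof (cases "i = s")
    case True
    have "\<forall>j\<in>I - {i}. Suc s \<le> j" using Cons.prems(5) True by force
    then show ?thesis using Cons.prems True by (intro Cons.IH[of "I - {i}" "Suc s"]) auto
  next
    case False
    then have "Suc s \<le> i" using Cons.prems(5) i by force
    then have "real r / b ^ i \<le> real r / b ^ Suc s"
      using assms(1) by (intro divide_left_mono power_increasing) auto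
    moreover have "weight b s mu + real r / b ^ Suc s < weight b s (r # mu)"
      using Cons.prems assms(1) by (intro weight_swap) auto
    ultimately have "weight b s mu < x - real r / b ^ i" using Cons.prems(6) by simp
    then show ?thesis using Cons.prems by (intro Cons.IH[of "I - {i}" s]) auto
  qed
  have "((\<lambda>t. 2 * (\<Sum>i\<in>I. (\<Prod>j\<in>I - {i}. (grow b t i + grow b t j) / (grow b t i - grow b t j)) *
      (Q_on (grow b t) mu (I - {i}) * exp (- (t * (x - real r / b ^ i)))))) \<longlongrightarrow>
      2 * (\<Sum>i\<in>I. (\<Prod>j\<in>I - {i}. if i < j then 1 else - 1) * 0)) at_top"
    using assms(1) by (intro tendsto_intros grow_cross_tendsto IH) auto
  moreover have "2 * (\<Sum>i\<in>I. (\<Prod>j\<in>I - {i}. (grow b t i + grow b t j) / (grow b t i - grow b t j)) *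
      (Q_on (grow b t) mu (I - {i}) * exp (- (t * (x - real r / b ^ i))))) =
     Q_on (grow b t) (r # mu) I * exp (- (t * x))" for t
    unfolding grow_power_exp[symmetric] Q_on.simps sum_distrib_left sum_distrib_right mult.assoc
    by (intro sum.cong refl) (simp only: mult_ac)
  ultimately show ?case by simp
qed

text \<open>Only the term in which the first part takes the first variable survives; its cross
  factors tend to 1, since that variable dominates all others. Each part contributes the factor 2 of
  the recursion.\<close>

lemma Q_on_grow_leading:
  assumes "1 < b" "sorted_wrt (>) lam" "\<forall>r\<in>set lam. 0 < r" "real (sum_list lam) < b" "s + length lam \<le> Suc m"
  shows "((\<lambda>t. Q_on (grow b t) lam {s..m} * exp (- (t * weight b s lam))) \<longlongrightarrow> 2 ^ length lam) at_top"
  using assms(2-)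
proof (induction lam arbitrary: s)
  case Nil
  then show ?case by simp
next
  case (Cons r mu)
  let ?x = "weight b s (r # mu)"
  let ?I = "{s..m}"
  let ?g = "\<lambda>t i. (\<Prod>j\<in>?I - {i}. (grow b t i + grow b t j) / (grow b t i - grow b t j))"
  let ?Q = "\<lambda>t i. Q_on (grow b t) mu (?I - {i}) * exp (- (t * (?x - real r / b ^ i)))"
  have sI: "s \<in> ?I" "?I - {s} = {Suc s..m}" using Cons.prems(4) by auto
  have first: "((\<lambda>t. ?Q t s) \<longlongrightarrow> 2 ^ length mu) at_top"
    using Cons.IH[of "Suc s"] Cons.prems sI by simp
  have others: "((\<lambda>t. ?Q t i) \<longlongrightarrow> 0) at_top" if i: "i \<in> ?I - {s}" for i
  proof -
    have "real r / b ^ i \<le> real r / b ^ Suc s"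
      using assms(1) i by (intro divide_left_mono power_increasing) auto
    moreover have "weight b s mu + real r / b ^ Suc s < weight b s (r # mu)"
      using Cons.prems assms(1) by (intro weight_swap) auto
    ultimately have "weight b s mu < ?x - real r / b ^ i" by linarith
    then show ?thesis using Cons.prems assms(1) by (intro Q_on_grow_upper[of b mu _ s]) auto
  qed
  have "((\<lambda>t. 2 * (?g t s * ?Q t s + (\<Sum>i\<in>?I - {s}. ?g t i * ?Q t i))) \<longlongrightarrow>
     2 * ((\<Prod>j\<in>?I - {s}. if s < j then 1 else - 1) * 2 ^ length mu +
       (\<Sum>i\<in>?I - {s}. (\<Prod>j\<in>?I - {i}. if i < j then 1 else - 1) * 0))) at_top"
    using assms(1) by (intro tendsto_intros grow_cross_tendsto first others) auto
  moreover have "(\<Prod>j\<in>?I - {s}. if s < j then 1 else - 1) = (1::real)"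
    unfolding sI(2) by (intro prod.neutral) auto
  moreover have "2 * (?g t s * ?Q t s + (\<Sum>i\<in>?I - {s}. ?g t i * ?Q t i)) =
     Q_on (grow b t) (r # mu) ?I * exp (- (t * ?x))" for t
  proof -
    have "?g t s * ?Q t s + (\<Sum>i\<in>?I - {s}. ?g t i * ?Q t i) = (\<Sum>i\<in>?I. ?g t i * ?Q t i)"
      using sI(1) by (simp add: sum.remove[of ?I s] del: weight.simps)
    also have "2 * \<dots> = Q_on (grow b t) (r # mu) ?I * exp (- (t * ?x))"
      unfolding grow_power_exp[symmetric] Q_on.simps sum_distrib_left sum_distrib_right mult.assoc
      by (intro sum.cong refl) (simp only: mult_ac)
    finally show ?thesis .
  qed
  ultimately show ?case by (simp del: weight.simps Q_on.simps)
qed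

text \<open>On strict lists both statistics are decided by the first part that differs: the excess
  by \<open>excess_strict\<close>, the weight because all later parts together add at most one unit
  of that place. So triangularity in one order can be used in the other.\<close>

lemma excess_less_of_weight_less:
  assumes "1 < b" "sorted_wrt (>) ka" "sorted_wrt (>) lam" "\<forall>r\<in>set lam. 0 < r" "\<forall>r\<in>set ka. 0 < r"
    "real (sum_list lam) < b" "weight b s ka < weight b s lam"
  shows "excess ka < excess lam"
  using assms(2-)
proof (induction ka arbitrary: lam s)
  case Nil
  then obtain r mu where lam: "lam = r # mu" by (cases lam) auto
  then have "0 < r" using Nil.prems(3) by simp
  then have "(2::nat) ^ 1 \<le> 2 ^ r" by (intro power_increasing) auto
  then show ?case unfolding lam excess_simps by simp
next
  case (Cons x xs)
  have b0: "0 < b" using assms(1) by simp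
  obtain y ys where lam: "lam = y # ys"
    using Cons.prems(6) weight_nonneg[OF b0, of s "x # xs"] by (cases lam) auto
  consider "x < y" | "x = y" | "y < x" by linarith
  then show ?case
  proof cases
    case 1
    then have "(2::nat) ^ Suc x \<le> 2 ^ y" by (intro power_increasing) auto
    moreover have "excess (x # xs) + 1 < 2 ^ Suc x" using Cons.prems(1) by (rule excess_strict)
    ultimately show ?thesis unfolding lam excess_simps by linarith
  next
    case 2
    then have "excess xs < excess ys"
      using Cons.prems lam by (intro Cons.IH[of ys "Suc s"]) auto
    then show ?thesis unfolding lam 2 excess_simps by linarith
  next
    case 3
    have "weight b (Suc s) ys * b = weight b s ys" using weight_Suc[OF b0, of s ys] b0 by simp
    have "weight b (Suc s) ys \<le> real (sum_list ys) / b ^ Suc s" using assms(1) by (intro weight_le) simp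
    also have "\<dots> \<le> 1 / b ^ s"
      using Cons.prems(5) lam b0 by (simp add: field_simps)
    finally have "weight b s lam \<le> real (Suc y) / b ^ s" unfolding lam by (simp add: add_divide_distrib)
    also have "\<dots> \<le> real x / b ^ s" using 3 b0 by (intro divide_right_mono) auto
    also have "\<dots> \<le> weight b s (x # xs)" using weight_nonneg[OF b0] by simp
    finally show ?thesis using Cons.prems(6) by simp
  qed
qed

text \<open>The entries are digits in base b; as their sum is below b, there are no carries.\<close>

lemma weight_inject:
  assumes "1 < b" "length xs = length ys" "real (sum_list xs) < b" "real (sum_list ys) < b"
    "weight b s xs = weight b s ys"
  shows "xs = ys"
  using assms(2-)
proof (induction xs ys arbitrary: s rule: list_induct2)
  case Nil
  then show ?case by simp
next
  case (Cons x xs y ys)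
  have b0: "0 < b" using assms(1) by simp
  have small: "weight b (Suc s) zs < 1 / b ^ s" if "real (sum_list zs) < b" for zs
  proof -
    have "weight b (Suc s) zs \<le> real (sum_list zs) / b ^ Suc s" using assms(1) by (intro weight_le) simp
    also have "\<dots> < 1 / b ^ s" using that b0 by (simp add: field_simps)
    finally show ?thesis .
  qed
  have less: False if "x < y" "real x / b ^ s + weight b (Suc s) xs = real y / b ^ s + weight b (Suc s) ys"
    "real (sum_list xs) < b" for x y :: nat and xs ys
  proof -
    have "real x / b ^ s + weight b (Suc s) xs < real (Suc x) / b ^ s"
      using small[OF that(3)] by (simp add: add_divide_distrib)
    also have "\<dots> \<le> real y / b ^ s" using that(1) b0 by (intro divide_right_mono) auto
    also have "\<dots> \<le> real y / b ^ s + weight b (Suc s) ys" using weight_nonneg[OF b0] by simp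
    finally show False using that(2) by simp
  qed
  have "x = y"
    using less[of x y xs ys] less[of y x ys xs] Cons.prems by (cases x y rule: linorder_cases) auto
  moreover from this have "xs = ys" using Cons.prems by (intro Cons.IH[of "Suc s"]) auto
  ultimately show ?case by simp
qed

lemma weight_map_upt:
  "weight b s (map f [s..<m]) = (\<Sum>i\<in>{s..<m}. real (f i) / b ^ i)"
proof (induction "m - s" arbitrary: s)
  case (Suc k)
  then have "s < m" by simp
  then show ?case using Suc by (simp add: upt_conv_Cons sum.atLeast_Suc_lessThan)
qed simp

section \<open>Exponents, and the monomials of the products q_nu\<close>

definition expo :: "nat \<Rightarrow> (nat \<Rightarrow> nat) \<Rightarrow> (nat \<Rightarrow>\<^sub>0 nat)" where
  "expo m f = (\<Sum>i\<in>{1..m}. Poly_Mapping.single i (f i))"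

definition part :: "nat list \<Rightarrow> nat \<Rightarrow> nat" where
  "part nu i = (if 1 \<le> i \<and> i \<le> length nu then nu ! (i - 1) else 0)"

lemma lookup_expo: "Poly_Mapping.lookup (expo m f) i = (if i \<in> {1..m} then f i else 0)"
  by (simp add: expo_def lookup_sum lookup_single when_def)

lemma keys_expo: "Poly_Mapping.keys (expo m f) \<subseteq> {1..m}"
  by (auto simp: in_keys_iff lookup_expo split: if_splits)

lemma expo_eq_iff: "expo m f = expo m g \<longleftrightarrow> (\<forall>i\<in>{1..m}. f i = g i)"
  by (auto simp: poly_mapping_eq_iff fun_eq_iff lookup_expo)

lemma expo_lookup: "Poly_Mapping.keys a \<subseteq> {1..m} \<Longrightarrow> expo m (Poly_Mapping.lookup a) = a"
  by (rule poly_mapping_eqI) (auto simp: lookup_expo in_keys_iff)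

lemma part_Cons: "part (r # mu) (Suc i) = (if i = 0 then r else part mu i)"
  by (cases i) (auto simp: part_def)

lemma sum_part:
  assumes "length nu \<le> m"
  shows "(\<Sum>i\<in>{1..m}. part nu i) = sum_list nu"
  using assms
proof (induction nu arbitrary: m)
  case Nil
  then show ?case by (simp add: part_def)
next
  case (Cons r mu)
  then obtain k where m: "m = Suc k" by (cases m) auto
  have "(\<Sum>i\<in>{1..m}. part (r # mu) i) = part (r # mu) 1 + (\<Sum>i\<in>{1..k}. part (r # mu) (Suc i))"
    unfolding m by (simp add: sum.atLeast_Suc_atMost sum.shift_bounds_cl_Suc_ivl del: sum.cl_ivl_Suc)
  also have "(\<Sum>i\<in>{1..k}. part (r # mu) (Suc i)) = (\<Sum>i\<in>{1..k}. part mu i)"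
    by (intro sum.cong) (auto simp: part_Cons)
  finally show ?case using Cons m by (simp add: part_def)
qed

lemma prod_part:
  assumes "length nu \<le> m" "h 0 = (1::'a::comm_monoid_mult)"
  shows "(\<Prod>i\<in>{1..m}. h (part nu i)) = prod_list (map h nu)"
  using assms(1)
proof (induction nu arbitrary: m)
  case Nil
  then show ?case by (simp add: part_def assms(2))
next
  case (Cons r mu)
  then obtain k where m: "m = Suc k" by (cases m) auto
  have "(\<Prod>i\<in>{1..m}. h (part (r # mu) i)) = h (part (r # mu) 1) * (\<Prod>i\<in>{1..k}. h (part (r # mu) (Suc i)))"
    unfolding m by (simp add: prod.atLeast_Suc_atMost prod.shift_bounds_cl_Suc_ivl del: prod.cl_ivl_Suc)
  also have "(\<Prod>i\<in>{1..k}. h (part (r # mu) (Suc i))) = (\<Prod>i\<in>{1..k}. h (part mu i))"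
    by (intro prod.cong) (auto simp: part_Cons)
  finally show ?case using Cons m by (simp add: part_def)
qed

lemma weight_part:
  assumes "length nu \<le> m" "0 < b"
  shows "(\<Sum>i\<in>{s..<s + m}. real (part nu (Suc i - s)) / b ^ i) = weight b s nu"
  using assms(1)
proof (induction nu arbitrary: m s)
  case Nil
  then show ?case by (simp add: part_def)
next
  case (Cons r mu)
  then obtain k where m: "m = Suc k" by (cases m) auto
  have "(\<Sum>i\<in>{s..<s + m}. real (part (r # mu) (Suc i - s)) / b ^ i) =
     real r / b ^ s + (\<Sum>i\<in>{Suc s..<Suc s + k}. real (part (r # mu) (Suc i - s)) / b ^ i)"
    unfolding m by (simp add: sum.atLeast_Suc_lessThan part_def)
  also have "(\<Sum>i\<in>{Suc s..<Suc s + k}. real (part (r # mu) (Suc i - s)) / b ^ i) =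
      (\<Sum>i\<in>{Suc s..<Suc s + k}. real (part mu (Suc i - Suc s)) / b ^ i)"
  proof (intro sum.cong refl)
    fix i assume "i \<in> {Suc s..<Suc s + k}"
    then obtain j where "i = Suc (s + j)" by (metis atLeastLessThan_iff le_Suc_ex add_Suc)
    then show "real (part (r # mu) (Suc i - s)) / b ^ i = real (part mu (Suc i - Suc s)) / b ^ i"
      by (simp add: part_Cons)
  qed
  also have "\<dots> = weight b (Suc s) mu"
    using Cons.prems m by (intro Cons.IH) simp
  finally show ?case by simp
qed

text \<open>Each factor (1 + z u) / (1 - z u) is 1 + 2 z u + 2 z^2 u^2 + ..., which explains the
  weights 1 and 2. Cutting the factors at degree N \<ge> r turns the product of series into one of
  finite sums without affecting the coefficient of u^r.\<close>

lemma q_series_nth_sum: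
  fixes z :: "nat \<Rightarrow> 'a::field"
  assumes "finite I" "r \<le> N"
  shows "fps_nth (q_series z I) r =
    (\<Sum>f\<in>{f \<in> PiE I (\<lambda>_. {..N}). sum f I = r}. \<Prod>i\<in>I. (if f i = 0 then 1 else 2) * z i ^ f i)"
proof -
  define T where "T i = (\<Sum>s\<le>N. fps_const ((if s = 0 then 1 else 2) * z i ^ s) * fps_X ^ s)" for i
  have factor_nth: "fps_nth ((1 + fps_const c * fps_X) / (1 - fps_const c * fps_X)) r = (if r = 0 then 1 else 2 * c ^ r)" for c :: 'a and r
  proof -
    have "(1 + fps_const c * fps_X) / (1 - fps_const c * fps_X) = (1 + fps_const c * fps_X) * inverse (1 - fps_const c * fps_X)"
      by (rule fps_divide_unit) simp
    then show ?thesis by (cases r) (simp_all add: distrib_right mult.assoc fps_geometric_nth)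
  qed
  have T_nth: "fps_nth (T i) k = (if k = 0 then 1 else 2 * z i ^ k)" if "k \<le> N" for i k
    using that by (simp add: T_def fps_sum_nth if_distrib[of "\<lambda>x. _ * x"] cong: if_cong)
  have "fps_nth (q_series z I) k = fps_nth (prod T I) k" if "k \<le> N" for k
    using assms(1) that
  proof (induction I arbitrary: k rule: finite_induct)
    case empty
    then show ?case by (simp add: q_series_def)
  next
    case (insert x F)
    show ?case
      unfolding q_series_def prod.insert[OF insert.hyps] fps_mult_nth factor_nth
    proof (intro sum.cong refl)
      fix i assume "i \<in> {0..k}"
      then show "(if i = 0 then 1 else 2 * z x ^ i) *
          fps_nth (\<Prod>i\<in>F. (1 + fps_const (z i) * fps_X) / (1 - fps_const (z i) * fps_X)) (k - i) =
          fps_nth (T x) i * fps_nth (prod T F) (k - i)"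
        using insert.IH[of "k - i", unfolded q_series_def] insert.prems T_nth[of i x] by auto
    qed
  qed
  then have "fps_nth (q_series z I) r = fps_nth (prod T I) r" using assms(2) by blast
  also have "prod T I = (\<Sum>f\<in>PiE I (\<lambda>_. {..N}). \<Prod>i\<in>I. fps_const ((if f i = 0 then 1 else 2) * z i ^ f i) * fps_X ^ f i)"
    unfolding T_def using assms(1) by (intro prod_sum_PiE) auto
  also have "\<dots> = (\<Sum>f\<in>PiE I (\<lambda>_. {..N}). fps_const (\<Prod>i\<in>I. (if f i = 0 then 1 else 2) * z i ^ f i) * fps_X ^ sum f I)"
  proof -
    have "fps_const (prod h I) = (\<Prod>i\<in>I. fps_const (h i))" for h :: "nat \<Rightarrow> 'a"
      by (induction I rule: infinite_finite_induct) (simp_all flip: fps_const_mult)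
    then have "(\<Prod>i\<in>I. fps_const (h i) * fps_X ^ f i) = fps_const (prod h I) * fps_X ^ sum f I" for h :: "nat \<Rightarrow> 'a" and f
      by (simp only: prod.distrib power_sum)
    then show ?thesis by (simp only:)
  qed
  also have "fps_nth \<dots> r = (\<Sum>f\<in>PiE I (\<lambda>_. {..N}). if sum f I = r then \<Prod>i\<in>I. (if f i = 0 then 1 else 2) * z i ^ f i else 0)"
    by (auto simp: fps_sum_nth intro!: sum.cong)
  also have "\<dots> = (\<Sum>f\<in>{f \<in> PiE I (\<lambda>_. {..N}). sum f I = r}. \<Prod>i\<in>I. (if f i = 0 then 1 else 2) * z i ^ f i)"
    using assms(1) by (intro sum.inter_filter[symmetric]) (auto intro: finite_PiE)
  finally show ?thesis .
qed

text \<open>The coefficient of a monomial in \<open>q_prod nu\<close> counts nonnegative integer matrices with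
  prescribed row and column sums, each with weight 2 to the number of its nonzero entries.\<close>

definition matrices :: "nat \<Rightarrow> nat \<Rightarrow> (nat \<Rightarrow> nat \<Rightarrow> nat) set" where
  "matrices m N = PiE {1..m} (\<lambda>_. PiE {1..m} (\<lambda>_. {..N}))"

definition row_matrices :: "nat \<Rightarrow> nat \<Rightarrow> (nat \<Rightarrow> nat) \<Rightarrow> (nat \<Rightarrow> nat \<Rightarrow> nat) set" where
  "row_matrices m N nu = {g \<in> matrices m N. \<forall>k\<in>{1..m}. (\<Sum>i\<in>{1..m}. g k i) = nu k}"

definition matrix_weight :: "nat \<Rightarrow> (nat \<Rightarrow> nat \<Rightarrow> nat) \<Rightarrow> nat" where
  "matrix_weight m g = (\<Prod>k\<in>{1..m}. \<Prod>i\<in>{1..m}. if g k i = 0 then 1 else 2)"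

lemma finite_row_matrices [simp]: "finite (row_matrices m N nu)"
  unfolding row_matrices_def matrices_def by (rule finite_subset[of _ "PiE {1..m} (\<lambda>_. PiE {1..m} (\<lambda>_. {..N}))"]) (auto intro!: finite_PiE)

lemma to_fract_prod: "to_fract (prod f A) = (\<Prod>x\<in>A. to_fract (f x))"
  by (induction A rule: infinite_finite_induct) simp_all

lemma to_fract_power: "to_fract (f ^ k) = to_fract f ^ k"
  by (induction k) simp_all

lemma prod_zvar_power:
  "(\<Prod>i\<in>{1..m}. zvar i ^ f i) = to_fract (Poly_Mapping.single (expo m f) 1)"
proof -
  have p: "Poly_Mapping.single (Poly_Mapping.single i 1) 1 ^ k = (Poly_Mapping.single (Poly_Mapping.single i k) 1 :: zpoly)" for i k
  proof (induction k)
    case 0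
    then show ?case by simp
  next
    case (Suc k)
    have "Poly_Mapping.single i 1 + Poly_Mapping.single i k = Poly_Mapping.single i (Suc k)"
      by (simp flip: single_add)
    then show ?case using Suc by (simp add: mult_single)
  qed
  have "(\<Prod>i\<in>A. Poly_Mapping.single (Poly_Mapping.single i (f i)) 1) =
      (Poly_Mapping.single (\<Sum>i\<in>A. Poly_Mapping.single i (f i)) 1 :: zpoly)" for A
    by (induction A rule: infinite_finite_induct) (simp_all add: mult_single)
  then show ?thesis
    by (simp only: zvar_def expo_def p to_fract_power[symmetric] to_fract_prod[symmetric])
qed

definition q_poly :: "nat \<Rightarrow> nat list \<Rightarrow> zpoly" where
  "q_poly m nu = (\<Sum>g\<in>row_matrices m (sum_list nu) (part nu).
     Poly_Mapping.single (expo m (\<lambda>i. \<Sum>k\<in>{1..m}. g k i)) (of_nat (matrix_weight m g)))"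

text \<open>Row k of the matrix selects a monomial of the factor q_(nu_k), and the column sums are
  the resulting exponents. Rows beyond the length of nu are zero, as q_0 = 1.\<close>

lemma to_fract_q_poly:
  assumes "length nu \<le> m"
  shows "to_fract (q_poly m nu) = q_prod nu m"
proof -
  let ?N = "sum_list nu"
  let ?R = "\<lambda>k. {f \<in> PiE {1..m} (\<lambda>_. {..?N}). sum f {1..m} = part nu k}"
  have le: "part nu k \<le> ?N" if "k \<in> {1..m}" for k
    unfolding sum_part[OF assms, symmetric] using that by (intro member_le_sum) auto
  have "q_prod nu m = (\<Prod>k\<in>{1..m}. fps_nth (q_series zvar {1..m}) (part nu k))"
    using prod_part[OF assms, of "fps_nth (q_series zvar {1..m})"]
    by (simp add: prod_list_q_fun q_list_def q_series_nth_0)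
  also have "\<dots> = (\<Prod>k\<in>{1..m}. \<Sum>f\<in>?R k. \<Prod>i\<in>{1..m}. (if f i = 0 then 1 else 2) * zvar i ^ f i)"
    using le by (intro prod.cong refl q_series_nth_sum) auto
  also have "\<dots> = (\<Sum>g\<in>PiE {1..m} ?R. \<Prod>k\<in>{1..m}. \<Prod>i\<in>{1..m}. (if g k i = 0 then 1 else 2) * zvar i ^ g k i)"
  proof (intro prod_sum_PiE)
    show "finite (?R k)" for k
      by (rule finite_subset[of _ "PiE {1..m} (\<lambda>_. {..?N})"]) (auto intro!: finite_PiE)
  qed simp
  also have "PiE {1..m} ?R = row_matrices m ?N (part nu)"
    by (auto simp: row_matrices_def matrices_def PiE_iff extensional_def)
  also have "(\<Sum>g\<in>row_matrices m ?N (part nu). \<Prod>k\<in>{1..m}. \<Prod>i\<in>{1..m}. (if g k i = 0 then 1 else 2) * zvar i ^ g k i) =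
     (\<Sum>g\<in>row_matrices m ?N (part nu). to_fract (Poly_Mapping.single (expo m (\<lambda>i. \<Sum>k\<in>{1..m}. g k i)) (of_nat (matrix_weight m g))))"
  proof (intro sum.cong refl)
    fix g :: "nat \<Rightarrow> nat \<Rightarrow> nat"
    have "(\<Prod>k\<in>{1..m}. \<Prod>i\<in>{1..m}. (if g k i = 0 then 1 else 2) * zvar i ^ g k i) =
       of_nat (matrix_weight m g) * (\<Prod>k\<in>{1..m}. \<Prod>i\<in>{1..m}. zvar i ^ g k i)"
    proof -
      have "(of_nat (matrix_weight m g) :: zpoly fract) = (\<Prod>k\<in>{1..m}. \<Prod>i\<in>{1..m}. if g k i = 0 then 1 else 2)"
        unfolding matrix_weight_def of_nat_prod by (intro prod.cong refl) simp
      then show ?thesis by (simp only: prod.distrib)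
    qed
    also have "(\<Prod>k\<in>{1..m}. \<Prod>i\<in>{1..m}. zvar i ^ g k i) = (\<Prod>i\<in>{1..m}. zvar i ^ (\<Sum>k\<in>{1..m}. g k i))"
      by (subst prod.swap) (simp add: power_sum)
    also have "\<dots> = to_fract (Poly_Mapping.single (expo m (\<lambda>i. \<Sum>k\<in>{1..m}. g k i)) 1)"
      by (rule prod_zvar_power)
    also have "of_nat (matrix_weight m g) * \<dots> =
       to_fract (of_nat (matrix_weight m g) * Poly_Mapping.single (expo m (\<lambda>i. \<Sum>k\<in>{1..m}. g k i)) 1)"
      using to_fract_of_int[of "int (matrix_weight m g)", where 'a = zpoly] by simp
    also have "of_nat (matrix_weight m g) * Poly_Mapping.single (expo m (\<lambda>i. \<Sum>k\<in>{1..m}. g k i)) 1 =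
      (Poly_Mapping.single (expo m (\<lambda>i. \<Sum>k\<in>{1..m}. g k i)) (of_nat (matrix_weight m g)) :: zpoly)"
      by (simp only: single_of_nat[symmetric] mult_single add_0 mult_1_right)
    finally show "(\<Prod>k\<in>{1..m}. \<Prod>i\<in>{1..m}. (if g k i = 0 then 1 else 2) * zvar i ^ g k i) =
      to_fract (Poly_Mapping.single (expo m (\<lambda>i. \<Sum>k\<in>{1..m}. g k i)) (of_nat (matrix_weight m g)) :: zpoly)" .
  qed
  finally show ?thesis by (simp add: q_poly_def to_fract_sum)
qed

lemma lookup_q_poly:
  "Poly_Mapping.lookup (q_poly m nu) (expo m mu) =
    (\<Sum>g\<in>{g \<in> row_matrices m (sum_list nu) (part nu). \<forall>i\<in>{1..m}. (\<Sum>k\<in>{1..m}. g k i) = mu i}. of_nat (matrix_weight m g))"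
  unfolding q_poly_def lookup_sum
  by (subst sum.inter_filter) (auto simp: lookup_single when_def expo_eq_iff intro!: sum.cong)

text \<open>Transposition exchanges row sums with column sums and keeps the number of nonzero
  entries. The restricted functions in \<open>?T\<close> make it an involution on extensional
  matrices.\<close>

lemma q_poly_symmetric:
  assumes "sum_list nu = sum_list mu"
  shows "Poly_Mapping.lookup (q_poly m nu) (expo m (part mu)) = Poly_Mapping.lookup (q_poly m mu) (expo m (part nu))"
proof -
  let ?T = "\<lambda>g. \<lambda>i\<in>{1..m}. \<lambda>k\<in>{1..m}. (g k i :: nat)"
  let ?S = "\<lambda>nu mu. {g \<in> row_matrices m (sum_list nu) (part nu). \<forall>i\<in>{1..m}. (\<Sum>k\<in>{1..m}. g k i) = part mu i}"
  have inv: "?T (?T g) = g" if "g \<in> ?S nu mu" for g nu mu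
  proof -
    have "g \<in> matrices m (sum_list nu)" using that by (simp add: row_matrices_def)
    then show ?thesis
      unfolding matrices_def by (auto simp: fun_eq_iff PiE_iff extensional_def)
  qed
  have mem: "?T g \<in> ?S mu nu" if "g \<in> ?S nu mu" "sum_list nu = sum_list mu" for g nu mu
    using that by (auto simp: row_matrices_def matrices_def PiE_iff)
  have wt: "matrix_weight m (?T g) = matrix_weight m g" for g
    unfolding matrix_weight_def by (subst prod.swap) simp
  show ?thesis
    unfolding lookup_q_poly
  proof (rule sum.reindex_bij_witness[of _ ?T ?T])
    fix g
    show "g \<in> ?S nu mu \<Longrightarrow> ?T (?T g) = g" by (rule inv)
    show "g \<in> ?S mu nu \<Longrightarrow> ?T (?T g) = g" by (rule inv)
    show "g \<in> ?S nu mu \<Longrightarrow> ?T g \<in> ?S mu nu" by (rule mem[OF _ assms])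
    show "g \<in> ?S mu nu \<Longrightarrow> ?T g \<in> ?S nu mu" by (rule mem[OF _ assms[symmetric]])
    show "of_nat (matrix_weight m (?T g)) = of_nat (matrix_weight m g)" by (simp only: wt)
  qed
qed

section \<open>The Cauchy identity\<close>

lemma Q_expansion_sum_length:
  "(c, al) \<in> set (Q_expansion lam) \<Longrightarrow> sum_list al = sum_list lam \<and> length al = length lam"
proof (induction lam arbitrary: c al)
  case Nil
  then show ?case by simp
next
  case (Cons r mu)
  then obtain c' ga d be where "(c', ga) \<in> set (Q_expansion mu)" "(d, be) \<in> set (lower_terms ga)"
    "al = (r + (sum_list ga - sum_list be)) # be" by auto
  then show ?case using Cons.IH[of c' ga] lower_terms_sum_length[of d be ga] by simp
qed

text \<open>Defined by the expansion in the q's, as the coset formula only gives a fraction. In this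
  form it is visibly a homogeneous polynomial.\<close>

definition Q_poly :: "nat \<Rightarrow> nat list \<Rightarrow> zpoly" where
  "Q_poly m lam = (\<Sum>(c, al)\<leftarrow>Q_expansion lam. Poly_Mapping.single 0 (of_int c) * q_poly m al)"

lemma to_fract_Q_poly:
  assumes "\<forall>r\<in>set lam. 0 < r" "length lam \<le> m"
  shows "to_fract (Q_poly m lam) = schur_Q lam m"
proof -
  have to_fract_sum_list: "to_fract (sum_list fs) = sum_list (map to_fract fs)" for fs :: "zpoly list"
    by (induction fs) simp_all
  have sum_list_apply: "sum_list fs m = sum_list (map (\<lambda>f. f m) fs)" for fs :: "symfun list"
    by (induction fs) simp_all
  show ?thesis
    unfolding schur_Q_expansion[OF assms(1)] Q_poly_def to_fract_sum_list sum_list_apply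
    using assms(2) Q_expansion_sum_length[of _ _ lam]
    by (auto simp: comp_def split_def sf_scale_def to_fract_q_poly intro!: arg_cong[of _ _ sum_list])
qed

definition homogeneous_expos :: "nat \<Rightarrow> nat \<Rightarrow> (nat \<Rightarrow>\<^sub>0 nat) set" where
  "homogeneous_expos m n = {a. Poly_Mapping.keys a \<subseteq> {1..m} \<and> (\<Sum>i\<in>{1..m}. Poly_Mapping.lookup a i) = n}"

lemma keys_sum_subset:
  "(\<And>x. x \<in> A \<Longrightarrow> Poly_Mapping.keys (F x) \<subseteq> S) \<Longrightarrow> Poly_Mapping.keys (sum F A) \<subseteq> S"
  by (induction A rule: infinite_finite_induct) (auto dest!: subsetD[OF keys_add])

lemma keys_q_poly:
  assumes "length nu \<le> m"
  shows "Poly_Mapping.keys (q_poly m nu) \<subseteq> homogeneous_expos m (sum_list nu)"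
  unfolding q_poly_def
proof (rule keys_sum_subset)
  fix g assume g: "g \<in> row_matrices m (sum_list nu) (part nu)"
  have "(\<Sum>i\<in>{1..m}. \<Sum>k\<in>{1..m}. g k i) = (\<Sum>k\<in>{1..m}. \<Sum>i\<in>{1..m}. g k i)" by (rule sum.swap)
  also have "\<dots> = (\<Sum>k\<in>{1..m}. part nu k)" using g by (simp add: row_matrices_def)
  also have "\<dots> = sum_list nu" by (rule sum_part[OF assms])
  finally have "expo m (\<lambda>i. \<Sum>k\<in>{1..m}. g k i) \<in> homogeneous_expos m (sum_list nu)"
    using keys_expo[of m] by (simp add: homogeneous_expos_def lookup_expo)
  then show "Poly_Mapping.keys (Poly_Mapping.single (expo m (\<lambda>i. \<Sum>k\<in>{1..m}. g k i)) (of_nat (matrix_weight m g) :: complex))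
      \<subseteq> homogeneous_expos m (sum_list nu)"
    by simp
qed

lemma keys_scalar_mult: "Poly_Mapping.keys (Poly_Mapping.single 0 c * f) \<subseteq> Poly_Mapping.keys (f :: zpoly)"
  using keys_mult[of "Poly_Mapping.single 0 c" f] by (auto split: if_splits)

lemma keys_Q_poly:
  assumes "length lam \<le> m"
  shows "Poly_Mapping.keys (Q_poly m lam) \<subseteq> homogeneous_expos m (sum_list lam)"
proof -
  have *: "Poly_Mapping.keys (sum_list fs) \<subseteq> S" if "\<And>f. f \<in> set fs \<Longrightarrow> Poly_Mapping.keys f \<subseteq> S" for fs :: "zpoly list" and S
    using that by (induction fs) (auto dest!: subsetD[OF keys_add])
  have "Poly_Mapping.keys (Poly_Mapping.single 0 (of_int c) * q_poly m al) \<subseteq> homogeneous_expos m (sum_list lam)"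
    if "(c, al) \<in> set (Q_expansion lam)" for c al
    using keys_scalar_mult[of "of_int c" "q_poly m al"] keys_q_poly[of al m] Q_expansion_sum_length[OF that] assms by auto
  then show ?thesis unfolding Q_poly_def by (intro *) auto
qed

definition expo_weight :: "real \<Rightarrow> nat \<Rightarrow> (nat \<Rightarrow>\<^sub>0 nat) \<Rightarrow> real" where
  "expo_weight b m a = (\<Sum>i\<in>{1..m}. real (Poly_Mapping.lookup a i) / b ^ i)"

lemma expo_weight_inject:
  assumes "a \<in> homogeneous_expos m n" "a' \<in> homogeneous_expos m n" "1 < b" "real n < b"
    "expo_weight b m a = expo_weight b m a'"
  shows "a = a'"
proof -
  let ?l = "\<lambda>a. map (Poly_Mapping.lookup a) [1..<Suc m]"
  have w: "weight b 1 (?l a) = expo_weight b m a" for a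
    unfolding weight_map_upt expo_weight_def by (simp add: atLeastLessThanSuc_atLeastAtMost)
  have s: "sum_list (?l a) = n" if "a \<in> homogeneous_expos m n" for a
    using that by (simp only: interv_sum_list_conv_sum_set_nat set_upt homogeneous_expos_def
        atLeastLessThanSuc_atLeastAtMost mem_Collect_eq)
  have "?l a = ?l a'"
    by (rule weight_inject[OF assms(3), where s = 1]) (use w s assms in auto)
  then have "\<forall>i\<in>{1..m}. Poly_Mapping.lookup a i = Poly_Mapping.lookup a' i"
    by (simp add: atLeastLessThanSuc_atLeastAtMost del: upt_Suc)
  then have "expo m (Poly_Mapping.lookup a) = expo m (Poly_Mapping.lookup a')" by (simp add: expo_eq_iff)
  then show ?thesis using assms(1,2) by (simp add: homogeneous_expos_def expo_lookup)
qed

text \<open>A monomial of weight x takes the value exp (t x) on the curve, so after scaling by exp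
  (-t y) only the monomials of weight y survive.\<close>

lemma poly_eval_grow_tendsto:
  assumes "Poly_Mapping.keys f \<subseteq> homogeneous_expos m n" "\<forall>a\<in>Poly_Mapping.keys f. expo_weight b m a \<le> y"
  shows "((\<lambda>t. poly_eval (\<lambda>i. complex_of_real (grow b t i)) f * of_real (exp (- (t * y)))) \<longlongrightarrow>
    (\<Sum>a\<in>Poly_Mapping.keys f. if expo_weight b m a = y then Poly_Mapping.lookup f a else 0)) at_top"
proof -
  have mono: "mono_eval (\<lambda>i. complex_of_real (grow b t i)) a = of_real (exp (t * expo_weight b m a))"
    if "a \<in> homogeneous_expos m n" for a t
  proof -
    have "mono_eval (\<lambda>i. complex_of_real (grow b t i)) a = of_real (\<Prod>i\<in>{1..m}. grow b t i ^ Poly_Mapping.lookup a i)"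
      using that by (subst mono_eval_superset[of "{1..m}"]) (auto simp: homogeneous_expos_def)
    also have "(\<Prod>i\<in>{1..m}. grow b t i ^ Poly_Mapping.lookup a i) = exp (t * expo_weight b m a)"
      by (simp add: grow_def expo_weight_def exp_sum sum_distrib_left exp_of_nat_mult[symmetric] mult.commute[of t])
    finally show ?thesis .
  qed
  have "poly_eval (\<lambda>i. complex_of_real (grow b t i)) f * of_real (exp (- (t * y))) =
     (\<Sum>a\<in>Poly_Mapping.keys f. Poly_Mapping.lookup f a * of_real (exp (t * (expo_weight b m a - y))))" for t
    unfolding poly_eval_def sum_distrib_right
  proof (intro sum.cong refl)
    fix a assume "a \<in> Poly_Mapping.keys f"
    then have "a \<in> homogeneous_expos m n" using assms(1) by blast
    then show "Poly_Mapping.lookup f a * mono_eval (\<lambda>i. complex_of_real (grow b t i)) a * of_real (exp (- (t * y))) =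
       Poly_Mapping.lookup f a * of_real (exp (t * (expo_weight b m a - y)))"
      by (simp add: mono right_diff_distrib mult_exp_exp flip: of_real_mult mult.assoc exp_of_real)
  qed
  moreover have "((\<lambda>t. \<Sum>a\<in>Poly_Mapping.keys f. Poly_Mapping.lookup f a * of_real (exp (t * (expo_weight b m a - y)))) \<longlongrightarrow>
     (\<Sum>a\<in>Poly_Mapping.keys f. Poly_Mapping.lookup f a * of_real (if expo_weight b m a = y then 1 else 0))) at_top"
  proof (intro tendsto_intros)
    fix a assume "a \<in> Poly_Mapping.keys f"
    then show "((\<lambda>t. exp (t * (expo_weight b m a - y))) \<longlongrightarrow> (if expo_weight b m a = y then 1 else 0)) at_top"
      using assms(2) tendsto_exp_neg_mult[of "expo_weight b m a - y"] by force
  qed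
  moreover have "(\<Sum>a\<in>Poly_Mapping.keys f. Poly_Mapping.lookup f a * complex_of_real (if expo_weight b m a = y then 1 else 0)) =
     (\<Sum>a\<in>Poly_Mapping.keys f. if expo_weight b m a = y then Poly_Mapping.lookup f a else 0)"
    by (intro sum.cong) auto
  ultimately show ?thesis by simp
qed

lemma strict_partitionsD:
  assumes "lam \<in> strict_partitions n"
  shows "sorted_wrt (>) lam" "\<forall>r\<in>set lam. 0 < r" "sum_list lam = n" "length lam \<le> n"
proof -
  show *: "sorted_wrt (>) lam" "\<forall>r\<in>set lam. 0 < r" "sum_list lam = n"
    using assms by (auto simp: strict_partitions_def strict_partition_def)
  have "length xs \<le> sum_list xs" if "\<forall>r\<in>set xs. 0 < r" for xs :: "nat list"
    using that by (induction xs) auto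
  then show "length lam \<le> n" using * by auto
qed

lemma expo_part_homogeneous:
  "length nu \<le> m \<Longrightarrow> expo m (part nu) \<in> homogeneous_expos m (sum_list nu)"
  using keys_expo[of m] sum_part[of nu m] by (simp add: homogeneous_expos_def lookup_expo)

lemma expo_weight_part:
  assumes "length nu \<le> m" "0 < b"
  shows "expo_weight b m (expo m (part nu)) = weight b 1 nu"
proof -
  have "expo_weight b m (expo m (part nu)) = (\<Sum>i\<in>{1..m}. real (part nu i) / b ^ i)"
    by (auto simp: expo_weight_def lookup_expo intro!: sum.cong)
  then show ?thesis
    using weight_part[OF assms, of 1] by (simp add: atLeastLessThanSuc_atLeastAtMost)
qed

text \<open>The base has to exceed both n and 1, also for n = 0.\<close>

abbreviation strict_weight :: "nat \<Rightarrow> nat list \<Rightarrow> real" where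
  "strict_weight n \<equiv> weight (real n + 2) 1"

text \<open>The growth of Q_lam along \<open>grow\<close> is computed twice, from the fractions and
  from the monomials of \<open>Q_poly\<close>. The base n + 2 separates the exponents of degree n,
  so that a limit isolates one coefficient.\<close>

lemma Q_poly_leading:
  assumes lam: "lam \<in> strict_partitions n" and m: "length lam \<le> m"
  shows "Poly_Mapping.lookup (Q_poly m lam) (expo m (part lam)) = 2 ^ length lam"
    and "\<forall>a\<in>Poly_Mapping.keys (Q_poly m lam). expo_weight (real n + 2) m a \<le> strict_weight n lam"
proof -
  let ?b = "real n + 2" and ?f = "Q_poly m lam"
  let ?w = "weight ?b 1 lam"
  note lamD = strict_partitionsD[OF lam]
  have b: "1 < ?b" "real n < ?b" by simp_all
  have keys: "Poly_Mapping.keys ?f \<subseteq> homogeneous_expos m n" using keys_Q_poly[OF m] lamD(3) by simp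
  have eval: "poly_eval (\<lambda>i. complex_of_real (grow ?b t i)) ?f = of_real (Q_on (grow ?b t) lam {1..m})" if "0 < t" for t
  proof -
    have inj: "inj_on (\<lambda>i. complex_of_real (grow ?b t i)) {1..m}"
      using inj_grow[OF b(1) that] by (auto simp: inj_on_def inj_def)
    have "to_fract ?f = Q_on zvar lam {1..m}"
      using to_fract_Q_poly[OF lamD(2) m] by (simp add: schur_Q_eq_Q_on)
    then have "evaluates (\<lambda>i. complex_of_real (grow ?b t i)) (to_fract ?f) (Q_on (\<lambda>i. complex_of_real (grow ?b t i)) lam {1..m})"
      using evaluates_Q_on[OF inj] by simp
    then show ?thesis using evaluates_unique[OF evaluates_to_fract] by (simp add: Q_on_of_real)
  qed
  have tend: "((\<lambda>t. poly_eval (\<lambda>i. complex_of_real (grow ?b t i)) ?f * of_real (exp (- (t * y)))) \<longlongrightarrow> of_real c) at_top"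
    if "((\<lambda>t. Q_on (grow ?b t) lam {1..m} * exp (- (t * y))) \<longlongrightarrow> c) at_top" for y c
  proof -
    have "((\<lambda>t. complex_of_real (Q_on (grow ?b t) lam {1..m} * exp (- (t * y)))) \<longlongrightarrow> of_real c) at_top"
      using that by (intro tendsto_of_real)
    moreover have "eventually (\<lambda>t. complex_of_real (Q_on (grow ?b t) lam {1..m} * exp (- (t * y))) =
        poly_eval (\<lambda>i. complex_of_real (grow ?b t i)) ?f * of_real (exp (- (t * y)))) at_top"
      using eventually_gt_at_top[of 0] by eventually_elim (simp add: eval)
    ultimately show ?thesis by (rule Lim_transform_eventually)
  qed
  have limit_unique: "(\<Sum>a\<in>Poly_Mapping.keys ?f. if expo_weight ?b m a = expo_weight ?b m a0 then Poly_Mapping.lookup ?f a else 0) = Poly_Mapping.lookup ?f a0"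
    if a0: "a0 \<in> homogeneous_expos m n" for a0
  proof -
    have "(\<Sum>a\<in>Poly_Mapping.keys ?f. if expo_weight ?b m a = expo_weight ?b m a0 then Poly_Mapping.lookup ?f a else 0) =
       (\<Sum>a\<in>Poly_Mapping.keys ?f. if a = a0 then Poly_Mapping.lookup ?f a else 0)"
      using expo_weight_inject[OF _ a0 b] keys by (intro sum.cong) auto
    then show ?thesis by (simp add: in_keys_iff)
  qed
  show upper: "\<forall>a\<in>Poly_Mapping.keys ?f. expo_weight ?b m a \<le> ?w"
  proof (rule ccontr)
    assume "\<not> ?thesis"
    then obtain a1 where a1: "a1 \<in> Poly_Mapping.keys ?f" "?w < expo_weight ?b m a1" by auto
    \<comment> \<open>If some exponent outweighed lam, the greatest weight y would do so too. The
      fractions then give the limit 0, whereas the monomials give the nonzero coefficient of the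
      only exponent of weight y.\<close>
    define y where "y = Max (expo_weight ?b m ` Poly_Mapping.keys ?f)"
    have "y \<in> expo_weight ?b m ` Poly_Mapping.keys ?f" unfolding y_def using a1 by (intro Max_in) auto
    then obtain a0 where a0: "a0 \<in> Poly_Mapping.keys ?f" "y = expo_weight ?b m a0" by auto
    have ymax: "\<forall>a\<in>Poly_Mapping.keys ?f. expo_weight ?b m a \<le> y" unfolding y_def by simp
    then have "?w < y" using a1 by force
    then have "((\<lambda>t. Q_on (grow ?b t) lam {1..m} * exp (- (t * y))) \<longlongrightarrow> 0) at_top"
      using lamD b by (intro Q_on_grow_upper[of _ _ _ 1]) auto
    from tendsto_unique[OF _ tend[OF this] poly_eval_grow_tendsto[OF keys ymax]]
    have "Poly_Mapping.lookup ?f a0 = 0" using limit_unique[of a0] a0 keys by auto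
    then show False using a0 by (simp add: in_keys_iff)
  qed
  have "((\<lambda>t. Q_on (grow ?b t) lam {1..m} * exp (- (t * ?w))) \<longlongrightarrow> 2 ^ length lam) at_top"
    using lamD m b by (intro Q_on_grow_leading) auto
  from tendsto_unique[OF _ tend[OF this] poly_eval_grow_tendsto[OF keys upper]]
  show "Poly_Mapping.lookup ?f (expo m (part lam)) = 2 ^ length lam"
    using limit_unique[of "expo m (part lam)"] expo_part_homogeneous[OF m] expo_weight_part[OF m, of ?b] lamD(3) by simp
qed

lemma Q_poly_lookup_0:
  assumes "ka \<in> strict_partitions n" "length ka \<le> m" "length mu \<le> m" "strict_weight n ka < strict_weight n mu"
  shows "Poly_Mapping.lookup (Q_poly m ka) (expo m (part mu)) = 0"
proof (rule ccontr)
  assume "\<not> ?thesis"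
  then have "expo m (part mu) \<in> Poly_Mapping.keys (Q_poly m ka)" by (simp add: in_keys_iff)
  then have "expo_weight (real n + 2) m (expo m (part mu)) \<le> strict_weight n ka"
    using Q_poly_leading(2)[OF assms(1,2)] by blast
  then show False using assms expo_weight_part[of mu m "real n + 2"] by simp
qed

text \<open>Padding with zeros to n entries makes \<open>expo_weight_inject\<close> applicable; as
  the parts are positive, the lengths are then recovered from the nonzero entries.\<close>

lemma strict_weight_inject:
  assumes "lam \<in> strict_partitions n" "mu \<in> strict_partitions n" "strict_weight n lam = strict_weight n mu"
  shows "lam = mu"
proof -
  have len: "length lam \<le> n" "length mu \<le> n" using strict_partitionsD assms by auto
  have "expo n (part lam) = expo n (part mu)"
    by (rule expo_weight_inject[where b = "real n + 2"])
      (use expo_part_homogeneous[OF len(1)] expo_part_homogeneous[OF len(2)] strict_partitionsD(3)[OF assms(1)]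
        strict_partitionsD(3)[OF assms(2)] expo_weight_part[OF len(1)] expo_weight_part[OF len(2)] assms(3) in auto)
  then have eq: "part lam i = part mu i" if "i \<in> {1..n}" for i using that by (simp add: expo_eq_iff)
  have pos: "part nu i \<noteq> 0 \<longleftrightarrow> i \<in> {1..length nu}" if "nu \<in> strict_partitions n" for nu i
  proof -
    have "0 < nu ! (i - 1)" if "i \<in> {1..length nu}"
      using that strict_partitionsD(2)[OF \<open>nu \<in> strict_partitions n\<close>] by (auto intro!: nth_mem)
    then show ?thesis by (auto simp: part_def)
  qed
  have "i \<in> {1..length lam} \<longleftrightarrow> i \<in> {1..length mu}" for i
    using pos[OF assms(1), of i] pos[OF assms(2), of i] eq[of i] len by auto
  then have "{1..length lam} = {1..length mu}" by blast
  then have l: "length lam = length mu" by (metis card_atLeastAtMost diff_Suc_1)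
  show ?thesis
  proof (rule nth_equalityI[OF l])
    fix i assume "i < length lam"
    then show "lam ! i = mu ! i" using eq[of "Suc i"] l len by (simp add: part_def)
  qed
qed

lemma sum_apply: "sum F A m = (\<Sum>x\<in>A. F x m)" for F :: "'b \<Rightarrow> symfun"
  by (induction A rule: infinite_finite_induct) simp_all

lemma Q_combination_poly:
  assumes "n \<le> m"
  shows "(\<Sum>lam\<in>strict_partitions n. sf_scale (a lam) (schur_Q lam)) m =
     to_fract (\<Sum>lam\<in>strict_partitions n. Poly_Mapping.single 0 (a lam) * Q_poly m lam)"
  unfolding sum_apply to_fract_sum
proof (intro sum.cong refl)
  fix lam assume "lam \<in> strict_partitions n"
  then have "to_fract (Q_poly m lam) = schur_Q lam m"
    using strict_partitionsD[of lam n] assms by (intro to_fract_Q_poly) auto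
  then show "sf_scale (a lam) (schur_Q lam) m = to_fract (Poly_Mapping.single 0 (a lam) * Q_poly m lam)"
    by (simp add: sf_scale_def)
qed

lemma lookup_scalar_mult: "Poly_Mapping.lookup (Poly_Mapping.single 0 c * f) a = c * Poly_Mapping.lookup (f :: zpoly) a"
proof -
  have "Poly_Mapping.single 0 c * f = (\<Sum>b\<in>Poly_Mapping.keys f. Poly_Mapping.single b (c * Poly_Mapping.lookup f b))"
  proof -
    have "Poly_Mapping.single 0 c * f =
        Poly_Mapping.single 0 c * (\<Sum>b\<in>Poly_Mapping.keys f. Poly_Mapping.single b (Poly_Mapping.lookup f b))"
      by (simp only: poly_mapping_sum_single)
    then show ?thesis by (simp add: sum_distrib_left mult_single)
  qed
  then show ?thesis by (simp add: lookup_sum lookup_single when_def in_keys_iff)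
qed

text \<open>Among the labels with different coefficients take mu of greatest weight and compare the
  coefficients of its leading monomial, in n variables. A lighter Q_ka does not contain that
  monomial, and the heavier ones cancel.\<close>

lemma schur_Q_independent:
  assumes "(\<Sum>lam\<in>strict_partitions n. sf_scale (a lam) (schur_Q lam)) = (\<Sum>lam\<in>strict_partitions n. sf_scale (b lam) (schur_Q lam))"
    "lam \<in> strict_partitions n"
  shows "a lam = b lam"
proof (rule ccontr)
  assume ne: "a lam \<noteq> b lam"
  let ?D = "{lam \<in> strict_partitions n. a lam \<noteq> b lam}"
  have "finite ?D" "?D \<noteq> {}" using ne assms(2) by auto
  then have "Max (strict_weight n ` ?D) \<in> strict_weight n ` ?D" by (intro Max_in) auto
  then obtain mu where mu0: "mu \<in> ?D" "Max (strict_weight n ` ?D) = strict_weight n mu" by blast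
  have mu: "mu \<in> ?D" "\<And>ka. ka \<in> ?D \<Longrightarrow> strict_weight n ka \<le> strict_weight n mu"
    unfolding mu0(2)[symmetric] using mu0(1) \<open>finite ?D\<close> by (auto intro!: Max_ge)
  have "to_fract (\<Sum>lam\<in>strict_partitions n. Poly_Mapping.single 0 (a lam) * Q_poly n lam) =
     to_fract (\<Sum>lam\<in>strict_partitions n. Poly_Mapping.single 0 (b lam) * Q_poly n lam)"
    using assms(1) by (simp only: Q_combination_poly[OF order_refl, symmetric])
  then have "(\<Sum>lam\<in>strict_partitions n. Poly_Mapping.single 0 (a lam) * Q_poly n lam) =
      (\<Sum>lam\<in>strict_partitions n. Poly_Mapping.single 0 (b lam) * Q_poly n lam)"
    by (simp only: to_fract_eq_iff)
  then have "(\<Sum>lam\<in>strict_partitions n. a lam * Poly_Mapping.lookup (Q_poly n lam) (expo n (part mu))) =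
     (\<Sum>lam\<in>strict_partitions n. b lam * Poly_Mapping.lookup (Q_poly n lam) (expo n (part mu)))"
    by (simp only: lookup_sum[symmetric] lookup_scalar_mult[symmetric])
  then have "(\<Sum>lam\<in>strict_partitions n. (a lam - b lam) * Poly_Mapping.lookup (Q_poly n lam) (expo n (part mu))) = 0"
    by (simp add: left_diff_distrib sum_subtractf)
  also have "(\<Sum>lam\<in>strict_partitions n. (a lam - b lam) * Poly_Mapping.lookup (Q_poly n lam) (expo n (part mu))) =
     (\<Sum>lam\<in>{mu}. (a lam - b lam) * Poly_Mapping.lookup (Q_poly n lam) (expo n (part mu)))"
  proof (rule sum.mono_neutral_right)
    show "\<forall>ka\<in>strict_partitions n - {mu}. (a ka - b ka) * Poly_Mapping.lookup (Q_poly n ka) (expo n (part mu)) = 0"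
    proof
      fix ka assume ka: "ka \<in> strict_partitions n - {mu}"
      show "(a ka - b ka) * Poly_Mapping.lookup (Q_poly n ka) (expo n (part mu)) = 0"
      proof (cases "ka \<in> ?D")
        case True
        then have "strict_weight n ka < strict_weight n mu"
          using mu strict_weight_inject[of ka n mu] ka by (force simp del: weight.simps)
        then have "Poly_Mapping.lookup (Q_poly n ka) (expo n (part mu)) = 0"
          using ka mu strict_partitionsD(4) by (intro Q_poly_lookup_0) auto
        then show ?thesis by simp
      qed (use ka in auto)
    qed
  qed (use mu in auto)
  finally show False
    using Q_poly_leading(1)[of mu n n] mu(1) strict_partitionsD(4)[of mu n] by auto
qed

text \<open>Write K(lam, nu) for the coefficient of y^nu in Q_lam. The symmetry of the matrix of the
  q_nu says that the sum over ka of a(nu, ka) K(ka, lam) equals that of a(lam, ka) K(ka, nu). By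
  induction the terms with ka heavier than lam agree one by one, the lighter ones vanish, and ka =
  lam leaves a(nu, lam) 2^l = K(lam, nu), since a(lam, lam) = 1. The coefficients a are chosen
  before m, so one choice serves every number of variables.\<close>

theorem schur_Q_Cauchy:
  obtains a where
    "\<And>nu. sum_list nu = n \<Longrightarrow> q_prod nu = (\<Sum>lam\<in>strict_partitions n. sf_scale (a nu lam) (schur_Q lam))"
    "\<And>nu lam m. sum_list nu = n \<Longrightarrow> length nu \<le> m \<Longrightarrow> n \<le> m \<Longrightarrow> lam \<in> strict_partitions n \<Longrightarrow>
       a nu lam * 2 ^ length lam = Poly_Mapping.lookup (Q_poly m lam) (expo m (part nu))"
proof -
  let ?P = "\<lambda>nu a. q_prod nu = (\<Sum>lam\<in>strict_partitions n. sf_scale (a lam) (schur_Q lam)) \<and>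
    (\<forall>lam. a lam \<noteq> 0 \<longrightarrow> lam = nu \<or> excess nu \<le> excess lam) \<and>
    (nu \<in> strict_partitions n \<longrightarrow> a nu = 1 \<and> (\<forall>lam. a lam \<noteq> 0 \<longrightarrow> lam = nu \<or> excess nu < excess lam))"
  define a where "a nu = (SOME a. ?P nu a)" for nu
  have a: "?P nu (a nu)" if "sum_list nu = n" for nu
    unfolding a_def using q_prod_expansion[OF that] by (rule someI_ex)
  have "a nu lam * 2 ^ length lam = Poly_Mapping.lookup (Q_poly m lam) (expo m (part nu))"
    if nu: "sum_list nu = n" "length nu \<le> m" and m: "n \<le> m" and "lam \<in> strict_partitions n" for nu lam m
    using \<open>lam \<in> strict_partitions n\<close> nu
  proof (induction "card {ka \<in> strict_partitions n. strict_weight n lam < strict_weight n ka}" arbitrary: lam nu rule: less_induct)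
    case less
    let ?K = "\<lambda>lam nu. Poly_Mapping.lookup (Q_poly m lam) (expo m (part nu))"
    let ?SP = "strict_partitions n"
    note lam = strict_partitionsD[OF less.prems(1)]
    have N: "Poly_Mapping.lookup (q_poly m nu) (expo m (part mu)) = (\<Sum>ka\<in>?SP. a nu ka * ?K ka mu)"
      if "sum_list nu = n" "length nu \<le> m" for nu mu
    proof -
      have "to_fract (q_poly m nu) = to_fract (\<Sum>ka\<in>?SP. Poly_Mapping.single 0 (a nu ka) * Q_poly m ka)"
        using a[OF that(1)] to_fract_q_poly[OF that(2)] Q_combination_poly[OF m] by simp
      then have "q_poly m nu = (\<Sum>ka\<in>?SP. Poly_Mapping.single 0 (a nu ka) * Q_poly m ka)"
        by (simp only: to_fract_eq_iff)
      then show ?thesis by (simp add: lookup_sum lookup_scalar_mult)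
    qed
    have "(\<Sum>ka\<in>?SP. a nu ka * ?K ka lam) = (\<Sum>ka\<in>?SP. a lam ka * ?K ka nu)"
      using N[of nu lam] N[of lam nu] q_poly_symmetric[of nu lam m] less.prems lam m by simp
    then have eq: "a nu lam * ?K lam lam + (\<Sum>ka\<in>?SP - {lam}. a nu ka * ?K ka lam) =
        a lam lam * ?K lam nu + (\<Sum>ka\<in>?SP - {lam}. a lam ka * ?K ka nu)"
      using less.prems(1) by (simp only: sum.remove[OF finite_strict_partitions, of lam])
    have "(\<Sum>ka\<in>?SP - {lam}. a nu ka * ?K ka lam) = (\<Sum>ka\<in>?SP - {lam}. a lam ka * ?K ka nu)"
    proof (intro sum.cong refl)
      fix ka assume ka: "ka \<in> ?SP - {lam}"
      then have kaD: "length ka \<le> m" using strict_partitionsD(4)[of ka n] m by auto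
      have "strict_weight n ka \<noteq> strict_weight n lam" using strict_weight_inject[of ka n lam] ka less.prems(1) by auto
      then consider "strict_weight n lam < strict_weight n ka" | "strict_weight n ka < strict_weight n lam" by linarith
      then show "a nu ka * ?K ka lam = a lam ka * ?K ka nu"
      proof cases
        \<comment> \<open>For ka heavier than lam both coefficients a are known, and each side is
          2^(-length ka) K(ka, nu) K(ka, lam).\<close>
        case 1
        have "card {ka' \<in> ?SP. strict_weight n ka < strict_weight n ka'} < card {ka' \<in> ?SP. strict_weight n lam < strict_weight n ka'}"
          using 1 ka by (intro psubset_card_mono) auto
        then have IH: "a nu' ka * 2 ^ length ka = ?K ka nu'" if "sum_list nu' = n" "length nu' \<le> m" for nu'
          using less.hyps[of ka nu'] ka that by auto
        show ?thesis
          unfolding IH[OF less.prems(2,3), symmetric] using IH[of lam] lam m by simp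
      next
        \<comment> \<open>Here K(ka, lam) = 0 because lam outweighs ka, and a(lam, ka) = 0 by
          triangularity in the excess, which follows the weight on strict partitions.\<close>
        case 2
        have "excess ka < excess lam"
          using 2 strict_partitionsD[of ka n] ka lam
          by (intro excess_less_of_weight_less[of "real n + 2" ka lam 1]) auto
        then have "a lam ka = 0" using a[OF lam(3)] less.prems(1) by force
        moreover have "?K ka lam = 0" using 2 ka kaD lam m by (intro Q_poly_lookup_0[of _ n]) auto
        ultimately show ?thesis by simp
      qed
    qed
    with eq have "a nu lam * ?K lam lam = a lam lam * ?K lam nu" by simp
    moreover have "?K lam lam = 2 ^ length lam" using Q_poly_leading(1)[OF less.prems(1)] lam m by simp
    moreover have "a lam lam = 1" using a[OF lam(3)] less.prems(1) by blast
    ultimately show ?case by simp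
  qed
  with a show ?thesis by (intro that[of a]) blast+
qed

section \<open>Modules with a monomial basis\<close>

lemma clinearI:
  "(\<And>x y. f (x + y) = f x + f y) \<Longrightarrow> (\<And>c x. f (cscale c x) = cscale c (f x)) \<Longrightarrow> clinear f"
  by (simp add: Vector_Spaces.linear_iff cvs.vector_space_axioms)

lemma clinear_add: "clinear f \<Longrightarrow> f (x + y) = f x + f y"
  by (simp add: Vector_Spaces.linear_iff)

lemma clinear_scale: "clinear f \<Longrightarrow> f (cscale c x) = cscale c (f x)"
  by (simp add: Vector_Spaces.linear_iff)

lemma clinear_0: "clinear f \<Longrightarrow> f 0 = 0"
  using clinear_scale[of f 0 0] by simp

lemma clinear_neg: "clinear f \<Longrightarrow> f (- x) = - f x"
  using clinear_scale[of f "- 1" x] by simp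

lemma clinear_diff: "clinear f \<Longrightarrow> f (x - y) = f x - f y"
  using clinear_add[of f x "- y"] clinear_neg[of f y] by simp

lemma clinear_sum: "clinear f \<Longrightarrow> f (sum g A) = (\<Sum>a\<in>A. f (g a))"
  by (induction A rule: infinite_finite_induct) (simp_all add: clinear_0 clinear_add)

lemma clinear_id [simp]: "clinear id" "clinear (\<lambda>x. x)"
  by (auto intro: clinearI)

lemma clinear_zero [simp]: "clinear (\<lambda>x. 0)"
  by (auto intro: clinearI)

lemma clinear_compose: "clinear f \<Longrightarrow> clinear g \<Longrightarrow> clinear (\<lambda>x. f (g x))"
  by (rule clinearI) (simp_all add: clinear_add clinear_scale)

lemma clinear_plus: "clinear f \<Longrightarrow> clinear g \<Longrightarrow> clinear (\<lambda>x. f x + g x)"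
  by (rule clinearI) (simp_all add: clinear_add clinear_scale cvs.scale_right_distrib)

lemma clinear_uminus: "clinear f \<Longrightarrow> clinear (\<lambda>x. - f x)"
  by (rule clinearI) (simp_all add: clinear_add clinear_scale)

lemma clinear_cscale: "clinear f \<Longrightarrow> clinear (\<lambda>x. cscale c (f x))"
  by (rule clinearI) (simp_all add: clinear_add clinear_scale cvs.scale_right_distrib mult.commute)

lemma lin_ext_superset:
  assumes "finite S" "Poly_Mapping.keys x \<subseteq> S"
  shows "lin_ext f x = (\<Sum>a\<in>S. cscale (Poly_Mapping.lookup x a) (f a))"
  unfolding lin_ext_def using assms
  by (intro sum.mono_neutral_left) (auto simp: in_keys_iff)

lemma clinear_lin_ext [simp]: "clinear (lin_ext f)"
proof (rule clinearI)
  fix x y :: "'a \<Rightarrow>\<^sub>0 complex"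
  let ?S = "Poly_Mapping.keys x \<union> Poly_Mapping.keys y"
  have "lin_ext f (x + y) = (\<Sum>a\<in>?S. cscale (Poly_Mapping.lookup (x + y) a) (f a))"
    using keys_add[of x y] by (intro lin_ext_superset) auto
  also have "\<dots> = lin_ext f x + lin_ext f y"
    using lin_ext_superset[of ?S x f] lin_ext_superset[of ?S y f]
    by (simp add: lookup_add cvs.scale_left_distrib sum.distrib)
  finally show "lin_ext f (x + y) = lin_ext f x + lin_ext f y" .
next
  fix c and x :: "'a \<Rightarrow>\<^sub>0 complex"
  have "Poly_Mapping.keys (cscale c x) \<subseteq> Poly_Mapping.keys x" by (auto simp: in_keys_iff)
  then have "lin_ext f (cscale c x) = (\<Sum>a\<in>Poly_Mapping.keys x. cscale (Poly_Mapping.lookup (cscale c x) a) (f a))"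
    by (intro lin_ext_superset) auto
  then show "lin_ext f (cscale c x) = cscale c (lin_ext f x)"
    by (simp add: lin_ext_def cvs.scale_sum_right)
qed

lemma lin_ext_basis [simp]: "lin_ext f (basis_vec a) = f a"
  by (simp add: lin_ext_def)

lemma basis_expansion: "x = (\<Sum>a\<in>Poly_Mapping.keys x. cscale (Poly_Mapping.lookup x a) (basis_vec a))"
  by (rule poly_mapping_eqI)
    (auto simp: lookup_sum lookup_single when_def in_keys_iff if_distrib[of "\<lambda>x. _ * x"] cong: if_cong)

text \<open>Coordinate subspaces. For modules with a monomial basis they turn identities of
  operators into checks on basis vectors.\<close>

definition coords :: "'b set \<Rightarrow> ('b \<Rightarrow>\<^sub>0 complex) set" where
  "coords S = {x. Poly_Mapping.keys x \<subseteq> S}"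

lemma subspace_coords [simp]: "cvs.subspace (coords S)"
  unfolding cvs.subspace_def coords_def
  by (auto dest!: subsetD[OF keys_add]) (auto simp: in_keys_iff)

lemma basis_in_coords [simp]: "basis_vec a \<in> coords S \<longleftrightarrow> a \<in> S"
  by (simp add: coords_def)

lemma zero_in_coords [simp]: "0 \<in> coords S"
  by (simp add: coords_def)

lemma span_basis: "cvs.span (basis_vec ` S) = coords S"
proof
  show "cvs.span (basis_vec ` S) \<subseteq> coords S" by (rule cvs.span_minimal) auto
  show "coords S \<subseteq> cvs.span (basis_vec ` S)"
  proof
    fix x assume "x \<in> coords S"
    then have "(\<Sum>a\<in>Poly_Mapping.keys x. cscale (Poly_Mapping.lookup x a) (basis_vec a)) \<in> cvs.span (basis_vec ` S)"
      by (intro cvs.span_sum cvs.span_scale cvs.span_base) (auto simp: coords_def)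
    then show "x \<in> cvs.span (basis_vec ` S)" using basis_expansion[of x] by simp
  qed
qed

lemma coords_linear_eq:
  assumes "clinear f" "clinear g" "\<And>a. a \<in> S \<Longrightarrow> f (basis_vec a) = g (basis_vec a)" "x \<in> coords S"
  shows "f x = g x"
proof -
  have *: "h x = (\<Sum>a\<in>Poly_Mapping.keys x. cscale (Poly_Mapping.lookup x a) (h (basis_vec a)))" if "clinear h" for h
    by (subst basis_expansion) (simp add: that clinear_sum clinear_scale)
  show ?thesis
    unfolding *[OF assms(1)] *[OF assms(2)] using assms(3,4) by (intro sum.cong) (auto simp: coords_def)
qed

lemma clinear_eq:
  assumes "clinear f" "clinear g" "\<And>a. f (basis_vec a) = g (basis_vec a)"
  shows "f x = g x"
  by (rule coords_linear_eq[of f g UNIV]) (use assms in \<open>auto simp: coords_def\<close>)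

lemma coords_image_subset:
  assumes "clinear f" "cvs.subspace W" "\<And>a. a \<in> S \<Longrightarrow> f (basis_vec a) \<in> W"
  shows "f ` coords S \<subseteq> W"
proof
  fix y assume "y \<in> f ` coords S"
  then obtain x where x: "x \<in> coords S" "y = f x" by auto
  have "f x = (\<Sum>a\<in>Poly_Mapping.keys x. cscale (Poly_Mapping.lookup x a) (f (basis_vec a)))"
    by (subst basis_expansion) (simp add: assms(1) clinear_sum clinear_scale)
  also have "\<dots> \<in> W" using x assms by (intro cvs.subspace_sum cvs.subspace_scale) (auto simp: coords_def)
  finally show "y \<in> W" using x by simp
qed

lemma coords_Un: "coords (S \<union> T) = {u + v |u v. u \<in> coords S \<and> v \<in> coords T}"
proof (intro equalityI subsetI)
  fix x assume x: "x \<in> coords (S \<union> T)"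
  let ?p = "lin_ext (\<lambda>a. if a \<in> S then basis_vec a else 0) x"
  let ?q = "lin_ext (\<lambda>a. if a \<in> S then 0 else basis_vec a) x"
  have "x = ?p + ?q"
    by (rule clinear_eq[of "\<lambda>x. x" "\<lambda>x. lin_ext (\<lambda>a. if a \<in> S then basis_vec a else 0) x + lin_ext (\<lambda>a. if a \<in> S then 0 else basis_vec a) x"])
      (auto intro: clinear_plus)
  moreover have "?p \<in> coords S"
  proof -
    have "lin_ext (\<lambda>a. if a \<in> S then basis_vec a else 0) ` coords (S \<union> T) \<subseteq> coords S"
      by (rule coords_image_subset) auto
    then show ?thesis using x by blast
  qed
  moreover have "?q \<in> coords T"
  proof -
    have "lin_ext (\<lambda>a. if a \<in> S then 0 else basis_vec a) ` coords (S \<union> T) \<subseteq> coords T"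
      by (rule coords_image_subset) auto
    then show ?thesis using x by blast
  qed
  ultimately show "x \<in> {u + v |u v. u \<in> coords S \<and> v \<in> coords T}" by blast
next
  fix x assume "x \<in> {u + v |u v. u \<in> coords S \<and> v \<in> coords T}"
  then show "x \<in> coords (S \<union> T)" by (auto simp: coords_def dest!: subsetD[OF keys_add])
qed

lemma coords_disjoint: "S \<inter> T = {} \<Longrightarrow> coords S \<inter> coords T = {0}"
  by (auto simp: coords_def) (metis disjoint_iff keys_eq_empty subsetD all_not_in_conv)

lemma clinear_tensor_vec_left: "clinear (\<lambda>u. tensor_vec u x)"
  unfolding tensor_vec_def by simp

lemma clinear_tensor_vec_right: "clinear (\<lambda>x. tensor_vec u x)"
proof (rule clinearI)
  fix x y
  show "tensor_vec u (x + y) = tensor_vec u x + tensor_vec u y"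
    unfolding tensor_vec_def clinear_add[OF clinear_lin_ext]
    by (rule clinear_eq[where x = u]) (auto intro: clinear_plus)
next
  fix c x
  show "tensor_vec u (cscale c x) = cscale c (tensor_vec u x)"
    unfolding tensor_vec_def clinear_scale[OF clinear_lin_ext]
    by (rule clinear_eq[where x = u]) (auto intro: clinear_cscale)
qed

lemma tensor_vec_basis [simp]: "tensor_vec (basis_vec a) (basis_vec b) = basis_vec (a, b)"
  by (simp add: tensor_vec_def)

lemma tensor_vec_scale:
  "tensor_vec (cscale c u) x = cscale c (tensor_vec u x)" "tensor_vec u (cscale c x) = cscale c (tensor_vec u x)"
  using clinear_scale[OF clinear_tensor_vec_left] clinear_scale[OF clinear_tensor_vec_right] by auto

lemma tensor_vec_0 [simp]: "tensor_vec 0 x = 0" "tensor_vec u 0 = 0"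
  using clinear_0[OF clinear_tensor_vec_left] clinear_0[OF clinear_tensor_vec_right] by auto

lemma tensor_vec_in_coords:
  assumes "u \<in> coords S" "x \<in> coords T"
  shows "tensor_vec u x \<in> coords (S \<times> T)"
proof -
  have "tensor_vec (basis_vec a) x \<in> coords (S \<times> T)" if "a \<in> S" for a
    using coords_image_subset[OF clinear_tensor_vec_right, of "coords (S \<times> T)" T "basis_vec a"] that assms(2) by auto
  then show ?thesis
    using coords_image_subset[OF clinear_tensor_vec_left, of "coords (S \<times> T)" S x] assms(1) by auto
qed

lemma tensor_space_coords: "tensor_space (coords S) (coords T) = coords (S \<times> T)"
  unfolding tensor_space_def
proof
  show "cvs.span {tensor_vec u x |u x. u \<in> coords S \<and> x \<in> coords T} \<subseteq> coords (S \<times> T)"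
    by (rule cvs.span_minimal) (auto intro: tensor_vec_in_coords)
  have "basis_vec ` (S \<times> T) \<subseteq> {tensor_vec u x |u x. u \<in> coords S \<and> x \<in> coords T}"
    by (force intro!: exI[of _ "basis_vec _"])
  then have "cvs.span (basis_vec ` (S \<times> T)) \<subseteq> cvs.span {tensor_vec u x |u x. u \<in> coords S \<and> x \<in> coords T}"
    by (rule cvs.span_mono)
  then show "coords (S \<times> T) \<subseteq> cvs.span {tensor_vec u x |u x. u \<in> coords S \<and> x \<in> coords T}"
    by (simp add: span_basis)
qed

lemma clinear_tensor_op [simp]: "clinear (tensor_op f g)"
  by (simp add: tensor_op_def)

lemma tensor_op_basis [simp]: "tensor_op f g (basis_vec (a, b)) = tensor_vec (f (basis_vec a)) (g (basis_vec b))"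
  by (simp add: tensor_op_def)

lemma tensor_op_vec:
  assumes "clinear f" "clinear g"
  shows "tensor_op f g (tensor_vec u x) = tensor_vec (f u) (g x)"
proof (rule clinear_eq[of "\<lambda>u. tensor_op f g (tensor_vec u x)" "\<lambda>u. tensor_vec (f u) (g x)"])
  show "tensor_op f g (tensor_vec (basis_vec a) x) = tensor_vec (f (basis_vec a)) (g x)" for a
    by (rule clinear_eq[of "\<lambda>x. tensor_op f g (tensor_vec (basis_vec a) x)" "\<lambda>x. tensor_vec (f (basis_vec a)) (g x)"])
      (auto intro: clinear_compose[OF clinear_tensor_op clinear_tensor_vec_right] clinear_compose[OF clinear_tensor_vec_right assms(2)])
qed (auto intro: clinear_compose[OF clinear_tensor_op clinear_tensor_vec_left] clinear_compose[OF clinear_tensor_vec_left assms(1)])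

section \<open>Anticommuting operators and the signs of permutations\<close>

definition anticommuting :: "complex \<Rightarrow> (nat \<Rightarrow> ('b \<Rightarrow>\<^sub>0 complex) \<Rightarrow> ('b \<Rightarrow>\<^sub>0 complex)) \<Rightarrow> bool" where
  "anticommuting k ga \<longleftrightarrow> (\<forall>i. clinear (ga i)) \<and> (\<forall>i v. ga i (ga i v) = cscale k v) \<and>
     (\<forall>i j v. i \<noteq> j \<longrightarrow> ga i (ga j v) = - ga j (ga i v))"

lemma anticommutingD:
  assumes "anticommuting k ga"
  shows "clinear (ga i)" "ga i (ga i v) = cscale k v" "i \<noteq> j \<Longrightarrow> ga i (ga j v) = - ga j (ga i v)"
  using assms unfolding anticommuting_def by blast+

lemma anticommutingI:
  "(\<And>i. clinear (ga i)) \<Longrightarrow> (\<And>i v. ga i (ga i v) = cscale k v) \<Longrightarrow>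
    (\<And>i j v. i \<noteq> j \<Longrightarrow> ga i (ga j v) = - ga j (ga i v)) \<Longrightarrow> anticommuting k ga"
  unfolding anticommuting_def by blast

lemma sorted_list_of_set_insert_min:
  assumes "finite A" "\<And>a. a \<in> A \<Longrightarrow> b < a"
  shows "sorted_list_of_set (insert b A) = b # sorted_list_of_set (A :: nat set)"
proof -
  have "b \<notin> A" using assms(2) by blast
  then have "sorted_list_of_set (insert b A) = insort b (sorted_list_of_set A)" using assms(1) by simp
  also have "\<dots> = b # sorted_list_of_set A"
    using assms by (intro insort_is_Cons) (auto intro: less_imp_le)
  finally show ?thesis .
qed

text \<open>Moving the operator past each smaller element of A costs a sign, after which it either
  meets itself, giving k, or has found its place. Clifford multiplication is the case k = 1 and the
  wedge product the case k = 0; treating them together shows that the same signs occur in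
  both.\<close>

lemma anticommuting_insert:
  assumes ga: "anticommuting k ga" and "finite A"
  shows "ga i (foldr ga (sorted_list_of_set A) v) = cscale ((- 1) ^ card {a \<in> A. a < i})
     (if i \<in> A then cscale k (foldr ga (sorted_list_of_set (A - {i})) v)
      else foldr ga (sorted_list_of_set (insert i A)) v)"
  using assms(2)
proof (induction A rule: finite_linorder_min_induct)
  case empty
  then show ?case by simp
next
  case (insert b A)
  note lin = anticommutingD(1)[OF ga]
  have sb: "sorted_list_of_set (insert b A) = b # sorted_list_of_set A"
    using insert by (intro sorted_list_of_set_insert_min) auto
  have bA: "b \<notin> A" using insert by auto
  consider "i < b" | "i = b" | "b < i" by linarith
  then show ?case
  proof cases
    case 1
    then have "sorted_list_of_set (insert i (insert b A)) = i # sorted_list_of_set (insert b A)"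
      using insert by (intro sorted_list_of_set_insert_min) auto
    moreover have e: "{a \<in> insert b A. a < i} = {}" "i \<notin> insert b A" using 1 insert by auto
    ultimately show ?thesis unfolding e sb by simp
  next
    case 2
    have e: "{a \<in> insert b A. a < i} = {}" "insert b A - {i} = A" using 2 insert by auto
    show ?thesis unfolding e sb using 2 anticommutingD(2)[OF ga] by simp
  next
    case 3
    have "{a \<in> insert b A. a < i} = insert b {a \<in> A. a < i}" using 3 by auto
    then have card: "card {a \<in> insert b A. a < i} = Suc (card {a \<in> A. a < i})"
      using bA insert by simp
    have s1: "sorted_list_of_set (insert b A - {i}) = b # sorted_list_of_set (A - {i})" if "i \<in> A"
    proof -
      have eq: "insert b A - {i} = insert b (A - {i})" using 3 by auto
      show ?thesis unfolding eq by (intro sorted_list_of_set_insert_min) (use insert in auto)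
    qed
    have s2: "sorted_list_of_set (insert i (insert b A)) = b # sorted_list_of_set (insert i A)"
    proof -
      have eq: "insert i (insert b A) = insert b (insert i A)" by auto
      show ?thesis unfolding eq by (intro sorted_list_of_set_insert_min) (use insert 3 in auto)
    qed
    have "ga i (foldr ga (sorted_list_of_set (insert b A)) v) = - ga b (ga i (foldr ga (sorted_list_of_set A) v))"
      unfolding sb using anticommutingD(3)[OF ga, of i b] 3 by simp
    also have "\<dots> = cscale ((- 1) ^ card {a \<in> insert b A. a < i}) (ga b
      (if i \<in> A then cscale k (foldr ga (sorted_list_of_set (A - {i})) v)
      else foldr ga (sorted_list_of_set (insert i A)) v))"
      unfolding card by (simp add: insert.IH clinear_scale[OF lin])
    also have "\<dots> = cscale ((- 1) ^ card {a \<in> insert b A. a < i})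
     (if i \<in> insert b A then cscale k (foldr ga (sorted_list_of_set (insert b A - {i})) v)
      else foldr ga (sorted_list_of_set (insert i (insert b A))) v)"
    proof (cases "i \<in> A")
      case True
      then have "i \<in> insert b A" by simp
      show ?thesis
        unfolding if_P[OF True] if_P[OF \<open>i \<in> insert b A\<close>] s1[OF True] clinear_scale[OF lin] by simp
    next
      case False
      then have "i \<notin> insert b A" using 3 by simp
      show ?thesis
        unfolding if_not_P[OF False] if_not_P[OF \<open>i \<notin> insert b A\<close>] s2 by simp
    qed
    finally show ?thesis .
  qed
qed

text \<open>For distinct entries, (-1) to the number of inversions.\<close>

fun inv_sign :: "nat list \<Rightarrow> complex" where
  "inv_sign [] = 1"
| "inv_sign (x # xs) = (- 1) ^ card {a \<in> set xs. a < x} * inv_sign xs"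

text \<open>Sorting distinct entries never squares an operator, so the sign does not involve k. This
  is why a permutation acts by the same sign on c_B and on e_B.\<close>

lemma anticommuting_list:
  assumes "anticommuting k ga" "distinct xs"
  shows "foldr ga xs v = cscale (inv_sign xs) (foldr ga (sorted_list_of_set (set xs)) v)"
  using assms(2)
proof (induction xs)
  case Nil
  then show ?case by simp
next
  case (Cons x xs)
  have "foldr ga (x # xs) v = cscale (inv_sign xs) (ga x (foldr ga (sorted_list_of_set (set xs)) v))"
    using Cons anticommutingD(1)[OF assms(1)] by (simp add: clinear_scale)
  also have "\<dots> = cscale (inv_sign (x # xs)) (foldr ga (sorted_list_of_set (set (x # xs))) v)"
    using Cons.prems by (simp add: anticommuting_insert[OF assms(1)] mult.commute)
  finally show ?case .
qed

lemma anticommuting_reindex: "anticommuting k ga \<Longrightarrow> inj w \<Longrightarrow> anticommuting k (\<lambda>i. ga (w i))"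
  by (intro anticommutingI) (auto simp: anticommutingD(1,2) inj_eq intro: anticommutingD(3))

lemma clinear_clifford_mult [simp]: "clinear (clifford_mult i)"
  by (simp add: clifford_mult_def)

lemma clifford_mult_basis:
  "clifford_mult i (basis_vec A) = cscale ((- 1) ^ card {a \<in> A. a < i}) (basis_vec (if i \<in> A then A - {i} else insert i A))"
  by (simp add: clifford_mult_def)

text \<open>Toggling j in a set changes the number of elements below i only if j < i.\<close>

lemma anticommuting_sign_aux:
  assumes "i \<noteq> (j :: nat)" "B = (if j \<in> A then A - {j} else insert j A)"
  shows "(- 1) ^ card {a \<in> B. a < i} = (if j < i then - 1 else 1) * ((- 1) ^ card {a \<in> A. a < i} :: complex)"
proof -
  have fin: "finite {a \<in> A. a < i}" by simp
  show ?thesis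
  proof (cases "j < i")
    case True
    show ?thesis
    proof (cases "j \<in> A")
      case jA: True
      then have "{a \<in> A. a < i} = insert j {a \<in> B. a < i}" "j \<notin> {a \<in> B. a < i}" "finite {a \<in> B. a < i}"
        using True assms by auto
      then show ?thesis using True by simp
    next
      case jA: False
      then have "{a \<in> B. a < i} = insert j {a \<in> A. a < i}" "j \<notin> {a \<in> A. a < i}"
        using True assms by auto
      then show ?thesis using True fin by simp
    qed
  next
    case False
    then have "{a \<in> B. a < i} = {a \<in> A. a < i}" using assms by auto
    then show ?thesis using False by simp
  qed
qed

lemma anticommuting_clifford: "anticommuting 1 clifford_mult"
proof (rule anticommutingI)
  fix i v
  show "clifford_mult i (clifford_mult i v) = cscale 1 v"
  proof (rule clinear_eq[of "\<lambda>v. clifford_mult i (clifford_mult i v)" "\<lambda>v. cscale 1 v"])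
    fix A :: "nat set"
    have "{a \<in> (if i \<in> A then A - {i} else insert i A). a < i} = {a \<in> A. a < i}" by auto
    moreover have "(if i \<in> (if i \<in> A then A - {i} else insert i A) then (if i \<in> A then A - {i} else insert i A) - {i}
       else insert i (if i \<in> A then A - {i} else insert i A)) = A" by auto
    ultimately show "clifford_mult i (clifford_mult i (basis_vec A)) = cscale 1 (basis_vec A)"
      by (simp only: clifford_mult_basis clinear_scale[OF clinear_clifford_mult] cvs.scale_scale power_add[symmetric])
        simp
  qed (auto intro: clinear_compose clinear_cscale)
next
  fix i j :: nat and v assume ij: "i \<noteq> j"
  show "clifford_mult i (clifford_mult j v) = - clifford_mult j (clifford_mult i v)"
  proof (rule clinear_eq[of "\<lambda>v. clifford_mult i (clifford_mult j v)" "\<lambda>v. - clifford_mult j (clifford_mult i v)"])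
    fix A :: "nat set"
    define B C where "B = (if j \<in> A then A - {j} else insert j A)" and "C = (if i \<in> A then A - {i} else insert i A)"
    have "(if i \<in> B then B - {i} else insert i B) = (if j \<in> C then C - {j} else insert j C)"
      unfolding B_def C_def using ij by auto
    moreover have "(if j < i then - 1 else 1) = - (if i < j then - 1 else 1 :: complex)" using ij by auto
    ultimately show "clifford_mult i (clifford_mult j (basis_vec A)) = - clifford_mult j (clifford_mult i (basis_vec A))"
      by (simp add: clifford_mult_basis clinear_scale B_def[symmetric] C_def[symmetric]
        anticommuting_sign_aux[OF ij B_def] anticommuting_sign_aux[OF ij[symmetric] C_def] mult_ac)
  qed (auto intro: clinear_compose intro!: clinear_uminus[OF clinear_compose[OF clinear_clifford_mult clinear_clifford_mult]])
qed simp

lemma wedge_basis_basis: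
  "wedge (basis_vec i) (basis_vec A) = (if i \<in> A then 0 else cscale ((- 1) ^ card {a \<in> A. a < i}) (basis_vec (insert i A)))"
  by (simp add: wedge_def)

lemma clinear_wedge_right: "clinear (wedge v)"
  unfolding wedge_def
proof (rule clinearI)
  show "lin_ext (\<lambda>b. lin_ext (f b) (x + y)) v = lin_ext (\<lambda>b. lin_ext (f b) x) v + lin_ext (\<lambda>b. lin_ext (f b) y) v" for f x y
    unfolding clinear_add[OF clinear_lin_ext]
    by (rule clinear_eq[where x = v]) (auto intro: clinear_plus)
  show "lin_ext (\<lambda>b. lin_ext (f b) (cscale c x)) v = cscale c (lin_ext (\<lambda>b. lin_ext (f b) x) v)" for f c x
    unfolding clinear_scale[OF clinear_lin_ext]
    by (rule clinear_eq[where x = v]) (auto intro: clinear_cscale)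
qed

lemma clinear_wedge_left: "clinear (\<lambda>v. wedge v x)"
  by (simp add: wedge_def)

lemma anticommuting_wedge: "anticommuting 0 (\<lambda>i :: nat. wedge (basis_vec i))"
proof (rule anticommutingI)
  fix i and v :: "nat set \<Rightarrow>\<^sub>0 complex"
  show "wedge (basis_vec i) (wedge (basis_vec i) v) = cscale 0 v"
  proof (rule clinear_eq[of "\<lambda>v. wedge (basis_vec i) (wedge (basis_vec i) v)" "\<lambda>v. cscale 0 v"])
    show "wedge (basis_vec i) (wedge (basis_vec i) (basis_vec A)) = cscale 0 (basis_vec A)" for A
      by (simp add: wedge_basis_basis clinear_scale[OF clinear_wedge_right] clinear_0[OF clinear_wedge_right])
  qed (auto intro: clinear_compose clinear_cscale clinear_wedge_right)
next
  fix i j :: nat and v :: "nat set \<Rightarrow>\<^sub>0 complex" assume ij: "i \<noteq> j"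
  show "wedge (basis_vec i) (wedge (basis_vec j) v) = - wedge (basis_vec j) (wedge (basis_vec i) v)"
  proof (rule clinear_eq[of "\<lambda>v. wedge (basis_vec i) (wedge (basis_vec j) v)" "\<lambda>v. - wedge (basis_vec j) (wedge (basis_vec i) v)"])
    fix A :: "nat set"
    show "wedge (basis_vec i) (wedge (basis_vec j) (basis_vec A)) = - wedge (basis_vec j) (wedge (basis_vec i) (basis_vec A))"
    proof (cases "i \<in> A \<or> j \<in> A")
      case True
      then show ?thesis
        by (auto simp: wedge_basis_basis clinear_scale[OF clinear_wedge_right] clinear_0[OF clinear_wedge_right])
    next
      case False
      have "(if j < i then - 1 else 1) = - (if i < j then - 1 else 1 :: complex)" using ij by auto
      moreover have "insert i (insert j A) = insert j (insert i A)" by auto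
      ultimately show ?thesis
        using False ij anticommuting_sign_aux[OF ij, of "insert j A" A] anticommuting_sign_aux[OF ij[symmetric], of "insert i A" A]
        by (simp add: wedge_basis_basis clinear_scale[OF clinear_wedge_right] mult_ac)
    qed
  qed (auto intro: clinear_compose clinear_wedge_right intro!: clinear_uminus[OF clinear_compose[OF clinear_wedge_right clinear_wedge_right]])
qed (rule clinear_wedge_right)

lemma foldr_clifford_sorted:
  "finite A \<Longrightarrow> foldr clifford_mult (sorted_list_of_set A) (basis_vec {}) = basis_vec A"
proof (induction A rule: finite_linorder_min_induct)
  case (insert b A)
  then have e: "{a \<in> A. a < b} = {}" "b \<notin> A" by force+
  have "sorted_list_of_set (insert b A) = b # sorted_list_of_set A"
    using insert by (intro sorted_list_of_set_insert_min) auto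
  show ?case unfolding \<open>sorted_list_of_set (insert b A) = _\<close> using insert e(2) by (simp add: clifford_mult_basis e(1))
qed simp

lemma foldr_wedge_sorted:
  "finite A \<Longrightarrow> foldr (\<lambda>i. wedge (basis_vec i)) (sorted_list_of_set A) (basis_vec {}) = basis_vec (A :: nat set)"
proof (induction A rule: finite_linorder_min_induct)
  case (insert b A)
  then have e: "{a \<in> A. a < b} = {}" "b \<notin> A" by force+
  have "sorted_list_of_set (insert b A) = b # sorted_list_of_set A"
    using insert by (intro sorted_list_of_set_insert_min) auto
  show ?case unfolding \<open>sorted_list_of_set (insert b A) = _\<close> using insert e(2) by (simp add: wedge_basis_basis e(1))
qed simp

text \<open>The sign by which w sends c_A to c_(w A), and e_A to e_(w A).\<close>

definition perm_sign :: "(nat \<Rightarrow> nat) \<Rightarrow> nat set \<Rightarrow> complex" where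
  "perm_sign w A = inv_sign (map w (sorted_list_of_set A))"

lemma inv_sign_square: "inv_sign xs * inv_sign xs = 1"
proof (induction xs)
  case (Cons x xs)
  have "inv_sign (x # xs) * inv_sign (x # xs) =
      ((- 1) ^ card {a \<in> set xs. a < x} * (- 1) ^ card {a \<in> set xs. a < x}) * (inv_sign xs * inv_sign xs)"
    by (simp only: inv_sign.simps mult_ac)
  then show ?case using Cons by (simp flip: power_add)
qed simp

lemma perm_sign_square: "perm_sign w A * perm_sign w A = 1"
  by (simp add: perm_sign_def inv_sign_square)

lemma anticommuting_image:
  assumes "anticommuting k ga" "inj w" "finite A"
  shows "foldr (\<lambda>i. ga (w i)) (sorted_list_of_set A) v =
    cscale (perm_sign w A) (foldr ga (sorted_list_of_set (w ` A)) v)"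
proof -
  have "foldr (\<lambda>i. ga (w i)) (sorted_list_of_set A) v = foldr ga (map w (sorted_list_of_set A)) v"
    by (simp add: foldr_map comp_def)
  also have "\<dots> = cscale (inv_sign (map w (sorted_list_of_set A))) (foldr ga (sorted_list_of_set (set (map w (sorted_list_of_set A)))) v)"
    using assms by (intro anticommuting_list) (auto simp: distinct_map intro: inj_on_subset)
  finally show ?thesis using assms(3) by (simp add: perm_sign_def)
qed

text \<open>Read off from the Clifford algebra instead of counting inversions: c_A is transformed by
  the composite and by w and v in turn, and the coefficients of the resulting basis vector are
  compared.\<close>

lemma perm_sign_comp:
  assumes "inj v" "inj w" "finite A"
  shows "perm_sign (v \<circ> w) A = perm_sign v (w ` A) * perm_sign w A"
proof -
  have "cscale (perm_sign (v \<circ> w) A) (basis_vec ((v \<circ> w) ` A)) =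
      foldr (\<lambda>i. clifford_mult (v (w i))) (sorted_list_of_set A) (basis_vec {})"
    using anticommuting_image[OF anticommuting_clifford inj_compose[OF assms(1,2)] assms(3), of "basis_vec {}"] assms
    by (simp add: foldr_clifford_sorted)
  also have "\<dots> = cscale (perm_sign w A) (foldr (\<lambda>i. clifford_mult (v i)) (sorted_list_of_set (w ` A)) (basis_vec {}))"
    using anticommuting_image[OF anticommuting_reindex[OF anticommuting_clifford assms(1)] assms(2,3)] .
  also have "\<dots> = cscale (perm_sign v (w ` A) * perm_sign w A) (basis_vec ((v \<circ> w) ` A))"
    using anticommuting_image[OF anticommuting_clifford assms(1), of "w ` A"] assms(3)
    by (simp add: foldr_clifford_sorted image_image mult.commute)
  finally have "Poly_Mapping.lookup (cscale (perm_sign (v \<circ> w) A) (basis_vec ((v \<circ> w) ` A))) ((v \<circ> w) ` A) =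
    Poly_Mapping.lookup (cscale (perm_sign v (w ` A) * perm_sign w A) (basis_vec ((v \<circ> w) ` A))) ((v \<circ> w) ` A)"
    by (simp only:)
  moreover have "Poly_Mapping.lookup (cscale c (basis_vec k)) k = c" for c and k :: "nat set" by simp
  ultimately show ?thesis by (simp only:)
qed

lemma perm_sign_id: "finite A \<Longrightarrow> perm_sign id A = 1"
proof -
  assume "finite A"
  then have "basis_vec A = cscale (perm_sign id A) (basis_vec A)"
    using anticommuting_image[OF anticommuting_clifford, of id A "basis_vec {}"] by (simp add: foldr_clifford_sorted)
  then have "Poly_Mapping.lookup (basis_vec A) A = Poly_Mapping.lookup (cscale (perm_sign id A) (basis_vec A)) A" by simp
  then show ?thesis by simp
qed

text \<open>The map from the Clifford algebra that sends 1 to v and turns c_i into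
  \<open>ga i\<close>.\<close>

definition clifford_lift :: "(nat \<Rightarrow> ('b \<Rightarrow>\<^sub>0 complex) \<Rightarrow> ('b \<Rightarrow>\<^sub>0 complex)) \<Rightarrow> ('b \<Rightarrow>\<^sub>0 complex) \<Rightarrow> (nat set \<Rightarrow>\<^sub>0 complex) \<Rightarrow> ('b \<Rightarrow>\<^sub>0 complex)" where
  "clifford_lift ga v = lin_ext (\<lambda>A. foldr ga (sorted_list_of_set A) v)"

text \<open>The ambient basis contains infinite sets, which have no sorted list of elements; the
  assumption on x excludes them.\<close>

lemma clifford_lift_mult:
  assumes "anticommuting 1 ga" "x \<in> coords {A. finite A}"
  shows "clifford_lift ga v (clifford_mult i x) = ga i (clifford_lift ga v x)"
proof (rule coords_linear_eq[OF _ _ _ assms(2), of "\<lambda>x. clifford_lift ga v (clifford_mult i x)" "\<lambda>x. ga i (clifford_lift ga v x)"])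
  show "clinear (\<lambda>x. clifford_lift ga v (clifford_mult i x))" "clinear (\<lambda>x. ga i (clifford_lift ga v x))"
    using anticommutingD(1)[OF assms(1)] unfolding clifford_lift_def by (auto intro: clinear_compose)
  fix A :: "nat set" assume "A \<in> {A. finite A}"
  then show "clifford_lift ga v (clifford_mult i (basis_vec A)) = ga i (clifford_lift ga v (basis_vec A))"
    using anticommuting_insert[OF assms(1), of A i v]
    by (simp add: clifford_lift_def clifford_mult_basis clinear_scale[OF clinear_lin_ext])
qed

section \<open>Modules over the symmetric group with a signed permutation basis\<close>

definition sn_monomial ::
  "nat \<Rightarrow> 't set \<Rightarrow> ((nat \<Rightarrow> nat) \<Rightarrow> 't \<Rightarrow> 't) \<Rightarrow> ((nat \<Rightarrow> nat) \<Rightarrow> 't \<Rightarrow> complex) \<Rightarrow> 't snmod \<Rightarrow> bool" where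
  "sn_monomial n T pm sg M \<longleftrightarrow> finite T \<and> sn_space M = coords T \<and>
     (\<forall>w. w permutes {1..n} \<longrightarrow> clinear (sn_act M w) \<and>
        (\<forall>t\<in>T. pm w t \<in> T \<and> sn_act M w (basis_vec t) = cscale (sg w t) (basis_vec (pm w t)))) \<and>
     (\<forall>t\<in>T. pm id t = t \<and> sg id t = 1) \<and>
     (\<forall>v w. v permutes {1..n} \<longrightarrow> w permutes {1..n} \<longrightarrow>
        (\<forall>t\<in>T. pm (v \<circ> w) t = pm v (pm w t) \<and> sg (v \<circ> w) t = sg v (pm w t) * sg w t))"

lemma sn_monomialD:
  assumes "sn_monomial n T pm sg M"
  shows "finite T" "sn_space M = coords T"
    "w permutes {1..n} \<Longrightarrow> clinear (sn_act M w)"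
    "w permutes {1..n} \<Longrightarrow> t \<in> T \<Longrightarrow> pm w t \<in> T"
    "w permutes {1..n} \<Longrightarrow> t \<in> T \<Longrightarrow> sn_act M w (basis_vec t) = cscale (sg w t) (basis_vec (pm w t))"
    "t \<in> T \<Longrightarrow> pm id t = t" "t \<in> T \<Longrightarrow> sg id t = 1"
    "v permutes {1..n} \<Longrightarrow> w permutes {1..n} \<Longrightarrow> t \<in> T \<Longrightarrow> pm (v \<circ> w) t = pm v (pm w t)"
    "v permutes {1..n} \<Longrightarrow> w permutes {1..n} \<Longrightarrow> t \<in> T \<Longrightarrow> sg (v \<circ> w) t = sg v (pm w t) * sg w t"
  using assms unfolding sn_monomial_def by blast+

lemma sn_monomialI:
  assumes "finite T" "sn_space M = coords T"
    "\<And>w. w permutes {1..n} \<Longrightarrow> clinear (sn_act M w)"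
    "\<And>w t. w permutes {1..n} \<Longrightarrow> t \<in> T \<Longrightarrow> pm w t \<in> T"
    "\<And>w t. w permutes {1..n} \<Longrightarrow> t \<in> T \<Longrightarrow> sn_act M w (basis_vec t) = cscale (sg w t) (basis_vec (pm w t))"
    "\<And>t. t \<in> T \<Longrightarrow> pm id t = t" "\<And>t. t \<in> T \<Longrightarrow> sg id t = 1"
    "\<And>v w t. v permutes {1..n} \<Longrightarrow> w permutes {1..n} \<Longrightarrow> t \<in> T \<Longrightarrow> pm (v \<circ> w) t = pm v (pm w t)"
    "\<And>v w t. v permutes {1..n} \<Longrightarrow> w permutes {1..n} \<Longrightarrow> t \<in> T \<Longrightarrow> sg (v \<circ> w) t = sg v (pm w t) * sg w t"
  shows "sn_monomial n T pm sg M"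
  unfolding sn_monomial_def using assms by blast

lemma sn_monomial_tensor:
  assumes "sn_monomial n T pm sg M" "sn_monomial n T' pm' sg' M'"
  shows "sn_monomial n (T \<times> T') (\<lambda>w (t, t'). (pm w t, pm' w t')) (\<lambda>w (t, t'). sg w t * sg' w t') (sn_tensor M M')"
proof -
  note M = sn_monomialD[OF assms(1)] and M' = sn_monomialD[OF assms(2)]
  show ?thesis
  proof (rule sn_monomialI)
    show "finite (T \<times> T')" using M(1) M'(1) by simp
    show "sn_space (sn_tensor M M') = coords (T \<times> T')"
      by (simp add: sn_tensor_def M(2) M'(2) tensor_space_coords)
    fix w assume w: "w permutes {1..n}"
    show "clinear (sn_act (sn_tensor M M') w)" by (simp add: sn_tensor_def)
    fix x assume x: "x \<in> T \<times> T'"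
    obtain t t' where [simp]: "x = (t, t')" "t \<in> T" "t' \<in> T'" using x by auto
    show "(case x of (t, t') \<Rightarrow> (pm w t, pm' w t')) \<in> T \<times> T'"
      using M(4)[OF w, of t] M'(4)[OF w, of t'] by simp
    show "sn_act (sn_tensor M M') w (basis_vec x) =
      cscale (case x of (t, t') \<Rightarrow> sg w t * sg' w t') (basis_vec (case x of (t, t') \<Rightarrow> (pm w t, pm' w t')))"
      by (simp add: sn_tensor_def M(5)[OF w] M'(5)[OF w] tensor_vec_scale mult.commute)
    fix v assume v: "v permutes {1..n}"
    show "(case x of (t, t') \<Rightarrow> (pm (v \<circ> w) t, pm' (v \<circ> w) t')) =
        (case case x of (t, t') \<Rightarrow> (pm w t, pm' w t') of (t, t') \<Rightarrow> (pm v t, pm' v t'))"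
      using M(8)[OF v w, of t] M'(8)[OF v w, of t'] by simp
    show "(case x of (t, t') \<Rightarrow> sg (v \<circ> w) t * sg' (v \<circ> w) t') =
        (case case x of (t, t') \<Rightarrow> (pm w t, pm' w t') of (t, t') \<Rightarrow> sg v t * sg' v t') *
        (case x of (t, t') \<Rightarrow> sg w t * sg' w t')"
      using M(9)[OF v w, of t] M'(9)[OF v w, of t'] by simp
  next
    fix x assume "x \<in> T \<times> T'"
    then show "(case x of (t, t') \<Rightarrow> (pm id t, pm' id t')) = x"
      "(case x of (t, t') \<Rightarrow> sg id t * sg' id t') = 1"
      using M(6,7) M'(6,7) by auto
  qed
qed

section \<open>The modules C_n \<otimes> M\<close>

definition clifford_basis :: "nat \<Rightarrow> bit \<Rightarrow> nat set set" where
  "clifford_basis n p = {A. A \<subseteq> {1..n} \<and> of_nat (card A) = p}"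

lemma clifford_basis_cover: "clifford_basis n 0 \<union> clifford_basis n 1 = Pow {1..n}"
  by (auto simp: clifford_basis_def)

lemma clifford_basis_disjoint: "clifford_basis n 0 \<inter> clifford_basis n 1 = {}"
  by (auto simp: clifford_basis_def)

lemma grade_clifford_module: "grade (clifford_module n) p = coords (clifford_basis n p)"
  by (simp add: clifford_module_def span_basis clifford_basis_def)

lemma hc_c_clifford_module: "hc_c (clifford_module n) = clifford_mult"
  by (simp add: clifford_module_def)

lemma hc_s_clifford_module:
  "hc_s (clifford_module n) w = clifford_lift (\<lambda>i. clifford_mult (w i)) (basis_vec {})"
  by (simp add: clifford_module_def clifford_lift_def)

lemma clinear_clifford_lift [simp]: "clinear (clifford_lift ga v)"
  by (simp add: clifford_lift_def)

lemma hc_s_clifford_basis: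
  assumes "w permutes {1..n}" "finite A"
  shows "hc_s (clifford_module n) w (basis_vec A) = cscale (perm_sign w A) (basis_vec (w ` A))"
  using anticommuting_image[OF anticommuting_clifford permutes_inj[OF assms(1)] assms(2)] assms(2)
  by (simp add: hc_s_clifford_module clifford_lift_def foldr_clifford_sorted)

text \<open>The operator of w is the lift for the reindexed generators c_(w i), so it carries c_i to
  c_(w i) by construction.\<close>

lemma hc_s_clifford_mult:
  assumes "w permutes {1..n}" "finite A"
  shows "hc_s (clifford_module n) w (clifford_mult i (basis_vec A)) =
    clifford_mult (w i) (hc_s (clifford_module n) w (basis_vec A))"
  unfolding hc_s_clifford_module
  using assms(2) clifford_lift_mult[OF anticommuting_reindex[OF anticommuting_clifford permutes_inj[OF assms(1)]],
    of "basis_vec A" "basis_vec {}" i] by simp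

lemma clifford_mult_grade:
  assumes "A \<in> clifford_basis n p" "i \<in> {1..n}"
  shows "clifford_mult i (basis_vec A) \<in> coords (clifford_basis n (p + 1))"
proof -
  have A: "A \<subseteq> {1..n}" "finite A" "of_nat (card A) = p"
    using assms(1) by (auto simp: clifford_basis_def intro: finite_subset)
  have "of_nat (card (if i \<in> A then A - {i} else insert i A)) = p + 1"
  proof (cases "i \<in> A")
    case True
    then have "card A = Suc (card (A - {i}))" using A(2) by (metis card_Suc_Diff1)
    then have "p = of_nat (card (A - {i})) + 1" using A(3) by simp
    then show ?thesis using True by simp
  next
    case False
    then show ?thesis using A by (simp add: add.commute)
  qed
  then have "(if i \<in> A then A - {i} else insert i A) \<in> clifford_basis n (p + 1)"
    using A(1) assms(2) by (auto simp: clifford_basis_def)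
  then show ?thesis
    unfolding clifford_mult_basis by (intro cvs.subspace_scale) auto
qed

lemma grade_hc_tensor:
  assumes "sn_monomial n T pm sg M"
  shows "grade (hc_tensor (clifford_module n) M) p = coords (clifford_basis n p \<times> T)"
  by (simp add: hc_tensor_def grade_clifford_module sn_monomialD(2)[OF assms] tensor_space_coords)

lemma hc_space_hc_tensor:
  assumes "sn_monomial n T pm sg M"
  shows "hc_space (hc_tensor (clifford_module n) M) = coords (Pow {1..n} \<times> T)"
proof -
  have "Pow {1..n} \<times> T = clifford_basis n 0 \<times> T \<union> clifford_basis n 1 \<times> T"
    using clifford_basis_cover by blast
  then show ?thesis
    by (simp add: hc_space_def grade_hc_tensor[OF assms] coords_Un)
qed

lemma hc_s_hc_tensor_basis:
  assumes "sn_monomial n T pm sg M" "w permutes {1..n}" "finite A" "t \<in> T"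
  shows "hc_s (hc_tensor (clifford_module n) M) w (basis_vec (A, t)) =
    cscale (perm_sign w A * sg w t) (basis_vec (w ` A, pm w t))"
  using assms by (simp add: hc_tensor_def hc_s_clifford_basis sn_monomialD(5)[OF assms(1)] tensor_vec_scale mult.commute)

lemma hc_c_hc_tensor: "hc_c (hc_tensor F M) i = tensor_op (hc_c F i) id"
  by (simp add: hc_tensor_def)

lemma anticommuting_tensor:
  assumes "anticommuting k ga"
  shows "anticommuting k (\<lambda>i. tensor_op (ga i) id)"
proof (rule anticommutingI)
  note ga = anticommutingD[OF assms]
  fix i v
  show "clinear (tensor_op (ga i) id)" by simp
  have lin: "clinear (\<lambda>v. tensor_op (ga i) id (tensor_op (ga j) id v))" for i j
    by (rule clinear_compose) simp_all
  show "tensor_op (ga i) id (tensor_op (ga i) id v) = cscale k v"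
  proof (rule clinear_eq[where f = "\<lambda>v. tensor_op (ga i) id (tensor_op (ga i) id v)"])
    fix x :: "'a \<times> 'c"
    obtain a b where x: "x = (a, b)" by fastforce
    show "tensor_op (ga i) id (tensor_op (ga i) id (basis_vec x)) = cscale k (basis_vec x)"
      unfolding x tensor_op_basis tensor_op_vec[OF ga(1) clinear_id(1)] ga(2)
      by (simp add: tensor_vec_scale)
  qed (intro lin clinear_cscale[OF clinear_id(2)])+
  fix j assume "i \<noteq> j"
  show "tensor_op (ga i) id (tensor_op (ga j) id v) = - tensor_op (ga j) id (tensor_op (ga i) id v)"
  proof (rule clinear_eq[where f = "\<lambda>v. tensor_op (ga i) id (tensor_op (ga j) id v)"])
    fix x :: "'a \<times> 'c"
    obtain a b where x: "x = (a, b)" by fastforce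
    show "tensor_op (ga i) id (tensor_op (ga j) id (basis_vec x)) = - tensor_op (ga j) id (tensor_op (ga i) id (basis_vec x))"
      unfolding x tensor_op_basis tensor_op_vec[OF ga(1) clinear_id(1)] ga(3)[OF \<open>i \<noteq> j\<close>]
      by (simp add: clinear_neg[OF clinear_tensor_vec_left])
  qed (intro lin clinear_uminus[OF lin])+
qed

lemma clinear_hc_tensor: "clinear (hc_s (hc_tensor F M) w)" "clinear (hc_c (hc_tensor F M) i)"
  by (simp_all add: hc_tensor_def)

text \<open>The relation w c_i = c_(w i) w for all permutations; those in the definition of a module
  are its cases for simple transpositions.\<close>

lemma hc_s_hc_c_hc_tensor:
  assumes M: "sn_monomial n T pm sg M" and w: "w permutes {1..n}"
    and x: "x \<in> coords (Pow {1..n} \<times> T)"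
  shows "hc_s (hc_tensor (clifford_module n) M) w (hc_c (hc_tensor (clifford_module n) M) i x) =
    hc_c (hc_tensor (clifford_module n) M) (w i) (hc_s (hc_tensor (clifford_module n) M) w x)"
proof (rule coords_linear_eq[OF _ _ _ x, where f = "\<lambda>x. hc_s (hc_tensor (clifford_module n) M) w (hc_c (hc_tensor (clifford_module n) M) i x)"
      and g = "\<lambda>x. hc_c (hc_tensor (clifford_module n) M) (w i) (hc_s (hc_tensor (clifford_module n) M) w x)"])
  show "clinear (\<lambda>x. hc_s (hc_tensor (clifford_module n) M) w (hc_c (hc_tensor (clifford_module n) M) i x))"
    "clinear (\<lambda>x. hc_c (hc_tensor (clifford_module n) M) (w i) (hc_s (hc_tensor (clifford_module n) M) w x))"
    by (rule clinear_compose[OF clinear_hc_tensor(1) clinear_hc_tensor(2)])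
      (rule clinear_compose[OF clinear_hc_tensor(2) clinear_hc_tensor(1)])
  fix y assume "y \<in> Pow {1..n} \<times> T"
  then obtain A t where y: "y = (A, t)" "finite A" by (auto intro: finite_subset)
  have l1: "clinear (hc_s (clifford_module n) w)" by (simp add: hc_s_clifford_module)
  have l2: "clinear (sn_act M w)" by (rule sn_monomialD(3)[OF M w])
  have hs: "hc_s (hc_tensor (clifford_module n) M) w = tensor_op (hc_s (clifford_module n) w) (sn_act M w)"
    by (simp add: hc_tensor_def)
  show "hc_s (hc_tensor (clifford_module n) M) w (hc_c (hc_tensor (clifford_module n) M) i (basis_vec y)) =
    hc_c (hc_tensor (clifford_module n) M) (w i) (hc_s (hc_tensor (clifford_module n) M) w (basis_vec y))"
    unfolding hs hc_c_hc_tensor hc_c_clifford_module y(1) tensor_op_basis tensor_op_vec[OF l1 l2]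
      hc_s_clifford_mult[OF w y(2)] tensor_op_vec[OF clinear_clifford_mult clinear_id(1)] by simp
qed

lemma hc_moduleI:
  assumes "\<And>p. cvs.subspace (grade M p)" "grade M 0 \<inter> grade M 1 = {0}"
    "\<exists>B. finite B \<and> hc_space M = cvs.span B"
    "\<And>i. i \<in> {1..n} \<Longrightarrow> clinear (hc_c M i)"
    "\<And>i p. i \<in> {1..n} \<Longrightarrow> hc_c M i ` grade M p \<subseteq> grade M (p + 1)"
    "\<And>w. w permutes {1..n} \<Longrightarrow> clinear (hc_s M w)"
    "\<And>w p. w permutes {1..n} \<Longrightarrow> hc_s M w ` grade M p \<subseteq> grade M p"
    "\<And>x i. x \<in> hc_space M \<Longrightarrow> i \<in> {1..n} \<Longrightarrow> hc_c M i (hc_c M i x) = x"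
    "\<And>x i j. x \<in> hc_space M \<Longrightarrow> i \<in> {1..n} \<Longrightarrow> j \<in> {1..n} \<Longrightarrow> i \<noteq> j \<Longrightarrow>
       hc_c M i (hc_c M j x) = - hc_c M j (hc_c M i x)"
    "\<And>x. x \<in> hc_space M \<Longrightarrow> hc_s M id x = x"
    "\<And>x v w. x \<in> hc_space M \<Longrightarrow> v permutes {1..n} \<Longrightarrow> w permutes {1..n} \<Longrightarrow>
       hc_s M (v \<circ> w) x = hc_s M v (hc_s M w x)"
    "\<And>x i. x \<in> hc_space M \<Longrightarrow> i \<in> {1..<n} \<Longrightarrow>
       hc_s M (transpose i (i + 1)) (hc_c M i x) = hc_c M (i + 1) (hc_s M (transpose i (i + 1)) x)"
    "\<And>x i j. x \<in> hc_space M \<Longrightarrow> i \<in> {1..<n} \<Longrightarrow> j \<in> {1..n} - {i, i + 1} \<Longrightarrow>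
       hc_s M (transpose i (i + 1)) (hc_c M j x) = hc_c M j (hc_s M (transpose i (i + 1)) x)"
  shows "hc_module n M"
  unfolding hc_module_def
  by (intro conjI ballI allI impI; rule assms; assumption)

lemma hc_moduleD:
  assumes "hc_module n M"
  shows "cvs.subspace (grade M p)" "grade M 0 \<inter> grade M 1 = {0}"
    "\<exists>B. finite B \<and> hc_space M = cvs.span B"
    "i \<in> {1..n} \<Longrightarrow> clinear (hc_c M i)"
    "i \<in> {1..n} \<Longrightarrow> hc_c M i ` grade M p \<subseteq> grade M (p + 1)"
    "w permutes {1..n} \<Longrightarrow> clinear (hc_s M w)"
    "w permutes {1..n} \<Longrightarrow> hc_s M w ` grade M p \<subseteq> grade M p"
    "x \<in> hc_space M \<Longrightarrow> i \<in> {1..n} \<Longrightarrow> hc_c M i (hc_c M i x) = x"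
    "x \<in> hc_space M \<Longrightarrow> i \<in> {1..n} \<Longrightarrow> j \<in> {1..n} \<Longrightarrow> i \<noteq> j \<Longrightarrow>
       hc_c M i (hc_c M j x) = - hc_c M j (hc_c M i x)"
    "x \<in> hc_space M \<Longrightarrow> hc_s M id x = x"
    "x \<in> hc_space M \<Longrightarrow> v permutes {1..n} \<Longrightarrow> w permutes {1..n} \<Longrightarrow>
       hc_s M (v \<circ> w) x = hc_s M v (hc_s M w x)"
    "x \<in> hc_space M \<Longrightarrow> i \<in> {1..<n} \<Longrightarrow>
       hc_s M (transpose i (i + 1)) (hc_c M i x) = hc_c M (i + 1) (hc_s M (transpose i (i + 1)) x)"
    "x \<in> hc_space M \<Longrightarrow> i \<in> {1..<n} \<Longrightarrow> j \<in> {1..n} - {i, i + 1} \<Longrightarrow>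
       hc_s M (transpose i (i + 1)) (hc_c M j x) = hc_c M j (hc_s M (transpose i (i + 1)) x)"
proof -
  note a = assms[unfolded hc_module_def]
  note c3 = a[THEN conjunct2, THEN conjunct2]
  note c5 = c3[THEN conjunct2, THEN conjunct2]
  show "cvs.subspace (grade M p)" by (rule a[THEN conjunct1, THEN spec])
  show "grade M 0 \<inter> grade M 1 = {0}" by (rule a[THEN conjunct2, THEN conjunct1])
  show "\<exists>B. finite B \<and> hc_space M = cvs.span B" by (rule c3[THEN conjunct1])
  show "clinear (hc_c M i)" if "i \<in> {1..n}"
    by (rule c3[THEN conjunct2, THEN conjunct1, THEN bspec, OF that, THEN conjunct1])
  show "hc_c M i ` grade M p \<subseteq> grade M (p + 1)" if "i \<in> {1..n}"
    by (rule c3[THEN conjunct2, THEN conjunct1, THEN bspec, OF that, THEN conjunct2, THEN spec])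
  show "clinear (hc_s M w)" if "w permutes {1..n}"
    by (rule c5[THEN conjunct1, THEN spec, THEN mp, OF that, THEN conjunct1])
  show "hc_s M w ` grade M p \<subseteq> grade M p" if "w permutes {1..n}"
    by (rule c5[THEN conjunct1, THEN spec, THEN mp, OF that, THEN conjunct2, THEN spec])
  assume x: "x \<in> hc_space M"
  note d = c5[THEN conjunct2, THEN bspec, OF x]
  note d3 = d[THEN conjunct2, THEN conjunct2]
  show "hc_c M i (hc_c M i x) = x" if "i \<in> {1..n}"
    by (rule d[THEN conjunct1, THEN bspec, OF that])
  show "hc_c M i (hc_c M j x) = - hc_c M j (hc_c M i x)" if "i \<in> {1..n}" "j \<in> {1..n}" "i \<noteq> j"
    by (rule d[THEN conjunct2, THEN conjunct1, THEN bspec, THEN bspec, THEN mp, OF that])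
  show "hc_s M id x = x" by (rule d3[THEN conjunct1])
  show "hc_s M (v \<circ> w) x = hc_s M v (hc_s M w x)" if "v permutes {1..n}" "w permutes {1..n}"
    by (rule d3[THEN conjunct2, THEN conjunct1, THEN spec, THEN spec, THEN mp, THEN mp, OF that])
  show "hc_s M (transpose i (i + 1)) (hc_c M i x) = hc_c M (i + 1) (hc_s M (transpose i (i + 1)) x)" if "i \<in> {1..<n}"
    by (rule d3[THEN conjunct2, THEN conjunct2, THEN bspec, OF that, THEN conjunct1])
  show "hc_s M (transpose i (i + 1)) (hc_c M j x) = hc_c M j (hc_s M (transpose i (i + 1)) x)"
    if "i \<in> {1..<n}" "j \<in> {1..n} - {i, i + 1}"
    by (rule d3[THEN conjunct2, THEN conjunct2, THEN bspec, OF that(1), THEN conjunct2, THEN bspec, OF that(2)])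
qed

text \<open>All relations involving permutations are checked on basis vectors; multiplicativity of
  the action combines the cocycle of the signs on the Clifford factor with that of M.\<close>

lemma hc_module_hc_tensor:
  assumes M: "sn_monomial n T pm sg M"
  shows "hc_module n (hc_tensor (clifford_module n) M)"
proof -
  let ?N = "hc_tensor (clifford_module n) M"
  note M' = sn_monomialD[OF M]
  have gr: "grade ?N p = coords (clifford_basis n p \<times> T)" for p by (rule grade_hc_tensor[OF M])
  have sp: "hc_space ?N = coords (Pow {1..n} \<times> T)" by (rule hc_space_hc_tensor[OF M])
  have anti: "anticommuting 1 (hc_c ?N)"
  proof -
    have "hc_c ?N = (\<lambda>i. tensor_op (clifford_mult i) id)"
      by (rule ext) (simp add: hc_c_hc_tensor hc_c_clifford_module)
    then show ?thesis using anticommuting_tensor[OF anticommuting_clifford] by (simp only:)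
  qed
  have lin_s: "clinear (hc_s ?N w)" for w by (simp add: hc_tensor_def)
  have grade_c: "hc_c ?N i ` grade ?N p \<subseteq> grade ?N (p + 1)" if "i \<in> {1..n}" for i p
    unfolding gr
  proof (rule coords_image_subset)
    fix y assume "y \<in> clifford_basis n p \<times> T"
    then obtain A t where y: "y = (A, t)" "A \<in> clifford_basis n p" "t \<in> T" by auto
    show "hc_c ?N i (basis_vec y) \<in> coords (clifford_basis n (p + 1) \<times> T)"
      unfolding hc_c_hc_tensor hc_c_clifford_module y(1) tensor_op_basis
      using clifford_mult_grade[OF y(2) that] y(3) by (intro tensor_vec_in_coords) auto
  qed (simp_all add: anticommutingD(1)[OF anti])
  have grade_s: "hc_s ?N w ` grade ?N p \<subseteq> grade ?N p" if w: "w permutes {1..n}" for w p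
    unfolding gr
  proof (rule coords_image_subset)
    fix y assume "y \<in> clifford_basis n p \<times> T"
    then obtain A t where y: "y = (A, t)" "A \<in> clifford_basis n p" "t \<in> T" by auto
    have A: "A \<subseteq> {1..n}" "finite A" using y(2) by (auto simp: clifford_basis_def intro: finite_subset)
    have "w ` A \<subseteq> {1..n}" using A(1) permutes_image[OF w] by blast
    moreover have "card (w ` A) = card A"
      using permutes_inj[OF w] by (intro card_image) (auto intro: inj_on_subset)
    ultimately have "w ` A \<in> clifford_basis n p" using y(2) by (simp add: clifford_basis_def)
    then show "hc_s ?N w (basis_vec y) \<in> coords (clifford_basis n p \<times> T)"
      unfolding y(1) hc_s_hc_tensor_basis[OF M w A(2) y(3)] using M'(4)[OF w y(3)]
      by (intro cvs.subspace_scale) auto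
  qed (simp_all add: lin_s)
  have rel_id: "hc_s ?N id x = x" if x: "x \<in> hc_space ?N" for x
  proof (rule coords_linear_eq[where S = "Pow {1..n} \<times> T" and f = "hc_s ?N id" and g = "\<lambda>x. x"])
    fix y assume "y \<in> Pow {1..n} \<times> T"
    then obtain A t where y: "y = (A, t)" "finite A" "t \<in> T" by (auto intro: finite_subset)
    show "hc_s ?N id (basis_vec y) = basis_vec y"
      unfolding y(1) using M'(6,7)[OF y(3)]
      by (simp add: hc_s_hc_tensor_basis[OF M permutes_id y(2,3)] perm_sign_id[OF y(2)])
  next
    show "clinear (hc_s ?N id)" by (rule lin_s)
    show "x \<in> coords (Pow {1..n} \<times> T)" using x sp by simp
  qed simp
  have rel_mult: "hc_s ?N (v \<circ> w) x = hc_s ?N v (hc_s ?N w x)"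
    if x: "x \<in> hc_space ?N" and v: "v permutes {1..n}" and w: "w permutes {1..n}" for v w x
  proof (rule coords_linear_eq[where S = "Pow {1..n} \<times> T" and f = "hc_s ?N (v \<circ> w)" and g = "\<lambda>x. hc_s ?N v (hc_s ?N w x)"])
    fix y assume "y \<in> Pow {1..n} \<times> T"
    then obtain A t where y: "y = (A, t)" "finite A" "t \<in> T" by (auto intro: finite_subset)
    show "hc_s ?N (v \<circ> w) (basis_vec y) = hc_s ?N v (hc_s ?N w (basis_vec y))"
      unfolding y(1) hc_s_hc_tensor_basis[OF M w y(2,3)] hc_s_hc_tensor_basis[OF M permutes_compose[OF w v] y(2,3)]
        clinear_scale[OF lin_s] hc_s_hc_tensor_basis[OF M v finite_imageI[OF y(2)] M'(4)[OF w y(3)]]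
      using M'(8,9)[OF v w y(3)] perm_sign_comp[OF permutes_inj[OF v] permutes_inj[OF w] y(2)]
      by (simp add: image_comp mult_ac)
  next
    show "clinear (hc_s ?N (v \<circ> w))" by (rule lin_s)
    show "clinear (\<lambda>x. hc_s ?N v (hc_s ?N w x))" by (rule clinear_compose[OF lin_s lin_s])
    show "x \<in> coords (Pow {1..n} \<times> T)" using x sp by simp
  qed
  have rel_s: "hc_s ?N (transpose i (i + 1)) (hc_c ?N j x) = hc_c ?N (transpose i (i + 1) j) (hc_s ?N (transpose i (i + 1)) x)"
    if "x \<in> hc_space ?N" "i \<in> {1..<n}" for x i j
    using that sp by (intro hc_s_hc_c_hc_tensor[OF M]) (auto intro: permutes_swap_id)
  have "finite (Pow {1..n} \<times> T)" using M'(1) by simp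
  then have fin: "\<exists>B. finite B \<and> hc_space ?N = cvs.span B"
    unfolding sp by (intro exI[of _ "basis_vec ` (Pow {1..n} \<times> T)"]) (simp add: span_basis)
  have disj: "grade ?N 0 \<inter> grade ?N 1 = {0}"
    unfolding gr using clifford_basis_disjoint by (intro coords_disjoint) blast
  show ?thesis
  proof (rule hc_moduleI)
    show "cvs.subspace (grade ?N p)" for p by (simp add: gr)
    show "hc_c ?N i (hc_c ?N i x) = x" for i x
      using anticommutingD(2)[OF anti, of i x] by simp
    show "hc_s ?N (transpose i (i + 1)) (hc_c ?N i x) = hc_c ?N (i + 1) (hc_s ?N (transpose i (i + 1)) x)"
      if "x \<in> hc_space ?N" "i \<in> {1..<n}" for i x
      using rel_s[OF that, of i] by simp
    show "hc_s ?N (transpose i (i + 1)) (hc_c ?N j x) = hc_c ?N j (hc_s ?N (transpose i (i + 1)) x)"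
      if "x \<in> hc_space ?N" "i \<in> {1..<n}" "j \<in> {1..n} - {i, i + 1}" for i j x
      using rel_s[OF that(1,2), of j] that(3) by (simp add: transpose_def)
  qed (rule disj fin anticommutingD(1,3)[OF anti] grade_c grade_s lin_s rel_id rel_mult; assumption)+
qed

section \<open>Symmetric and exterior powers of the permutation module\<close>

lemma finite_homogeneous_expos [simp]: "finite (homogeneous_expos m p)"
proof (rule finite_subset)
  show "homogeneous_expos m p \<subseteq> expo m ` PiE {1..m} (\<lambda>_. {..p})"
  proof
    fix a assume a: "a \<in> homogeneous_expos m p"
    have "Poly_Mapping.lookup a i \<le> p" if "i \<in> {1..m}" for i
    proof -
      have "Poly_Mapping.lookup a i \<le> (\<Sum>i\<in>{1..m}. Poly_Mapping.lookup a i)"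
        using that by (intro member_le_sum) auto
      then show ?thesis using a by (simp add: homogeneous_expos_def)
    qed
    then have "restrict (Poly_Mapping.lookup a) {1..m} \<in> PiE {1..m} (\<lambda>_. {..p})" by auto
    moreover have "a = expo m (restrict (Poly_Mapping.lookup a) {1..m})"
      using a expo_lookup[of a m] expo_eq_iff[of m "Poly_Mapping.lookup a" "restrict (Poly_Mapping.lookup a) {1..m}"]
      by (simp add: homogeneous_expos_def)
    ultimately show "a \<in> expo m ` PiE {1..m} (\<lambda>_. {..p})" by blast
  qed
  show "finite (expo m ` PiE {1..m} (\<lambda>_. {..p}))" by (intro finite_imageI finite_PiE) auto
qed

definition sym_perm :: "(nat \<Rightarrow> nat) \<Rightarrow> (nat \<Rightarrow>\<^sub>0 nat) \<Rightarrow> (nat \<Rightarrow>\<^sub>0 nat)" where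
  "sym_perm w a = (\<Sum>b\<in>Poly_Mapping.keys a. Poly_Mapping.single (w b) (Poly_Mapping.lookup a b))"

lemma lookup_sym_perm:
  assumes "inj w"
  shows "Poly_Mapping.lookup (sym_perm w a) (w i) = Poly_Mapping.lookup a i"
  using assms by (simp add: sym_perm_def lookup_sum lookup_single when_def inj_eq in_keys_iff)

lemma sym_perm_eqI:
  assumes "w permutes {1..n}" "\<And>i. Poly_Mapping.lookup b (w i) = Poly_Mapping.lookup a i"
  shows "sym_perm w a = b"
proof (rule poly_mapping_eqI)
  fix j
  have "w (inv w j) = j" by (rule permutes_inverses(1)[OF assms(1)])
  then show "Poly_Mapping.lookup (sym_perm w a) j = Poly_Mapping.lookup b j"
    using lookup_sym_perm[OF permutes_inj[OF assms(1)], of a "inv w j"] assms(2)[of "inv w j"] by simp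
qed

lemma sym_perm_homogeneous:
  assumes w: "w permutes {1..n}" and a: "a \<in> homogeneous_expos n p"
  shows "sym_perm w a \<in> homogeneous_expos n p"
proof -
  have "Poly_Mapping.keys (sym_perm w a) \<subseteq> {1..n}"
  proof
    fix j assume j: "j \<in> Poly_Mapping.keys (sym_perm w a)"
    have e: "w (inv w j) = j" by (rule permutes_inverses(1)[OF w])
    then have "inv w j \<in> Poly_Mapping.keys a"
      using j lookup_sym_perm[OF permutes_inj[OF w], of a "inv w j"] by (simp add: in_keys_iff)
    then have "inv w j \<in> {1..n}" using a by (auto simp: homogeneous_expos_def)
    then show "j \<in> {1..n}" using permutes_in_image[OF w, of "inv w j"] e by simp
  qed
  moreover have "(\<Sum>i\<in>{1..n}. Poly_Mapping.lookup (sym_perm w a) i) = (\<Sum>i\<in>{1..n}. Poly_Mapping.lookup (sym_perm w a) (w i))"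
    using sum.permute[OF w, of "Poly_Mapping.lookup (sym_perm w a)"] by (simp add: comp_def)
  ultimately show ?thesis
    using a by (simp add: homogeneous_expos_def lookup_sym_perm[OF permutes_inj[OF w]])
qed

lemma basis_vec_power: "basis_vec (Poly_Mapping.single i 1) ^ k = (basis_vec (Poly_Mapping.single i k) :: ('b \<Rightarrow>\<^sub>0 nat) \<Rightarrow>\<^sub>0 complex)"
proof (induction k)
  case (Suc k)
  have "Poly_Mapping.single i 1 + Poly_Mapping.single i k = Poly_Mapping.single i (Suc k)"
    by (simp flip: single_add)
  then show ?case using Suc by (simp add: mult_single)
qed simp

lemma prod_basis_vec: "(\<Prod>i\<in>A. basis_vec (f i)) = (basis_vec (\<Sum>i\<in>A. f i) :: ('b \<Rightarrow>\<^sub>0 nat) \<Rightarrow>\<^sub>0 complex)"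
  by (induction A rule: infinite_finite_induct) (simp_all add: mult_single)

lemma sym_embed_basis: "sym_embed (basis_vec b) = basis_vec (Poly_Mapping.single b 1)"
  by (simp add: sym_embed_def)

lemma coords_mult:
  fixes f g :: "('b \<Rightarrow>\<^sub>0 nat) \<Rightarrow>\<^sub>0 complex"
  assumes "f \<in> coords S" "g \<in> coords T" "\<And>a b. a \<in> S \<Longrightarrow> b \<in> T \<Longrightarrow> a + b \<in> U"
  shows "f * g \<in> coords U"
  using keys_mult[of f g] assms by (fastforce simp: coords_def)

text \<open>A monomial of degree p is a product of p basis vectors, found by splitting off one
  variable at a time; conversely every product of p linear forms is homogeneous of degree p.\<close>

lemma sym_power_space:
  "sn_space (sym_power p (perm_rep n)) = coords (homogeneous_expos n p)"
proof -
  let ?P = "{prod_list (map sym_embed vs) |vs. length vs = p \<and> set vs \<subseteq> coords {1..n}}"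
  have V: "sn_space (perm_rep n) = coords {1..n}" by (simp add: perm_rep_def span_basis)
  have emb: "sym_embed v \<in> coords (homogeneous_expos n 1)" if "v \<in> coords {1..n}" for v
  proof -
    have "sym_embed ` coords {1..n} \<subseteq> coords (homogeneous_expos n 1)"
      unfolding sym_embed_def
    proof (rule coords_image_subset)
      fix a assume "a \<in> {1..n}"
      then show "lin_ext (\<lambda>b. basis_vec (Poly_Mapping.single b 1)) (basis_vec a) \<in> coords (homogeneous_expos n 1)"
        by (simp add: homogeneous_expos_def lookup_single when_def)
    qed auto
    then show ?thesis using that by blast
  qed
  have add: "a + b \<in> homogeneous_expos n (k + l)" if "a \<in> homogeneous_expos n k" "b \<in> homogeneous_expos n l" for a b k l
    using that keys_add[of a b] by (auto simp: homogeneous_expos_def lookup_add sum.distrib)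
  have sub: "prod_list (map sym_embed vs) \<in> coords (homogeneous_expos n (length vs))" if "set vs \<subseteq> coords {1..n}" for vs
    using that
  proof (induction vs)
    case Nil
    have "(1 :: (nat \<Rightarrow>\<^sub>0 nat) \<Rightarrow>\<^sub>0 complex) = basis_vec 0" by simp
    moreover have "0 \<in> homogeneous_expos n 0" by (simp add: homogeneous_expos_def)
    ultimately show ?case by (simp del: single_one add: coords_def)
  next
    case (Cons v vs)
    have "sym_embed v * prod_list (map sym_embed vs) \<in> coords (homogeneous_expos n (1 + length vs))"
      using Cons emb[of v] by (intro coords_mult[OF _ _ add]) auto
    then show ?case by simp
  qed
  have sup: "\<exists>vs. basis_vec a = prod_list (map sym_embed vs) \<and> length vs = p \<and> set vs \<subseteq> coords {1..n}"
    if "a \<in> homogeneous_expos n p" for a p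
    using that
  proof (induction p arbitrary: a)
    case 0
    then have "a = 0" by (intro poly_mapping_eqI) (auto simp: homogeneous_expos_def in_keys_iff)
    then show ?case by (intro exI[of _ "[]"]) simp
  next
    case (Suc p)
    then have "(\<Sum>i\<in>{1..n}. Poly_Mapping.lookup a i) \<noteq> 0" by (simp add: homogeneous_expos_def)
    then obtain i where i: "i \<in> {1..n}" "Poly_Mapping.lookup a i \<noteq> 0" by (meson sum.neutral)
    define a' where "a' = a - Poly_Mapping.single i 1"
    have aa: "a = Poly_Mapping.single i 1 + a'"
      using i(2) by (intro poly_mapping_eqI) (auto simp: a'_def lookup_add lookup_minus lookup_single when_def)
    have k: "Poly_Mapping.keys a' \<subseteq> {1..n}"
      using Suc.prems by (auto simp: a'_def homogeneous_expos_def in_keys_iff lookup_minus)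
    have "(\<Sum>j\<in>{1..n}. Poly_Mapping.lookup a j) = 1 + (\<Sum>j\<in>{1..n}. Poly_Mapping.lookup a' j)"
      unfolding aa lookup_add sum.distrib using i(1) by (simp add: lookup_single when_def)
    then have "a' \<in> homogeneous_expos n p" using Suc.prems k by (simp add: homogeneous_expos_def)
    then obtain vs where vs: "basis_vec a' = prod_list (map sym_embed vs)" "length vs = p" "set vs \<subseteq> coords {1..n}"
      using Suc.IH by blast
    have "basis_vec a = prod_list (map sym_embed (basis_vec i # vs))"
      using vs(1) by (simp add: aa sym_embed_basis mult_single flip: vs(1))
    then show ?case using vs i(1) by (intro exI[of _ "basis_vec i # vs"]) auto
  qed
  have "cvs.span ?P = coords (homogeneous_expos n p)"
  proof
    show "cvs.span ?P \<subseteq> coords (homogeneous_expos n p)"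
      using sub by (intro cvs.span_minimal) auto
    have "basis_vec ` homogeneous_expos n p \<subseteq> ?P" using sup by blast
    then have "cvs.span (basis_vec ` homogeneous_expos n p) \<subseteq> cvs.span ?P" by (rule cvs.span_mono)
    then show "coords (homogeneous_expos n p) \<subseteq> cvs.span ?P" by (simp add: span_basis)
  qed
  then show ?thesis by (simp add: sym_power_def V)
qed

lemma perm_rep_act: "sn_act (perm_rep n) w (basis_vec b) = basis_vec (w b)"
  by (simp add: perm_rep_def)

lemma sym_perm_id: "sym_perm id a = a"
  by (rule sym_perm_eqI[OF permutes_id]) simp

lemma sym_perm_comp:
  assumes "v permutes {1..n}" "w permutes {1..n}"
  shows "sym_perm (v \<circ> w) a = sym_perm v (sym_perm w a)"
  by (rule sym_perm_eqI[OF permutes_compose[OF assms(2,1)]])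
    (simp add: lookup_sym_perm permutes_inj[OF assms(1)] permutes_inj[OF assms(2)])

lemma sn_monomial_sym_power:
  "sn_monomial n (homogeneous_expos n p) sym_perm (\<lambda>_ _. 1) (sym_power p (perm_rep n))"
proof (rule sn_monomialI)
  fix w assume w: "w permutes {1..n}"
  show "clinear (sn_act (sym_power p (perm_rep n)) w)" by (simp add: sym_power_def)
  fix a assume a: "a \<in> homogeneous_expos n p"
  show "sym_perm w a \<in> homogeneous_expos n p" by (rule sym_perm_homogeneous[OF w a])
  show "sn_act (sym_power p (perm_rep n)) w (basis_vec a) = cscale 1 (basis_vec (sym_perm w a))"
    by (simp add: sym_power_def perm_rep_act sym_embed_basis sym_perm_def prod_basis_vec
        basis_vec_power[unfolded One_nat_def])
qed (auto simp: sym_power_space sym_perm_id sym_perm_comp)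

lemma wedge_in_coords:
  fixes v :: "nat \<Rightarrow>\<^sub>0 complex"
  assumes "v \<in> coords S" "x \<in> coords {A. A \<subseteq> S \<and> finite A \<and> card A = q}"
  shows "wedge v x \<in> coords {A. A \<subseteq> S \<and> finite A \<and> card A = Suc q}"
proof -
  have "wedge (basis_vec i) x \<in> coords {A. A \<subseteq> S \<and> finite A \<and> card A = Suc q}" if i: "i \<in> S" for i
  proof -
    have "wedge (basis_vec i) ` coords {A. A \<subseteq> S \<and> finite A \<and> card A = q} \<subseteq> coords {A. A \<subseteq> S \<and> finite A \<and> card A = Suc q}"
    proof (rule coords_image_subset[OF clinear_wedge_right subspace_coords])
      fix A assume A: "A \<in> {A. A \<subseteq> S \<and> finite A \<and> card A = q}"
      show "wedge (basis_vec i) (basis_vec A) \<in> coords {A. A \<subseteq> S \<and> finite A \<and> card A = Suc q}"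
      proof (cases "i \<in> A")
        case True
        then show ?thesis by (simp add: wedge_basis_basis)
      next
        case False
        then have "insert i A \<in> {A. A \<subseteq> S \<and> finite A \<and> card A = Suc q}" using A i by auto
        then show ?thesis
          using False unfolding wedge_basis_basis if_not_P[OF False] by (intro cvs.subspace_scale) simp_all
      qed
    qed
    then show ?thesis using assms(2) by blast
  qed
  then have "(\<lambda>v. wedge v x) ` coords S \<subseteq> coords {A. A \<subseteq> S \<and> finite A \<and> card A = Suc q}"
    by (intro coords_image_subset[OF clinear_wedge_left subspace_coords])
  then show ?thesis using assms(1) by blast
qed

definition subsets_of_card :: "nat \<Rightarrow> nat \<Rightarrow> nat set set" where
  "subsets_of_card n q = {B. B \<subseteq> {1..n} \<and> card B = q}"

lemma wedge_list_map: "wedge_list (map (\<lambda>b. basis_vec (w b)) xs) = foldr (\<lambda>b. wedge (basis_vec (w b))) xs (basis_vec {})"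
  by (induction xs) (simp_all add: wedge_list_def)

lemma ext_power_space:
  "sn_space (ext_power q (perm_rep n)) = coords (subsets_of_card n q)"
proof -
  let ?P = "{wedge_list vs |vs. length vs = q \<and> set vs \<subseteq> coords {1..n}}"
  have V: "sn_space (perm_rep n) = coords {1..n}" by (simp add: perm_rep_def span_basis)
  have T: "subsets_of_card n q = {A. A \<subseteq> {1..n} \<and> finite A \<and> card A = q}" for q
    by (auto simp: subsets_of_card_def intro: finite_subset)
  have sub: "wedge_list vs \<in> coords (subsets_of_card n (length vs))" if "set vs \<subseteq> coords {1..n}" for vs
    using that
  proof (induction vs)
    case Nil
    then show ?case by (simp add: wedge_list_def subsets_of_card_def)
  next
    case (Cons v vs)
    then show ?case using wedge_in_coords[of v "{1..n}" "wedge_list vs" "length vs"]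
      by (simp add: wedge_list_def T)
  qed
  have sup: "basis_vec ` subsets_of_card n q \<subseteq> ?P"
  proof
    fix x assume "x \<in> basis_vec ` subsets_of_card n q"
    then obtain B where B: "B \<subseteq> {1..n}" "card B = q" "x = basis_vec B" "finite B"
      by (auto simp: subsets_of_card_def intro: finite_subset)
    have "x = wedge_list (map basis_vec (sorted_list_of_set B))"
      using wedge_list_map[of "\<lambda>b. b" "sorted_list_of_set B"] foldr_wedge_sorted[OF B(4)] B(3) by (simp only:)
    then show "x \<in> ?P" using B by (intro CollectI exI[of _ "map basis_vec (sorted_list_of_set B)"]) auto
  qed
  have "cvs.span ?P = coords (subsets_of_card n q)"
  proof
    show "cvs.span ?P \<subseteq> coords (subsets_of_card n q)"
      using sub by (intro cvs.span_minimal) auto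
    have "cvs.span (basis_vec ` subsets_of_card n q) \<subseteq> cvs.span ?P" using sup by (rule cvs.span_mono)
    then show "coords (subsets_of_card n q) \<subseteq> cvs.span ?P" by (simp add: span_basis)
  qed
  then show ?thesis by (simp add: ext_power_def V)
qed

text \<open>The sign is \<open>perm_sign\<close>, because wedging by basis vectors is another
  anticommuting family.\<close>

lemma sn_monomial_ext_power:
  "sn_monomial n (subsets_of_card n q) (\<lambda>w B. w ` B) perm_sign (ext_power q (perm_rep n))"
proof (rule sn_monomialI)
  show "finite (subsets_of_card n q)"
    unfolding subsets_of_card_def by (rule finite_subset[of _ "Pow {1..n}"]) auto
  show "sn_space (ext_power q (perm_rep n)) = coords (subsets_of_card n q)" by (rule ext_power_space)
  have fin: "finite B" if "B \<in> subsets_of_card n q" for B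
    using that by (auto simp: subsets_of_card_def intro: finite_subset)
  fix w assume w: "w permutes {1..n}"
  show "clinear (sn_act (ext_power q (perm_rep n)) w)" by (simp add: ext_power_def)
  fix B assume B: "B \<in> subsets_of_card n q"
  have "w ` B \<subseteq> {1..n}" using B permutes_image[OF w] by (auto simp: subsets_of_card_def)
  moreover have "card (w ` B) = card B"
    using permutes_inj[OF w] by (intro card_image) (auto intro: inj_on_subset)
  ultimately show "w ` B \<in> subsets_of_card n q" using B by (simp add: subsets_of_card_def)
  show "sn_act (ext_power q (perm_rep n)) w (basis_vec B) = cscale (perm_sign w B) (basis_vec (w ` B))"
    using anticommuting_image[OF anticommuting_wedge permutes_inj[OF w] fin[OF B], of "basis_vec {}"] fin[OF B]
    by (simp add: ext_power_def perm_rep_act wedge_list_map foldr_wedge_sorted)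
  fix v assume v: "v permutes {1..n}"
  show "(v \<circ> w) ` B = v ` w ` B" by (simp add: image_comp)
  show "perm_sign (v \<circ> w) B = perm_sign v (w ` B) * perm_sign w B"
    by (rule perm_sign_comp[OF permutes_inj[OF v] permutes_inj[OF w] fin[OF B]])
next
  fix B assume "B \<in> subsets_of_card n q"
  then show "perm_sign id B = 1" by (intro perm_sign_id) (auto simp: subsets_of_card_def intro: finite_subset)
qed auto

section \<open>Permutation modules and the removal of signs\<close>

definition perm_module :: "'t set \<Rightarrow> ((nat \<Rightarrow> nat) \<Rightarrow> 't \<Rightarrow> 't) \<Rightarrow> 't snmod" where
  "perm_module T pm = \<lparr>sn_space = coords T, sn_act = (\<lambda>w. lin_ext (\<lambda>t. basis_vec (pm w t)))\<rparr>"

text \<open>Forgets the signs and passes to an invariant subset of the basis, such as an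
  orbit.\<close>

lemma sn_monomial_perm_module:
  assumes "sn_monomial n T pm sg M" "S \<subseteq> T" "\<And>w t. w permutes {1..n} \<Longrightarrow> t \<in> S \<Longrightarrow> pm w t \<in> S"
  shows "sn_monomial n S pm (\<lambda>_ _. 1) (perm_module S pm)"
  using sn_monomialD(1,6,8)[OF assms(1)] assms(2,3)
  by (intro sn_monomialI) (auto simp: perm_module_def intro: finite_subset)

text \<open>A matrix with one nonzero entry in each row and column is invertible; the inverse g has
  the reciprocal entries.\<close>

lemma bij_betw_coords:
  assumes "clinear f" "bij_betw h S S'" "\<And>x. x \<in> S \<Longrightarrow> f (basis_vec x) = cscale (e x) (basis_vec (h x))"
    "\<And>x. x \<in> S \<Longrightarrow> e x \<noteq> 0"
  shows "bij_betw f (coords S) (coords S')"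
proof -
  define k where "k = inv_into S h"
  have k: "k y \<in> S" "h (k y) = y" if "y \<in> S'" for y
    using that assms(2) unfolding k_def by (auto simp: bij_betw_def f_inv_into_f inv_into_into)
  have kh: "k (h x) = x" "h x \<in> S'" if "x \<in> S" for x
    using that assms(2) unfolding k_def by (auto simp: bij_betw_def)
  define g where "g = lin_ext (\<lambda>y. cscale (1 / e (k y)) (basis_vec (k y)))"
  have g: "clinear g" and g_basis: "g (basis_vec y) = cscale (1 / e (k y)) (basis_vec (k y))" for y
    by (simp_all add: g_def)
  have gf: "g (f x) = x" if "x \<in> coords S" for x
    by (rule coords_linear_eq[OF clinear_compose[OF g assms(1)] clinear_id(2) _ that])
      (simp add: assms(3,4) clinear_scale[OF g] g_basis kh)
  have fg: "f (g y) = y" if "y \<in> coords S'" for y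
    by (rule coords_linear_eq[OF clinear_compose[OF assms(1) g] clinear_id(2) _ that])
      (simp add: assms(3,4) clinear_scale[OF assms(1)] g_basis k)
  have "f ` coords S \<subseteq> coords S'"
    by (rule coords_image_subset[OF assms(1) subspace_coords]) (auto simp: assms(3) kh intro!: cvs.subspace_scale)
  moreover have "g ` coords S' \<subseteq> coords S"
    unfolding g_def by (rule coords_image_subset[OF clinear_lin_ext subspace_coords]) (auto simp: k intro!: cvs.subspace_scale)
  ultimately show ?thesis
    using gf fg by (intro bij_betw_byWitness[where f' = g]) auto
qed

text \<open>Multiplication by c_x toggles x, so the product lands on the symmetric difference. The
  scalar is left unspecified, as bijectivity only asks that it be nonzero.\<close>

lemma foldr_signed_clifford:
  assumes "distinct xs" "s * s = 1"
  shows "\<exists>e. e \<noteq> 0 \<and> foldr (\<lambda>i x. cscale s (tensor_op (clifford_mult i) id x)) xs (basis_vec (C, t)) =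
    cscale e (basis_vec ((set xs - C) \<union> (C - set xs), t))"
  using assms(1)
proof (induction xs)
  case Nil
  then show ?case by (intro exI[of _ 1]) simp
next
  case (Cons x xs)
  have "distinct xs" using Cons.prems by simp
  from Cons.IH[OF this] obtain e where e: "e \<noteq> 0" "foldr (\<lambda>i x. cscale s (tensor_op (clifford_mult i) id x)) xs (basis_vec (C, t)) =
    cscale e (basis_vec ((set xs - C) \<union> (C - set xs), t))" by blast
  let ?D = "(set xs - C) \<union> (C - set xs)"
  have D: "(if x \<in> ?D then ?D - {x} else insert x ?D) = (set (x # xs) - C) \<union> (C - set (x # xs))"
    using Cons.prems by auto
  have s: "s \<noteq> 0" using assms(2) by auto
  have "foldr (\<lambda>i x. cscale s (tensor_op (clifford_mult i) id x)) (x # xs) (basis_vec (C, t)) =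
     cscale s (tensor_op (clifford_mult x) id (cscale e (basis_vec (?D, t))))"
    using e(2) by simp
  also have "\<dots> = cscale (s * e * (- 1) ^ card {a \<in> ?D. a < x}) (basis_vec ((set (x # xs) - C) \<union> (C - set (x # xs)), t))"
    unfolding clinear_scale[OF clinear_tensor_op] tensor_op_basis clifford_mult_basis D
    by (simp add: tensor_vec_scale mult.assoc)
  finally have "foldr (\<lambda>i x. cscale s (tensor_op (clifford_mult i) id x)) (x # xs) (basis_vec (C, t)) =
    cscale (s * e * (- 1) ^ card {a \<in> ?D. a < x}) (basis_vec ((set (x # xs) - C) \<union> (C - set (x # xs)), t))" .
  moreover have "s * e * (- 1) ^ card {a \<in> ?D. a < x} \<noteq> 0" using e(1) s by simp
  ultimately show ?case by blast
qed

text \<open>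
  On $c_A\otimes t$ the isomorphism multiplies $c_A$ on the right by $c_{B(t)}$, whose sign under $w$
  compensates the one of the basis vector $t$.
\<close>

lemma untwist_isomorphism:
  assumes M: "sn_monomial n T pm sg M"
    and B: "\<And>t. t \<in> T \<Longrightarrow> B t \<subseteq> {1..n} \<and> card (B t) = q"
    and Bw: "\<And>w t. w permutes {1..n} \<Longrightarrow> t \<in> T \<Longrightarrow> B (pm w t) = w ` B t \<and> sg w t = perm_sign w (B t)"
  obtains f where "hc_hom_of_parity n (of_nat q) (hc_tensor (clifford_module n) (perm_module T pm)) (hc_tensor (clifford_module n) M) f"
    "bij_betw f (hc_space (hc_tensor (clifford_module n) (perm_module T pm))) (hc_space (hc_tensor (clifford_module n) M))"
proof -
  let ?P = "hc_tensor (clifford_module n) (perm_module T pm)" and ?N = "hc_tensor (clifford_module n) M"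
  note M' = sn_monomialD[OF M]
  have P: "sn_monomial n T pm (\<lambda>_ _. 1) (perm_module T pm)"
    by (rule sn_monomial_perm_module[OF M]) (auto intro: M'(4))
  \<comment> \<open>The isomorphism has parity q and must satisfy f(c_i x) = (-1)^q c_i f(x).
    Building this sign into the operators \<open>ga i\<close> lets f be a Clifford lift.\<close>
  define s :: complex where "s = (- 1) ^ q"
  have ss: "s * s = 1" by (simp add: s_def flip: power_add)
  define ga where "ga i x = cscale s (tensor_op (clifford_mult i) id x)" for i and x :: "nat set \<times> 'a \<Rightarrow>\<^sub>0 complex"
  have anti0: "anticommuting 1 (\<lambda>i. tensor_op (clifford_mult i) id)" by (rule anticommuting_tensor[OF anticommuting_clifford])
  note lin0 = clinear_tensor_op
  have anti: "anticommuting 1 ga"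
  proof (rule anticommutingI)
    fix i j and v :: "nat set \<times> 'a \<Rightarrow>\<^sub>0 complex"
    show "clinear (ga i)" unfolding ga_def by (rule clinear_cscale[OF lin0])
    show "ga i (ga i v) = cscale 1 v"
      unfolding ga_def clinear_scale[OF lin0] anticommutingD(2)[OF anti0] by (simp add: ss)
    assume "i \<noteq> j"
    show "ga i (ga j v) = - ga j (ga i v)"
      unfolding ga_def clinear_scale[OF lin0] anticommutingD(3)[OF anti0 \<open>i \<noteq> j\<close>] by simp
  qed
  define vv where "vv t = (basis_vec (B t, t) :: nat set \<times> 'a \<Rightarrow>\<^sub>0 complex)" for t
  define f where "f = lin_ext (\<lambda>(A, t). foldr ga (sorted_list_of_set A) (vv t))"
  have f: "clinear f" by (simp add: f_def)
  have f_basis: "f (basis_vec (A, t)) = foldr ga (sorted_list_of_set A) (vv t)" for A t by (simp add: f_def)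
  have f_lift: "f (tensor_vec u (basis_vec t)) = clifford_lift ga (vv t) u" for u t
    by (rule clinear_eq[OF clinear_compose[OF f clinear_tensor_vec_left] clinear_clifford_lift])
      (simp add: f_basis clifford_lift_def)
  have spP: "hc_space ?P = coords (Pow {1..n} \<times> T)" by (rule hc_space_hc_tensor[OF P])
  have spN: "hc_space ?N = coords (Pow {1..n} \<times> T)" by (rule hc_space_hc_tensor[OF M])
  have ga_hc: "ga i x = cscale s (hc_c ?N i x)" for i x
    by (simp add: ga_def hc_c_hc_tensor hc_c_clifford_module)
  have modN: "hc_module n ?N" by (rule hc_module_hc_tensor[OF M])
  have grade_fold: "foldr ga xs x \<in> grade ?N (p + of_nat (length xs))"
    if "set xs \<subseteq> {1..n}" "x \<in> grade ?N p" for xs x p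
    using that(1)
  proof (induction xs)
    case Nil
    then show ?case using that(2) by (simp only: list.size foldr.simps id_apply of_nat_0 add_0_right)
  next
    case (Cons i xs)
    then have "hc_c ?N i (foldr ga xs x) \<in> grade ?N (p + of_nat (length xs) + 1)"
      using hc_moduleD(5)[OF modN, of i "p + of_nat (length xs)"] by auto
    moreover have "p + of_nat (length xs) + 1 = p + of_nat (length (i # xs))" by (simp add: algebra_simps)
    ultimately have "hc_c ?N i (foldr ga xs x) \<in> grade ?N (p + of_nat (length (i # xs)))" by (simp only:)
    then have "cscale s (hc_c ?N i (foldr ga xs x)) \<in> grade ?N (p + of_nat (length (i # xs)))"
      by (rule cvs.subspace_scale[OF hc_moduleD(1)[OF modN]])
    then show ?case by (simp only: foldr.simps comp_apply ga_hc[of i "foldr ga xs x"])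
  qed
  have vv_grade: "vv t \<in> grade ?N (of_nat q)" if "t \<in> T" for t
    using B[OF that] that by (simp add: vv_def grade_hc_tensor[OF M] clifford_basis_def)
  have fin: "finite A" if "A \<subseteq> {1..n}" for A :: "nat set" using that by (rule finite_subset) simp
  have comm: "hc_s ?N w (foldr ga xs x) = foldr (\<lambda>i. ga (w i)) xs (hc_s ?N w x)"
    if w: "w permutes {1..n}" and xs: "set xs \<subseteq> {1..n}" and x: "x \<in> hc_space ?N" for w xs x
    using xs
  proof (induction xs)
    case Nil
    then show ?case by simp
  next
    case (Cons i xs)
    have "foldr ga xs x \<in> hc_space ?N"
    proof -
      have lin: "clinear (hc_c ?N i)" for i by (rule clinear_hc_tensor)
      have "hc_c ?N i ` hc_space ?N \<subseteq> hc_space ?N" if "i \<in> {1..n}" for i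
        unfolding spN
      proof (rule coords_image_subset[OF lin subspace_coords])
        fix y assume "y \<in> Pow {1..n} \<times> T"
        then obtain A t where y: "y = (A, t)" "A \<subseteq> {1..n}" "t \<in> T" by auto
        have "clifford_mult i (basis_vec A) \<in> coords (Pow {1..n})"
          unfolding clifford_mult_basis using y(2) that by (intro cvs.subspace_scale) auto
        then show "hc_c ?N i (basis_vec y) \<in> coords (Pow {1..n} \<times> T)"
          unfolding hc_c_hc_tensor hc_c_clifford_module y(1) tensor_op_basis using y(3)
          by (intro tensor_vec_in_coords) auto
      qed
      then have "ga i y \<in> hc_space ?N" if "i \<in> {1..n}" "y \<in> hc_space ?N" for i y
        unfolding ga_hc using that by (auto simp: spN intro!: cvs.subspace_scale[OF subspace_coords])
      with Cons.prems x show ?thesis by (induction xs) auto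
    qed
    then have "hc_s ?N w (ga i (foldr ga xs x)) = ga (w i) (hc_s ?N w (foldr ga xs x))"
      unfolding ga_hc clinear_scale[OF clinear_hc_tensor(1)] using hc_s_hc_c_hc_tensor[OF M w, of _ i] by (simp add: spN)
    then show ?case using Cons by simp
  qed
  have "hc_hom_of_parity n (of_nat q) ?P ?N f"
    unfolding hc_hom_of_parity_def
  proof (intro conjI allI ballI impI)
    show "clinear f" by (rule f)
    fix r
    show "f ` grade ?P r \<subseteq> grade ?N (r + of_nat q)"
      unfolding grade_hc_tensor[OF P]
    proof (rule coords_image_subset[OF f hc_moduleD(1)[OF modN]])
      fix y assume "y \<in> clifford_basis n r \<times> T"
      then obtain A t where y: "y = (A, t)" "A \<in> clifford_basis n r" "t \<in> T" by auto
      have A: "A \<subseteq> {1..n}" "of_nat (card A) = r" using y(2) by (auto simp: clifford_basis_def)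
      have "foldr ga (sorted_list_of_set A) (vv t) \<in> grade ?N (of_nat q + of_nat (length (sorted_list_of_set A)))"
        using A(1) fin[OF A(1)] vv_grade[OF y(3)] by (intro grade_fold) auto
      moreover have "of_nat (length (sorted_list_of_set A)) = r" using A(2) by simp
      ultimately show "f (basis_vec y) \<in> grade ?N (r + of_nat q)"
        unfolding y(1) f_basis by (simp only: add.commute)
    qed
  next
    fix x i assume x: "x \<in> hc_space ?P" and i: "i \<in> {1..n}"
    have "f (hc_c ?P i x) = ga i (f x)"
    proof (rule coords_linear_eq[OF clinear_compose[OF f clinear_hc_tensor(2)] clinear_compose[OF anticommutingD(1)[OF anti] f] _ x[unfolded spP]])
      fix y assume "y \<in> Pow {1..n} \<times> T"
      then obtain A t where y: "y = (A, t)" "A \<subseteq> {1..n}" "t \<in> T" by auto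
      show "f (hc_c ?P i (basis_vec y)) = ga i (f (basis_vec y))"
        unfolding y(1) hc_c_hc_tensor hc_c_clifford_module tensor_op_basis id_apply f_lift
          clifford_lift_mult[OF anti, of "basis_vec A", simplified, OF fin[OF y(2)]]
        by (simp add: f_basis clifford_lift_def)
    qed
    also have "\<dots> = (if of_nat q = (1 :: bit) then - hc_c ?N i (f x) else hc_c ?N i (f x))"
    proof -
      have "(of_nat q = (1 :: bit)) = odd q" by (induction q) auto
      then show ?thesis unfolding ga_hc s_def by (cases "even q") auto
    qed
    finally show "f (hc_c ?P i x) = (if of_nat q = (1 :: bit) then - hc_c ?N i (f x) else hc_c ?N i (f x))" .
  next
    fix x w assume x: "x \<in> hc_space ?P" and w: "w permutes {1..n}"
    show "f (hc_s ?P w x) = hc_s ?N w (f x)"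
    proof (rule coords_linear_eq[OF clinear_compose[OF f clinear_hc_tensor(1)] clinear_compose[OF clinear_hc_tensor(1) f] _ x[unfolded spP]])
      fix y assume "y \<in> Pow {1..n} \<times> T"
      then obtain A t where y: "y = (A, t)" "A \<subseteq> {1..n}" "t \<in> T" by auto
      \<comment> \<open>Here the two signs meet: the one of w on c_(B t) and the one on t are equal,
        so their product is 1.\<close>
      have vw: "hc_s ?N w (vv t) = vv (pm w t)"
        unfolding vv_def hc_s_hc_tensor_basis[OF M w fin[OF conjunct1[OF B[OF y(3)]]] y(3)]
        using Bw[OF w y(3)] by (simp add: perm_sign_square)
      have vsp: "vv t \<in> hc_space ?N" using B[OF y(3)] y(3) by (simp add: spN vv_def)
      have "f (hc_s ?P w (basis_vec y)) = cscale (perm_sign w A) (foldr ga (sorted_list_of_set (w ` A)) (vv (pm w t)))"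
        unfolding y(1) hc_s_hc_tensor_basis[OF P w fin[OF y(2)] y(3)] clinear_scale[OF f] f_basis by simp
      also have "\<dots> = foldr (\<lambda>i. ga (w i)) (sorted_list_of_set A) (hc_s ?N w (vv t))"
        unfolding vw by (rule anticommuting_image[OF anti permutes_inj[OF w] fin[OF y(2)], symmetric])
      also have "\<dots> = hc_s ?N w (f (basis_vec y))"
        unfolding y(1) f_basis using comm[OF w _ vsp, of "sorted_list_of_set A"] y(2) fin[OF y(2)] by simp
      finally show "f (hc_s ?P w (basis_vec y)) = hc_s ?N w (f (basis_vec y))" .
    qed
  qed
  moreover have "bij_betw f (hc_space ?P) (hc_space ?N)"
    unfolding spP spN
  proof (rule bij_betw_coords[OF f])
    \<comment> \<open>Taking the symmetric difference with B t is an involution, so the map is its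
      own inverse.\<close>
    let ?h = "\<lambda>(A, t). ((A - B t) \<union> (B t - A), t)"
    show "bij_betw ?h (Pow {1..n} \<times> T) (Pow {1..n} \<times> T)"
      using B by (intro bij_betw_byWitness[where f' = ?h]) auto
    define e where "e y = (SOME e. e \<noteq> 0 \<and> f (basis_vec y) = cscale e (basis_vec (?h y)))" for y
    have e: "e y \<noteq> 0 \<and> f (basis_vec y) = cscale (e y) (basis_vec (?h y))" if "y \<in> Pow {1..n} \<times> T" for y
    proof -
      obtain A t where y: "y = (A, t)" "A \<subseteq> {1..n}" "t \<in> T" using \<open>y \<in> Pow {1..n} \<times> T\<close> by auto
      have "ga = (\<lambda>i x. cscale s (tensor_op (clifford_mult i) id x))" by (simp add: ga_def fun_eq_iff)
      then have "\<exists>e. e \<noteq> 0 \<and> f (basis_vec y) = cscale e (basis_vec (?h y))"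
        using foldr_signed_clifford[OF distinct_sorted_list_of_set ss, of A "B t" t] fin[OF y(2)]
        by (simp add: y(1) f_basis vv_def)
      then show ?thesis unfolding e_def by (rule someI_ex)
    qed
    show "\<And>y. y \<in> Pow {1..n} \<times> T \<Longrightarrow> f (basis_vec y) = cscale (e y) (basis_vec (?h y))" using e by blast
    show "\<And>y. y \<in> Pow {1..n} \<times> T \<Longrightarrow> e y \<noteq> 0" using e by blast
  qed
  ultimately show ?thesis by (rule that)
qed

section \<open>Classes and composition series\<close>

lemma hc_hom_of_parityD:
  assumes "hc_hom_of_parity n p M N f"
  shows "clinear f" "f ` grade M q \<subseteq> grade N (q + p)"
    "x \<in> hc_space M \<Longrightarrow> i \<in> {1..n} \<Longrightarrow> f (hc_c M i x) = (if p = 1 then - hc_c N i (f x) else hc_c N i (f x))"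
    "x \<in> hc_space M \<Longrightarrow> w permutes {1..n} \<Longrightarrow> f (hc_s M w x) = hc_s N w (f x)"
  using assms by (simp_all add: hc_hom_of_parity_def)

lemma hc_hom_of_parityI:
  assumes "clinear f" "\<And>q x. x \<in> grade M q \<Longrightarrow> f x \<in> grade N (q + p)"
    "\<And>x i. x \<in> hc_space M \<Longrightarrow> i \<in> {1..n} \<Longrightarrow> f (hc_c M i x) = (if p = 1 then - hc_c N i (f x) else hc_c N i (f x))"
    "\<And>x w. x \<in> hc_space M \<Longrightarrow> w permutes {1..n} \<Longrightarrow> f (hc_s M w x) = hc_s N w (f x)"
  shows "hc_hom_of_parity n p M N f"
  using assms unfolding hc_hom_of_parity_def image_subset_iff by blast

lemma hc_spaceI: "x \<in> grade M 0 \<Longrightarrow> y \<in> grade M 1 \<Longrightarrow> x + y \<in> hc_space M"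
  by (auto simp: hc_space_def)

lemma hc_spaceE:
  assumes "x \<in> hc_space M"
  obtains u v where "x = u + v" "u \<in> grade M 0" "v \<in> grade M 1"
  using assms by (auto simp: hc_space_def)

lemma grade_subset_hc_space:
  assumes "hc_module n M"
  shows "grade M p \<subseteq> hc_space M"
proof
  fix x assume x: "x \<in> grade M p"
  have "x = x + 0" "x = 0 + x" by simp_all
  then show "x \<in> hc_space M"
    using x cvs.subspace_0[OF hc_moduleD(1)[OF assms]] hc_spaceI[of x M 0] hc_spaceI[of 0 M x] by (cases p) auto
qed

lemma subspace_hc_space:
  assumes "hc_module n M"
  shows "cvs.subspace (hc_space M)"
  unfolding hc_space_def
  using cvs.subspace_sums[OF hc_moduleD(1)[OF assms, of 0] hc_moduleD(1)[OF assms, of 1]] .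

lemma grade_sum_eq:
  assumes "hc_module n M" "u \<in> grade M 0" "v \<in> grade M 1" "u' \<in> grade M 0" "v' \<in> grade M 1" "u + v = u' + v'"
  shows "u = u'" "v = v'"
proof -
  have "u - u' = v' - v" using assms(6) by (metis add.commute add_diff_eq diff_add_cancel diff_diff_eq2 eq_diff_eq)
  moreover have "u - u' \<in> grade M 0" "v' - v \<in> grade M 1"
    using assms(2-5) cvs.subspace_diff[OF hc_moduleD(1)[OF assms(1)]] by auto
  ultimately have "u - u' \<in> grade M 0 \<inter> grade M 1" by simp
  then have "u - u' = 0" using hc_moduleD(2)[OF assms(1)] by simp
  then show "u = u'" "v = v'" using assms(6) by simp_all
qed

lemma hc_space_split:
  assumes "x \<in> hc_space M"
  shows "\<exists>a b. x = a + b \<and> a \<in> grade M r \<and> b \<in> grade M (r + 1)"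
proof -
  obtain u v where uv: "x = u + v" "u \<in> grade M 0" "v \<in> grade M 1" using hc_spaceE[OF assms] .
  show ?thesis
  proof (cases r)
    case zero
    then show ?thesis using uv by auto
  next
    case one
    then show ?thesis using uv by (intro exI[of _ v] exI[of _ u]) (auto simp: add.commute)
  qed
qed

lemma grade_disjoint:
  assumes "hc_module n M" "x \<in> grade M q" "x \<in> grade M (q + 1)"
  shows "x = 0"
  using hc_moduleD(2)[OF assms(1)] assms(2,3) by (cases q) auto

lemma hc_space_ops:
  assumes "hc_module n M" "x \<in> hc_space M"
  shows "i \<in> {1..n} \<Longrightarrow> hc_c M i x \<in> hc_space M" "w permutes {1..n} \<Longrightarrow> hc_s M w x \<in> hc_space M"
proof -
  obtain u v where x: "x = u + v" "u \<in> grade M 0" "v \<in> grade M 1" using hc_spaceE[OF assms(2)] .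
  note M = hc_moduleD[OF assms(1)]
  show "hc_c M i x \<in> hc_space M" if i: "i \<in> {1..n}"
  proof -
    have "hc_c M i u \<in> grade M (0 + 1)" "hc_c M i v \<in> grade M (1 + 1)"
      using M(5)[OF i] x by blast+
    then have "hc_c M i v + hc_c M i u \<in> hc_space M" by (intro hc_spaceI) simp_all
    then show ?thesis using x(1) clinear_add[OF M(4)[OF i]] by (simp add: add.commute)
  qed
  show "hc_s M w x \<in> hc_space M" if w: "w permutes {1..n}"
    using M(7)[OF w] x clinear_add[OF M(6)[OF w]] by (auto intro!: hc_spaceI)
qed

lemma hc_hom_space:
  assumes "hc_hom_of_parity n p M N f" "hc_module n N" "x \<in> hc_space M"
  shows "f x \<in> hc_space N"
proof -
  obtain u v where x: "x = u + v" "u \<in> grade M 0" "v \<in> grade M 1" using hc_spaceE[OF assms(3)] .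
  have "f u \<in> hc_space N" "f v \<in> hc_space N"
    using hc_hom_of_parityD(2)[OF assms(1)] x grade_subset_hc_space[OF assms(2)] by blast+
  then show ?thesis
    using x clinear_add[OF hc_hom_of_parityD(1)[OF assms(1)]] cvs.subspace_add[OF subspace_hc_space[OF assms(2)]] by auto
qed

lemma hc_hom_compose:
  assumes "hc_hom_of_parity n p M N f" "hc_hom_of_parity n q N L g" "hc_module n N"
  shows "hc_hom_of_parity n (p + q) M L (\<lambda>x. g (f x))"
proof (rule hc_hom_of_parityI)
  note f = hc_hom_of_parityD[OF assms(1)] and g = hc_hom_of_parityD[OF assms(2)]
  show "clinear (\<lambda>x. g (f x))" by (rule clinear_compose[OF g(1) f(1)])
  show "g (f x) \<in> grade L (r + (p + q))" if "x \<in> grade M r" for r x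
    using f(2)[of r] g(2)[of "r + p"] that by (metis add.assoc image_subset_iff)
  fix x assume x: "x \<in> hc_space M"
  have fx: "f x \<in> hc_space N" by (rule hc_hom_space[OF assms(1,3) x])
  show "g (f (hc_c M i x)) = (if p + q = 1 then - hc_c L i (g (f x)) else hc_c L i (g (f x)))" if "i \<in> {1..n}" for i
    using f(3)[OF x that] g(3)[OF fx that] clinear_neg[OF g(1)] by (cases p; cases q) auto
  show "g (f (hc_s M w x)) = hc_s L w (g (f x))" if "w permutes {1..n}" for w
    using f(4)[OF x that] g(4)[OF fx that] by simp
qed

lemma vector_space_pair_cscale:
  "vector_space_pair (cscale :: complex \<Rightarrow> ('a \<Rightarrow>\<^sub>0 complex) \<Rightarrow> _) (cscale :: complex \<Rightarrow> ('b \<Rightarrow>\<^sub>0 complex) \<Rightarrow> _)"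
  by (intro vector_space_pair.intro cvs.vector_space_axioms)

text \<open>A linear left inverse on the whole ambient space exists because f is injective on the
  module. Its homogeneity needs an argument: the component of g y in the wrong degree is mapped by f
  into both degrees at once, so it vanishes.\<close>

lemma hc_iso_inverse:
  assumes M: "hc_module n M" and N: "hc_module n N" and f: "hc_hom_of_parity n p M N f"
    and bij: "bij_betw f (hc_space M) (hc_space N)"
  obtains g where "hc_hom_of_parity n p N M g" "\<And>x. x \<in> hc_space M \<Longrightarrow> g (f x) = x"
    "\<And>y. y \<in> hc_space N \<Longrightarrow> f (g y) = y" "bij_betw g (hc_space N) (hc_space M)"
proof -
  note f' = hc_hom_of_parityD[OF f]
  have inj: "inj_on f (hc_space M)" and img: "f ` hc_space M = hc_space N" using bij by (auto simp: bij_betw_def)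
  obtain g where g: "clinear g" "\<And>x. x \<in> hc_space M \<Longrightarrow> g (f x) = x"
    using vector_space_pair.linear_exists_left_inverse_on[OF vector_space_pair_cscale f'(1) subspace_hc_space[OF M] inj]
    by blast
  have fg: "f (g y) = y" and gy: "g y \<in> hc_space M" if "y \<in> hc_space N" for y
    using that g(2) img by (metis imageE)+
  have "hc_hom_of_parity n p N M g"
  proof (rule hc_hom_of_parityI[OF g(1)])
    fix q y assume y: "y \<in> grade N q"
    then have ysp: "y \<in> hc_space N" using grade_subset_hc_space[OF N] by blast
    obtain a b where ab: "g y = a + b" "a \<in> grade M (q + p)" "b \<in> grade M (q + p + 1)"
      using hc_space_split[OF gy[OF ysp]] by blast
    have bsp: "b \<in> hc_space M" using ab(3) grade_subset_hc_space[OF M] by blast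
    have "q + p + p = q" "q + p + 1 + p = q + 1" by (cases p; cases q; simp)+
    then have fa: "f a \<in> grade N q" "f b \<in> grade N (q + 1)" using f'(2) ab(2,3) by (metis image_subset_iff)+
    have "f b = y - f a" using fg[OF ysp] ab(1) clinear_add[OF f'(1)] by (metis add_diff_cancel_left')
    then have "f b \<in> grade N q" using cvs.subspace_diff[OF hc_moduleD(1)[OF N] y fa(1)] by simp
    then have "f b = 0" using grade_disjoint[OF N _ fa(2)] by blast
    then have "b = 0" using g(2)[OF bsp] clinear_0[OF g(1)] by simp
    then show "g y \<in> grade M (q + p)" using ab by simp
  next
    fix y i assume y: "y \<in> hc_space N" and i: "i \<in> {1..n}"
    have "f (if p = 1 then - hc_c M i (g y) else hc_c M i (g y)) = hc_c N i y"
      using f'(3)[OF gy[OF y] i] fg[OF y] clinear_neg[OF f'(1)] by simp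
    moreover have "(if p = 1 then - hc_c M i (g y) else hc_c M i (g y)) \<in> hc_space M"
      using hc_space_ops(1)[OF M gy[OF y] i] cvs.subspace_neg[OF subspace_hc_space[OF M]] by simp
    ultimately show "g (hc_c N i y) = (if p = 1 then - hc_c M i (g y) else hc_c M i (g y))"
      using g(2) by metis
  next
    fix y w assume y: "y \<in> hc_space N" and w: "w permutes {1..n}"
    show "g (hc_s N w y) = hc_s M w (g y)"
      using f'(4)[OF gy[OF y] w] fg[OF y] g(2)[OF hc_space_ops(2)[OF M gy[OF y] w]] by simp
  qed
  moreover have "bij_betw g (hc_space N) (hc_space M)"
    using g(2) fg gy img by (intro bij_betw_byWitness[where f' = f]) auto
  ultimately show ?thesis using that g(2) fg by blast
qed

lemma span_into:
  assumes "clinear f" "cvs.subspace W" "\<And>b. b \<in> B \<Longrightarrow> f b \<in> W" "x \<in> cvs.span B"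
  shows "f x \<in> W"
proof -
  have "cvs.subspace {x. f x \<in> W}"
    unfolding cvs.subspace_def using assms(1,2)
    by (auto simp: clinear_0 clinear_add clinear_scale cvs.subspace_0 cvs.subspace_add cvs.subspace_scale)
  then have "cvs.span B \<subseteq> {x. f x \<in> W}" using assms(3) by (intro cvs.span_minimal) auto
  then show ?thesis using assms(4) by blast
qed

lemma independent_union:
  assumes "finite A" "finite B" "cvs.independent A" "cvs.independent B" "cvs.span A \<inter> cvs.span B = {0}"
  shows "cvs.independent (A \<union> B)"
proof (rule cvs.independent_if_scalars_zero)
  show "finite (A \<union> B)" using assms by simp
  have disj: "A \<inter> B = {}"
  proof -
    have "A \<inter> B \<subseteq> {0}" using assms(5) cvs.span_superset by blast
    moreover have "0 \<notin> A" using assms(3) cvs.dependent_zero by blast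
    ultimately show ?thesis by blast
  qed
  fix f x assume s: "(\<Sum>x\<in>A \<union> B. cscale (f x) x) = 0" and x: "x \<in> A \<union> B"
  let ?a = "\<Sum>x\<in>A. cscale (f x) x" and ?b = "\<Sum>x\<in>B. cscale (f x) x"
  have ab: "?a + ?b = 0" using s assms(1,2) disj by (simp add: sum.union_disjoint)
  have "?a \<in> cvs.span A" "?b \<in> cvs.span B"
    by (rule cvs.span_sum, rule cvs.span_scale, rule cvs.span_base, assumption)+
  moreover have "?a = - ?b" using ab by (simp add: eq_neg_iff_add_eq_0)
  ultimately have "?a \<in> cvs.span A \<inter> cvs.span B" using cvs.span_neg[of ?b B] by simp
  then have a0: "?a = 0" using assms(5) by simp
  then have b0: "?b = 0" using ab by simp
  show "f x = 0"
    using x cvs.independentD[OF assms(3,1) order_refl a0] cvs.independentD[OF assms(4,2) order_refl b0] by auto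
qed

text \<open>A map compatible with the operators carries the module relations over to its image. That
  the two degrees still meet only in 0 is not inherited, hence \<open>disj\<close> is
  assumed.\<close>

lemma hc_module_image:
  assumes M: "hc_module n M" and pi: "clinear \<pi>"
    and gr: "\<And>p. grade M' p = \<pi> ` grade M p" and disj: "grade M' 0 \<inter> grade M' 1 = {0}"
    and lin: "\<And>i. i \<in> {1..n} \<Longrightarrow> clinear (hc_c M' i)" "\<And>w. w permutes {1..n} \<Longrightarrow> clinear (hc_s M' w)"
    and c: "\<And>x i. x \<in> hc_space M \<Longrightarrow> i \<in> {1..n} \<Longrightarrow> hc_c M' i (\<pi> x) = \<pi> (hc_c M i x)"
    and s: "\<And>x w. x \<in> hc_space M \<Longrightarrow> w permutes {1..n} \<Longrightarrow> hc_s M' w (\<pi> x) = \<pi> (hc_s M w x)"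
  shows "hc_module n M'" "hc_hom_of_parity n 0 M M' \<pi>" "\<pi> ` hc_space M = hc_space M'"
proof -
  note M' = hc_moduleD[OF M]
  note sub = grade_subset_hc_space[OF M]
  have linh: "module_hom cscale cscale \<pi>" using pi by (simp add: module_hom_iff_linear)
  show sp: "\<pi> ` hc_space M = hc_space M'"
  proof (intro equalityI subsetI)
    fix y assume "y \<in> \<pi> ` hc_space M"
    then obtain x where x: "x \<in> hc_space M" "y = \<pi> x" by blast
    then obtain u v where "x = u + v" "u \<in> grade M 0" "v \<in> grade M 1" using hc_spaceE by metis
    then show "y \<in> hc_space M'" using x(2) by (auto simp: clinear_add[OF pi] gr intro!: hc_spaceI)
  next
    fix y assume "y \<in> hc_space M'"
    then obtain u v where "y = \<pi> u + \<pi> v" "u \<in> grade M 0" "v \<in> grade M 1"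
      using hc_spaceE[of y M'] unfolding gr by blast
    then have "y = \<pi> (u + v)" "u + v \<in> hc_space M" by (auto simp: clinear_add[OF pi] intro: hc_spaceI)
    then show "y \<in> \<pi> ` hc_space M" by blast
  qed
  have subsp: "cvs.subspace (\<pi> ` grade M p)" for p
    using module_hom.subspace_image[OF linh M'(1)] .
  show "hc_module n M'"
  proof (rule hc_moduleI)
    show "cvs.subspace (grade M' p)" for p unfolding gr by (rule subsp)
    show "grade M' 0 \<inter> grade M' 1 = {0}" by (rule disj)
    obtain B where B: "finite B" "hc_space M = cvs.span B" using M'(3) by blast
    have "hc_space M' = cvs.span (\<pi> ` B)"
      unfolding sp[symmetric] B(2) by (rule module_hom.span_image[OF linh, symmetric])
    then show "\<exists>B. finite B \<and> hc_space M' = cvs.span B" using B(1) by blast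
    show "hc_c M' i ` grade M' p \<subseteq> grade M' (p + 1)" if "i \<in> {1..n}" for i p
    proof
      fix y assume "y \<in> hc_c M' i ` grade M' p"
      then obtain x where x: "x \<in> grade M p" "y = hc_c M' i (\<pi> x)" unfolding gr by blast
      then have "y = \<pi> (hc_c M i x)" using c[OF _ that] sub by blast
      moreover have "hc_c M i x \<in> grade M (p + 1)" using M'(5)[OF that] x(1) by blast
      ultimately show "y \<in> grade M' (p + 1)" unfolding gr by blast
    qed
    show "hc_s M' w ` grade M' p \<subseteq> grade M' p" if "w permutes {1..n}" for w p
    proof
      fix y assume "y \<in> hc_s M' w ` grade M' p"
      then obtain x where x: "x \<in> grade M p" "y = hc_s M' w (\<pi> x)" unfolding gr by blast
      then have "y = \<pi> (hc_s M w x)" using s[OF _ that] sub by blast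
      moreover have "hc_s M w x \<in> grade M p" using M'(7)[OF that] x(1) by blast
      ultimately show "y \<in> grade M' p" unfolding gr by blast
    qed
    fix y assume "y \<in> hc_space M'"
    then obtain x where x: "x \<in> hc_space M" "y = \<pi> x" unfolding sp[symmetric] by blast
    note ops = hc_space_ops[OF M x(1)]
    show "hc_c M' i (hc_c M' i y) = y" if "i \<in> {1..n}" for i
      using that x ops c M'(8)[OF x(1) that] by simp
    show "hc_c M' i (hc_c M' j y) = - hc_c M' j (hc_c M' i y)" if "i \<in> {1..n}" "j \<in> {1..n}" "i \<noteq> j" for i j
      unfolding x(2) c[OF x(1) that(1)] c[OF x(1) that(2)] c[OF ops(1)[OF that(1)] that(2)] c[OF ops(1)[OF that(2)] that(1)]
        M'(9)[OF x(1) that] clinear_neg[OF pi] ..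
    show "hc_s M' id y = y"
      using x s[OF x(1) permutes_id] M'(10)[OF x(1)] by simp
    show "hc_s M' (v \<circ> w) y = hc_s M' v (hc_s M' w y)" if "v permutes {1..n}" "w permutes {1..n}" for v w
      unfolding x(2) s[OF x(1) that(2)] s[OF ops(2)[OF that(2)] that(1)] s[OF x(1) permutes_compose[OF that(2,1)]]
        M'(11)[OF x(1) that] ..
    have tr: "transpose i (i + 1) permutes {1..n}" if "i \<in> {1..<n}" for i using that by (intro permutes_swap_id) auto
    show "hc_s M' (transpose i (i + 1)) (hc_c M' i y) = hc_c M' (i + 1) (hc_s M' (transpose i (i + 1)) y)" if "i \<in> {1..<n}" for i
    proof -
      have i: "i \<in> {1..n}" "i + 1 \<in> {1..n}" using that by auto
      show ?thesis
        unfolding x(2) c[OF x(1) i(1)] s[OF x(1) tr[OF that]] s[OF ops(1)[OF i(1)] tr[OF that]] c[OF ops(2)[OF tr[OF that]] i(2)]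
          M'(12)[OF x(1) that] ..
    qed
    show "hc_s M' (transpose i (i + 1)) (hc_c M' j y) = hc_c M' j (hc_s M' (transpose i (i + 1)) y)"
      if "i \<in> {1..<n}" "j \<in> {1..n} - {i, i + 1}" for i j
    proof -
      have j: "j \<in> {1..n}" using that by auto
      show ?thesis
        unfolding x(2) c[OF x(1) j] s[OF x(1) tr[OF that(1)]] s[OF ops(1)[OF j] tr[OF that(1)]] c[OF ops(2)[OF tr[OF that(1)]] j]
          M'(13)[OF x(1) that] ..
    qed
  qed (use lin in auto)
  show "hc_hom_of_parity n 0 M M' \<pi>"
    by (rule hc_hom_of_parityI[OF pi]) (auto simp: gr c s)
qed

lemma hc_submoduleD:
  assumes "hc_submodule n M U"
  shows "cvs.subspace U" "U \<subseteq> hc_space M"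
    "x \<in> U \<Longrightarrow> \<exists>u v. x = u + v \<and> u \<in> U \<inter> grade M 0 \<and> v \<in> U \<inter> grade M 1"
    "i \<in> {1..n} \<Longrightarrow> x \<in> U \<Longrightarrow> hc_c M i x \<in> U" "w permutes {1..n} \<Longrightarrow> x \<in> U \<Longrightarrow> hc_s M w x \<in> U"
  using assms unfolding hc_submodule_def by blast+

text \<open>In each degree a basis of the part of U is extended to one of the module. The added
  vectors, numbered by e, become the basis of the quotient; \<pi> kills U, and \<sigma> is a section
  through which the operators are transported.\<close>

lemma quotient_model:
  assumes M: "hc_module n (M :: 'b hcmod)" and U: "hc_submodule n M U"
  obtains M' :: "nat hcmod" and \<pi> where "hc_module n M'" "hc_hom_of_parity n 0 M M' \<pi>"
    "\<pi> ` hc_space M = hc_space M'" "{x \<in> hc_space M. \<pi> x = 0} = U"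
proof -
  note M' = hc_moduleD[OF M] and U' = hc_submoduleD[OF U]
  have sub: "grade M p \<subseteq> hc_space M" for p by (rule grade_subset_hc_space[OF M])
  have Up: "cvs.subspace (U \<inter> grade M p)" for p using U'(1) M'(1) by (intro cvs.subspace_inter)
  have "\<exists>BU B. BU \<subseteq> B \<and> B \<subseteq> grade M p \<and> cvs.independent B \<and> grade M p \<subseteq> cvs.span B \<and>
      BU \<subseteq> U \<inter> grade M p \<and> U \<inter> grade M p \<subseteq> cvs.span BU \<and> finite B" for p
  proof -
    obtain BU where BU: "BU \<subseteq> U \<inter> grade M p" "cvs.independent BU" "U \<inter> grade M p \<subseteq> cvs.span BU"
      using cvs.maximal_independent_subset by blast
    obtain B where B: "BU \<subseteq> B" "B \<subseteq> grade M p" "cvs.independent B" "grade M p \<subseteq> cvs.span B"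
      using cvs.maximal_independent_subset_extend[OF _ BU(2), of "grade M p"] BU(1) by blast
    obtain C where "finite C" "hc_space M = cvs.span C" using M'(3) by blast
    then have "finite B" using cvs.independent_span_bound[of C B] B(2,3) sub by blast
    then show ?thesis using BU B by blast
  qed
  then obtain BU B where BB: "\<And>p. BU p \<subseteq> B p" "\<And>p. B p \<subseteq> grade M p" "\<And>p. cvs.independent (B p)"
    "\<And>p. grade M p \<subseteq> cvs.span (B p)" "\<And>p. BU p \<subseteq> U \<inter> grade M p" "\<And>p. U \<inter> grade M p \<subseteq> cvs.span (BU p)" "\<And>p. finite (B p)"
    by metis
  have spB: "cvs.span (B p) = grade M p" for p
    using BB(2,4) cvs.span_minimal[OF _ M'(1)] by blast
  have ind: "cvs.independent (B 0 \<union> B 1)"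
    using BB M'(2) by (intro independent_union) (auto simp: spB)
  have disjB: "B 0 \<inter> B 1 = {}"
  proof -
    have "B 0 \<inter> B 1 \<subseteq> {0}" using BB(2) M'(2) by blast
    moreover have "0 \<notin> B 0" using BB(3) cvs.dependent_zero by blast
    ultimately show ?thesis by blast
  qed
  define C where "C p = B p - BU p" for p :: bit
  have finC: "finite (C 0 \<union> C 1)" using BB(7) by (simp add: C_def)
  obtain e :: "('b \<Rightarrow>\<^sub>0 complex) \<Rightarrow> nat" where e: "inj_on e (C 0 \<union> C 1)"
    using finite_imp_inj_to_nat_seg[OF finC] by blast
  define f where "f b = (if b \<in> C 0 \<union> C 1 then basis_vec (e b) else 0)" for b
  obtain \<pi> where pi: "clinear \<pi>" "\<And>b. b \<in> B 0 \<union> B 1 \<Longrightarrow> \<pi> b = f b"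
    using vector_space_pair.linear_independent_extend[OF vector_space_pair_cscale ind, of f] by blast
  define \<sigma> where "\<sigma> = lin_ext (\<lambda>k. if k \<in> e ` (C 0 \<union> C 1) then inv_into (C 0 \<union> C 1) e k else 0)"
  have sig: "clinear \<sigma>" by (simp add: \<sigma>_def)
  have sig_e: "\<sigma> (basis_vec (e b)) = b" if "b \<in> C p" for b p
    using that e by (cases p) (auto simp: \<sigma>_def)
  have pi_C: "\<pi> b = basis_vec (e b)" if "b \<in> C p" for b p
    using that pi(2)[of b] by (cases p) (auto simp: f_def C_def)
  have pi_BU: "\<pi> b = 0" if "b \<in> BU p" for b p
  proof -
    have "b \<in> B p" using that BB(1) by blast
    moreover have "b \<notin> C 0 \<union> C 1"
      using that BB(1) disjB by (cases p) (auto simp: C_def)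
    ultimately show ?thesis using pi(2)[of b] by (cases p) (auto simp: f_def)
  qed
  have section_pi: "\<sigma> (\<pi> x) - x \<in> U \<inter> grade M p" if x: "x \<in> grade M p" for x p
  proof (rule span_into[where f = "\<lambda>x. \<sigma> (\<pi> x) - x" and B = "B p"])
    show "clinear (\<lambda>x. \<sigma> (\<pi> x) - x)"
      using clinear_plus[OF clinear_compose[OF sig pi(1)] clinear_uminus[OF clinear_id(2)]] by simp
    show "x \<in> cvs.span (B p)" using x spB by simp
    fix b assume b: "b \<in> B p"
    show "\<sigma> (\<pi> b) - b \<in> U \<inter> grade M p"
    proof (cases "b \<in> BU p")
      case True
      then show ?thesis using pi_BU[OF True] clinear_0[OF sig] BB(5)[of p] cvs.subspace_neg[OF Up[of p], of b] by auto
    next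
      case False
      then have "b \<in> C p" using b by (simp add: C_def)
      then show ?thesis using pi_C sig_e cvs.subspace_0[OF Up[of p]] by simp
    qed
  qed (rule Up)
  have gr: "\<pi> ` grade M p = coords (e ` C p)" for p
  proof
    have "\<pi> x \<in> coords (e ` C p)" if "x \<in> grade M p" for x
    proof (rule span_into[OF pi(1) subspace_coords, where B = "B p"])
      show "x \<in> cvs.span (B p)" using that spB by simp
      show "\<pi> b \<in> coords (e ` C p)" if "b \<in> B p" for b
        using that pi_BU[of b p] pi_C[of b p] by (cases "b \<in> BU p") (auto simp: C_def)
    qed
    then show "\<pi> ` grade M p \<subseteq> coords (e ` C p)" by blast
    show "coords (e ` C p) \<subseteq> \<pi> ` grade M p"
    proof
      fix y assume y: "y \<in> coords (e ` C p)"
      have "\<pi> (\<sigma> y) = y"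
        by (rule coords_linear_eq[OF clinear_compose[OF pi(1) sig] clinear_id(2) _ y]) (auto simp: sig_e pi_C)
      moreover have "\<sigma> ` coords (e ` C p) \<subseteq> grade M p"
      proof (rule coords_image_subset[OF sig M'(1)])
        fix k assume "k \<in> e ` C p"
        then obtain b where "b \<in> C p" "k = e b" by blast
        then show "\<sigma> (basis_vec k) \<in> grade M p" using sig_e BB(2) by (auto simp: C_def)
      qed
      ultimately show "y \<in> \<pi> ` grade M p" using y by (metis image_eqI image_subset_iff)
    qed
  qed
  have ker_U: "\<pi> x = 0" if xU: "x \<in> U" for x
  proof -
    obtain u v where uv: "x = u + v" "u \<in> U \<inter> grade M 0" "v \<in> U \<inter> grade M 1" using U'(3)[OF xU] by blast
    have "\<pi> y \<in> {0}" if "y \<in> U \<inter> grade M p" for y p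
      by (rule span_into[OF pi(1), where B = "BU p"]) (use that BB(6)[of p] pi_BU in auto)
    then show ?thesis using uv clinear_add[OF pi(1)] by auto
  qed
  have back_sp: "\<sigma> (\<pi> x) - x \<in> U" if x: "x \<in> hc_space M" for x
  proof -
    obtain u v where uv: "x = u + v" "u \<in> grade M 0" "v \<in> grade M 1" using hc_spaceE[OF x] .
    have eq: "\<sigma> (\<pi> x) - x = (\<sigma> (\<pi> u) - u) + (\<sigma> (\<pi> v) - v)"
      using uv(1) by (simp add: clinear_add[OF pi(1)] clinear_add[OF sig])
    show ?thesis
      unfolding eq by (rule cvs.subspace_add[OF U'(1)]) (use section_pi uv in blast)+
  qed
  define M' :: "nat hcmod" where "M' = \<lparr>grade = (\<lambda>p. coords (e ` C p)),
    hc_c = (\<lambda>i x. \<pi> (hc_c M i (\<sigma> x))), hc_s = (\<lambda>w x. \<pi> (hc_s M w (\<sigma> x)))\<rparr>"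
  \<comment> \<open>Since \<sigma> (\<pi> x) differs from x by an element of U, an operator that
    preserves U gives both the same image in the quotient.\<close>
  have op: "\<pi> (h (\<sigma> (\<pi> x))) = \<pi> (h x)" if "clinear h" "\<And>y. y \<in> U \<Longrightarrow> h y \<in> U" "x \<in> hc_space M" for h x
  proof -
    have "\<pi> (h (\<sigma> (\<pi> x) - x)) = 0" using back_sp[OF that(3)] that(2) ker_U by blast
    then show ?thesis by (simp add: clinear_diff[OF that(1)] clinear_diff[OF pi(1)])
  qed
  note CM = hc_moduleD[OF M]
  have disj: "grade M' 0 \<inter> grade M' 1 = {0}"
  proof -
    have "e ` C 0 \<inter> e ` C 1 = {}"
      using e disjB by (auto simp: C_def inj_on_def)
    then show ?thesis by (simp add: M'_def coords_disjoint)
  qed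
  have c: "hc_c M' i (\<pi> x) = \<pi> (hc_c M i x)" if "x \<in> hc_space M" "i \<in> {1..n}" for x i
    unfolding M'_def using op[OF CM(4)[OF that(2)] _ that(1)] U'(4)[OF that(2)] by simp
  have s: "hc_s M' w (\<pi> x) = \<pi> (hc_s M w x)" if "x \<in> hc_space M" "w permutes {1..n}" for x w
    unfolding M'_def using op[OF CM(6)[OF that(2)] _ that(1)] U'(5)[OF that(2)] by simp
  have lin_c: "clinear (hc_c M' i)" if "i \<in> {1..n}" for i
    unfolding M'_def using clinear_compose[OF pi(1) clinear_compose[OF CM(4)[OF that] sig]] by simp
  have lin_s: "clinear (hc_s M' w)" if "w permutes {1..n}" for w
    unfolding M'_def using clinear_compose[OF pi(1) clinear_compose[OF CM(6)[OF that] sig]] by simp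
  have gr': "grade M' p = \<pi> ` grade M p" for p by (simp add: M'_def gr)
  note im = hc_module_image[OF M pi(1) gr' disj lin_c lin_s c s]
  have "{x \<in> hc_space M. \<pi> x = 0} = U"
  proof
    show "U \<subseteq> {x \<in> hc_space M. \<pi> x = 0}" using ker_U U'(2) by blast
    have "x \<in> U" if "x \<in> hc_space M" "\<pi> x = 0" for x
      using back_sp[OF that(1)] that(2) clinear_0[OF sig] cvs.subspace_neg[OF U'(1), of "- x"] by simp
    then show "{x \<in> hc_space M. \<pi> x = 0} \<subseteq> U" by blast
  qed
  then show ?thesis using that[OF im(1,2,3)] by blast
qed

section \<open>Classes in the Grothendieck group\<close>

definition zero_hcmod :: "nat hcmod" where
  "zero_hcmod = \<lparr>grade = (\<lambda>_. {0}), hc_c = (\<lambda>_ _. 0), hc_s = (\<lambda>_ _. 0)\<rparr>"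

lemma hc_space_zero_hcmod: "hc_space zero_hcmod = {0}"
  by (auto simp: hc_space_def zero_hcmod_def)

lemma hc_module_zero_hcmod: "hc_module n zero_hcmod"
proof (rule hc_moduleI)
  show "\<exists>B. finite B \<and> hc_space zero_hcmod = cvs.span B"
    by (rule exI[of _ "{}"]) (simp add: hc_space_zero_hcmod)
  show "cvs.subspace (grade zero_hcmod p)" for p by (simp add: zero_hcmod_def cvs.subspace_single_0)
qed (auto simp: zero_hcmod_def hc_space_zero_hcmod[unfolded zero_hcmod_def])

lemma k_class_short_exact:
  assumes "hc_module n M'" "hc_module n M" "hc_module n M''" "hc_short_exact n M' M M''"
  shows "k_class n M = k_class n M' + k_class n M''"
proof -
  have "basis_vec (Object (n, M)) - basis_vec (Object (n, M')) - basis_vec (Object (n, M'')) \<in> k_relations"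
    unfolding k_relations_def using assms by blast
  then have "basis_vec (Object (n, M)) - (basis_vec (Object (n, M')) + basis_vec (Object (n, M''))) \<in> cvs.span k_relations"
    by (simp add: cvs.span_base diff_diff_eq)
  then have "abs_k_group (basis_vec (Object (n, M))) = abs_k_group (basis_vec (Object (n, M')) + basis_vec (Object (n, M'')))"
    by (simp add: k_group.abs_eq_iff)
  then show ?thesis by (simp add: k_class_def plus_k_group.abs_eq)
qed

lemma k_class_parity_shift:
  assumes "hc_module n M"
  shows "k_class n (parity_shift M) = k_class n M"
proof -
  have "basis_vec (Object (n, parity_shift M)) - basis_vec (Object (n, M)) \<in> k_relations"
    unfolding k_relations_def using assms by blast
  then show ?thesis unfolding k_class_def k_group.abs_eq_iff by (rule cvs.span_base)
qed

lemma hc_hom_zero: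
  assumes "hc_module n N"
  shows "hc_hom_of_parity n p M N (\<lambda>x. 0)"
proof (rule hc_hom_of_parityI)
  show "0 \<in> grade N (q + p)" for q by (rule cvs.subspace_0[OF hc_moduleD(1)[OF assms]])
  show "0 = (if p = 1 then - hc_c N i 0 else hc_c N i 0)" if "i \<in> {1..n}" for i
    using clinear_0[OF hc_moduleD(4)[OF assms that]] by simp
  show "0 = hc_s N w 0" if "w permutes {1..n}" for w
    using clinear_0[OF hc_moduleD(6)[OF assms that]] by simp
qed simp

lemma hc_hom_id: "hc_hom_of_parity n 0 M M (\<lambda>x. x)"
  by (rule hc_hom_of_parityI) auto

text \<open>In the exact sequence of three zero modules the class equals its double.\<close>

lemma k_class_zero: "k_class n zero_hcmod = 0"
proof -
  have "hc_short_exact n zero_hcmod zero_hcmod zero_hcmod"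
    unfolding hc_short_exact_def hc_space_zero_hcmod
    by (intro exI[of _ "\<lambda>x. x"] conjI hc_hom_id) auto
  then have "k_class n zero_hcmod = k_class n zero_hcmod + k_class n zero_hcmod"
    by (intro k_class_short_exact hc_module_zero_hcmod)
  then show ?thesis by simp
qed

text \<open>An isomorphism is an exact sequence whose third term is 0.\<close>

lemma k_class_iso:
  assumes "hc_module n M" "hc_module n N" "hc_hom_of_parity n 0 M N f" "bij_betw f (hc_space M) (hc_space N)"
  shows "k_class n M = k_class n N"
proof -
  have "hc_short_exact n M N zero_hcmod"
    unfolding hc_short_exact_def hc_space_zero_hcmod
    using assms cvs.subspace_0[OF subspace_hc_space[OF assms(2)]]
    by (intro exI[of _ f] exI[of _ "\<lambda>x. 0"] conjI hc_hom_zero hc_module_zero_hcmod) (auto simp: bij_betw_def)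
  then have "k_class n N = k_class n M + k_class n zero_hcmod"
    by (intro k_class_short_exact assms hc_module_zero_hcmod)
  then show ?thesis by (simp add: k_class_zero)
qed

text \<open>Classes in the Grothendieck group are only defined for modules inside \<open>nat \<Rightarrow>\<^sub>0 complex\<close>.\<close>

definition nat_model :: "nat \<Rightarrow> 'b hcmod \<Rightarrow> nat hcmod" where
  "nat_model n M = (SOME M'. hc_module n M' \<and> (\<exists>f. hc_hom_of_parity n 0 M M' f \<and> bij_betw f (hc_space M) (hc_space M')))"

definition kcl :: "nat \<Rightarrow> 'b hcmod \<Rightarrow> k_group" where
  "kcl n M = k_class n (nat_model n M)"

lemma hc_submodule_0:
  assumes "hc_module n M"
  shows "hc_submodule n M {0}"
proof -
  have z: "0 \<in> grade M p" for p by (rule cvs.subspace_0[OF hc_moduleD(1)[OF assms]])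
  have "0 \<in> hc_space M" by (rule cvs.subspace_0[OF subspace_hc_space[OF assms]])
  then show ?thesis
    unfolding hc_submodule_def using z clinear_0[OF hc_moduleD(4)[OF assms]] clinear_0[OF hc_moduleD(6)[OF assms]]
    by (auto simp: cvs.subspace_single_0)
qed

text \<open>The quotient by the zero submodule is a copy of M in the required ambient space.\<close>

lemma nat_model:
  assumes "hc_module n M"
  obtains f where "hc_module n (nat_model n M)" "hc_hom_of_parity n 0 M (nat_model n M) f"
    "bij_betw f (hc_space M) (hc_space (nat_model n M))"
proof -
  obtain M' :: "nat hcmod" and \<pi> where *: "hc_module n M'" "hc_hom_of_parity n 0 M M' \<pi>"
    "\<pi> ` hc_space M = hc_space M'" "{x \<in> hc_space M. \<pi> x = 0} = {0}"
    using quotient_model[OF assms hc_submodule_0[OF assms]] .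
  have "inj_on \<pi> (hc_space M)"
  proof (rule inj_onI)
    fix x y assume xy: "x \<in> hc_space M" "y \<in> hc_space M" "\<pi> x = \<pi> y"
    then have "x - y \<in> {x \<in> hc_space M. \<pi> x = 0}"
      using clinear_diff[OF hc_hom_of_parityD(1)[OF *(2)]] cvs.subspace_diff[OF subspace_hc_space[OF assms]] by simp
    then have "x - y = 0" using *(4) by blast
    then show "x = y" by simp
  qed
  then have "\<exists>M' :: nat hcmod. hc_module n M' \<and> (\<exists>f. hc_hom_of_parity n 0 M M' f \<and> bij_betw f (hc_space M) (hc_space M'))"
    using * by (intro exI[of _ M'] conjI exI[of _ \<pi>]) (auto simp: bij_betw_def)
  from someI_ex[OF this] show ?thesis
    using that unfolding nat_model_def[symmetric] by blast
qed

text \<open>The class does not depend on the copy that \<open>SOME\<close> chooses.\<close>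

lemma kcl_eq_k_class:
  fixes N :: "nat hcmod"
  assumes M: "hc_module n M" and N: "hc_module n N" and f: "hc_hom_of_parity n 0 M N f" "bij_betw f (hc_space M) (hc_space N)"
  shows "kcl n M = k_class n N"
proof -
  obtain h where h: "hc_module n (nat_model n M)" "hc_hom_of_parity n 0 M (nat_model n M) h"
    "bij_betw h (hc_space M) (hc_space (nat_model n M))" using nat_model[OF M] .
  obtain g where g': "hc_hom_of_parity n 0 (nat_model n M) M g" "\<And>x. x \<in> hc_space M \<Longrightarrow> g (h x) = x"
    "\<And>y. y \<in> hc_space (nat_model n M) \<Longrightarrow> h (g y) = y" "bij_betw g (hc_space (nat_model n M)) (hc_space M)"
    using hc_iso_inverse[OF M h] by blast
  note g = g'(1,4)
  have "hc_hom_of_parity n (0 + 0) (nat_model n M) N (\<lambda>x. f (g x))" by (rule hc_hom_compose[OF g(1) f(1) M])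
  then show ?thesis
    unfolding kcl_def using bij_betw_trans[OF g(2) f(2)] by (intro k_class_iso[OF h(1) N]) (simp_all add: comp_def)
qed

lemma kcl_nat: "hc_module n M \<Longrightarrow> kcl n M = k_class n (M :: nat hcmod)"
  by (rule kcl_eq_k_class[OF _ _ hc_hom_id]) (simp_all add: bij_betw_def)

text \<open>Conjugating both maps with the isomorphisms onto the chosen copies carries over a
  sequence between modules on arbitrary basis types.\<close>

lemma kcl_short_exact:
  assumes M: "hc_module n M1" "hc_module n M2" "hc_module n M3"
    and f: "hc_hom_of_parity n 0 M1 M2 f" "inj_on f (hc_space M1)"
    and g: "hc_hom_of_parity n 0 M2 M3 g" "g ` hc_space M2 = hc_space M3"
    and ex: "f ` hc_space M1 = {x \<in> hc_space M2. g x = 0}"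
  shows "kcl n M2 = kcl n M1 + kcl n M3"
proof -
  obtain h1 where h1: "hc_module n (nat_model n M1)" "hc_hom_of_parity n 0 M1 (nat_model n M1) h1"
    "bij_betw h1 (hc_space M1) (hc_space (nat_model n M1))" using nat_model[OF M(1)] .
  obtain h2 where h2: "hc_module n (nat_model n M2)" "hc_hom_of_parity n 0 M2 (nat_model n M2) h2"
    "bij_betw h2 (hc_space M2) (hc_space (nat_model n M2))" using nat_model[OF M(2)] .
  obtain h3 where h3: "hc_module n (nat_model n M3)" "hc_hom_of_parity n 0 M3 (nat_model n M3) h3"
    "bij_betw h3 (hc_space M3) (hc_space (nat_model n M3))" using nat_model[OF M(3)] .
  obtain k1 where k1': "hc_hom_of_parity n 0 (nat_model n M1) M1 k1" "\<And>x. x \<in> hc_space M1 \<Longrightarrow> k1 (h1 x) = x"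
    "\<And>y. y \<in> hc_space (nat_model n M1) \<Longrightarrow> h1 (k1 y) = y" "bij_betw k1 (hc_space (nat_model n M1)) (hc_space M1)"
    using hc_iso_inverse[OF M(1) h1] by blast
  note k1 = k1'(1,4)
  obtain k2 where k2': "hc_hom_of_parity n 0 (nat_model n M2) M2 k2" "\<And>x. x \<in> hc_space M2 \<Longrightarrow> k2 (h2 x) = x"
    "\<And>y. y \<in> hc_space (nat_model n M2) \<Longrightarrow> h2 (k2 y) = y" "bij_betw k2 (hc_space (nat_model n M2)) (hc_space M2)"
    using hc_iso_inverse[OF M(2) h2] by blast
  note k2 = k2'(1,4,2,3)
  define F where "F = (\<lambda>x. h2 (f (k1 x)))"
  define G where "G = (\<lambda>x. h3 (g (k2 x)))"
  have F: "hc_hom_of_parity n 0 (nat_model n M1) (nat_model n M2) F"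
    using hc_hom_compose[OF hc_hom_compose[OF k1(1) f(1) M(1)] h2(2) M(2)] by (simp add: F_def)
  have G: "hc_hom_of_parity n 0 (nat_model n M2) (nat_model n M3) G"
    using hc_hom_compose[OF hc_hom_compose[OF k2(1) g(1) M(2)] h3(2) M(3)] by (simp add: G_def)
  have k1_img: "k1 ` hc_space (nat_model n M1) = hc_space M1" and k2_img: "k2 ` hc_space (nat_model n M2) = hc_space M2"
    using k1(2) k2(2) by (auto simp: bij_betw_def)
  have f_sp: "f ` hc_space M1 \<subseteq> hc_space M2" using ex by blast
  have "inj_on F (hc_space (nat_model n M1))"
  proof (rule inj_onI)
    fix x y assume xy: "x \<in> hc_space (nat_model n M1)" "y \<in> hc_space (nat_model n M1)" "F x = F y"
    then have "k1 x \<in> hc_space M1" "k1 y \<in> hc_space M1" using k1_img by blast+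
    moreover from this have "f (k1 x) \<in> hc_space M2" "f (k1 y) \<in> hc_space M2" using f_sp by blast+
    ultimately have "k1 x = k1 y" using xy(3) h2(3) f(2) unfolding F_def bij_betw_def inj_on_def by metis
    then show "x = y" using xy(1,2) k1(2) unfolding bij_betw_def inj_on_def by metis
  qed
  moreover have "F ` hc_space (nat_model n M1) = {x \<in> hc_space (nat_model n M2). G x = 0}"
  proof -
    have h30: "h3 y = 0 \<longleftrightarrow> y = 0" if "y \<in> hc_space M3" for y
      using that h3(3) clinear_0[OF hc_hom_of_parityD(1)[OF h3(2)]] cvs.subspace_0[OF subspace_hc_space[OF M(3)]]
      unfolding bij_betw_def inj_on_def by metis
    have "F ` hc_space (nat_model n M1) = h2 ` {x \<in> hc_space M2. g x = 0}"
      unfolding ex[symmetric] k1_img[symmetric] F_def by (simp add: image_image)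
    also have "\<dots> = {x \<in> hc_space (nat_model n M2). G x = 0}"
    proof (intro equalityI subsetI)
      fix y assume "y \<in> h2 ` {x \<in> hc_space M2. g x = 0}"
      then obtain x where x: "y = h2 x" "x \<in> hc_space M2" "g x = 0" by blast
      have "y \<in> hc_space (nat_model n M2)" using x h2(3) by (auto simp: bij_betw_def)
      then show "y \<in> {x \<in> hc_space (nat_model n M2). G x = 0}"
        using x k2(3) clinear_0[OF hc_hom_of_parityD(1)[OF h3(2)]] by (simp add: G_def)
    next
      fix y assume "y \<in> {x \<in> hc_space (nat_model n M2). G x = 0}"
      then have y: "y \<in> hc_space (nat_model n M2)" "h3 (g (k2 y)) = 0" by (auto simp: G_def)
      have "k2 y \<in> hc_space M2" using y(1) k2_img by blast
      moreover from this have "g (k2 y) = 0" using y(2) h30 g(2) by blast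
      ultimately show "y \<in> h2 ` {x \<in> hc_space M2. g x = 0}" using k2(4)[OF y(1)] by force
    qed
    finally show ?thesis .
  qed
  moreover have "G ` hc_space (nat_model n M2) = hc_space (nat_model n M3)"
  proof -
    have "G ` hc_space (nat_model n M2) = h3 ` g ` k2 ` hc_space (nat_model n M2)" by (auto simp: G_def)
    then show ?thesis using h3(3) by (simp add: k2_img g(2) bij_betw_def)
  qed
  ultimately have "hc_short_exact n (nat_model n M1) (nat_model n M2) (nat_model n M3)"
    unfolding hc_short_exact_def using F G by blast
  then show ?thesis unfolding kcl_def by (intro k_class_short_exact h1 h2 h3)
qed

lemma hc_space_parity_shift: "hc_space (parity_shift M) = hc_space M"
  unfolding hc_space_def parity_shift_def by (auto simp: add.commute) (metis add.commute)+

lemma hc_module_parity_shift: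
  assumes "hc_module n M"
  shows "hc_module n (parity_shift M)"
proof (rule hc_moduleI)
  note M = hc_moduleD[OF assms]
  show "cvs.subspace (grade (parity_shift M) p)" for p by (simp add: parity_shift_def M(1))
  show "grade (parity_shift M) 0 \<inter> grade (parity_shift M) 1 = {0}" using M(2) by (auto simp: parity_shift_def)
  show "\<exists>B. finite B \<and> hc_space (parity_shift M) = cvs.span B" using M(3) by (simp add: hc_space_parity_shift)
  show "clinear (hc_c (parity_shift M) i)" if "i \<in> {1..n}" for i
    using clinear_uminus[OF M(4)[OF that]] by (simp add: parity_shift_def)
  show "hc_c (parity_shift M) i ` grade (parity_shift M) p \<subseteq> grade (parity_shift M) (p + 1)" if "i \<in> {1..n}" for i p
    using M(5)[OF that, of "p + 1"] cvs.subspace_neg[OF M(1), of _ "p + 1 + 1"]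
    unfolding parity_shift_def hcmod.simps by blast
  show "clinear (hc_s (parity_shift M) w)" if "w permutes {1..n}" for w
    using M(6)[OF that] by (simp add: parity_shift_def)
  show "hc_s (parity_shift M) w ` grade (parity_shift M) p \<subseteq> grade (parity_shift M) p" if "w permutes {1..n}" for w p
    using M(7)[OF that] by (simp add: parity_shift_def)
  fix x assume "x \<in> hc_space (parity_shift M)"
  then have x: "x \<in> hc_space M" by (simp add: hc_space_parity_shift)
  show "hc_c (parity_shift M) i (hc_c (parity_shift M) i x) = x" if "i \<in> {1..n}" for i
    using M(8)[OF x that] clinear_neg[OF M(4)[OF that]] by (simp add: parity_shift_def)
  show "hc_c (parity_shift M) i (hc_c (parity_shift M) j x) = - hc_c (parity_shift M) j (hc_c (parity_shift M) i x)"
    if "i \<in> {1..n}" "j \<in> {1..n}" "i \<noteq> j" for i j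
    unfolding parity_shift_def hcmod.simps clinear_neg[OF M(4)[OF that(1)]] clinear_neg[OF M(4)[OF that(2)]]
    by (simp only: M(9)[OF x that])
  show "hc_s (parity_shift M) id x = x" using M(10)[OF x] by (simp add: parity_shift_def)
  show "hc_s (parity_shift M) (v \<circ> w) x = hc_s (parity_shift M) v (hc_s (parity_shift M) w x)"
    if "v permutes {1..n}" "w permutes {1..n}" for v w
    using M(11)[OF x that] by (simp add: parity_shift_def)
  have tr: "transpose i (i + 1) permutes {1..n}" if "i \<in> {1..<n}" for i using that by (intro permutes_swap_id) auto
  show "hc_s (parity_shift M) (transpose i (i + 1)) (hc_c (parity_shift M) i x) =
     hc_c (parity_shift M) (i + 1) (hc_s (parity_shift M) (transpose i (i + 1)) x)" if "i \<in> {1..<n}" for i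
    unfolding parity_shift_def hcmod.simps clinear_neg[OF M(6)[OF tr[OF that]]] M(12)[OF x that] ..
  show "hc_s (parity_shift M) (transpose i (i + 1)) (hc_c (parity_shift M) j x) =
     hc_c (parity_shift M) j (hc_s (parity_shift M) (transpose i (i + 1)) x)" if "i \<in> {1..<n}" "j \<in> {1..n} - {i, i + 1}" for i j
    unfolding parity_shift_def hcmod.simps clinear_neg[OF M(6)[OF tr[OF that(1)]]] M(13)[OF x that] ..
qed

text \<open>Shifting the target changes the degree by one and the sign of c_i, which is exactly the
  difference between even and odd maps.\<close>

lemma hc_hom_parity_shift:
  assumes "hc_hom_of_parity n p M N f"
  shows "hc_hom_of_parity n (p + 1) M (parity_shift N) f"
proof (rule hc_hom_of_parityI)
  note f = hc_hom_of_parityD[OF assms]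
  show "clinear f" by (rule f(1))
  show "f x \<in> grade (parity_shift N) (q + (p + 1))" if "x \<in> grade M q" for q x
  proof -
    have "q + (p + 1) + 1 = q + p" by (cases p; cases q) simp_all
    moreover have "f x \<in> grade N (q + p)" using f(2) that by blast
    ultimately show ?thesis by (simp only: parity_shift_def hcmod.simps)
  qed
  show "f (hc_c M i x) = (if p + 1 = 1 then - hc_c (parity_shift N) i (f x) else hc_c (parity_shift N) i (f x))"
    if "x \<in> hc_space M" "i \<in> {1..n}" for x i
    using f(3)[OF that] by (cases p) (simp_all add: parity_shift_def)
  show "f (hc_s M w x) = hc_s (parity_shift N) w (f x)" if "x \<in> hc_space M" "w permutes {1..n}" for x w
    using f(4)[OF that] by (simp add: parity_shift_def)
qed

text \<open>An odd isomorphism onto N is an even one onto the parity shift of N, which has the same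
  class.\<close>

lemma kcl_iso:
  assumes M: "hc_module n M" and N: "hc_module n N" and f: "hc_hom_of_parity n p M N f" "bij_betw f (hc_space M) (hc_space N)"
  shows "kcl n M = kcl n N"
proof -
  obtain h where h: "hc_module n (nat_model n N)" "hc_hom_of_parity n 0 N (nat_model n N) h"
    "bij_betw h (hc_space N) (hc_space (nat_model n N))" using nat_model[OF N] .
  have hf: "hc_hom_of_parity n p M (nat_model n N) (\<lambda>x. h (f x))" using hc_hom_compose[OF f(1) h(2) N] by (simp only: add_0_right)
  have bij: "bij_betw (\<lambda>x. h (f x)) (hc_space M) (hc_space (nat_model n N))"
    using bij_betw_trans[OF f(2) h(3)] by (simp add: comp_def)
  show ?thesis
  proof (cases p)
    case zero
    then show ?thesis using kcl_eq_k_class[OF M h(1) _ bij] hf by (simp add: kcl_def)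
  next
    case one
    have "hc_hom_of_parity n 0 M (parity_shift (nat_model n N)) (\<lambda>x. h (f x))"
      using hc_hom_parity_shift[OF hf] one by simp
    then have "kcl n M = k_class n (parity_shift (nat_model n N))"
      using bij by (intro kcl_eq_k_class[OF M hc_module_parity_shift[OF h(1)]]) (simp_all add: hc_space_parity_shift)
    then show ?thesis by (simp add: k_class_parity_shift[OF h(1)] kcl_def)
  qed
qed

lemma kcl_zero:
  assumes M: "hc_module n M" and "hc_space M = {0}"
  shows "kcl n M = 0"
proof -
  have "bij_betw (\<lambda>x. 0) (hc_space M) (hc_space zero_hcmod)"
    by (simp add: assms(2) hc_space_zero_hcmod bij_betw_def)
  then have "kcl n M = k_class n zero_hcmod"
    using hc_hom_zero[OF hc_module_zero_hcmod] by (intro kcl_eq_k_class[OF M hc_module_zero_hcmod])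
  then show ?thesis by (simp add: k_class_zero)
qed

section \<open>Submodules and composition series\<close>

lemma hc_space_restrict:
  assumes "hc_submodule n M U"
  shows "hc_space (hc_restrict M U) = U"
proof
  show "hc_space (hc_restrict M U) \<subseteq> U"
    using cvs.subspace_add[OF hc_submoduleD(1)[OF assms]] by (auto simp: hc_space_def hc_restrict_def)
  show "U \<subseteq> hc_space (hc_restrict M U)"
    using hc_submoduleD(3)[OF assms] by (fastforce simp: hc_space_def hc_restrict_def)
qed

lemma finite_dim_subspace:
  assumes "finite B" "U \<subseteq> cvs.span B" "cvs.subspace U"
  obtains C where "finite C" "U = cvs.span C" "card C \<le> card B" "cvs.independent C"
proof -
  obtain C where C: "C \<subseteq> U" "cvs.independent C" "U \<subseteq> cvs.span C" using cvs.maximal_independent_subset by blast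
  have "finite C \<and> card C \<le> card B" using cvs.independent_span_bound[OF assms(1) C(2)] C(1) assms(2) by blast
  moreover have "U = cvs.span C" using C cvs.span_minimal[OF C(1) assms(3)] by blast
  ultimately show ?thesis using C(2) that by blast
qed

lemma hc_module_restrict:
  assumes M: "hc_module n M" and U: "hc_submodule n M U"
  shows "hc_module n (hc_restrict M U)"
proof (rule hc_moduleI)
  note M' = hc_moduleD[OF M] and U' = hc_submoduleD[OF U]
  have gr: "grade (hc_restrict M U) p = grade M p \<inter> U" for p by (simp add: hc_restrict_def)
  show "cvs.subspace (grade (hc_restrict M U) p)" for p
    using M'(1) U'(1) by (simp add: hc_restrict_def cvs.subspace_inter)
  show "grade (hc_restrict M U) 0 \<inter> grade (hc_restrict M U) 1 = {0}"
    using M'(2) cvs.subspace_0[OF U'(1)] by (auto simp: hc_restrict_def)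
  obtain B where "finite B" "hc_space M = cvs.span B" using M'(3) by blast
  then obtain C where "finite C" "U = cvs.span C" using finite_dim_subspace[of B U] U' by metis
  then show "\<exists>B. finite B \<and> hc_space (hc_restrict M U) = cvs.span B" unfolding hc_space_restrict[OF U] by blast
  show "clinear (hc_c (hc_restrict M U) i)" if "i \<in> {1..n}" for i using M'(4)[OF that] by (simp add: hc_restrict_def)
  show "hc_c (hc_restrict M U) i ` grade (hc_restrict M U) p \<subseteq> grade (hc_restrict M U) (p + 1)" if "i \<in> {1..n}" for i p
  proof
    fix y assume "y \<in> hc_c (hc_restrict M U) i ` grade (hc_restrict M U) p"
    then obtain x where x: "x \<in> grade M p" "x \<in> U" "y = hc_c M i x" by (auto simp: hc_restrict_def)
    have "y \<in> grade M (p + 1)" unfolding x(3) using M'(5)[OF that, of p] x(1) by blast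
    moreover have "y \<in> U" unfolding x(3) by (rule U'(4)[OF that x(2)])
    ultimately show "y \<in> grade (hc_restrict M U) (p + 1)" by (simp only: gr Int_iff)
  qed
  show "clinear (hc_s (hc_restrict M U) w)" if "w permutes {1..n}" for w using M'(6)[OF that] by (simp add: hc_restrict_def)
  show "hc_s (hc_restrict M U) w ` grade (hc_restrict M U) p \<subseteq> grade (hc_restrict M U) p" if "w permutes {1..n}" for w p
  proof
    fix y assume "y \<in> hc_s (hc_restrict M U) w ` grade (hc_restrict M U) p"
    then obtain x where x: "x \<in> grade M p" "x \<in> U" "y = hc_s M w x" by (auto simp: hc_restrict_def)
    have "y \<in> grade M (p)" unfolding x(3) using M'(7)[OF that, of p] x(1) by blast
    moreover have "y \<in> U" unfolding x(3) by (rule U'(5)[OF that x(2)])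
    ultimately show "y \<in> grade (hc_restrict M U) (p)" by (simp only: gr Int_iff)
  qed
  fix x assume "x \<in> hc_space (hc_restrict M U)"
  then have x: "x \<in> hc_space M" using U'(2) by (auto simp: hc_space_restrict[OF U])
  have r: "hc_c (hc_restrict M U) = hc_c M" "hc_s (hc_restrict M U) = hc_s M" by (simp_all add: hc_restrict_def)
  show "hc_c (hc_restrict M U) i (hc_c (hc_restrict M U) i x) = x" if "i \<in> {1..n}" for i
    unfolding r by (rule M'(8)[OF x that])
  show "hc_c (hc_restrict M U) i (hc_c (hc_restrict M U) j x) = - hc_c (hc_restrict M U) j (hc_c (hc_restrict M U) i x)"
    if "i \<in> {1..n}" "j \<in> {1..n}" "i \<noteq> j" for i j
    unfolding r by (rule M'(9)[OF x that])
  show "hc_s (hc_restrict M U) id x = x" unfolding r by (rule M'(10)[OF x])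
  show "hc_s (hc_restrict M U) (v \<circ> w) x = hc_s (hc_restrict M U) v (hc_s (hc_restrict M U) w x)"
    if "v permutes {1..n}" "w permutes {1..n}" for v w
    unfolding r by (rule M'(11)[OF x that])
  show "hc_s (hc_restrict M U) (transpose i (i + 1)) (hc_c (hc_restrict M U) i x) =
     hc_c (hc_restrict M U) (i + 1) (hc_s (hc_restrict M U) (transpose i (i + 1)) x)" if "i \<in> {1..<n}" for i
    unfolding r by (rule M'(12)[OF x that])
  show "hc_s (hc_restrict M U) (transpose i (i + 1)) (hc_c (hc_restrict M U) j x) =
     hc_c (hc_restrict M U) j (hc_s (hc_restrict M U) (transpose i (i + 1)) x)" if "i \<in> {1..<n}" "j \<in> {1..n} - {i, i + 1}" for i j
    unfolding r by (rule M'(13)[OF x that])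
qed

lemma hc_submoduleI:
  assumes "cvs.subspace U" "U \<subseteq> hc_space M"
    "\<And>x. x \<in> U \<Longrightarrow> \<exists>u v. x = u + v \<and> u \<in> U \<inter> grade M 0 \<and> v \<in> U \<inter> grade M 1"
    "\<And>i x. i \<in> {1..n} \<Longrightarrow> x \<in> U \<Longrightarrow> hc_c M i x \<in> U" "\<And>w x. w permutes {1..n} \<Longrightarrow> x \<in> U \<Longrightarrow> hc_s M w x \<in> U"
  shows "hc_submodule n M U"
proof -
  have "U = {u + v |u v. u \<in> U \<inter> grade M 0 \<and> v \<in> U \<inter> grade M 1}"
    using assms(3) cvs.subspace_add[OF assms(1)] by blast
  then show ?thesis unfolding hc_submodule_def using assms by blast
qed

lemma hc_submodule_image:
  assumes M: "hc_module n M" and N: "hc_module n N" and f: "hc_hom_of_parity n p M N f"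
  shows "hc_submodule n N (f ` hc_space M)"
proof (rule hc_submoduleI)
  note f' = hc_hom_of_parityD[OF f]
  have linh: "module_hom cscale cscale f" using f'(1) by (simp add: module_hom_iff_linear)
  show sub: "cvs.subspace (f ` hc_space M)" by (rule module_hom.subspace_image[OF linh subspace_hc_space[OF M]])
  show "f ` hc_space M \<subseteq> hc_space N" using hc_hom_space[OF f N] by blast
  fix y assume "y \<in> f ` hc_space M"
  then obtain x where x: "x \<in> hc_space M" "y = f x" by blast
  obtain a b where ab: "x = a + b" "a \<in> grade M p" "b \<in> grade M (p + 1)" using hc_space_split[OF x(1)] by blast
  have "p + p = 0" "p + 1 + p = 1" by (cases p; simp)+
  then have "f a \<in> grade N 0" "f b \<in> grade N 1" using f'(2) ab(2,3) by (metis image_subset_iff)+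
  moreover have "f a \<in> f ` hc_space M" "f b \<in> f ` hc_space M" using ab grade_subset_hc_space[OF M] by blast+
  moreover have "y = f a + f b" using x ab clinear_add[OF f'(1)] by simp
  ultimately show "\<exists>u v. y = u + v \<and> u \<in> f ` hc_space M \<inter> grade N 0 \<and> v \<in> f ` hc_space M \<inter> grade N 1" by blast
  show "hc_c N i y \<in> f ` hc_space M" if i: "i \<in> {1..n}" for i
  proof (cases "p = 1")
    case True
    then have "hc_c N i y = - f (hc_c M i x)" using f'(3)[OF x(1) i] x(2) by simp
    moreover have "f (hc_c M i x) \<in> f ` hc_space M" using hc_space_ops(1)[OF M x(1) i] by blast
    ultimately show ?thesis using cvs.subspace_neg[OF sub] by simp
  next
    case False
    then have "hc_c N i y = f (hc_c M i x)" using f'(3)[OF x(1) i] x(2) by simp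
    then show ?thesis using hc_space_ops(1)[OF M x(1) i] by blast
  qed
  show "hc_s N w y \<in> f ` hc_space M" if w: "w permutes {1..n}" for w
    using f'(4)[OF x(1) w] hc_space_ops(2)[OF M x(1) w] x(2) by (metis image_eqI)
qed

text \<open>Homogeneity of f matters: the two components of x map to the two components of f x,
  which lie in W because W is graded.\<close>

lemma hc_submodule_vimage:
  assumes M: "hc_module n M" and N: "hc_module n N" and f: "hc_hom_of_parity n p M N f" and W: "hc_submodule n N W"
  shows "hc_submodule n M {x \<in> hc_space M. f x \<in> W}"
proof (rule hc_submoduleI)
  note f' = hc_hom_of_parityD[OF f] and W' = hc_submoduleD[OF W]
  have sp: "cvs.subspace (hc_space M)" by (rule subspace_hc_space[OF M])
  show "cvs.subspace {x \<in> hc_space M. f x \<in> W}"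
    using sp W'(1) unfolding cvs.subspace_def by (auto simp: clinear_0[OF f'(1)] clinear_add[OF f'(1)] clinear_scale[OF f'(1)])
  show "{x \<in> hc_space M. f x \<in> W} \<subseteq> hc_space M" by blast
  fix x assume "x \<in> {x \<in> hc_space M. f x \<in> W}"
  then have x: "x \<in> hc_space M" "f x \<in> W" by auto
  obtain u v where uv: "x = u + v" "u \<in> grade M 0" "v \<in> grade M 1" using hc_spaceE[OF x(1)] .
  have usp: "u \<in> hc_space M" "v \<in> hc_space M" using uv grade_subset_hc_space[OF M] by blast+
  have "f u \<in> W \<and> f v \<in> W"
  proof -
    obtain a b where ab: "f x = a + b" "a \<in> W \<inter> grade N 0" "b \<in> W \<inter> grade N 1" using W'(3)[OF x(2)] by blast
    have fx: "f x = f u + f v" using uv(1) clinear_add[OF f'(1)] by simp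
    have fu: "f u \<in> grade N (0 + p)" "f v \<in> grade N (1 + p)" using f'(2) uv by blast+
    show ?thesis
    proof (cases p)
      case zero
      then have "f u = a" "f v = b" using grade_sum_eq[OF N, of "f u" "f v" a b] fu ab fx by auto
      then show ?thesis using ab by blast
    next
      case one
      then have "f v = a" "f u = b" using grade_sum_eq[OF N, of "f v" "f u" a b] fu ab fx by (auto simp: add.commute)
      then show ?thesis using ab by blast
    qed
  qed
  then show "\<exists>u v. x = u + v \<and> u \<in> {x \<in> hc_space M. f x \<in> W} \<inter> grade M 0 \<and> v \<in> {x \<in> hc_space M. f x \<in> W} \<inter> grade M 1"
    using uv usp by blast
  show "hc_c M i x \<in> {x \<in> hc_space M. f x \<in> W}" if i: "i \<in> {1..n}" for i
    using f'(3)[OF x(1) i] W'(4)[OF i x(2)] hc_space_ops(1)[OF M x(1) i] cvs.subspace_neg[OF W'(1)] by auto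
  show "hc_s M w x \<in> {x \<in> hc_space M. f x \<in> W}" if w: "w permutes {1..n}" for w
    using f'(4)[OF x(1) w] W'(5)[OF w x(2)] hc_space_ops(2)[OF M x(1) w] by auto
qed

lemma hc_submodule_restrict:
  assumes U: "hc_submodule n M U" and W: "hc_submodule n (hc_restrict M U) W"
  shows "hc_submodule n M W"
proof (rule hc_submoduleI)
  note W' = hc_submoduleD[OF W]
  show "cvs.subspace W" by (rule W'(1))
  show "W \<subseteq> hc_space M" using W'(2) hc_submoduleD(2)[OF U] by (auto simp: hc_space_restrict[OF U])
  show "\<exists>u v. x = u + v \<and> u \<in> W \<inter> grade M 0 \<and> v \<in> W \<inter> grade M 1" if "x \<in> W" for x
    using W'(3)[OF that] by (auto simp: hc_restrict_def)
  show "hc_c M i x \<in> W" if "i \<in> {1..n}" "x \<in> W" for i x using W'(4)[OF that] by (simp add: hc_restrict_def)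
  show "hc_s M w x \<in> W" if "w permutes {1..n}" "x \<in> W" for w x using W'(5)[OF that] by (simp add: hc_restrict_def)
qed

lemma hc_hom_inclusion:
  "U \<subseteq> W \<Longrightarrow> hc_hom_of_parity n 0 (hc_restrict M U) (hc_restrict M W) (\<lambda>x. x)"
  by (rule hc_hom_of_parityI) (auto simp: hc_restrict_def)

definition adjacent_submodules :: "nat \<Rightarrow> 'b hcmod \<Rightarrow> ('b \<Rightarrow>\<^sub>0 complex) set \<Rightarrow> ('b \<Rightarrow>\<^sub>0 complex) set \<Rightarrow> bool" where
  "adjacent_submodules n M U W \<longleftrightarrow> hc_submodule n M U \<and> hc_submodule n M W \<and> U \<subset> W \<and>
     (\<forall>X. hc_submodule n M X \<and> U \<subseteq> X \<and> X \<subseteq> W \<longrightarrow> X = U \<or> X = W)"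

text \<open>The isomorphism of W/U with D may mix parities. On homogeneous elements of U its even
  and odd components take values in opposite degrees and add up to 0, so both vanish on U. One of
  them is nonzero on W; as D is irreducible and nothing lies strictly between U and W, that
  component induces an isomorphism by itself. Even or odd, it yields the class of D.\<close>

lemma kcl_adjacent:
  fixes D :: "nat hcmod"
  assumes M: "hc_module n M" and adj: "adjacent_submodules n M U W" and D: "hc_irreducible n D"
    and q: "hc_quotient_iso n (hc_restrict M W) U D"
  shows "kcl n (hc_restrict M W) = kcl n (hc_restrict M U) + k_class n D"
proof -
  have U: "hc_submodule n M U" and W: "hc_submodule n M W" and UW: "U \<subset> W"
    and max: "\<And>X. hc_submodule n M X \<Longrightarrow> U \<subseteq> X \<Longrightarrow> X \<subseteq> W \<Longrightarrow> X = U \<or> X = W"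
    using adj by (auto simp: adjacent_submodules_def)
  have mU: "hc_module n (hc_restrict M U)" and mW: "hc_module n (hc_restrict M W)"
    using hc_module_restrict[OF M] U W by blast+
  have mD: "hc_module n D" and D0: "hc_space D \<noteq> {0}" and irr: "\<And>X. hc_submodule n D X \<Longrightarrow> X = {0} \<or> X = hc_space D"
    using D by (auto simp: hc_irreducible_def)
  have spW: "hc_space (hc_restrict M W) = W" and spU: "hc_space (hc_restrict M U) = U"
    using hc_space_restrict U W by blast+
  obtain f f0 f1 where f: "hc_hom_of_parity n 0 (hc_restrict M W) D f0" "hc_hom_of_parity n 1 (hc_restrict M W) D f1"
    "f = (\<lambda>x. f0 x + f1 x)" "f ` W = hc_space D" "{x \<in> W. f x = 0} = U"
    using q unfolding hc_quotient_iso_def hc_hom_def spW by blast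
  note f0 = hc_hom_of_parityD[OF f(1)] and f1 = hc_hom_of_parityD[OF f(2)]
  have zero_on_U: "f0 x = 0 \<and> f1 x = 0" if x: "x \<in> U" for x
  proof -
    obtain u v where uv: "x = u + v" "u \<in> U \<inter> grade M 0" "v \<in> U \<inter> grade M 1" using hc_submoduleD(3)[OF U x] by blast
    have *: "f0 y = 0 \<and> f1 y = 0" if y: "y \<in> U \<inter> grade M p" for y p
    proof -
      have yW: "y \<in> grade (hc_restrict M W) p" using y UW by (auto simp: hc_restrict_def)
      have "f0 y \<in> grade D (p + 0)" "f1 y \<in> grade D (p + 1)" using f0(2) f1(2) yW by blast+
      moreover have "f0 y + f1 y = 0" using f(3,5) y by blast
      then have "f0 y = - f1 y" by (simp add: eq_neg_iff_add_eq_0)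
      ultimately have "f0 y \<in> grade D p" "f0 y \<in> grade D (p + 1)"
        using cvs.subspace_neg[OF hc_moduleD(1)[OF mD]] by (simp_all only: add_0_right)
      then have "f0 y = 0" by (rule grade_disjoint[OF mD])
      then show ?thesis using \<open>f0 y + f1 y = 0\<close> by simp
    qed
    show ?thesis using *[OF uv(2)] *[OF uv(3)] uv(1) clinear_add[OF f0(1)] clinear_add[OF f1(1)] by simp
  qed
  \<comment> \<open>Irreducibility of D makes g surjective, and its kernel contains U and is not W,
    hence is U. An odd g is regarded as an even map to the parity shift.\<close>
  have main: "\<exists>q. kcl n (hc_restrict M W) = kcl n (hc_restrict M U) + kcl n (if q = (0::bit) then D else parity_shift D)"
    if g: "hc_hom_of_parity n p (hc_restrict M W) D g" and g0: "\<And>x. x \<in> U \<Longrightarrow> g x = 0" and ne: "g ` W \<noteq> {0}" for g p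
  proof -
    have "hc_submodule n D (g ` W)" using hc_submodule_image[OF mW mD g] by (simp add: spW)
    then have surj: "g ` W = hc_space D" using irr ne by blast
    have "hc_submodule n (hc_restrict M W) {x \<in> W. g x \<in> {0}}"
      using hc_submodule_vimage[OF mW mD g hc_submodule_0[OF mD]] by (simp add: spW)
    then have "hc_submodule n M {x \<in> W. g x \<in> {0}}" by (rule hc_submodule_restrict[OF W])
    moreover have "U \<subseteq> {x \<in> W. g x \<in> {0}}" using g0 UW by auto
    moreover have "{x \<in> W. g x \<in> {0}} \<noteq> W"
    proof
      assume "{x \<in> W. g x \<in> {0}} = W"
      then have sub: "g ` W \<subseteq> {0}" by blast
      have W0: "W \<noteq> {}" using cvs.subspace_0[OF hc_submoduleD(1)[OF W]] by blast
      have "g ` W = {0}" using subset_singletonD[OF sub] W0 by blast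
      then show False using ne by simp
    qed
    ultimately have "{x \<in> W. g x \<in> {0}} = U" using max[of "{x \<in> W. g x \<in> {0}}"] by blast
    then have ker: "{x \<in> W. g x = 0} = U" by simp
    define D' where "D' = (if p = 0 then D else parity_shift D)"
    have D': "hc_module n D'" "hc_space D' = hc_space D"
      using mD hc_module_parity_shift[OF mD] by (simp_all add: D'_def hc_space_parity_shift)
    have g': "hc_hom_of_parity n 0 (hc_restrict M W) D' g"
      using g hc_hom_parity_shift[OF g] by (cases p) (simp_all add: D'_def)
    have "kcl n (hc_restrict M W) = kcl n (hc_restrict M U) + kcl n D'"
    proof (rule kcl_short_exact[OF mU mW D'(1) hc_hom_inclusion _ g'])
      show "U \<subseteq> W" using UW by blast
      show "inj_on (\<lambda>x. x) (hc_space (hc_restrict M U))" by simp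
      show "g ` hc_space (hc_restrict M W) = hc_space D'" by (simp only: spW D'(2) surj)
      show "(\<lambda>x. x) ` hc_space (hc_restrict M U) = {x \<in> hc_space (hc_restrict M W). g x = 0}"
        by (simp only: spU spW ker image_ident)
    qed
    then show ?thesis unfolding D'_def by blast
  qed
  have "f0 ` W \<noteq> {0} \<or> f1 ` W \<noteq> {0}"
  proof (rule ccontr)
    assume "\<not> ?thesis"
    then have "f0 x = 0" "f1 x = 0" if "x \<in> W" for x using that by blast+
    then have "f ` W \<subseteq> {0}" using f(3) by auto
    then show False using f(4) D0 cvs.subspace_0[OF subspace_hc_space[OF mD]] by blast
  qed
  then have "\<exists>q. kcl n (hc_restrict M W) = kcl n (hc_restrict M U) + kcl n (if q = (0::bit) then D else parity_shift D)"
    using main[OF f(1)] main[OF f(2)] zero_on_U by blast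
  moreover have "kcl n (if q = (0::bit) then D else parity_shift D) = k_class n D" for q
    using kcl_nat[OF mD] kcl_nat[OF hc_module_parity_shift[OF mD]] k_class_parity_shift[OF mD] by simp
  ultimately show ?thesis by simp
qed

text \<open>Submodules of the quotient pull back to submodules from U to W, and only these two
  exist.\<close>

lemma adjacent_quotient_irreducible:
  assumes M: "hc_module n M" and adj: "adjacent_submodules n M U W"
  obtains Q :: "nat hcmod" and \<pi> where "hc_irreducible n Q" "hc_hom_of_parity n 0 (hc_restrict M W) Q \<pi>"
    "\<pi> ` W = hc_space Q" "{x \<in> W. \<pi> x = 0} = U"
proof -
  have U: "hc_submodule n M U" and W: "hc_submodule n M W" and UW: "U \<subset> W"
    and max: "\<And>X. hc_submodule n M X \<Longrightarrow> U \<subseteq> X \<Longrightarrow> X \<subseteq> W \<Longrightarrow> X = U \<or> X = W"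
    using adj by (auto simp: adjacent_submodules_def)
  have mW: "hc_module n (hc_restrict M W)" by (rule hc_module_restrict[OF M W])
  have spW: "hc_space (hc_restrict M W) = W" by (rule hc_space_restrict[OF W])
  have "hc_submodule n (hc_restrict M W) U"
  proof (rule hc_submoduleI)
    note U' = hc_submoduleD[OF U]
    show "cvs.subspace U" by (rule U'(1))
    show "U \<subseteq> hc_space (hc_restrict M W)" using UW spW by blast
    show "\<exists>u v. x = u + v \<and> u \<in> U \<inter> grade (hc_restrict M W) 0 \<and> v \<in> U \<inter> grade (hc_restrict M W) 1" if "x \<in> U" for x
      using U'(3)[OF that] UW by (auto simp: hc_restrict_def)
    show "hc_c (hc_restrict M W) i x \<in> U" if "i \<in> {1..n}" "x \<in> U" for i x using U'(4)[OF that] by (simp add: hc_restrict_def)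
    show "hc_s (hc_restrict M W) w x \<in> U" if "w permutes {1..n}" "x \<in> U" for w x using U'(5)[OF that] by (simp add: hc_restrict_def)
  qed
  from quotient_model[OF mW this] obtain Q :: "nat hcmod" and \<pi> where Q: "hc_module n Q"
    "hc_hom_of_parity n 0 (hc_restrict M W) Q \<pi>" "\<pi> ` W = hc_space Q" "{x \<in> W. \<pi> x = 0} = U"
    unfolding spW by blast
  have "hc_irreducible n Q"
    unfolding hc_irreducible_def
  proof (intro conjI allI impI)
    show "hc_module n Q" by (rule Q(1))
    show "hc_space Q \<noteq> {0}" using Q(3,4) UW by blast
    fix X assume X: "hc_submodule n Q X"
    have "hc_submodule n (hc_restrict M W) {x \<in> W. \<pi> x \<in> X}"
      using hc_submodule_vimage[OF mW Q(1,2) X] by (simp add: spW)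
    then have "hc_submodule n M {x \<in> W. \<pi> x \<in> X}" by (rule hc_submodule_restrict[OF W])
    moreover have "U \<subseteq> {x \<in> W. \<pi> x \<in> X}" using Q(4) cvs.subspace_0[OF hc_submoduleD(1)[OF X]] by auto
    ultimately consider "{x \<in> W. \<pi> x \<in> X} = U" | "{x \<in> W. \<pi> x \<in> X} = W" using max by blast
    then show "X = {0} \<or> X = hc_space Q"
    proof cases
      case 1
      have "X \<subseteq> {0}"
      proof
        fix y assume y: "y \<in> X"
        then obtain x where "x \<in> W" "y = \<pi> x" using hc_submoduleD(2)[OF X] Q(3) by blast
        then show "y \<in> {0}" using 1 Q(4) y by blast
      qed
      then show ?thesis using cvs.subspace_0[OF hc_submoduleD(1)[OF X]] by blast
    next
      case 2
      have "hc_space Q \<subseteq> X"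
      proof
        fix y assume "y \<in> hc_space Q"
        then obtain x where x: "x \<in> W" "y = \<pi> x" using Q(3) by blast
        then have "x \<in> {x \<in> W. \<pi> x \<in> X}" using 2 by simp
        then show "y \<in> X" using x by simp
      qed
      then show ?thesis using hc_submoduleD(2)[OF X] by blast
    qed
  qed
  then show ?thesis using Q that by blast
qed

lemma quotient_iso_compose:
  assumes "hc_hom_of_parity n 0 M Q \<pi>" "\<pi> ` hc_space M = hc_space Q" "hc_module n Q" "hc_iso n Q D" "hc_module n D"
  shows "hc_quotient_iso n M {x \<in> hc_space M. \<pi> x = 0} D"
proof -
  obtain g g0 g1 where g: "hc_hom_of_parity n 0 Q D g0" "hc_hom_of_parity n 1 Q D g1" "g = (\<lambda>x. g0 x + g1 x)"
    "bij_betw g (hc_space Q) (hc_space D)"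
    using assms(4) unfolding hc_iso_def hc_hom_def by blast
  have "hc_hom_of_parity n 0 M D (\<lambda>x. g0 (\<pi> x))" "hc_hom_of_parity n 1 M D (\<lambda>x. g1 (\<pi> x))"
    using hc_hom_compose[OF assms(1) g(1) assms(3)] hc_hom_compose[OF assms(1) g(2) assms(3)] by (simp_all only: add_0_left)
  then have "hc_hom n M D (\<lambda>x. g (\<pi> x))" unfolding hc_hom_def g(3) by blast
  moreover have "(\<lambda>x. g (\<pi> x)) ` hc_space M = hc_space D"
    using assms(2) g(4) unfolding bij_betw_def by (metis image_image)
  moreover have "{x \<in> hc_space M. g (\<pi> x) = 0} = {x \<in> hc_space M. \<pi> x = 0}"
  proof -
    have g0: "g 0 = 0"
      using clinear_0[OF hc_hom_of_parityD(1)[OF g(1)]] clinear_0[OF hc_hom_of_parityD(1)[OF g(2)]] g(3) by simp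
    have "0 \<in> hc_space Q" by (rule cvs.subspace_0[OF subspace_hc_space[OF assms(3)]])
    then have "g y = 0 \<longleftrightarrow> y = 0" if "y \<in> hc_space Q" for y
      using g0 g(4) that unfolding bij_betw_def inj_on_def by metis
    then show ?thesis using assms(2) by blast
  qed
  ultimately show ?thesis unfolding hc_quotient_iso_def by blast
qed

lemma composition_series_adjacent:
  "composition_series n M Us \<longleftrightarrow> Us \<noteq> [] \<and> hd Us = {0} \<and> last Us = hc_space M \<and> (\<forall>U\<in>set Us. hc_submodule n M U) \<and>
     (\<forall>i. Suc i < length Us \<longrightarrow> adjacent_submodules n M (Us ! i) (Us ! Suc i))"
  unfolding composition_series_def adjacent_submodules_def by (auto simp: Suc_lessD) 

text \<open>Induction on the dimension: for nonzero U, a proper submodule X of greatest dimension is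
  adjacent to U, so a series up to X extends by U.\<close>

lemma composition_series_exists:
  assumes M: "hc_module n M"
  shows "\<exists>Us. composition_series n M Us"
proof -
  obtain B where B: "finite B" "hc_space M = cvs.span B" using hc_moduleD(3)[OF M] by blast
  have "\<exists>Us. Us \<noteq> [] \<and> hd Us = {0} \<and> last Us = U \<and> (\<forall>U\<in>set Us. hc_submodule n M U) \<and>
     (\<forall>i. Suc i < length Us \<longrightarrow> adjacent_submodules n M (Us ! i) (Us ! Suc i))" if "hc_submodule n M U" for U
    using that
  proof (induction "cvs.dim U" arbitrary: U rule: less_induct)
    case less
    note U = hc_submoduleD[OF less.prems]
    show ?case
    proof (cases "U = {0}")
      case True
      then show ?thesis using less.prems by (intro exI[of _ "[{0}]"]) auto
    next
      case False
      have dim_less: "cvs.dim X < cvs.dim Y" if sX: "hc_submodule n M X" and sY: "hc_submodule n M Y" and XY: "X \<subset> Y" for X Y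
      proof -
        note X = hc_submoduleD[OF sX] and Y = hc_submoduleD[OF sY]
        obtain C where C: "C \<subseteq> X" "cvs.independent C" "X \<subseteq> cvs.span C" using cvs.maximal_independent_subset by blast
        obtain E where E: "C \<subseteq> E" "E \<subseteq> Y" "cvs.independent E" "Y \<subseteq> cvs.span E"
          using cvs.maximal_independent_subset_extend[OF _ C(2), of Y] C(1) XY by blast
        have "finite E" using cvs.independent_span_bound[OF B(1) E(3)] E(2) Y(2) B(2) by blast
        have "C \<noteq> E" using C(3) E(2,4) XY cvs.span_minimal[OF C(1) X(1)] by blast
        then have "card C < card E" using E(1) \<open>finite E\<close> by (intro psubset_card_mono) auto
        then show ?thesis using cvs.basis_card_eq_dim[OF C(1,3,2)] cvs.basis_card_eq_dim[OF E(2,4,3)] by simp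
      qed
      let ?S = "{X. hc_submodule n M X \<and> X \<subset> U}"
      have "{0} \<in> ?S" using hc_submodule_0[OF M] False cvs.subspace_0[OF U(1)] by blast
      moreover have "\<forall>X\<in>?S. cvs.dim X \<le> cvs.dim U" using dim_less less.prems by (auto intro: less_imp_le)
      ultimately have "\<exists>X. X \<in> ?S \<and> (\<forall>Y. Y \<in> ?S \<longrightarrow> cvs.dim Y \<le> cvs.dim X)"
        by (intro ex_has_greatest_nat[of "\<lambda>X. X \<in> ?S" "{0}" cvs.dim "Suc (cvs.dim U)"]) (simp_all add: less_Suc_eq_le)
      then obtain X where X: "X \<in> ?S" "\<forall>Y. Y \<in> ?S \<longrightarrow> cvs.dim Y \<le> cvs.dim X" by (elim exE conjE)
      have "cvs.dim X < cvs.dim U" using dim_less X(1) less.prems by blast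
      then obtain Us where Us: "Us \<noteq> []" "hd Us = {0}" "last Us = X" "\<forall>U\<in>set Us. hc_submodule n M U"
        "\<forall>i. Suc i < length Us \<longrightarrow> adjacent_submodules n M (Us ! i) (Us ! Suc i)"
        using less.hyps[of X] X(1) by blast
      have adj: "adjacent_submodules n M X U"
        unfolding adjacent_submodules_def
      proof (intro conjI allI impI)
        show "hc_submodule n M X" "X \<subset> U" using X(1) by auto
        show "hc_submodule n M U" by (rule less.prems)
        fix Y assume Y: "hc_submodule n M Y \<and> X \<subseteq> Y \<and> Y \<subseteq> U"
        show "Y = X \<or> Y = U"
        proof (rule ccontr)
          assume "\<not> ?thesis"
          then have "X \<subset> Y" "Y \<in> ?S" using Y by auto
          then have "cvs.dim Y \<le> cvs.dim X" using X(2) by blast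
          moreover have "cvs.dim X < cvs.dim Y"
            using \<open>X \<subset> Y\<close> X(1) Y by (intro dim_less) auto
          ultimately show False by simp
        qed
      qed
      have "adjacent_submodules n M ((Us @ [U]) ! i) ((Us @ [U]) ! Suc i)" if i: "Suc i < length (Us @ [U])" for i
      proof (cases "Suc i < length Us")
        case True
        then show ?thesis using Us(5) by (simp add: nth_append)
      next
        case False
        then have "i = length Us - 1" "Suc i = length Us" using i Us(1) by auto
        then show ?thesis using adj Us(1,3) by (simp add: nth_append last_conv_nth)
      qed
      then show ?thesis using Us less.prems by (intro exI[of _ "Us @ [U]"]) auto
    qed
  qed
  moreover have "hc_submodule n M (hc_space M)"
  proof (rule hc_submoduleI)
    fix x assume x: "x \<in> hc_space M"
    obtain u v where uv: "x = u + v" "u \<in> grade M 0" "v \<in> grade M 1" using hc_spaceE[OF x] .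
    then have "u \<in> hc_space M" "v \<in> hc_space M" using grade_subset_hc_space[OF M] by blast+
    with uv show "\<exists>u v. x = u + v \<and> u \<in> hc_space M \<inter> grade M 0 \<and> v \<in> hc_space M \<inter> grade M 1" by blast
    show "hc_c M i x \<in> hc_space M" if "i \<in> {1..n}" for i using hc_space_ops(1)[OF M x that] .
    show "hc_s M w x \<in> hc_space M" if "w permutes {1..n}" for w using hc_space_ops(2)[OF M x that] .
  qed (use subspace_hc_space[OF M] in simp_all)
  ultimately show ?thesis unfolding composition_series_adjacent by blast
qed

section \<open>Multiplicities from the characteristic\<close>

lemma characteristic_map_sum:
  assumes "characteristic_map ch"
  shows "ch (\<Sum>x\<in>A. h x) = (\<Sum>x\<in>A. ch (h x))"
proof -
  have ch_add: "ch (x + y) = ch x + ch y" for x y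
    using assms by (simp add: characteristic_map_def Vector_Spaces.linear_iff)
  have "ch 0 = 0" using ch_add[of 0 0] by simp
  then show ?thesis by (induction A rule: infinite_finite_induct) (simp_all add: ch_add)
qed

text \<open>The factor of Q_lam in the characteristic of D^lam.\<close>

definition Q_coeff :: "nat list \<Rightarrow> complex" where
  "Q_coeff lam = 1 / 2 ^ ((length lam - partition_delta lam) div 2)"

lemma Q_coeff_nonzero: "Q_coeff lam \<noteq> 0"
  by (simp add: Q_coeff_def)

lemma schur_Q_scale_inject:
  assumes "lam \<in> strict_partitions n" "mu \<in> strict_partitions n" "c \<noteq> 0"
    "sf_scale c (schur_Q lam) = sf_scale d (schur_Q mu)"
  shows "lam = mu"
proof (rule ccontr)
  assume ne: "lam \<noteq> mu"
  have single: "(\<Sum>ka\<in>strict_partitions n. sf_scale (if ka = nu then e else 0) (schur_Q ka)) = sf_scale e (schur_Q nu)"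
    if "nu \<in> strict_partitions n" for nu e
  proof -
    have "(\<Sum>ka\<in>strict_partitions n. sf_scale (if ka = nu then e else 0) (schur_Q ka)) =
        (\<Sum>ka\<in>strict_partitions n. if ka = nu then sf_scale e (schur_Q ka) else 0)"
      by (intro sum.cong) auto
    then show ?thesis using that by simp
  qed
  have "(\<Sum>ka\<in>strict_partitions n. sf_scale (if ka = lam then c else 0) (schur_Q ka)) =
      (\<Sum>ka\<in>strict_partitions n. sf_scale (if ka = mu then d else 0) (schur_Q ka))"
    unfolding single[OF assms(1)] single[OF assms(2)] by (rule assms(4))
  from schur_Q_independent[OF this assms(1)] show False using ne assms(3) by simp
qed

text \<open>Each factor of the series is some D^mu, and the class of N telescopes to the sum of
  their classes. Applying ch and comparing coefficients of the linearly independent Q_mu counts the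
  factors with label lam.\<close>

lemma multiplicity_in_series:
  fixes N :: "'b hcmod" and D :: "nat list \<Rightarrow> nat hcmod"
  assumes ch: "characteristic_map ch" and lab: "irreducible_labelling ch n D"
    and N: "hc_module n N" and lam: "lam \<in> strict_partitions n"
    and ka: "ch (kcl n N) = (\<Sum>mu\<in>strict_partitions n. sf_scale (ka mu) (schur_Q mu))"
    and Us: "composition_series n N Us"
  shows "of_nat (card {i. Suc i < length Us \<and>
     hc_quotient_iso n (hc_restrict N (Us ! Suc i)) (Us ! i) (D lam)}) * Q_coeff lam = ka lam"
proof -
  have D: "hc_irreducible n (D mu)" "ch (k_class n (D mu)) = sf_scale (Q_coeff mu) (schur_Q mu)"
    if "mu \<in> strict_partitions n" for mu
    using lab that by (auto simp: irreducible_labelling_def strict_partitions_def Q_coeff_def)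
  have complete: "\<exists>mu\<in>strict_partitions n. hc_iso n M (D mu)" if "hc_irreducible n M" for M :: "nat hcmod"
    using lab that unfolding irreducible_labelling_def strict_partitions_def by blast
  have adj: "adjacent_submodules n N (Us ! i) (Us ! Suc i)" if "Suc i < length Us" for i
    using Us that by (simp add: composition_series_adjacent)
  let ?q = "\<lambda>i mu. hc_quotient_iso n (hc_restrict N (Us ! Suc i)) (Us ! i) (D mu)"
  have "\<exists>mu. mu \<in> strict_partitions n \<and> ?q i mu" if i: "Suc i < length Us" for i
  proof -
    have sub: "hc_submodule n N (Us ! Suc i)" using adj[OF i] by (simp add: adjacent_submodules_def)
    obtain Q :: "nat hcmod" and \<pi> where Q: "hc_irreducible n Q" "hc_hom_of_parity n 0 (hc_restrict N (Us ! Suc i)) Q \<pi>"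
      "\<pi> ` (Us ! Suc i) = hc_space Q" "{x \<in> Us ! Suc i. \<pi> x = 0} = Us ! i"
      using adjacent_quotient_irreducible[OF N adj[OF i]] by blast
    obtain mu where mu: "mu \<in> strict_partitions n" "hc_iso n Q (D mu)" using complete[OF Q(1)] by blast
    have "hc_module n Q" "hc_module n (D mu)" using Q(1) D(1)[OF mu(1)] by (simp_all add: hc_irreducible_def)
    then have "hc_quotient_iso n (hc_restrict N (Us ! Suc i)) {x \<in> hc_space (hc_restrict N (Us ! Suc i)). \<pi> x = 0} (D mu)"
      using Q(3) mu(2) by (intro quotient_iso_compose[OF Q(2)]) (simp_all add: hc_space_restrict[OF sub])
    then have "?q i mu" by (simp only: hc_space_restrict[OF sub] Q(4))
    then show ?thesis using mu(1) by blast
  qed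
  then obtain mu where mu: "\<And>i. Suc i < length Us \<Longrightarrow> mu i \<in> strict_partitions n"
    "\<And>i. Suc i < length Us \<Longrightarrow> ?q i (mu i)" by metis
  have step: "kcl n (hc_restrict N (Us ! Suc i)) = kcl n (hc_restrict N (Us ! i)) + k_class n (D nu)"
    if "Suc i < length Us" "nu \<in> strict_partitions n" "?q i nu" for i nu
    using kcl_adjacent[OF N adj[OF that(1)] D(1)[OF that(2)] that(3)] .
  \<comment> \<open>The label of a factor is unique because its class is the difference of two
    successive classes in the series; equal classes give proportional Schur Q-functions, hence equal
    labels.\<close>
  have unique: "?q i nu \<longleftrightarrow> mu i = nu" if i: "Suc i < length Us" and nu: "nu \<in> strict_partitions n" for i nu
  proof
    assume "?q i nu"
    then have "k_class n (D nu) = k_class n (D (mu i))"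
      using step[OF i nu] step[OF i mu(1)[OF i] mu(2)[OF i]] by simp
    then have "sf_scale (Q_coeff nu) (schur_Q nu) = sf_scale (Q_coeff (mu i)) (schur_Q (mu i))"
      using D(2)[OF nu] D(2)[OF mu(1)[OF i]] by simp
    then show "mu i = nu" by (rule schur_Q_scale_inject[OF nu mu(1)[OF i] Q_coeff_nonzero, symmetric])
  next
    assume "mu i = nu"
    then show "?q i nu" using mu(2)[OF i] by simp
  qed
  have Us': "Us \<noteq> []" "hd Us = {0}" "last Us = hc_space N" "\<forall>U\<in>set Us. hc_submodule n N U"
    using Us by (auto simp: composition_series_adjacent)
  define m where "m = length Us - 1"
  have len: "length Us = Suc m" using Us'(1) by (simp add: m_def)
  have partial: "kcl n (hc_restrict N (Us ! i)) = (\<Sum>j<i. k_class n (D (mu j)))" if "i \<le> m" for i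
    using that
  proof (induction i)
    case 0
    have sub: "hc_submodule n N (Us ! 0)" using Us'(4) len by simp
    have "Us ! 0 = {0}" using Us'(1,2) by (simp add: hd_conv_nth)
    then have "hc_space (hc_restrict N (Us ! 0)) = {0}" using hc_space_restrict[OF sub] by simp
    then show ?case using kcl_zero[OF hc_module_restrict[OF N sub]] by simp
  next
    case (Suc i)
    then show ?case using step[of i "mu i"] mu[of i] len by simp
  qed
  have top: "hc_submodule n N (hc_space N)" using Us'(1,3,4) last_in_set[of Us] by metis
  have "kcl n (hc_restrict N (hc_space N)) = kcl n N"
  proof (rule kcl_iso[OF hc_module_restrict[OF N top] N])
    show "hc_hom_of_parity n 0 (hc_restrict N (hc_space N)) N (\<lambda>x. x)"
      by (rule hc_hom_of_parityI) (auto simp: hc_restrict_def)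
    show "bij_betw (\<lambda>x. x) (hc_space (hc_restrict N (hc_space N))) (hc_space N)"
      by (simp add: hc_space_restrict[OF top] bij_betw_def)
  qed
  moreover have "Us ! m = hc_space N" using Us'(1,3) by (simp add: m_def last_conv_nth)
  ultimately have "kcl n N = (\<Sum>j<m. k_class n (D (mu j)))" using partial[of m] by simp
  then have "ch (kcl n N) = (\<Sum>j<m. sf_scale (Q_coeff (mu j)) (schur_Q (mu j)))"
    using D(2) mu(1) len by (simp add: characteristic_map_sum[OF ch])
  also have "\<dots> = (\<Sum>nu\<in>strict_partitions n. \<Sum>j\<in>{j \<in> {..<m}. mu j = nu}. sf_scale (Q_coeff (mu j)) (schur_Q (mu j)))"
    using mu(1) len by (intro sum.group[symmetric]) auto
  also have "\<dots> = (\<Sum>nu\<in>strict_partitions n. sf_scale (of_nat (card {j \<in> {..<m}. mu j = nu}) * Q_coeff nu) (schur_Q nu))"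
  proof (intro sum.cong refl)
    fix nu
    have "(\<Sum>j\<in>{j \<in> {..<m}. mu j = nu}. sf_scale (Q_coeff (mu j)) (schur_Q (mu j))) =
       (\<Sum>j\<in>{j \<in> {..<m}. mu j = nu}. sf_scale (Q_coeff nu) (schur_Q nu))" by (intro sum.cong) auto
    also have "\<dots> = sf_scale (\<Sum>j\<in>{j \<in> {..<m}. mu j = nu}. Q_coeff nu) (schur_Q nu)"
      by (rule sf.scale_sum_left[symmetric])
    finally show "(\<Sum>j\<in>{j \<in> {..<m}. mu j = nu}. sf_scale (Q_coeff (mu j)) (schur_Q (mu j))) =
       sf_scale (of_nat (card {j \<in> {..<m}. mu j = nu}) * Q_coeff nu) (schur_Q nu)" by simp
  qed
  finally have "of_nat (card {j \<in> {..<m}. mu j = lam}) * Q_coeff lam = ka lam"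
    using schur_Q_independent[OF _ lam, of "\<lambda>nu. of_nat (card {j \<in> {..<m}. mu j = nu}) * Q_coeff nu" ka] ka by simp
  moreover have "{i. Suc i < length Us \<and> ?q i lam} = {j \<in> {..<m}. mu j = lam}"
    using unique lam len by auto
  ultimately show ?thesis by simp
qed

text \<open>The coefficient of Q_lam fixes the count in every composition series at once, so
  \<open>THE\<close> has exactly one candidate.\<close>

lemma hc_multiplicity_eq:
  fixes N :: "'b hcmod" and D :: "nat list \<Rightarrow> nat hcmod"
  assumes ch: "characteristic_map ch" and lab: "irreducible_labelling ch n D"
    and N: "hc_module n N" and lam: "lam \<in> strict_partitions n"
    and ka: "ch (kcl n N) = (\<Sum>mu\<in>strict_partitions n. sf_scale (ka mu) (schur_Q mu))"
  shows "of_nat (hc_multiplicity n (D lam) N) * Q_coeff lam = ka lam"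
proof -
  let ?count = "\<lambda>Us. card {i. Suc i < length Us \<and> hc_quotient_iso n (hc_restrict N (Us ! Suc i)) (Us ! i) (D lam)}"
  note series = multiplicity_in_series[OF ch lab N lam ka]
  obtain Us where Us: "composition_series n N Us" using composition_series_exists[OF N] by blast
  have "hc_multiplicity n (D lam) N = ?count Us"
    unfolding hc_multiplicity_def
  proof (rule the_equality)
    show "\<exists>Us'. composition_series n N Us' \<and> ?count Us = ?count Us'" using Us by blast
    fix k assume "\<exists>Us. composition_series n N Us \<and> k = ?count Us"
    then obtain Us' where Us': "composition_series n N Us'" "k = ?count Us'" by blast
    have "of_nat (?count Us') * Q_coeff lam = of_nat (?count Us) * Q_coeff lam"
      using series[OF Us] series[OF Us'(1)] by simp
    then have "(of_nat (?count Us') :: complex) = of_nat (?count Us)" using Q_coeff_nonzero[of lam] by simp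
    then show "k = ?count Us" using Us'(2) of_nat_eq_iff by blast
  qed
  then show ?thesis using series[OF Us] by simp
qed

section \<open>Induced modules from orbits\<close>

lemma sn_monomial_regular:
  "sn_monomial n {w. w permutes {1..n}} (\<lambda>v w. v \<circ> w) (\<lambda>_ _. 1) (regular_sn n)"
proof (rule sn_monomialI)
  show "finite {w. w permutes {1..n}}" by (rule finite_permutations) simp
  show "sn_space (regular_sn n) = coords {w. w permutes {1..n}}" by (simp add: regular_sn_def span_basis)
qed (auto simp: regular_sn_def permutes_compose)

text \<open>An equivariant map of the second factors, tensored with the identity of C_n. The values
  of h are vectors, not only basis elements, so that projections are covered.\<close>

lemma perm_module_tensor_hom:
  assumes S: "sn_monomial n S pm (\<lambda>_ _. 1) (perm_module S pm)" and R: "sn_monomial n R rm (\<lambda>_ _. 1) M"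
    and h: "\<And>x. x \<in> R \<Longrightarrow> h x \<in> coords S"
      "\<And>w x. w permutes {1..n} \<Longrightarrow> x \<in> R \<Longrightarrow> h (rm w x) = sn_act (perm_module S pm) w (h x)"
  shows "hc_hom_of_parity n 0 (hc_tensor (clifford_module n) M) (hc_tensor (clifford_module n) (perm_module S pm))
    (tensor_op id (lin_ext h))"
proof -
  let ?R = "hc_tensor (clifford_module n) M" and ?P = "hc_tensor (clifford_module n) (perm_module S pm)"
  let ?f = "tensor_op id (lin_ext h) :: (nat set \<times> 'b \<Rightarrow>\<^sub>0 complex) \<Rightarrow> (nat set \<times> 'a \<Rightarrow>\<^sub>0 complex)"
  note lin_op = clinear_hc_tensor
  have f_vec: "?f (tensor_vec u x) = tensor_vec u (lin_ext h x)" for u x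
    by (simp add: tensor_op_vec)
  have fin: "finite A" if "A \<subseteq> {1..n}" for A :: "nat set" using that by (rule finite_subset) simp
  have spR: "hc_space ?R = coords (Pow {1..n} \<times> R)" by (rule hc_space_hc_tensor[OF R])
  show ?thesis
  proof (rule hc_hom_of_parityI)
    show "clinear ?f" by simp
    fix q x assume x: "x \<in> grade ?R q"
    have "?f ` coords (clifford_basis n q \<times> R) \<subseteq> coords (clifford_basis n q \<times> S)"
    proof (rule coords_image_subset[OF clinear_tensor_op subspace_coords])
      fix y assume "y \<in> clifford_basis n q \<times> R"
      then obtain A t where y: "y = (A, t)" "A \<in> clifford_basis n q" "t \<in> R" by blast
      show "?f (basis_vec y) \<in> coords (clifford_basis n q \<times> S)"
        using y h(1)[OF y(3)] tensor_vec_in_coords[of "basis_vec A" "clifford_basis n q" "h t" S] by simp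
    qed
    then show "?f x \<in> grade ?P (q + 0)" using x by (auto simp only: grade_hc_tensor[OF R] grade_hc_tensor[OF S] add_0_right)
  next
    fix x i assume x: "x \<in> hc_space ?R" and i: "i \<in> {1..n}"
    have "?f (hc_c ?R i x) = hc_c ?P i (?f x)"
    proof (rule coords_linear_eq[OF clinear_compose[OF clinear_tensor_op lin_op(2)] clinear_compose[OF lin_op(2) clinear_tensor_op] _ x[unfolded spR]])
      fix y assume "y \<in> Pow {1..n} \<times> R"
      then obtain A t where y: "y = (A, t)" by force
      show "?f (hc_c ?R i (basis_vec y)) = hc_c ?P i (?f (basis_vec y))"
        by (simp add: y hc_c_hc_tensor hc_c_clifford_module f_vec tensor_op_vec)
    qed
    then show "?f (hc_c ?R i x) = (if (0::bit) = 1 then - hc_c ?P i (?f x) else hc_c ?P i (?f x))" by simp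
  next
    fix x w assume x: "x \<in> hc_space ?R" and w: "w permutes {1..n}"
    show "?f (hc_s ?R w x) = hc_s ?P w (?f x)"
    proof (rule coords_linear_eq[OF clinear_compose[OF clinear_tensor_op lin_op(1)] clinear_compose[OF lin_op(1) clinear_tensor_op] _ x[unfolded spR]])
      fix y assume "y \<in> Pow {1..n} \<times> R"
      then obtain A t where y: "y = (A, t)" "A \<subseteq> {1..n}" "t \<in> R" by force
      have hs: "hc_s ?P w = tensor_op (hc_s (clifford_module n) w) (sn_act (perm_module S pm) w)"
        by (simp add: hc_tensor_def)
      have l: "clinear (hc_s (clifford_module n) w)" "clinear (sn_act (perm_module S pm) w)"
        using sn_monomialD(3)[OF S w] by (simp_all add: hc_s_clifford_module)
      show "?f (hc_s ?R w (basis_vec y)) = hc_s ?P w (?f (basis_vec y))"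
        unfolding y(1) hc_s_hc_tensor_basis[OF R w fin[OF y(2)] y(3)] tensor_op_basis hs id_apply lin_ext_basis
          tensor_op_vec[OF l] hc_s_clifford_basis[OF w fin[OF y(2)]] clinear_scale[OF clinear_tensor_op]
          tensor_vec_scale h(2)[OF w y(3), symmetric] by simp
    qed
  qed
qed

text \<open>Orbit and stabiliser: c_A w goes to c_A \<otimes> w t0. Two permutations have equal
  images exactly when they differ by a right factor that fixes t0, that is, one from the Young
  subgroup, so the kernel is spanned by the differences h v - h.\<close>

lemma is_induced_trivial_orbit:
  assumes T: "sn_monomial n T pm (\<lambda>_ _. 1) (perm_module T pm)"
    and t0: "t0 \<in> T" and trans: "\<And>t. t \<in> T \<Longrightarrow> \<exists>w. w permutes {1..n} \<and> pm w t0 = t"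
    and stab: "\<And>w. w permutes {1..n} \<Longrightarrow> pm w t0 = t0 \<longleftrightarrow> w \<in> young_subgroup nu" and nu: "sum_list nu = n"
  shows "is_induced_trivial n nu (nat_model n (hc_tensor (clifford_module n) (perm_module T pm)))"
proof -
  let ?R = "hc_regular n" and ?P = "hc_tensor (clifford_module n) (perm_module T pm)"
  let ?S = "{w. w permutes {1..n}}"
  let ?K = "cvs.span {hc_right_mult v h - h |v h. v \<in> young_subgroup nu \<and> h \<in> hc_space ?R}"
  have R: "sn_monomial n ?S (\<lambda>v w. v \<circ> w) (\<lambda>_ _. 1) (regular_sn n)" by (rule sn_monomial_regular)
  note T' = sn_monomialD[OF T]
  have mP: "hc_module n ?P" by (rule hc_module_hc_tensor[OF T])
  have spR: "hc_space ?R = coords (Pow {1..n} \<times> ?S)" unfolding hc_regular_def by (rule hc_space_hc_tensor[OF R])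
  have spP: "hc_space ?P = coords (Pow {1..n} \<times> T)" by (rule hc_space_hc_tensor[OF T])
  define f where "f = (tensor_op id (lin_ext (\<lambda>w. basis_vec (pm w t0))) :: (nat set \<times> (nat \<Rightarrow> nat) \<Rightarrow>\<^sub>0 complex) \<Rightarrow> (nat set \<times> 'a \<Rightarrow>\<^sub>0 complex))"
  have f_basis: "f (basis_vec (A, w)) = basis_vec (A, pm w t0)" for A w by (simp add: f_def)
  have lin_f: "clinear f" by (simp add: f_def)
  have hom_f: "hc_hom_of_parity n 0 ?R ?P f"
    unfolding hc_regular_def f_def
  proof (rule perm_module_tensor_hom[OF T R])
    show "basis_vec (pm x t0) \<in> coords T" if "x \<in> ?S" for x using T'(4)[OF _ t0] that by simp
    show "basis_vec (pm (w \<circ> x) t0) = sn_act (perm_module T pm) w (basis_vec (pm x t0))"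
      if "w permutes {1..n}" "x \<in> ?S" for w x
      using T'(8)[OF that(1) _ t0, of x] that(2) by (simp add: perm_module_def)
  qed
  \<comment> \<open>A coset representative for each point of the orbit; it gives the section g of
    f.\<close>
  define r where "r t = (SOME w. w permutes {1..n} \<and> pm w t0 = t)" for t
  have r: "r t permutes {1..n}" "pm (r t) t0 = t" if "t \<in> T" for t
    using someI_ex[OF trans[OF that]] by (simp_all add: r_def)
  define g where "g = lin_ext (\<lambda>(A, t). basis_vec (A :: nat set, r t))"
  have lin_g: "clinear g" and g_basis: "g (basis_vec (A, t)) = basis_vec (A, r t)" for A t by (simp_all add: g_def)
  have g_R: "g ` coords (Pow {1..n} \<times> T) \<subseteq> hc_space ?R"
    unfolding spR by (rule coords_image_subset[OF lin_g subspace_coords]) (use r in \<open>auto simp: g_basis\<close>)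
  have fg: "f (g y) = y" if "y \<in> coords (Pow {1..n} \<times> T)" for y
    by (rule coords_linear_eq[OF clinear_compose[OF lin_f lin_g] clinear_id(2) _ that]) (auto simp: g_basis f_basis r)
  have f_img: "f ` hc_space ?R = hc_space ?P"
  proof
    show "f ` hc_space ?R \<subseteq> hc_space ?P" using hc_hom_space[OF hom_f mP] by blast
    show "hc_space ?P \<subseteq> f ` hc_space ?R"
    proof
      fix y assume "y \<in> hc_space ?P"
      then have "g y \<in> hc_space ?R" "y = f (g y)" using fg[of y] g_R unfolding spP by auto
      then show "y \<in> f ` hc_space ?R" by blast
    qed
  qed
  have young: "v permutes {1..n}" if "v \<in> young_subgroup nu" for v using that by (simp add: young_subgroup_def nu)
  have lin_rm: "clinear (hc_right_mult v)" for v by (simp add: hc_right_mult_def)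
  have rm_basis: "hc_right_mult v (basis_vec (A, w)) = basis_vec (A, w \<circ> v)" for v A w by (simp add: hc_right_mult_def)
  have ker: "{x \<in> hc_space ?R. f x = 0} = ?K"
  proof
    show "{x \<in> hc_space ?R. f x = 0} \<subseteq> ?K"
    proof
      fix x assume "x \<in> {x \<in> hc_space ?R. f x = 0}"
      then have x: "x \<in> coords (Pow {1..n} \<times> ?S)" "f x = 0" by (auto simp: spR)
      \<comment> \<open>Replacing w by the representative of w t0 is right multiplication by an
        element of the Young subgroup. So x and g (f x) agree modulo the span, which for f x = 0
        puts x into it.\<close>
      have "(\<lambda>x. g (f x) - x) ` coords (Pow {1..n} \<times> ?S) \<subseteq> ?K"
      proof (rule coords_image_subset[OF _ cvs.subspace_span])
        show "clinear (\<lambda>x. g (f x) - x)"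
          using clinear_plus[OF clinear_compose[OF lin_g lin_f] clinear_uminus[OF clinear_id(2)]] by simp
        fix y assume y0: "y \<in> Pow {1..n} \<times> ?S"
        then obtain A w where y: "y = (A, w)" "A \<subseteq> {1..n}" "w permutes {1..n}" by auto
        have t: "pm w t0 \<in> T" by (rule T'(4)[OF y(3) t0])
        define w' where "w' = r (pm w t0)"
        have w': "w' permutes {1..n}" "pm w' t0 = pm w t0" using r[OF t] by (simp_all add: w'_def)
        define v where "v = inv w \<circ> w'"
        have v: "v permutes {1..n}" unfolding v_def by (rule permutes_compose[OF w'(1) permutes_inv[OF y(3)]])
        have "pm v t0 = pm (inv w) (pm w' t0)" unfolding v_def by (rule T'(8)[OF permutes_inv[OF y(3)] w'(1) t0])
        also have "\<dots> = pm (inv w \<circ> w) t0" unfolding w'(2) by (rule T'(8)[OF permutes_inv[OF y(3)] y(3) t0, symmetric])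
        also have "inv w \<circ> w = id" by (rule permutes_inv_o(2)[OF y(3)])
        also have "pm id t0 = t0" by (rule T'(6)[OF t0])
        finally have vy: "v \<in> young_subgroup nu" using stab[OF v] by simp
        have wv: "w \<circ> v = w'" unfolding v_def using permutes_inverses(1)[OF y(3)] by (auto simp: fun_eq_iff)
        have "basis_vec y \<in> hc_space ?R" unfolding spR using y0 by simp
        then have "hc_right_mult v (basis_vec y) - basis_vec y \<in> ?K"
          using vy by (intro cvs.span_base) blast
        moreover have "g (f (basis_vec y)) = hc_right_mult v (basis_vec y)"
          by (simp add: y(1) f_basis g_basis rm_basis wv flip: w'_def)
        ultimately show "g (f (basis_vec y)) - basis_vec y \<in> ?K" by simp
      qed
      then have "g (f x) - x \<in> ?K" using x(1) by blast
      then have "- x \<in> ?K" using x(2) clinear_0[OF lin_g] by simp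
      then show "x \<in> ?K" using cvs.span_neg[of "- x"] by simp
    qed
    show "?K \<subseteq> {x \<in> hc_space ?R. f x = 0}"
    proof (rule cvs.span_minimal)
      show "cvs.subspace {x \<in> hc_space ?R. f x = 0}"
        unfolding cvs.subspace_def spR using cvs.subspace_add[OF subspace_coords] cvs.subspace_scale[OF subspace_coords]
        by (auto simp: clinear_0[OF lin_f] clinear_add[OF lin_f] clinear_scale[OF lin_f])
      have "hc_right_mult v h - h \<in> hc_space ?R \<and> f (hc_right_mult v h - h) = 0"
        if v: "v \<in> young_subgroup nu" and h: "h \<in> hc_space ?R" for v h
      proof -
        have "hc_right_mult v ` coords (Pow {1..n} \<times> ?S) \<subseteq> coords (Pow {1..n} \<times> ?S)"
        proof (rule coords_image_subset[OF lin_rm subspace_coords])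
          fix y assume "y \<in> Pow {1..n} \<times> ?S"
          then obtain A w where y: "y = (A, w)" "A \<subseteq> {1..n}" "w permutes {1..n}" by auto
          then show "hc_right_mult v (basis_vec y) \<in> coords (Pow {1..n} \<times> ?S)"
            using permutes_compose[OF young[OF v] y(3)] by (simp add: rm_basis)
        qed
        then have "hc_right_mult v h \<in> coords (Pow {1..n} \<times> ?S)" using h unfolding spR by blast
        then have 1: "hc_right_mult v h - h \<in> hc_space ?R" using h unfolding spR by (intro cvs.subspace_diff[OF subspace_coords])
        have "f (hc_right_mult v h) = f h"
        proof (rule coords_linear_eq[OF clinear_compose[OF lin_f lin_rm] lin_f _ h[unfolded spR]])
          fix y assume "y \<in> Pow {1..n} \<times> ?S"
          then obtain A w where y: "y = (A, w)" "w permutes {1..n}" by auto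
          have "pm (w \<circ> v) t0 = pm w t0"
            using T'(8)[OF y(2) young[OF v] t0] stab[OF young[OF v]] v by simp
          then show "f (hc_right_mult v (basis_vec y)) = f (basis_vec y)" by (simp add: y(1) rm_basis f_basis)
        qed
        then show ?thesis using 1 by (simp add: clinear_diff[OF lin_f])
      qed
      then show "{hc_right_mult v h - h |v h. v \<in> young_subgroup nu \<and> h \<in> hc_space ?R} \<subseteq> {x \<in> hc_space ?R. f x = 0}"
        by blast
    qed
  qed
  obtain h where h: "hc_module n (nat_model n ?P)" "hc_hom_of_parity n 0 ?P (nat_model n ?P) h"
    "bij_betw h (hc_space ?P) (hc_space (nat_model n ?P))" using nat_model[OF mP] .
  have hf: "hc_hom_of_parity n 0 ?R (nat_model n ?P) (\<lambda>x. h (f x))"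
    using hc_hom_compose[OF hom_f h(2) mP] by (simp only: add_0_right)
  have "hc_hom n ?R (nat_model n ?P) (\<lambda>x. h (f x))"
    unfolding hc_hom_def
    by (intro exI[of _ "\<lambda>x. h (f x)"] exI[of _ "\<lambda>x. 0"] conjI hf hc_hom_zero[OF h(1)]) simp
  moreover have "(\<lambda>x. h (f x)) ` hc_space ?R = hc_space (nat_model n ?P)"
    using h(3) f_img unfolding bij_betw_def by (metis image_image)
  moreover have "{x \<in> hc_space ?R. h (f x) = 0} = ?K"
  proof -
    have "h y = 0 \<longleftrightarrow> y = 0" if "y \<in> hc_space ?P" for y
      using that h(3) clinear_0[OF hc_hom_of_parityD(1)[OF h(2)]] cvs.subspace_0[OF subspace_hc_space[OF mP]]
      unfolding bij_betw_def inj_on_def by metis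
    then have "h (f x) = 0 \<longleftrightarrow> f x = 0" if "x \<in> hc_space ?R" for x using that f_img by blast
    then show ?thesis using ker by blast
  qed
  ultimately show ?thesis
    unfolding is_induced_trivial_def hc_quotient_iso_def using h(1) by blast
qed

text \<open>The exact sequence of the inclusion of the part over S and the projection onto the part
  over T. The projection is equivariant because S and T are both invariant and disjoint.\<close>

lemma kcl_perm_module_union:
  assumes S: "sn_monomial n S pm (\<lambda>_ _. 1) (perm_module S pm)" and T: "sn_monomial n T pm (\<lambda>_ _. 1) (perm_module T pm)"
    and ST: "sn_monomial n (S \<union> T) pm (\<lambda>_ _. 1) (perm_module (S \<union> T) pm)" and disj: "S \<inter> T = {}"
  shows "kcl n (hc_tensor (clifford_module n) (perm_module (S \<union> T) pm)) =
    kcl n (hc_tensor (clifford_module n) (perm_module S pm)) + kcl n (hc_tensor (clifford_module n) (perm_module T pm))"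
proof -
  let ?P = "\<lambda>S. hc_tensor (clifford_module n) (perm_module S pm)"
  have i: "hc_hom_of_parity n 0 (?P S) (?P (S \<union> T)) (tensor_op id (lin_ext (\<lambda>t. basis_vec t)))"
    by (rule perm_module_tensor_hom[OF ST S]) (auto simp: perm_module_def)
  have i_id: "tensor_op id (lin_ext (\<lambda>t. basis_vec t)) x = x" for x :: "nat set \<times> 'a \<Rightarrow>\<^sub>0 complex"
    by (rule clinear_eq[OF clinear_tensor_op clinear_id(2)]) auto
  have g: "hc_hom_of_parity n 0 (?P (S \<union> T)) (?P T) (tensor_op id (lin_ext (\<lambda>t. if t \<in> T then basis_vec t else 0)))"
  proof (rule perm_module_tensor_hom[OF T ST])
    show "(if t \<in> T then basis_vec t else 0) \<in> coords T" for t by simp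
    fix w x assume w: "w permutes {1..n}" and x: "x \<in> S \<union> T"
    have "pm w x \<in> T \<longleftrightarrow> x \<in> T"
      using sn_monomialD(4)[OF S w, of x] sn_monomialD(4)[OF T w, of x] x disj by blast
    then show "(if pm w x \<in> T then basis_vec (pm w x) else 0) =
        sn_act (perm_module T pm) w (if x \<in> T then basis_vec x else 0)"
      by (simp add: perm_module_def clinear_0[OF clinear_lin_ext])
  qed
  let ?g = "tensor_op id (lin_ext (\<lambda>t. if t \<in> T then basis_vec t else 0)) :: (nat set \<times> 'a \<Rightarrow>\<^sub>0 complex) \<Rightarrow> _"
  have sp: "hc_space (?P S) = coords (Pow {1..n} \<times> S)" "hc_space (?P T) = coords (Pow {1..n} \<times> T)"
    "hc_space (?P (S \<union> T)) = coords (Pow {1..n} \<times> (S \<union> T))"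
    using hc_space_hc_tensor S T ST by blast+
  have g_basis: "?g (basis_vec (A, t)) = (if t \<in> T then basis_vec (A, t) else 0)" for A t by simp
  \<comment> \<open>The coordinates of the projection, from which its kernel is determined.\<close>
  have lookup_g: "Poly_Mapping.lookup (?g x) (A, t) = (if t \<in> T then Poly_Mapping.lookup x (A, t) else 0)" for x A t
  proof -
    have "Poly_Mapping.lookup (?g x) (A, t) = Poly_Mapping.lookup (lin_ext (\<lambda>(A, t). if t \<in> T then basis_vec (A, t) else 0) x) (A, t)"
      by (rule arg_cong[of _ _ "\<lambda>y. Poly_Mapping.lookup y (A, t)"], rule clinear_eq[OF clinear_tensor_op clinear_lin_ext])
        (auto simp: g_basis)
    also have "\<dots> = (\<Sum>b\<in>Poly_Mapping.keys x. if b = (A, t) then (if t \<in> T then Poly_Mapping.lookup x (A, t) else 0) else 0)"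
      unfolding lin_ext_def lookup_sum
    proof (intro sum.cong refl)
      fix b
      show "Poly_Mapping.lookup (cscale (Poly_Mapping.lookup x b) (case b of (A, t) \<Rightarrow> if t \<in> T then basis_vec (A, t) else 0)) (A, t) =
        (if b = (A, t) then if t \<in> T then Poly_Mapping.lookup x (A, t) else 0 else 0)"
      proof (cases "b = (A, t)")
        case False
        then show ?thesis by (cases b) (simp add: lookup_single_not_eq)
      qed simp
    qed
    also have "\<dots> = (if t \<in> T then Poly_Mapping.lookup x (A, t) else 0)"
      by (simp add: in_keys_iff)
    finally show ?thesis .
  qed
  show ?thesis
  proof (rule kcl_short_exact[OF _ _ _ i _ g])
    show "hc_module n (?P S)" "hc_module n (?P T)" "hc_module n (?P (S \<union> T))"
      using hc_module_hc_tensor S T ST by blast+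
    show "inj_on (tensor_op id (lin_ext (\<lambda>t. basis_vec t))) (hc_space (?P S))" by (simp add: i_id inj_on_def)
    show "?g ` hc_space (?P (S \<union> T)) = hc_space (?P T)"
    proof
      show "?g ` hc_space (?P (S \<union> T)) \<subseteq> hc_space (?P T)"
        unfolding sp by (rule coords_image_subset[OF clinear_tensor_op subspace_coords]) (auto simp: g_basis)
      show "hc_space (?P T) \<subseteq> ?g ` hc_space (?P (S \<union> T))"
      proof
        fix y assume y: "y \<in> hc_space (?P T)"
        have "?g y = y"
          by (rule coords_linear_eq[OF clinear_tensor_op clinear_id(2) _ y[unfolded sp]]) (auto simp: g_basis)
        moreover have "y \<in> hc_space (?P (S \<union> T))" using y unfolding sp by (auto simp: coords_def)
        ultimately show "y \<in> ?g ` hc_space (?P (S \<union> T))" by (rule image_eqI[OF sym])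
      qed
    qed
    show "tensor_op id (lin_ext (\<lambda>t. basis_vec t)) ` hc_space (?P S) = {x \<in> hc_space (?P (S \<union> T)). ?g x = 0}"
    proof -
      have "x \<in> coords (Pow {1..n} \<times> S) \<longleftrightarrow> x \<in> coords (Pow {1..n} \<times> (S \<union> T)) \<and> ?g x = 0" for x
      proof
        assume x: "x \<in> coords (Pow {1..n} \<times> S)"
        have "?g x = 0"
          by (rule coords_linear_eq[OF clinear_tensor_op clinear_zero _ x]) (use disj in \<open>auto simp: g_basis\<close>)
        then show "x \<in> coords (Pow {1..n} \<times> (S \<union> T)) \<and> ?g x = 0" using x by (auto simp: coords_def)
      next
        assume x: "x \<in> coords (Pow {1..n} \<times> (S \<union> T)) \<and> ?g x = 0"
        have "t \<in> S" "A \<subseteq> {1..n}" if "(A, t) \<in> Poly_Mapping.keys x" for A t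
        proof -
          have "(A, t) \<in> Pow {1..n} \<times> (S \<union> T)" using x that by (auto simp: coords_def)
          moreover have "t \<notin> T" using lookup_g[of x A t] x that by (auto simp: in_keys_iff)
          ultimately show "t \<in> S" "A \<subseteq> {1..n}" by auto
        qed
        then have "Poly_Mapping.keys x \<subseteq> Pow {1..n} \<times> S" by (intro subrelI SigmaI PowI)
        then show "x \<in> coords (Pow {1..n} \<times> S)" by (simp only: coords_def mem_Collect_eq)
      qed
      then show ?thesis unfolding sp by (auto simp: i_id)
    qed
  qed
qed

lemma kcl_perm_module_UNION:
  assumes M: "sn_monomial n T pm sg M" and "finite L" and sub: "\<And>nu. nu \<in> L \<Longrightarrow> X nu \<subseteq> T"
    and stable: "\<And>nu w t. nu \<in> L \<Longrightarrow> w permutes {1..n} \<Longrightarrow> t \<in> X nu \<Longrightarrow> pm w t \<in> X nu"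
    and disj: "\<And>nu mu. nu \<in> L \<Longrightarrow> mu \<in> L \<Longrightarrow> nu \<noteq> mu \<Longrightarrow> X nu \<inter> X mu = {}"
  shows "kcl n (hc_tensor (clifford_module n) (perm_module (\<Union>nu\<in>L. X nu) pm)) =
    (\<Sum>nu\<in>L. kcl n (hc_tensor (clifford_module n) (perm_module (X nu) pm)))"
  using assms(2-)
proof (induction L rule: finite_induct)
  case empty
  have E: "sn_monomial n {} pm (\<lambda>_ _. 1) (perm_module {} pm)" by (rule sn_monomial_perm_module[OF M]) auto
  have "hc_space (hc_tensor (clifford_module n) (perm_module {} pm)) = {0}"
    using hc_space_hc_tensor[OF E] by (auto simp: coords_def)
  then show ?case using kcl_zero[OF hc_module_hc_tensor[OF E]] by simp
next
  case (insert nu L)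
  have mono: "sn_monomial n S pm (\<lambda>_ _. 1) (perm_module S pm)"
    if "S \<subseteq> T" "\<And>w t. w permutes {1..n} \<Longrightarrow> t \<in> S \<Longrightarrow> pm w t \<in> S" for S
    using sn_monomial_perm_module[OF M that] .
  have "kcl n (hc_tensor (clifford_module n) (perm_module (X nu \<union> (\<Union>mu\<in>L. X mu)) pm)) =
     kcl n (hc_tensor (clifford_module n) (perm_module (X nu) pm)) +
     kcl n (hc_tensor (clifford_module n) (perm_module (\<Union>mu\<in>L. X mu) pm))"
  proof (rule kcl_perm_module_union)
    show "sn_monomial n (X nu) pm (\<lambda>_ _. 1) (perm_module (X nu) pm)"
      using insert.prems(1,2)[of nu] by (intro mono) auto
    show "sn_monomial n (\<Union>mu\<in>L. X mu) pm (\<lambda>_ _. 1) (perm_module (\<Union>mu\<in>L. X mu) pm)"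
      using insert.prems(1) insert.prems(2) by (intro mono) blast+
    show "sn_monomial n (X nu \<union> (\<Union>mu\<in>L. X mu)) pm (\<lambda>_ _. 1) (perm_module (X nu \<union> (\<Union>mu\<in>L. X mu)) pm)"
      using insert.prems(1) insert.prems(2) by (intro mono) blast+
    show "X nu \<inter> (\<Union>mu\<in>L. X mu) = {}"
    proof -
      have "X nu \<inter> X mu = {}" if "mu \<in> L" for mu using insert.prems(3)[of nu mu] that insert.hyps(2) by blast
      then show ?thesis by blast
    qed
  qed
  moreover have "kcl n (hc_tensor (clifford_module n) (perm_module (\<Union>mu\<in>L. X mu) pm)) =
    (\<Sum>mu\<in>L. kcl n (hc_tensor (clifford_module n) (perm_module (X mu) pm)))"
    using insert.prems by (intro insert.IH) blast+
  ultimately show ?case using insert.hyps by simp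
qed

section \<open>Young subgroups and consecutive blocks\<close>

fun block_index :: "nat list \<Rightarrow> nat \<Rightarrow> nat" where
  "block_index [] i = 0"
| "block_index (r # rs) i = (if i \<le> r then 0 else Suc (block_index rs (i - r)))"

lemma block_index_eq_iff:
  assumes "i \<in> {1..sum_list nu}" "j < length nu"
  shows "block_index nu i = j \<longleftrightarrow> i \<in> {sum_list (take j nu) + 1..sum_list (take (Suc j) nu)}"
  using assms
proof (induction nu arbitrary: i j)
  case (Cons r rs)
  show ?case
  proof (cases "i \<le> r")
    case True
    then show ?thesis using Cons.prems by (cases j) auto
  next
    case False
    then have "i - r \<in> {1..sum_list rs}" using Cons.prems by auto
    then show ?thesis using Cons.IH[of "i - r"] Cons.prems(2) False by (cases j) auto
  qed
qed simp

lemma block_index_less: "1 \<le> i \<Longrightarrow> i \<le> sum_list nu \<Longrightarrow> block_index nu i < length nu"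
  by (induction nu arbitrary: i) auto

text \<open>Empty blocks change the numbers of the other blocks but not the division into blocks.
  Positions start at 1, since 0 would be assigned to an empty first block.\<close>

lemma block_index_filter:
  assumes "1 \<le> i" "1 \<le> i'"
  shows "block_index (filter ((<) 0) nu) i = block_index (filter ((<) 0) nu) i' \<longleftrightarrow> block_index nu i = block_index nu i'"
  using assms
proof (induction nu arbitrary: i i')
  case (Cons r nu)
  show ?case
    using Cons.IH[of i i'] Cons.IH[of "i - r" "i' - r"] Cons.prems by (cases "r = 0") auto
qed simp

lemma block_eq_fibre:
  assumes "j < length nu"
  shows "{sum_list (take j nu) + 1..sum_list (take (Suc j) nu)} = {i \<in> {1..sum_list nu}. block_index nu i = j}"
proof -
  have "sum_list (take (Suc j) nu) \<le> sum_list nu"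
    using sum_list_append[of "take (Suc j) nu" "drop (Suc j) nu"] by simp
  then have "i \<in> {1..sum_list nu}" if "i \<in> {sum_list (take j nu) + 1..sum_list (take (Suc j) nu)}" for i
    using that by (simp only: atLeastAtMost_iff) linarith
  then show ?thesis using block_index_eq_iff[OF _ assms] by blast
qed

lemma card_block_fibre:
  assumes "j < length nu"
  shows "card {i \<in> {1..sum_list nu}. block_index nu i = j} = nu ! j"
  unfolding block_eq_fibre[OF assms, symmetric] using assms by (simp add: take_Suc_conv_app_nth)

text \<open>The Young subgroup as the stabiliser of the block numbering: a permutation that sends
  every block into itself maps it onto itself, as blocks are finite.\<close>

lemma young_subgroup_eq:
  "young_subgroup nu = {w. w permutes {1..sum_list nu} \<and> (\<forall>i\<in>{1..sum_list nu}. block_index nu (w i) = block_index nu i)}"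
  (is "_ = ?R")
proof -
  let ?F = "\<lambda>j. {i \<in> {1..sum_list nu}. block_index nu i = j}"
  have "(\<forall>j<length nu. w ` ?F j = ?F j) \<longleftrightarrow> (\<forall>i\<in>{1..sum_list nu}. block_index nu (w i) = block_index nu i)"
    if w: "w permutes {1..sum_list nu}" for w
  proof
    assume *: "\<forall>j<length nu. w ` ?F j = ?F j"
    show "\<forall>i\<in>{1..sum_list nu}. block_index nu (w i) = block_index nu i"
    proof
      fix i assume i: "i \<in> {1..sum_list nu}"
      then have "block_index nu i < length nu" by (intro block_index_less) auto
      then have "w ` ?F (block_index nu i) = ?F (block_index nu i)" using * by blast
      moreover have "w i \<in> w ` ?F (block_index nu i)" using i by blast
      ultimately show "block_index nu (w i) = block_index nu i" by blast
    qed
  next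
    assume *: "\<forall>i\<in>{1..sum_list nu}. block_index nu (w i) = block_index nu i"
    show "\<forall>j<length nu. w ` ?F j = ?F j"
    proof (intro allI impI)
      fix j
      have "w ` ?F j \<subseteq> ?F j" using * permutes_in_image[OF w] by blast
      then show "w ` ?F j = ?F j"
        by (intro endo_inj_surj) (auto intro: inj_on_subset[OF permutes_inj[OF w]])
    qed
  qed
  then show ?thesis
    unfolding young_subgroup_def Let_def using block_eq_fibre[of _ nu] by auto
qed

text \<open>Colour counts may contain zeros whereas compositions may not; this allows the zeros to
  be dropped.\<close>

lemma young_subgroup_filter: "young_subgroup (filter ((<) 0) nu) = young_subgroup nu"
proof -
  have "sum_list (filter ((<) 0) nu) = sum_list nu" by (rule sum_list_filter_pos)
  moreover have "(\<forall>i\<in>{1..sum_list nu}. block_index (filter ((<) 0) nu) (w i) = block_index (filter ((<) 0) nu) i) \<longleftrightarrow>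
      (\<forall>i\<in>{1..sum_list nu}. block_index nu (w i) = block_index nu i)" if w: "w permutes {1..sum_list nu}" for w
    using permutes_in_image[OF w] by (intro ball_cong refl block_index_filter) auto
  ultimately show ?thesis unfolding young_subgroup_eq by auto
qed

lemma sum_over_fibres:
  fixes f :: "nat \<Rightarrow> nat"
  assumes "finite A" "\<And>i. i \<in> A \<Longrightarrow> h i < m"
  shows "(\<Sum>j<m. card {i \<in> A. h i = j} * f j) = (\<Sum>i\<in>A. f (h i))"
proof -
  have "(\<Sum>i\<in>A. f (h i)) = (\<Sum>j<m. \<Sum>i\<in>{i \<in> A. h i = j}. f (h i))"
    using assms by (intro sum.group[symmetric]) auto
  also have "\<dots> = (\<Sum>j<m. card {i \<in> A. h i = j} * f j)" by (intro sum.cong) auto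
  finally show ?thesis by simp
qed

text \<open>
  A basis element $x^a\otimes e_B$ of $S^pV\otimes\wedge^qV$ colours \<open>i\<close> by \<open>a\<^sub>i\<close> or, if \<open>i \<in> B\<close>, by
  \<open>k + a\<^sub>i\<close>. The numbers of elements of the colours $0,\dots,2k-1$ determine its $S_n$-orbit when $p<k$.
\<close>

definition color :: "nat \<Rightarrow> (nat \<Rightarrow>\<^sub>0 nat) \<times> nat set \<Rightarrow> nat \<Rightarrow> nat" where
  "color k t i = Poly_Mapping.lookup (fst t) i + (if i \<in> snd t then k else 0)"

definition color_counts :: "nat \<Rightarrow> nat \<Rightarrow> (nat \<Rightarrow>\<^sub>0 nat) \<times> nat set \<Rightarrow> nat list" where
  "color_counts n k t = map (\<lambda>j. card {i \<in> {1..n}. color k t i = j}) [0..<2 * k]"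

definition move :: "(nat \<Rightarrow> nat) \<Rightarrow> (nat \<Rightarrow>\<^sub>0 nat) \<times> nat set \<Rightarrow> (nat \<Rightarrow>\<^sub>0 nat) \<times> nat set" where
  "move w t = (sym_perm w (fst t), w ` snd t)"

abbreviation monomials :: "nat \<Rightarrow> nat \<Rightarrow> nat \<Rightarrow> ((nat \<Rightarrow>\<^sub>0 nat) \<times> nat set) set" where
  "monomials n p q \<equiv> homogeneous_expos n p \<times> subsets_of_card n q"

text \<open>The exponent of t in the variable number j + 1 of \<open>principal_vars\<close>: colours
  below k stand for 1, ..., t^(k-1), and colours from k on for s, ..., s t^(k-1). The exponent of s
  is \<open>s_weight\<close>.\<close>

definition t_weight :: "nat \<Rightarrow> nat \<Rightarrow> nat" where
  "t_weight k j = (if j < k then j else j - k)"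

definition s_weight :: "nat \<Rightarrow> nat \<Rightarrow> nat" where
  "s_weight k j = (if j < k then 0 else 1)"

text \<open>These lists play two roles: they are the colour counts of the orbits in the p-th
  symmetric times the q-th exterior power when p < k, and the exponents of the monomials of degree n
  that specialise to t^p s^q. This coincidence links the modules with the specialization.\<close>

definition contents :: "nat \<Rightarrow> nat \<Rightarrow> nat \<Rightarrow> nat \<Rightarrow> nat list set" where
  "contents n p q k = {nu. length nu = 2 * k \<and> sum_list nu = n \<and>
     (\<Sum>j<2 * k. nu ! j * t_weight k j) = p \<and> (\<Sum>j<2 * k. nu ! j * s_weight k j) = q}"

lemma finite_contents [simp]: "finite (contents n p q k)"
proof (rule finite_subset)
  show "contents n p q k \<subseteq> {xs. set xs \<subseteq> {..n} \<and> length xs = 2 * k}"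
    using member_le_sum_list by (fastforce simp: contents_def)
qed (rule finite_lists_length_eq, simp)

text \<open>As the exponents add up to p < k, each is below k. So a colour determines the exponent
  and, by comparison with k, whether i lies in the subset.\<close>

lemma monomialsD:
  assumes "t \<in> monomials n p q" "p < k"
  shows "Poly_Mapping.lookup (fst t) i < k" "color k t i < 2 * k" "color k t i < k \<longleftrightarrow> i \<notin> snd t"
    "t_weight k (color k t i) = Poly_Mapping.lookup (fst t) i" "snd t \<subseteq> {1..n}" "card (snd t) = q"
    "i \<notin> {1..n} \<Longrightarrow> Poly_Mapping.lookup (fst t) i = 0"
proof -
  have a: "Poly_Mapping.keys (fst t) \<subseteq> {1..n}" "(\<Sum>i\<in>{1..n}. Poly_Mapping.lookup (fst t) i) = p"
    using assms(1) by (auto simp: homogeneous_expos_def)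
  show 0: "Poly_Mapping.lookup (fst t) i = 0" if "i \<notin> {1..n}" for i using a(1) that by (auto simp: in_keys_iff)
  have "Poly_Mapping.lookup (fst t) i \<le> p"
  proof (cases "i \<in> {1..n}")
    case True
    then show ?thesis using member_le_sum[of i "{1..n}" "Poly_Mapping.lookup (fst t)"] a(2) by simp
  qed (use 0 in simp)
  then show l: "Poly_Mapping.lookup (fst t) i < k" using assms(2) by simp
  then show "color k t i < 2 * k" "color k t i < k \<longleftrightarrow> i \<notin> snd t" "t_weight k (color k t i) = Poly_Mapping.lookup (fst t) i"
    by (auto simp: color_def t_weight_def)
  show "snd t \<subseteq> {1..n}" "card (snd t) = q" using assms(1) by (auto simp: subsets_of_card_def)
qed

lemma color_move:
  assumes "w permutes {1..n}"
  shows "color k (move w t) (w i) = color k t i"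
  using permutes_inj[OF assms] by (simp add: color_def move_def lookup_sym_perm inj_image_mem_iff)

text \<open>A basis element is determined by its colouring because p < k; points outside {1..n} have
  colour 0 and are fixed by w.\<close>

lemma move_eq_iff:
  assumes "w permutes {1..n}" "t \<in> monomials n p q" "t' \<in> monomials n p q" "p < k"
  shows "move w t = t' \<longleftrightarrow> (\<forall>i\<in>{1..n}. color k t' (w i) = color k t i)"
proof
  assume "\<forall>i\<in>{1..n}. color k t' (w i) = color k t i"
  moreover have "color k t' (w i) = color k t i" if "i \<notin> {1..n}" for i
    using that monomialsD(5,7)[OF assms(2,4)] monomialsD(5,7)[OF assms(3,4)] permutes_not_in[OF assms(1) that]
    by (auto simp: color_def)
  ultimately have *: "color k t' (w i) = color k t i" for i by blast
  have "sym_perm w (fst t) = fst t'"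
    using monomialsD(4)[OF assms(2,4)] monomialsD(4)[OF assms(3,4)] *
    by (intro sym_perm_eqI[OF assms(1)]) metis
  moreover have "w i \<in> snd t' \<longleftrightarrow> i \<in> snd t" for i
    using monomialsD(3)[OF assms(2,4)] monomialsD(3)[OF assms(3,4)] * by metis
  then have "w ` snd t = snd t'" using permutes_surj[OF assms(1)] by (auto simp: image_iff) (metis surj_def)
  ultimately show "move w t = t'" by (simp add: move_def)
next
  assume "move w t = t'"
  then show "\<forall>i\<in>{1..n}. color k t' (w i) = color k t i" using color_move[OF assms(1)] by blast
qed

lemma color_counts_move:
  assumes "w permutes {1..n}"
  shows "color_counts n k (move w t) = color_counts n k t"
proof -
  have "{i \<in> {1..n}. color k (move w t) i = j} = w ` {i \<in> {1..n}. color k t i = j}" for j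
  proof (intro set_eqI iffI)
    fix y assume y: "y \<in> {i \<in> {1..n}. color k (move w t) i = j}"
    obtain x where "y = w x" using permutes_surj[OF assms] by blast
    then show "y \<in> w ` {i \<in> {1..n}. color k t i = j}"
      using y color_move[OF assms, of k t x] permutes_in_image[OF assms, of x] by simp
  next
    fix y assume "y \<in> w ` {i \<in> {1..n}. color k t i = j}"
    then show "y \<in> {i \<in> {1..n}. color k (move w t) i = j}"
      using color_move[OF assms, of k t] permutes_in_image[OF assms] by blast
  qed
  then have "card {i \<in> {1..n}. color k (move w t) i = j} = card {i \<in> {1..n}. color k t i = j}" for j
    using card_image[OF inj_on_subset[OF permutes_inj[OF assms]]] by simp
  then show ?thesis by (simp add: color_counts_def)
qed

lemma color_counts_in_contents:
  assumes "t \<in> monomials n p q" "p < k"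
  shows "color_counts n k t \<in> contents n p q k"
proof -
  note D = monomialsD[OF assms]
  have f: "(\<Sum>j<2 * k. color_counts n k t ! j * f j) = (\<Sum>i\<in>{1..n}. f (color k t i))" for f :: "nat \<Rightarrow> nat"
    using sum_over_fibres[of "{1..n}" "color k t" "2 * k" f] D(2) by (simp add: color_counts_def)
  have len: "length (color_counts n k t) = 2 * k" by (simp add: color_counts_def)
  have "sum_list (color_counts n k t) = (\<Sum>j<2 * k. color_counts n k t ! j * 1)"
    by (simp add: sum_list_sum_nth len atLeast0LessThan)
  also have "\<dots> = n" by (subst f) simp
  finally have 1: "sum_list (color_counts n k t) = n" .
  have "(\<Sum>j<2 * k. color_counts n k t ! j * t_weight k j) = (\<Sum>i\<in>{1..n}. Poly_Mapping.lookup (fst t) i)"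
    unfolding f D(4) ..
  also have "\<dots> = p" using assms(1) by (auto simp: homogeneous_expos_def)
  finally have 2: "(\<Sum>j<2 * k. color_counts n k t ! j * t_weight k j) = p" .
  have "(\<Sum>j<2 * k. color_counts n k t ! j * s_weight k j) = (\<Sum>i\<in>{1..n}. if i \<in> snd t then 1 else 0)"
    unfolding f s_weight_def D(3) by (intro sum.cong) auto
  also have "\<dots> = card ({1..n} \<inter> snd t)" by (simp flip: sum.inter_restrict)
  also have "\<dots> = q" using D(5,6) by (simp add: Int_absorb1)
  finally show ?thesis using 1 2 len by (simp add: contents_def)
qed

text \<open>Equal colour counts mean equal multisets of colours, so some permutation matches the two
  colourings.\<close>

lemma color_counts_transitive:
  assumes "t \<in> monomials n p q" "t' \<in> monomials n p q" "p < k" "color_counts n k t = color_counts n k t'"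
  obtains w where "w permutes {1..n}" "move w t = t'"
proof -
  have "image_mset (color k t) (mset_set {1..n}) = image_mset (color k t') (mset_set {1..n})"
  proof (rule multiset_eqI)
    fix j
    have c: "count (image_mset (color k u) (mset_set {1..n})) j = card {i \<in> {1..n}. color k u i = j}" for u
      by (simp add: count_image_mset vimage_def Int_def conj_commute)
    show "count (image_mset (color k t) (mset_set {1..n})) j = count (image_mset (color k t') (mset_set {1..n})) j"
    proof (cases "j < 2 * k")
      case True
      then have "color_counts n k t ! j = color_counts n k t' ! j" using assms(4) by simp
      then show ?thesis unfolding c using True by (simp add: color_counts_def)
    next
      case False
      then have e: "{i \<in> {1..n}. color k u i = j} = {}" if "u \<in> monomials n p q" for u
        using monomialsD(2)[OF that assms(3)] by blast
      show ?thesis unfolding c e[OF assms(1)] e[OF assms(2)] ..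
    qed
  qed
  then obtain w where w: "w permutes {1..n}" "\<forall>i\<in>{1..n}. color k t i = color k t' (w i)"
    using image_mset_eq_implies_permutes[of "{1..n}" "color k t" "color k t'"] by auto
  have "move w t = t'" using move_eq_iff[OF w(1) assms(1,2,3)] w(2) by simp
  then show thesis by (rule that[OF w(1)])
qed

text \<open>Consecutive blocks are coloured in order. The stabiliser of this element is then
  \<open>young_subgroup nu\<close> itself and not merely a conjugate.\<close>

lemma color_counts_representative:
  assumes "nu \<in> contents n p q k"
  obtains t where "t \<in> monomials n p q" "color_counts n k t = nu" "\<forall>i\<in>{1..n}. color k t i = block_index nu i"
proof -
  have nu: "length nu = 2 * k" "sum_list nu = n" "(\<Sum>j<2 * k. nu ! j * t_weight k j) = p" "(\<Sum>j<2 * k. nu ! j * s_weight k j) = q"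
    using assms by (auto simp: contents_def)
  have less: "block_index nu i < 2 * k" if "i \<in> {1..n}" for i
    using block_index_less[of i nu] that nu(1,2) by simp
  have f: "(\<Sum>i\<in>{1..n}. f (block_index nu i)) = (\<Sum>j<2 * k. nu ! j * f j)" for f :: "nat \<Rightarrow> nat"
  proof -
    have "(\<Sum>i\<in>{1..n}. f (block_index nu i)) = (\<Sum>j<2 * k. card {i \<in> {1..n}. block_index nu i = j} * f j)"
      using sum_over_fibres[of "{1..n}" "block_index nu" "2 * k" f] less by simp
    also have "\<dots> = (\<Sum>j<2 * k. nu ! j * f j)" using card_block_fibre[of _ nu] nu(1,2) by simp
    finally show ?thesis .
  qed
  define t where "t = (expo n (\<lambda>i. t_weight k (block_index nu i)), {i \<in> {1..n}. k \<le> block_index nu i})"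
  have col: "color k t i = block_index nu i" if "i \<in> {1..n}" for i
    using that by (auto simp: color_def t_def lookup_expo t_weight_def)
  have "(\<Sum>i\<in>{1..n}. Poly_Mapping.lookup (fst t) i) = (\<Sum>i\<in>{1..n}. t_weight k (block_index nu i))"
    by (simp add: t_def lookup_expo)
  then have 1: "fst t \<in> homogeneous_expos n p"
    unfolding f nu(3) using keys_expo by (simp add: homogeneous_expos_def t_def)
  have "card (snd t) = (\<Sum>i\<in>{1..n}. s_weight k (block_index nu i))"
    by (auto simp: t_def s_weight_def sum.If_cases Int_def not_less)
  then have 2: "snd t \<in> subsets_of_card n q"
    unfolding f nu(4) by (auto simp: t_def subsets_of_card_def)
  have "color_counts n k t = nu"
  proof (rule nth_equalityI)
    show "length (color_counts n k t) = length nu" by (simp add: color_counts_def nu(1))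
    fix j assume "j < length (color_counts n k t)"
    then have j: "j < 2 * k" by (simp add: color_counts_def)
    have "{i \<in> {1..n}. color k t i = j} = {i \<in> {1..n}. block_index nu i = j}" using col by auto
    then show "color_counts n k t ! j = nu ! j"
      using card_block_fibre[of j nu] nu(1,2) j by (simp add: color_counts_def)
  qed
  moreover have "t \<in> monomials n p q" using 1 2 by (simp only: mem_Times_iff)
  ultimately show thesis using that col by blast
qed

abbreviation (input) sym_ext_module :: "nat \<Rightarrow> nat \<Rightarrow> nat \<Rightarrow> ((nat \<Rightarrow>\<^sub>0 nat) \<times> nat set) snmod" where
  "sym_ext_module n p q \<equiv> sn_tensor (sym_power p (perm_rep n)) (ext_power q (perm_rep n))"

lemma sn_monomial_sym_ext:
  "sn_monomial n (monomials n p q) move (\<lambda>w t. perm_sign w (snd t)) (sym_ext_module n p q)"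
proof -
  have "(\<lambda>w (t, t'). (sym_perm w t, w ` t')) = move" by (simp add: fun_eq_iff move_def)
  moreover have "(\<lambda>w (t :: nat \<Rightarrow>\<^sub>0 nat, t'). 1 * perm_sign w t') = (\<lambda>w t. perm_sign w (snd t))" by (simp add: fun_eq_iff)
  ultimately show ?thesis
    using sn_monomial_tensor[OF sn_monomial_sym_power sn_monomial_ext_power, of n p q] by (simp only:)
qed

text \<open>The untwisting is applied with B = \<open>snd\<close>, and the permutation basis is cut
  into the sets X nu. Each is a single orbit, nonempty for every nu in \<open>contents\<close>, with
  the block colouring as its base point.\<close>

lemma ch_sym_ext_module:
  assumes ch: "characteristic_map ch" and pk: "p < k"
  shows "ch (kcl n (hc_tensor (clifford_module n) (sym_ext_module n p q))) = (\<Sum>nu\<in>contents n p q k. q_prod nu)"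
proof -
  let ?T = "monomials n p q" and ?P = "\<lambda>S. hc_tensor (clifford_module n) (perm_module S move)"
  let ?N = "hc_tensor (clifford_module n) (sym_ext_module n p q)"
  note mono = sn_monomial_sym_ext[of n p q]
  have S: "sn_monomial n S move (\<lambda>_ _. 1) (perm_module S move)"
    if "S \<subseteq> ?T" "\<And>w t. w permutes {1..n} \<Longrightarrow> t \<in> S \<Longrightarrow> move w t \<in> S" for S
    using sn_monomial_perm_module[OF mono that] .
  have T: "sn_monomial n ?T move (\<lambda>_ _. 1) (perm_module ?T move)"
    by (rule S) (auto simp del: mem_Times_iff intro: sn_monomialD(4)[OF mono])
  have B: "snd t \<subseteq> {1..n} \<and> card (snd t) = q" if "t \<in> ?T" for t
    using that by (auto simp: subsets_of_card_def)
  have Bw: "snd (move w t) = w ` snd t \<and> perm_sign w (snd t) = perm_sign w (snd t)" for w t by (simp add: move_def)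
  obtain f where f: "hc_hom_of_parity n (of_nat q) (?P ?T) ?N f" "bij_betw f (hc_space (?P ?T)) (hc_space ?N)"
    using untwist_isomorphism[OF mono, of snd q, OF B Bw] .
  have iso: "kcl n (?P ?T) = kcl n ?N" by (rule kcl_iso[OF hc_module_hc_tensor[OF T] hc_module_hc_tensor[OF mono] f])
  define X where "X nu = {t \<in> ?T. color_counts n k t = nu}" for nu
  have X: "X nu \<subseteq> ?T" for nu by (auto simp: X_def)
  have stable: "move w t \<in> X nu" if "w permutes {1..n}" "t \<in> X nu" for w t nu
    using that sn_monomialD(4)[OF mono that(1), of t] color_counts_move[OF that(1)] by (simp only: X_def mem_Collect_eq)
  have "(\<Union>nu\<in>contents n p q k. X nu) = ?T"
    using color_counts_in_contents[OF _ pk, of _ n q] unfolding X_def by blast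
  then have union: "kcl n (?P ?T) = (\<Sum>nu\<in>contents n p q k. kcl n (?P (X nu)))"
    using kcl_perm_module_UNION[OF mono finite_contents[of n p q k], of X] X stable unfolding X_def by auto
  have orbit: "ch (kcl n (?P (X nu))) = q_prod nu" if nu: "nu \<in> contents n p q k" for nu
  proof -
    obtain t where t: "t \<in> ?T" "color_counts n k t = nu" "\<forall>i\<in>{1..n}. color k t i = block_index nu i"
      using color_counts_representative[OF nu] .
    have nu_n: "sum_list nu = n" using nu by (simp add: contents_def)
    have XS: "sn_monomial n (X nu) move (\<lambda>_ _. 1) (perm_module (X nu) move)"
      by (rule S[OF X stable])
    have "is_induced_trivial n nu (nat_model n (?P (X nu)))"
    proof (rule is_induced_trivial_orbit[OF XS _ _ _ nu_n])
      show "t \<in> X nu" using t by (simp add: X_def)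
      show "\<exists>w. w permutes {1..n} \<and> move w t = u" if "u \<in> X nu" for u
      proof -
        have "u \<in> ?T" "color_counts n k t = color_counts n k u" using that t(2) by (simp_all add: X_def)
        then show ?thesis using color_counts_transitive[OF t(1) _ pk] by metis
      qed
      show "move w t = t \<longleftrightarrow> w \<in> young_subgroup nu" if w: "w permutes {1..n}" for w
      proof -
        have "color k t (w i) = color k t i \<longleftrightarrow> block_index nu (w i) = block_index nu i" if "i \<in> {1..n}" for i
          using that permutes_in_image[OF w] t(3) by metis
        then show ?thesis
          unfolding move_eq_iff[OF w t(1,1) pk] young_subgroup_eq nu_n using w by blast
      qed
    qed
    \<comment> \<open>The hypothesis on ch speaks of compositions, whose parts are positive; a zero
      count contributes only q_0 = 1 to the product.\<close>
    then have "is_induced_trivial n (filter ((<) 0) nu) (nat_model n (?P (X nu)))"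
      by (simp only: is_induced_trivial_def young_subgroup_filter)
    moreover have "is_composition n (filter ((<) 0) nu)"
      by (simp add: is_composition_def sum_list_filter_pos nu_n)
    ultimately have "ch (k_class n (nat_model n (?P (X nu)))) = q_prod (filter ((<) 0) nu)"
      using ch unfolding characteristic_map_def by blast
    then show ?thesis by (simp only: kcl_def q_prod_filter)
  qed
  show ?thesis unfolding iso[symmetric] union characteristic_map_sum[OF ch] using orbit by (rule sum.cong[OF refl])
qed

text \<open>Multiplication by 2^l clears the denominator in the Cauchy coefficients. The condition n
  \<le> 2 * k lets these coefficients be read in the 2 k variables of the specialization.\<close>

lemma hc_multiplicity_sym_ext:
  assumes ch: "characteristic_map ch" and lab: "irreducible_labelling ch n D" and lam: "lam \<in> strict_partitions n"
    and k: "p < k" "n \<le> 2 * k"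
  shows "of_nat (hc_multiplicity n (D lam) (hc_tensor (clifford_module n) (sym_ext_module n p q))) * Q_coeff lam * 2 ^ length lam =
    (\<Sum>nu\<in>contents n p q k. Poly_Mapping.lookup (Q_poly (2 * k) lam) (expo (2 * k) (part nu)))"
proof -
  let ?N = "hc_tensor (clifford_module n) (sym_ext_module n p q)"
  show ?thesis
  proof (rule schur_Q_Cauchy[of n])
    fix a
    assume a: "\<And>nu. sum_list nu = n \<Longrightarrow> q_prod nu = (\<Sum>lam\<in>strict_partitions n. sf_scale (a nu lam) (schur_Q lam))"
      "\<And>nu lam m. sum_list nu = n \<Longrightarrow> length nu \<le> m \<Longrightarrow> n \<le> m \<Longrightarrow> lam \<in> strict_partitions n \<Longrightarrow>
         a nu lam * 2 ^ length lam = Poly_Mapping.lookup (Q_poly m lam) (expo m (part nu))"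
    have nu: "sum_list nu = n" "length nu = 2 * k" if "nu \<in> contents n p q k" for nu using that by (auto simp: contents_def)
    have "ch (kcl n ?N) = (\<Sum>nu\<in>contents n p q k. \<Sum>mu\<in>strict_partitions n. sf_scale (a nu mu) (schur_Q mu))"
      unfolding ch_sym_ext_module[OF ch k(1)] using a(1)[OF nu(1)] by (rule sum.cong[OF refl])
    also have "\<dots> = (\<Sum>mu\<in>strict_partitions n. sf_scale (\<Sum>nu\<in>contents n p q k. a nu mu) (schur_Q mu))"
      by (subst sum.swap) (simp only: sf.scale_sum_left)
    finally have "of_nat (hc_multiplicity n (D lam) ?N) * Q_coeff lam = (\<Sum>nu\<in>contents n p q k. a nu lam)"
      by (rule hc_multiplicity_eq[OF ch lab hc_module_hc_tensor[OF sn_monomial_sym_ext] lam])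
    then show ?thesis
      using a(2)[OF nu(1) _ k(2) lam] nu(2) by (simp add: sum_distrib_right)
  qed
qed

section \<open>The principal specialization\<close>

lemma prod_principal:
  fixes e u v :: "nat \<Rightarrow> nat"
  assumes "finite A"
  shows "(\<Prod>i\<in>A. (fps_const (monom 1 (u i)) * fps_X ^ v i :: complex poly fps) ^ e i) =
    fps_const (monom 1 (\<Sum>i\<in>A. e i * u i)) * fps_X ^ (\<Sum>i\<in>A. e i * v i)"
  using assms
proof (induction A rule: finite_induct)
  case (insert i A)
  have step: "(fps_const (monom 1 (u i)) * fps_X ^ v i :: complex poly fps) ^ e i =
      fps_const (monom 1 (e i * u i)) * fps_X ^ (e i * v i)"
    by (simp add: power_mult_distrib monom_power fps_const_power mult.commute flip: power_mult)
  have monom_add: "monom 1 (a + b) = (monom 1 a * monom 1 b :: complex poly)" for a b by (simp add: mult_monom)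
  show ?case
    unfolding prod.insert[OF insert.hyps] step sum.insert[OF insert.hyps] insert.IH monom_add fps_const_mult[symmetric] power_add
    by (simp only: mult_ac)
qed simp

lemma principal_vars_eq:
  assumes "1 \<le> i"
  shows "principal_vars k i = fps_const (monom 1 (s_weight k (i - 1))) * fps_X ^ t_weight k (i - 1)"
proof -
  have "[:0, 1:] = (monom 1 1 :: complex poly)" by (simp add: monom_altdef)
  then show ?thesis using assms by (auto simp: principal_vars_def s_weight_def t_weight_def)
qed

lemma sum_positions:
  fixes a :: "nat \<Rightarrow>\<^sub>0 nat" and g :: "nat \<Rightarrow> nat"
  assumes "Poly_Mapping.keys a \<subseteq> {1..m}"
  shows "(\<Sum>i\<in>Poly_Mapping.keys a. Poly_Mapping.lookup a i * g (i - 1)) = (\<Sum>j<m. Poly_Mapping.lookup a (Suc j) * g j)"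
proof -
  have "(\<Sum>i\<in>Poly_Mapping.keys a. Poly_Mapping.lookup a i * g (i - 1)) = (\<Sum>i\<in>{1..m}. Poly_Mapping.lookup a i * g (i - 1))"
    using assms by (intro sum.mono_neutral_left) (auto simp: in_keys_iff)
  also have "\<dots> = (\<Sum>j<m. Poly_Mapping.lookup a (Suc j) * g j)"
    by (rule sum.reindex_bij_witness[of _ Suc "\<lambda>i. i - 1"]) auto
  finally show ?thesis .
qed

text \<open>The monomial y^nu specialises to a power of t times a power of s, whose exponents are
  the two weighted sums in \<open>contents\<close>. Extracting one coefficient is therefore a sum
  over these nu.\<close>

lemma coeff_zpoly_eval_principal:
  fixes f :: zpoly
  assumes "Poly_Mapping.keys f \<subseteq> homogeneous_expos (2 * k) n"
  shows "coeff (fps_nth (zpoly_eval (principal_vars k) f) p) q =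
    (\<Sum>nu\<in>contents n p q k. Poly_Mapping.lookup f (expo (2 * k) (part nu)))"
proof -
  let ?t = "\<lambda>a. \<Sum>j<2 * k. Poly_Mapping.lookup a (Suc j) * t_weight k j"
  let ?s = "\<lambda>a. \<Sum>j<2 * k. Poly_Mapping.lookup a (Suc j) * s_weight k j"
  let ?E = "{a \<in> homogeneous_expos (2 * k) n. ?t a = p \<and> ?s a = q}"
  have k: "Poly_Mapping.keys a \<subseteq> {1..2 * k}" if "a \<in> Poly_Mapping.keys f" for a
    using assms that by (auto simp only: homogeneous_expos_def)
  have "coeff (fps_nth (fps_const [:Poly_Mapping.lookup f a:] *
      (\<Prod>i\<in>Poly_Mapping.keys a. principal_vars k i ^ Poly_Mapping.lookup a i)) p) q =
      (if ?t a = p \<and> ?s a = q then Poly_Mapping.lookup f a else 0)" if a: "a \<in> Poly_Mapping.keys f" for a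
  proof -
    have "(\<Prod>i\<in>Poly_Mapping.keys a. principal_vars k i ^ Poly_Mapping.lookup a i) =
        (\<Prod>i\<in>Poly_Mapping.keys a. (fps_const (monom 1 (s_weight k (i - 1))) * fps_X ^ t_weight k (i - 1)) ^ Poly_Mapping.lookup a i)"
    proof (rule prod.cong[OF refl])
      fix i assume "i \<in> Poly_Mapping.keys a"
      then have "1 \<le> i" using k[OF a] by auto
      then show "principal_vars k i ^ Poly_Mapping.lookup a i =
        (fps_const (monom 1 (s_weight k (i - 1))) * fps_X ^ t_weight k (i - 1)) ^ Poly_Mapping.lookup a i"
        by (simp only: principal_vars_eq)
    qed
    also have "\<dots> = fps_const (monom 1 (?s a)) * fps_X ^ ?t a"
      unfolding prod_principal[OF finite_keys] sum_positions[OF k[OF a]] ..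
    finally have "(\<Prod>i\<in>Poly_Mapping.keys a. principal_vars k i ^ Poly_Mapping.lookup a i) = fps_const (monom 1 (?s a)) * fps_X ^ ?t a" .
    then show ?thesis by (simp add: fps_X_power_nth)
  qed
  then have "coeff (fps_nth (zpoly_eval (principal_vars k) f) p) q =
      (\<Sum>a\<in>Poly_Mapping.keys f. if ?t a = p \<and> ?s a = q then Poly_Mapping.lookup f a else 0)"
    unfolding zpoly_eval_def fps_sum_nth coeff_sum by (rule sum.cong[OF refl])
  also have "\<dots> = (\<Sum>a\<in>homogeneous_expos (2 * k) n. if ?t a = p \<and> ?s a = q then Poly_Mapping.lookup f a else 0)"
    using assms by (intro sum.mono_neutral_left) (auto simp: in_keys_iff)
  also have "\<dots> = (\<Sum>a\<in>?E. Poly_Mapping.lookup f a)"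
    by (rule sum.inter_filter[symmetric]) simp
  also have "\<dots> = (\<Sum>nu\<in>contents n p q k. Poly_Mapping.lookup f (expo (2 * k) (part nu)))"
  \<comment> \<open>Variables are numbered from 1 and list entries from 0, hence the shift by
    \<open>Suc\<close>.\<close>
  proof (rule sum.reindex_bij_witness[of _ "\<lambda>nu. expo (2 * k) (part nu)" "\<lambda>a. map (\<lambda>j. Poly_Mapping.lookup a (Suc j)) [0..<2 * k]"])
    fix a assume a: "a \<in> ?E"
    then have keys: "Poly_Mapping.keys a \<subseteq> {1..2 * k}" and total: "(\<Sum>i\<in>{1..2 * k}. Poly_Mapping.lookup a i) = n"
      by (auto simp only: homogeneous_expos_def)
    let ?nu = "map (\<lambda>j. Poly_Mapping.lookup a (Suc j)) [0..<2 * k]"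
    have "expo (2 * k) (part ?nu) = expo (2 * k) (Poly_Mapping.lookup a)"
      unfolding expo_eq_iff by (auto simp: part_def)
    then have e: "expo (2 * k) (part ?nu) = a" using expo_lookup[OF keys] by simp
    then show "expo (2 * k) (part ?nu) = a" .
    show "Poly_Mapping.lookup f (expo (2 * k) (part ?nu)) = Poly_Mapping.lookup f a" unfolding e ..
    have "sum_list ?nu = (\<Sum>j<2 * k. Poly_Mapping.lookup a (Suc j))"
      by (simp add: interv_sum_list_conv_sum_set_nat atLeast0LessThan)
    also have "\<dots> = n"
      unfolding total[symmetric] by (rule sum.reindex_bij_witness[of _ "\<lambda>i. i - 1" Suc]) auto
    finally show "?nu \<in> contents n p q k" using a by (simp add: contents_def)
  next
    fix nu assume nu: "nu \<in> contents n p q k"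
    then have len: "length nu = 2 * k" by (simp add: contents_def)
    have l: "Poly_Mapping.lookup (expo (2 * k) (part nu)) (Suc j) = nu ! j" if "j < 2 * k" for j
      using that len by (simp add: lookup_expo part_def)
    show "map (\<lambda>j. Poly_Mapping.lookup (expo (2 * k) (part nu)) (Suc j)) [0..<2 * k] = nu"
      using l len by (intro nth_equalityI) simp_all
    have "expo (2 * k) (part nu) \<in> homogeneous_expos (2 * k) n"
      using nu sum_part[of nu "2 * k"] len keys_expo[of "2 * k" "part nu"]
      by (auto simp: homogeneous_expos_def lookup_expo contents_def)
    then show "expo (2 * k) (part nu) \<in> ?E" using nu l by (simp add: contents_def)
  qed
  finally show ?thesis .
qed

text \<open>The exponent of s counts the elements whose colour is at least k, so it is at most n.
  This matches the range of q in the theorem.\<close>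

lemma contents_empty: "n < q \<Longrightarrow> contents n p q k = {}"
proof -
  have "(\<Sum>j<2 * k. nu ! j * s_weight k j) \<le> sum_list nu" if "length nu = 2 * k" for nu
    unfolding sum_list_sum_nth that atLeast0LessThan by (intro sum_mono) (simp add: s_weight_def)
  then show "contents n p q k = {}" if "n < q" using that by (fastforce simp: contents_def)
qed

text \<open>A fraction has at most one polynomial representative, so \<open>THE\<close> finds
  \<open>Q_poly\<close>.\<close>

lemma the_schur_Q_poly:
  assumes "lam \<in> strict_partitions n" "n \<le> m"
  shows "(THE f. to_fract f = schur_Q lam m) = Q_poly m lam"
  using to_fract_Q_poly[of lam m] strict_partitionsD[OF assms(1)] assms(2)
  by (intro the_equality) (auto simp: to_fract_eq_iff simp flip: to_fract_Q_poly)

text \<open>The coefficient at t^p is constant once k > p and k \<ge> n, so the limit of power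
  series exists coefficientwise.\<close>

lemma schur_Q_principal_eqI:
  assumes lam: "lam \<in> strict_partitions n"
    and g: "\<And>p k. p < k \<Longrightarrow> n \<le> k \<Longrightarrow> fps_nth (zpoly_eval (principal_vars k) (Q_poly (2 * k) lam)) p = fps_nth g p"
  shows "schur_Q_principal lam = g"
  unfolding schur_Q_principal_def
proof (rule limI, rule tendsto_fpsI)
  fix p
  show "\<forall>\<^sub>F k in sequentially.
      fps_nth (zpoly_eval (principal_vars k) (THE f. to_fract f = schur_Q lam (2 * k))) p = fps_nth g p"
    using eventually_ge_at_top[of "max n (Suc p)"]
  proof eventually_elim
    case (elim k)
    then show ?case using g[of p k] the_schur_Q_poly[OF lam, of "2 * k"] by simp
  qed
qed

theorem theoremC:
  fixes n :: nat and lam :: "nat list"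
    and ch :: "k_group \<Rightarrow> symfun" and D :: "nat list \<Rightarrow> nat hcmod"
  assumes "n \<ge> 1"
    and "characteristic_map ch"
    and "irreducible_labelling ch n D"
    and "strict_partition n lam"
  shows "Abs_fps (\<lambda>p. \<Sum>q\<le>n. monom (of_nat (hc_multiplicity n (D lam)
             (hc_tensor (clifford_module n)
                (sn_tensor (sym_power p (perm_rep n)) (ext_power q (perm_rep n)))))) q) =
         fps_const [:1 / 2 ^ ((length lam + partition_delta lam) div 2):] * schur_Q_principal lam"
proof -
  let ?m = "\<lambda>p q. of_nat (hc_multiplicity n (D lam) (hc_tensor (clifford_module n) (sym_ext_module n p q))) :: complex"
  define e where "e = (length lam + partition_delta lam) div 2"
  have lam: "lam \<in> strict_partitions n" using assms(4) by (simp add: strict_partitions_def)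
  \<comment> \<open>The identity l = (l - delta)/2 + (l + delta)/2, in which both halves are
    integers because delta is the parity of l.\<close>
  have "length lam = (length lam - partition_delta lam) div 2 + e"
    unfolding e_def partition_delta_def by (cases "even (length lam)") (auto elim!: oddE evenE)
  then have "(2::complex) ^ length lam = 2 ^ ((length lam - partition_delta lam) div 2) * 2 ^ e"
    using power_add[of "2::complex" "(length lam - partition_delta lam) div 2" e] by simp
  then have scale: "Q_coeff lam * 2 ^ length lam = 2 ^ e" by (simp add: Q_coeff_def)
  have "schur_Q_principal lam = Abs_fps (\<lambda>p. \<Sum>q\<le>n. monom (2 ^ e * ?m p q) q)"
  proof (rule schur_Q_principal_eqI[OF lam])
    fix p k :: nat
    assume k: "p < k" "n \<le> k"
    have keys: "Poly_Mapping.keys (Q_poly (2 * k) lam) \<subseteq> homogeneous_expos (2 * k) n"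
      using keys_Q_poly[of lam "2 * k"] strict_partitionsD[OF lam] k by simp
    have "coeff (fps_nth (zpoly_eval (principal_vars k) (Q_poly (2 * k) lam)) p) q =
        coeff (\<Sum>q\<le>n. monom (2 ^ e * ?m p q) q) q" for q
    proof -
      have "coeff (\<Sum>q\<le>n. monom (2 ^ e * ?m p q) q) q = (if q \<le> n then 2 ^ e * ?m p q else 0)"
        by (simp add: coeff_sum)
      also have "\<dots> = (\<Sum>nu\<in>contents n p q k. Poly_Mapping.lookup (Q_poly (2 * k) lam) (expo (2 * k) (part nu)))"
      proof (cases "q \<le> n")
        case True
        have "n \<le> 2 * k" using k by simp
        have "2 ^ e * ?m p q = ?m p q * Q_coeff lam * 2 ^ length lam"
          unfolding scale[symmetric] by (simp only: mult_ac)
        then show ?thesis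
          using True hc_multiplicity_sym_ext[OF assms(2,3) lam k(1) \<open>n \<le> 2 * k\<close>, of q] by simp
      qed (simp add: contents_empty)
      finally show ?thesis unfolding coeff_zpoly_eval_principal[OF keys] ..
    qed
    then show "fps_nth (zpoly_eval (principal_vars k) (Q_poly (2 * k) lam)) p =
        fps_nth (Abs_fps (\<lambda>p. \<Sum>q\<le>n. monom (2 ^ e * ?m p q) q)) p"
      unfolding fps_nth_Abs_fps by (rule poly_eqI)
  qed
  then show ?thesis
    unfolding e_def[symmetric] by (intro fps_ext poly_eqI) (simp add: coeff_sum)
qed

end
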